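(* Let $\Lambda$ be an Artin algebra and let $\mathcal{C}\subseteq \mathrm{mod}\,\Lambda$ be an $(n,t,V,\mathcal{D})$-GLIT class. Then $\mathrm{fin.dim}(\mathcal{C})<\infty$. In particular, if $\Lambda$ is a GLIT algebra, then $\Lambda$ satisfies the finitistic dimension conjecture, i.e. $\mathrm{fin.dim}(\mathrm{mod}\,\Lambda)<\infty$.
   Context: All modules are finitely generated left modules over an Artin algebra $\Lambda$; $\mathrm{mod}\,\Lambda$ is the category of these. Subcategories of $\mathrm{mod}\,\Lambda$ are regarded as classes of modules, membership being understood up to isomorphism. $\Omega$ is the syzygy operator (kernel of a projective cover), $\Omega^0X=X$. For a class $\mathcal{C}$, $\Omega^t\mathcal{C}=\{\Omega^tX: X\in\mathcal{C}\}$, and $\mathrm{add}\,\mathcal{C}$ is the class of direct summands of finite direct sums of modules in $\mathcal{C}$ (for a module $V$, $\mathrm{add}\,V=\mathrm{add}\{V\}$). $\mathrm{fin.dim}(\mathcal{C})=\sup\{\mathrm{pd}(X): X\in\mathcal{C},\ \mathrm{pd}(X)<\infty\}$. Igusa-Todorov function $\Phi$: Let $K$ be the free abelian group on the isoclasses $[X]$ of indecomposable non-projective modules; for arbitrary $Y$ let $[Y]\in K$ be the sum (with multiplicities) of the classes of the non-projective indecomposable summands of $Y$. Let $L:K\to K$ be the endomorphism with $L([X])=[\Omega X]$. For a module $X$ let $\langle X\rangle\subseteq K$ be the subgroup generated by the classes of the indecomposable non-projective direct summands of $X$. Then $\Phi(X)=\min\{n\ge 0: \mathrm{rk}\,L^k(\langle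 X\rangle)=\mathrm{rk}\,L^{k+1}(\langle X\rangle)\ \forall k\ge n\}$, and $\Phi\,\mathrm{dim}(\mathcal{C})=\sup\{\Phi(X):X\in\mathcal{C}\}$. GLIT classes: a class $\mathcal{C}\subseteq\mathrm{mod}\,\Lambda$ is an $(n,t,V,\mathcal{D})$-GLIT class ($n\ge0$, $t\ge1$, $V\in\mathrm{mod}\,\Lambda$, $\mathcal{D}\subseteq\mathrm{mod}\,\Lambda$) if: (a) $\mathrm{add}\,\mathcal{D}=\mathcal{D}$, $\Omega^t\mathcal{D}\subseteq\mathcal{D}$ and $\Phi\,\mathrm{dim}(\mathcal{D})<\infty$; (b) for each $C\in\mathcal{C}$ there is an exact sequence $0\to V_1\oplus D_1\to V_0\oplus D_0\to\Omega^nC\to0$ with $V_0,V_1\in\mathrm{add}\,V$ and $D_0,D_1\in\mathcal{D}$. $\Lambda$ is a GLIT algebra if $\mathrm{mod}\,\Lambda$ is an $(n,t,V,\mathcal{D})$-GLIT class for some $n,t,V,\mathcal{D}$. *)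

theory Defs
  imports "HOL-Library.Extended_Nat" "HOL-Algebra.Free_Abelian_Groups"
    "HOL-Algebra.Generated_Groups" "HOL-Algebra.Ideal" "HOL-Algebra.Module"
begin

section \<open>Modules over a not necessarily commutative ring\<close>

text \<open>Modules use the record type of \<open>HOL-Algebra.Module\<close>, whose locale \<open>module\<close> is restricted to
  commutative rings.  The record fields \<open>mult\<close> and \<open>one\<close> of a module are junk and never used.\<close>

locale left_module = R?: ring R + M?: abelian_group M
  for R :: "('a, 'r) ring_scheme" (structure) and M :: "('a, 'b, 'm) module_scheme" (structure) +
  assumes smult_closed [simp, intro]:
      "\<lbrakk>a \<in> carrier R; x \<in> carrier M\<rbrakk> \<Longrightarrow> a \<odot>\<^bsub>M\<^esub> x \<in> carrier M"
    and smult_l_distr: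
      "\<lbrakk>a \<in> carrier R; b \<in> carrier R; x \<in> carrier M\<rbrakk> \<Longrightarrow>
        (a \<oplus> b) \<odot>\<^bsub>M\<^esub> x = a \<odot>\<^bsub>M\<^esub> x \<oplus>\<^bsub>M\<^esub> b \<odot>\<^bsub>M\<^esub> x"
    and smult_r_distr:
      "\<lbrakk>a \<in> carrier R; x \<in> carrier M; y \<in> carrier M\<rbrakk> \<Longrightarrow>
        a \<odot>\<^bsub>M\<^esub> (x \<oplus>\<^bsub>M\<^esub> y) = a \<odot>\<^bsub>M\<^esub> x \<oplus>\<^bsub>M\<^esub> a \<odot>\<^bsub>M\<^esub> y"
    and smult_assoc1:
      "\<lbrakk>a \<in> carrier R; b \<in> carrier R; x \<in> carrier M\<rbrakk> \<Longrightarrow>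
        (a \<otimes> b) \<odot>\<^bsub>M\<^esub> x = a \<odot>\<^bsub>M\<^esub> (b \<odot>\<^bsub>M\<^esub> x)"
    and smult_one [simp]:
      "x \<in> carrier M \<Longrightarrow> \<one> \<odot>\<^bsub>M\<^esub> x = x"

definition fin_gen :: "('a, 'r) ring_scheme \<Rightarrow> ('a, 'b, 'm) module_scheme \<Rightarrow> bool" where
  "fin_gen R M \<longleftrightarrow> (\<exists>S. finite S \<and> S \<subseteq> carrier M \<and>
      (\<forall>N. submodule N R M \<and> S \<subseteq> N \<longrightarrow> N = carrier M))"

definition module_hom ::
  "('a, 'r) ring_scheme \<Rightarrow> ('a, 'b, 'm) module_scheme \<Rightarrow> ('a, 'c, 'n) module_scheme \<Rightarrow> ('b \<Rightarrow> 'c) set" where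
  "module_hom R M N = {f \<in> hom (add_monoid M) (add_monoid N).
      \<forall>a \<in> carrier R. \<forall>x \<in> carrier M. f (a \<odot>\<^bsub>M\<^esub> x) = a \<odot>\<^bsub>N\<^esub> f x}"

definition module_iso ::
  "('a, 'r) ring_scheme \<Rightarrow> ('a, 'b, 'm) module_scheme \<Rightarrow> ('a, 'c, 'n) module_scheme \<Rightarrow> bool" where
  "module_iso R M N \<longleftrightarrow> (\<exists>f \<in> module_hom R M N. bij_betw f (carrier M) (carrier N))"

text \<open>Exactness of \<open>0 \<longrightarrow> A \<longrightarrow> B \<longrightarrow> C \<longrightarrow> 0\<close> with maps \<open>f\<close> and \<open>g\<close>.\<close>

definition short_exact ::
  "('a, 'r) ring_scheme \<Rightarrow> ('a, 'b, 'm) module_scheme \<Rightarrow> ('a, 'c, 'n) module_scheme \<Rightarrow>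
    ('a, 'd, 'k) module_scheme \<Rightarrow> ('b \<Rightarrow> 'c) \<Rightarrow> ('c \<Rightarrow> 'd) \<Rightarrow> bool" where
  "short_exact R A B C f g \<longleftrightarrow>
      f \<in> module_hom R A B \<and> g \<in> module_hom R B C \<and>
      inj_on f (carrier A) \<and> f ` carrier A = a_kernel B C g \<and> g ` carrier B = carrier C"

definition zero_module :: "('a, 'b, 'm) module_scheme \<Rightarrow> bool" where
  "zero_module M \<longleftrightarrow> carrier M = {\<zero>\<^bsub>M\<^esub>}"

definition dsum ::
  "('a, 'b) module \<Rightarrow> ('a, 'c) module \<Rightarrow> ('a, 'b \<times> 'c) module" (infixr \<open>\<boxplus>\<close> 65) where
  "M \<boxplus> N = \<lparr>carrier = carrier M \<times> carrier N,
      monoid.mult = (\<lambda>_ _. undefined), one = undefined,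
      ring.zero = (\<zero>\<^bsub>M\<^esub>, \<zero>\<^bsub>N\<^esub>),
      ring.add = (\<lambda>(x, y) (x', y'). (x \<oplus>\<^bsub>M\<^esub> x', y \<oplus>\<^bsub>N\<^esub> y')),
      smult = (\<lambda>a (x, y). (a \<odot>\<^bsub>M\<^esub> x, a \<odot>\<^bsub>N\<^esub> y))\<rparr>"

definition dsum_list :: "('a, 'b) module list \<Rightarrow> ('a, 'b list) module" where
  "dsum_list Ms = \<lparr>carrier = {xs. length xs = length Ms \<and> (\<forall>i < length Ms. xs ! i \<in> carrier (Ms ! i))},
      monoid.mult = (\<lambda>_ _. undefined), one = undefined,
      ring.zero = map (\<lambda>M. \<zero>\<^bsub>M\<^esub>) Ms,
      ring.add = (\<lambda>xs ys. map (\<lambda>i. xs ! i \<oplus>\<^bsub>Ms ! i\<^esub> ys ! i) [0..<length Ms]),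
      smult = (\<lambda>a xs. map (\<lambda>i. a \<odot>\<^bsub>Ms ! i\<^esub> xs ! i) [0..<length Ms])\<rparr>"


section \<open>Artin algebras and their finitely generated modules\<close>

text \<open>The record \<open>L\<close> is a ring together with an action of the commutative artinian ring \<open>K\<close>; the
  last two axioms say that \<open>K\<close> acts through the centre of \<open>L\<close>.\<close>

locale artin_algebra = module K L + ring L
  for K :: "('k, 'r) ring_scheme" (structure) and L :: "('k, 'a) module" (structure) +
  assumes artinian: "\<lbrakk>\<And>n. ideal (I n) K; \<And>n. I (Suc n) \<subseteq> I n\<rbrakk> \<Longrightarrow>
      \<exists>n. \<forall>m \<ge> n. (I :: nat \<Rightarrow> 'k set) m = I n"
    and fin_gen: "fin_gen K L"
    and smult_mult_left: "\<lbrakk>c \<in> carrier K; x \<in> carrier L; y \<in> carrier L\<rbrakk> \<Longrightarrow>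
      c \<odot>\<^bsub>L\<^esub> (x \<otimes>\<^bsub>L\<^esub> y) = (c \<odot>\<^bsub>L\<^esub> x) \<otimes>\<^bsub>L\<^esub> y"
    and smult_mult_right: "\<lbrakk>c \<in> carrier K; x \<in> carrier L; y \<in> carrier L\<rbrakk> \<Longrightarrow>
      c \<odot>\<^bsub>L\<^esub> (x \<otimes>\<^bsub>L\<^esub> y) = x \<otimes>\<^bsub>L\<^esub> (c \<odot>\<^bsub>L\<^esub> y)"

text \<open>The finitely generated modules whose elements are lists of ring elements.  By
  \<open>ex_iso_fmod\<close> below, every finitely generated module, on whatever type, is isomorphic to one
  of these, so that they form a model of \<open>mod R\<close>.\<close>

definition fmod :: "('a, 'r) ring_scheme \<Rightarrow> ('a, 'a list) module set" where
  "fmod R = {M. left_module R M \<and> fin_gen R M}"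

fun lincomb :: "('a, 'b, 'm) module_scheme \<Rightarrow> 'a list \<Rightarrow> 'b list \<Rightarrow> 'b" where
  "lincomb M (r # rs) (x # xs) = r \<odot>\<^bsub>M\<^esub> x \<oplus>\<^bsub>M\<^esub> lincomb M rs xs"
| "lincomb M _ _ = \<zero>\<^bsub>M\<^esub>"

context left_module
begin

lemma smult_l_null [simp]: "x \<in> carrier M \<Longrightarrow> \<zero> \<odot>\<^bsub>M\<^esub> x = \<zero>\<^bsub>M\<^esub>"
  by (metis M.add.l_cancel_one' R.l_zero R.zero_closed smult_closed smult_l_distr)

lemma smult_r_null [simp]: "a \<in> carrier R \<Longrightarrow> a \<odot>\<^bsub>M\<^esub> \<zero>\<^bsub>M\<^esub> = \<zero>\<^bsub>M\<^esub>"
  by (metis M.add.l_cancel_one' M.l_zero M.zero_closed smult_closed smult_r_distr)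

lemma smult_minus_one: "x \<in> carrier M \<Longrightarrow> (\<ominus> \<one>) \<odot>\<^bsub>M\<^esub> x = \<ominus>\<^bsub>M\<^esub> x"
  by (metis M.minus_equality R.add.inv_closed R.l_neg R.one_closed smult_closed smult_l_distr
      smult_l_null smult_one)

lemma lincomb_closed:
  "\<lbrakk>set rs \<subseteq> carrier R; set xs \<subseteq> carrier M\<rbrakk> \<Longrightarrow> lincomb M rs xs \<in> carrier M"
proof (induction rs arbitrary: xs)
  case (Cons r rs)
  then show ?case by (cases xs) auto
qed auto

lemma lincomb_smult:
  "\<lbrakk>a \<in> carrier R; set rs \<subseteq> carrier R; set xs \<subseteq> carrier M\<rbrakk> \<Longrightarrow>
    a \<odot>\<^bsub>M\<^esub> lincomb M rs xs = lincomb M (map (\<lambda>r. a \<otimes> r) rs) xs"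
proof (induction rs arbitrary: xs)
  case (Cons r rs)
  then show ?case by (cases xs) (auto simp: smult_r_distr smult_assoc1 lincomb_closed)
qed auto

lemma lincomb_add:
  "\<lbrakk>length rs = length xs; length ss = length xs;
    set rs \<subseteq> carrier R; set ss \<subseteq> carrier R; set xs \<subseteq> carrier M\<rbrakk> \<Longrightarrow>
    lincomb M rs xs \<oplus>\<^bsub>M\<^esub> lincomb M ss xs = lincomb M (map2 (\<oplus>) rs ss) xs"
proof (induction xs arbitrary: rs ss)
  case (Cons x xs)
  then obtain r rs' s ss' where "rs = r # rs'" "ss = s # ss'"
    by (metis length_Suc_conv)
  with Cons show ?case
    by (auto simp: smult_l_distr lincomb_closed Cons.IH[symmetric] M.a_ac)
qed auto

lemma lincomb_zero:
  "set xs \<subseteq> carrier M \<Longrightarrow> lincomb M (map (\<lambda>_. \<zero>) xs) xs = \<zero>\<^bsub>M\<^esub>"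
  by (induction xs) auto

lemma lincomb_unit:
  "\<lbrakk>x \<in> set xs; set xs \<subseteq> carrier M\<rbrakk> \<Longrightarrow>
    \<exists>rs. length rs = length xs \<and> set rs \<subseteq> carrier R \<and> lincomb M rs xs = x"
proof (induction xs)
  case (Cons y xs)
  show ?case
  proof (cases "x = y")
    case True
    then show ?thesis using Cons.prems
      by (intro exI[of _ "\<one> # map (\<lambda>_. \<zero>) xs"]) (auto simp: lincomb_zero)
  next
    case False
    with Cons obtain rs where "length rs = length xs" "set rs \<subseteq> carrier R" "lincomb M rs xs = x"
      by auto
    then show ?thesis using Cons.prems False
      by (intro exI[of _ "\<zero> # rs"]) auto
  qed
qed auto

lemma fin_gen_lincomb:
  assumes "fin_gen R M"
  shows "\<exists>xs. set xs \<subseteq> carrier M \<and> (\<forall>m \<in> carrier M.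
    \<exists>rs. length rs = length xs \<and> set rs \<subseteq> carrier R \<and> lincomb M rs xs = m)"
proof -
  obtain S where S: "finite S" "S \<subseteq> carrier M"
      "\<And>N. submodule N R M \<Longrightarrow> S \<subseteq> N \<Longrightarrow> N = carrier M"
    using assms by (auto simp: fin_gen_def)
  obtain xs where xs: "set xs = S" using S(1) finite_list by blast
  let ?N = "{lincomb M rs xs | rs. length rs = length xs \<and> set rs \<subseteq> carrier R}"
  have sm: "a \<odot>\<^bsub>M\<^esub> n \<in> ?N" if a: "a \<in> carrier R" and n: "n \<in> ?N" for a n
  proof -
    obtain rs where rs: "n = lincomb M rs xs" "length rs = length xs" "set rs \<subseteq> carrier R"
      using n by blast
    then have "a \<odot>\<^bsub>M\<^esub> n = lincomb M (map (\<lambda>r. a \<otimes> r) rs) xs"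
      using lincomb_smult a xs S by simp
    moreover have "set (map (\<lambda>r. a \<otimes> r) rs) \<subseteq> carrier R" using rs a by auto
    moreover have "length (map (\<lambda>r. a \<otimes> r) rs) = length xs" using rs by simp
    ultimately show ?thesis by blast
  qed
  have ad: "m \<oplus>\<^bsub>M\<^esub> n \<in> ?N" if m: "m \<in> ?N" and n: "n \<in> ?N" for m n
  proof -
    obtain rs where rs: "m = lincomb M rs xs" "length rs = length xs" "set rs \<subseteq> carrier R"
      using m by blast
    obtain ss where ss: "n = lincomb M ss xs" "length ss = length xs" "set ss \<subseteq> carrier R"
      using n by blast
    have "m \<oplus>\<^bsub>M\<^esub> n = lincomb M (map2 (\<oplus>) rs ss) xs"
      using rs ss lincomb_add xs S by simp
    moreover have "set (map2 (\<oplus>) rs ss) \<subseteq> carrier R"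
      using rs ss by (auto simp: set_zip intro!: R.a_closed)
    moreover have "length (map2 (\<oplus>) rs ss) = length xs" using rs ss by simp
    ultimately show ?thesis by blast
  qed
  have sub: "?N \<subseteq> carrier M" using lincomb_closed xs S by auto
  have "submodule ?N R M"
  proof (intro submodule.intro subgroup.intro submodule_axioms.intro)
    show "?N \<subseteq> carrier (add_monoid M)" using sub by simp
    show "\<one>\<^bsub>add_monoid M\<^esub> \<in> ?N"
      using lincomb_zero[of xs] xs S by (auto intro!: exI[of _ "map (\<lambda>_. \<zero>) xs"])
    fix x assume x: "x \<in> ?N"
    have "(\<ominus> \<one>) \<odot>\<^bsub>M\<^esub> x \<in> ?N" using sm[OF _ x] by blast
    moreover have "(\<ominus> \<one>) \<odot>\<^bsub>M\<^esub> x = \<ominus>\<^bsub>M\<^esub> x" using smult_minus_one x sub by blast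
    ultimately have "\<ominus>\<^bsub>M\<^esub> x \<in> ?N" by (simp only:)
    then show "inv\<^bsub>add_monoid M\<^esub> x \<in> ?N" by (simp add: a_inv_def)
  next
    fix x y assume "x \<in> ?N" "y \<in> ?N"
    then show "x \<otimes>\<^bsub>add_monoid M\<^esub> y \<in> ?N" using ad by simp
  qed (use sm in blast)
  moreover have "S \<subseteq> ?N" using lincomb_unit[of _ xs] xs S by blast
  ultimately have "?N = carrier M" by (rule S(3))
  then have "\<exists>rs. length rs = length xs \<and> set rs \<subseteq> carrier R \<and> lincomb M rs xs = m"
    if "m \<in> carrier M" for m
    using that unfolding set_eq_iff mem_Collect_eq by metis
  with xs S(2) show ?thesis by blast
qed

end

lemma ex_iso_fmod:
  assumes "left_module R M" "fin_gen R M"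
  shows "\<exists>N \<in> fmod R. module_iso R M N"
proof -
  interpret left_module R M by fact
  obtain xs where xs: "set xs \<subseteq> carrier M"
      "\<And>m. m \<in> carrier M \<Longrightarrow> \<exists>rs. length rs = length xs \<and> set rs \<subseteq> carrier R \<and> lincomb M rs xs = m"
    using fin_gen_lincomb[OF assms(2)] by auto
  define f where "f m = (SOME rs. lincomb M rs xs = m)" for m
  define g where "g rs = lincomb M rs xs" for rs
  have gf: "g (f m) = m" if "m \<in> carrier M" for m
    unfolding f_def g_def using someI_ex xs(2)[OF that] by (metis (mono_tags, lifting))
  define N :: "('a, 'a list) module" where "N = \<lparr>carrier = f ` carrier M,
      monoid.mult = (\<lambda>_ _. undefined), one = undefined,
      ring.zero = f \<zero>\<^bsub>M\<^esub>,
      ring.add = (\<lambda>x y. f (g x \<oplus>\<^bsub>M\<^esub> g y)),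
      smult = (\<lambda>a x. f (a \<odot>\<^bsub>M\<^esub> g x))\<rparr>"
  have inj: "inj_on f (carrier M)" by (metis gf inj_onI)
  have N: "carrier N = f ` carrier M" "\<zero>\<^bsub>N\<^esub> = f \<zero>\<^bsub>M\<^esub>" "x \<oplus>\<^bsub>N\<^esub> y = f (g x \<oplus>\<^bsub>M\<^esub> g y)"
      "a \<odot>\<^bsub>N\<^esub> x = f (a \<odot>\<^bsub>M\<^esub> g x)" for a x y
    by (simp_all add: N_def)
  have "abelian_group N"
  proof (rule abelian_groupI)
    fix x assume "x \<in> carrier N"
    then obtain m where m: "m \<in> carrier M" "x = f m" by (auto simp: N)
    then show "\<exists>y\<in>carrier N. y \<oplus>\<^bsub>N\<^esub> x = \<zero>\<^bsub>N\<^esub>"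
      by (intro bexI[of _ "f (\<ominus>\<^bsub>M\<^esub> m)"]) (auto simp: N gf M.l_neg)
  qed (auto simp: N gf M.a_ac)
  then have lm: "left_module R N"
    by (intro left_module.intro left_module_axioms.intro)
      (auto simp: N gf smult_l_distr smult_r_distr smult_assoc1 R.ring_axioms)
  have hom: "f \<in> module_hom R M N"
    by (auto simp: module_hom_def hom_def N gf)
  have "fin_gen R N"
  proof -
    obtain S where S: "finite S" "S \<subseteq> carrier M"
        "\<And>H. submodule H R M \<Longrightarrow> S \<subseteq> H \<Longrightarrow> H = carrier M"
      using assms(2) by (auto simp: fin_gen_def)
    have "H = carrier N" if H: "submodule H R N" "f ` S \<subseteq> H" for H
    proof -
      interpret H: submodule H R N by fact
      interpret N: left_module R N by fact
      let ?H = "{m \<in> carrier M. f m \<in> H}"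
      have ad: "f (m \<oplus>\<^bsub>M\<^esub> n) \<in> H" if "m \<in> ?H" "n \<in> ?H" for m n
        using H.m_closed[of "f m" "f n"] that by (simp add: N gf)
      have sm: "f (a \<odot>\<^bsub>M\<^esub> m) \<in> H" if "a \<in> carrier R" "m \<in> ?H" for a m
        using H.smult_closed[of a "f m"] that by (simp add: N gf)
      have "submodule ?H R M"
      proof (intro submodule.intro subgroup.intro submodule_axioms.intro)
        show "\<one>\<^bsub>add_monoid M\<^esub> \<in> ?H" using H.one_closed by (simp add: N)
        fix x assume x: "x \<in> ?H"
        have "\<ominus>\<^bsub>M\<^esub> x \<in> ?H" using sm[OF _ x, of "\<ominus>\<^bsub>R\<^esub> \<one>\<^bsub>R\<^esub>"] smult_minus_one[of x] x by auto
        then show "inv\<^bsub>add_monoid M\<^esub> x \<in> ?H" by (simp add: a_inv_def)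
      qed (use ad sm in auto)
      moreover have "S \<subseteq> ?H" using S(2) that by auto
      ultimately have "?H = carrier M" by (rule S(3))
      then show ?thesis using H.subset by (auto simp: N)
    qed
    then show ?thesis using S(1,2) unfolding fin_gen_def
      by (intro exI[of _ "f ` S"]) (auto simp: N)
  qed
  with lm have "N \<in> fmod R" by (simp add: fmod_def)
  moreover have "module_iso R M N"
    using hom inj by (auto simp: module_iso_def bij_betw_def N)
  ultimately show ?thesis by blast
qed

text \<open>Classes of modules are sets \<open>C \<subseteq> fmod R\<close>, which need not be closed under isomorphism.
  \<open>add_class R C\<close> is closed under isomorphism in \<open>fmod R\<close>, so that \<open>add_class R D = D\<close> makes
  literal membership in \<open>D\<close> the same as membership up to isomorphism.\<close>

definition direct_summand ::
  "('a, 'r) ring_scheme \<Rightarrow> ('a, 'a list) module \<Rightarrow> ('a, 'b) module \<Rightarrow> bool" where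
  "direct_summand R Z X \<longleftrightarrow> (\<exists>Y \<in> fmod R. module_iso R X (Z \<boxplus> Y))"

definition add_class ::
  "('a, 'r) ring_scheme \<Rightarrow> ('a, 'a list) module set \<Rightarrow> ('a, 'a list) module set" where
  "add_class R C = {X \<in> fmod R. \<exists>Ms. set Ms \<subseteq> C \<and> direct_summand R X (dsum_list Ms)}"

definition indecomposable :: "('a, 'r) ring_scheme \<Rightarrow> ('a, 'a list) module \<Rightarrow> bool" where
  "indecomposable R X \<longleftrightarrow> \<not> zero_module X \<and>
      (\<forall>A \<in> fmod R. \<forall>B \<in> fmod R. module_iso R X (A \<boxplus> B) \<longrightarrow> zero_module A \<or> zero_module B)"


section \<open>Projectives, syzygies and projective dimension\<close>

definition projective :: "('a, 'r) ring_scheme \<Rightarrow> ('a, 'a list) module \<Rightarrow> bool" where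
  "projective R P \<longleftrightarrow> (\<forall>A \<in> fmod R. \<forall>B \<in> fmod R. \<forall>g \<in> module_hom R A B. \<forall>h \<in> module_hom R P B.
      g ` carrier A = carrier B \<longrightarrow>
      (\<exists>k \<in> module_hom R P A. \<forall>x \<in> carrier P. g (k x) = h x))"

definition projective_cover ::
  "('a, 'r) ring_scheme \<Rightarrow> ('a, 'a list) module \<Rightarrow> ('a, 'a list) module \<Rightarrow> ('a list \<Rightarrow> 'a list) \<Rightarrow> bool" where
  "projective_cover R X P p \<longleftrightarrow>
      P \<in> fmod R \<and> projective R P \<and> p \<in> module_hom R P X \<and> p ` carrier P = carrier X \<and>
      (\<forall>N. submodule N R P \<and> N <+>\<^bsub>P\<^esub> a_kernel P X p = carrier P \<longrightarrow> N = carrier P)"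

text \<open>Over an artin algebra a projective cover exists and its kernel is unique up to isomorphism.
  Kernels are taken as objects of \<open>fmod R\<close>, hence the exact sequence.\<close>

definition Syz :: "('a, 'r) ring_scheme \<Rightarrow> ('a, 'a list) module \<Rightarrow> ('a, 'a list) module" where
  "Syz R X = (SOME Y. Y \<in> fmod R \<and>
      (\<exists>P p i. projective_cover R X P p \<and> short_exact R Y P X i p))"

text \<open>An exact sequence \<open>0 \<longrightarrow> Q (n+1) \<longrightarrow> \<dots> \<longrightarrow> Q 1 \<longrightarrow> Q 0 = X \<longrightarrow> 0\<close> with
  \<open>Q 1, \<dots>, Q (n+1)\<close> projective and maps \<open>d i : Q (i+1) \<rightarrow> Q i\<close>; the term \<open>P\<^sub>i\<close> of the usual
  numbering is \<open>Q (i+1)\<close>.\<close>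

definition projective_resolution ::
  "('a, 'r) ring_scheme \<Rightarrow> ('a, 'a list) module \<Rightarrow> nat \<Rightarrow>
    (nat \<Rightarrow> ('a, 'a list) module) \<Rightarrow> (nat \<Rightarrow> 'a list \<Rightarrow> 'a list) \<Rightarrow> bool" where
  "projective_resolution R X n Q d \<longleftrightarrow>
      Q 0 = X \<and>
      (\<forall>i \<le> n. Q (Suc i) \<in> fmod R \<and> projective R (Q (Suc i)) \<and>
        d i \<in> module_hom R (Q (Suc i)) (Q i)) \<and>
      d 0 ` carrier (Q 1) = carrier X \<and>
      (\<forall>i < n. d (Suc i) ` carrier (Q (Suc (Suc i))) = a_kernel (Q (Suc i)) (Q i) (d i)) \<and>
      inj_on (d n) (carrier (Q (Suc n)))"

definition pd :: "('a, 'r) ring_scheme \<Rightarrow> ('a, 'a list) module \<Rightarrow> enat" where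
  "pd R X = Inf {enat n | n. \<exists>Q d. projective_resolution R X n Q d}"

definition fin_dim :: "('a, 'r) ring_scheme \<Rightarrow> ('a, 'a list) module set \<Rightarrow> enat" where
  "fin_dim R C = Sup {pd R X | X. X \<in> C \<and> pd R X < \<infinity>}"


section \<open>The Igusa--Todorov function\<close>

definition iso_class ::
  "('a, 'r) ring_scheme \<Rightarrow> ('a, 'a list) module \<Rightarrow> ('a, 'a list) module set" where
  "iso_class R X = {Y \<in> fmod R. module_iso R X Y}"

definition ind_nonproj :: "('a, 'r) ring_scheme \<Rightarrow> ('a, 'a list) module set" where
  "ind_nonproj R = {X \<in> fmod R. indecomposable R X \<and> \<not> projective R X}"

definition IT_group ::
  "('a, 'r) ring_scheme \<Rightarrow> (('a, 'a list) module set \<Rightarrow>\<^sub>0 int) monoid" where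
  "IT_group R = free_Abelian_group (iso_class R ` ind_nonproj R)"

text \<open>The choice of the decomposition is immaterial by the Krull--Schmidt theorem.\<close>

definition ind_decomposition ::
  "('a, 'r) ring_scheme \<Rightarrow> ('a, 'a list) module \<Rightarrow> ('a, 'a list) module list" where
  "ind_decomposition R Y = (SOME Ms. set Ms \<subseteq> fmod R \<and> (\<forall>M \<in> set Ms. indecomposable R M) \<and>
      module_iso R Y (dsum_list Ms))"

definition IT_class ::
  "('a, 'r) ring_scheme \<Rightarrow> ('a, 'a list) module \<Rightarrow> ('a, 'a list) module set \<Rightarrow>\<^sub>0 int" where
  "IT_class R Y = (\<Sum>M \<leftarrow> filter (\<lambda>M. \<not> projective R M) (ind_decomposition R Y).
      frag_of (iso_class R M))"

text \<open>The homomorphism of free abelian groups that sends \<open>[X]\<close> to \<open>[\<Omega> X]\<close>.\<close>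

definition IT_L ::
  "('a, 'r) ring_scheme \<Rightarrow> (('a, 'a list) module set \<Rightarrow>\<^sub>0 int) \<Rightarrow> (('a, 'a list) module set \<Rightarrow>\<^sub>0 int)" where
  "IT_L R = frag_extend (\<lambda>c. IT_class R (Syz R (SOME X. X \<in> c)))"

definition IT_span ::
  "('a, 'r) ring_scheme \<Rightarrow> ('a, 'a list) module \<Rightarrow> (('a, 'a list) module set \<Rightarrow>\<^sub>0 int) set" where
  "IT_span R X = generate (IT_group R)
      {frag_of (iso_class R Z) | Z. Z \<in> ind_nonproj R \<and> direct_summand R Z X}"

definition int_rank :: "('b \<Rightarrow>\<^sub>0 int) set \<Rightarrow> enat" where
  "int_rank H = Sup {enat (card B) | B. B \<subseteq> H \<and> finite B \<and> \<not> module.dependent frag_cmul B}"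

definition IT_Phi :: "('a, 'r) ring_scheme \<Rightarrow> ('a, 'a list) module \<Rightarrow> nat" where
  "IT_Phi R X = (LEAST n. \<forall>k \<ge> n.
      int_rank ((IT_L R ^^ k) ` IT_span R X) = int_rank ((IT_L R ^^ Suc k) ` IT_span R X))"

definition Phi_dim :: "('a, 'r) ring_scheme \<Rightarrow> ('a, 'a list) module set \<Rightarrow> enat" where
  "Phi_dim R C = Sup {enat (IT_Phi R X) | X. X \<in> C}"


section \<open>GLIT classes and GLIT algebras\<close>

definition GLIT_class ::
  "('a, 'r) ring_scheme \<Rightarrow> nat \<Rightarrow> nat \<Rightarrow> ('a, 'a list) module \<Rightarrow> ('a, 'a list) module set \<Rightarrow>
    ('a, 'a list) module set \<Rightarrow> bool" where
  "GLIT_class R n t V D C \<longleftrightarrow>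
      C \<subseteq> fmod R \<and> 1 \<le> t \<and> V \<in> fmod R \<and> D \<subseteq> fmod R \<and>
      add_class R D = D \<and> (Syz R ^^ t) ` D \<subseteq> D \<and> Phi_dim R D < \<infinity> \<and>
      (\<forall>X \<in> C. \<exists>V0 \<in> add_class R {V}. \<exists>V1 \<in> add_class R {V}. \<exists>D0 \<in> D. \<exists>D1 \<in> D. \<exists>f g.
        short_exact R (V1 \<boxplus> D1) (V0 \<boxplus> D0) ((Syz R ^^ n) X) f g)"

definition GLIT_algebra :: "('a, 'r) ring_scheme \<Rightarrow> bool" where
  "GLIT_algebra R \<longleftrightarrow> (\<exists>n t V D. GLIT_class R n t V D (fmod R))"

end

theory Submission
  imports Defs "HOL-Library.Multiset"
begin

text \<open>Let \<open>L\<close> be the endomorphism \<open>[X] \<mapsto> [\<Omega> X]\<close>. For \<open>X\<close> in the class, with \<open>pd X < \<infinity>\<close> and \<open>Y =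
  \<Omega>\<^sup>n X\<close>, take \<open>0 \<rightarrow> A \<rightarrow> B \<rightarrow> Y \<rightarrow> 0\<close> with \<open>A = V\<^sub>1 \<oplus> D\<^sub>1\<close> and \<open>B = V\<^sub>0 \<oplus> D\<^sub>0\<close>. High syzygies of \<open>Y\<close>
  are projective, so some power of \<open>L\<close> kills \<open>[A] - [B]\<close>. These differences lie in the subgroup
  generated by the finitely many summands of \<open>V\<close> and by the classes from \<open>\<D>\<close>; finiteness of \<open>\<Phi> dim
  \<D>\<close> makes \<open>L\<close> eventually injective on the latter, and finite generation of the former then gives
  a single multiple \<open>N\<close> of \<open>t\<close> with \<open>L\<^sup>N ([A] - [B]) = 0\<close> for all \<open>X\<close>. Hence \<open>\<Omega>\<^sup>N A\<close> and \<open>\<Omega>\<^sup>N B\<close>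
  are stably isomorphic, and \<open>\<Omega>\<^sup>N Y\<close> is the cokernel of a map that is stably an endomorphism of
  \<open>\<Omega>\<^sup>N A\<close>. By Fitting's lemma its projective dimension exceeds by at most one the largest finite
  projective dimension of a summand of \<open>\<Omega>\<^sup>N A\<close>; such summands come from \<open>\<Omega>\<^sup>N V\<close>, which has
  finitely many indecomposable summands, or from \<open>\<Omega>\<^sup>N \<D> \<subseteq> \<D>\<close>, where \<open>\<Phi> dim \<D>\<close> is a bound.\<close>

section \<open>Chain conditions over artin algebras\<close>

text \<open>A bound on \<Phi> over \<open>\<D>\<close> does not directly bound \<Phi> on the sums
  \<open>V\<^sub>1 \<oplus> D\<^sub>1\<close>, and \<open>\<D>\<close> may contain infinitely many
  indecomposables. Working with exponents on subgroups avoids this: on a torsion-free group,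
  constant finite rank forces injectivity, so one exponent serves all classes from
  \<open>\<D>\<close>, and a uniform exponent survives each added generator. Only \<Omega>^t is
  known to preserve \<open>\<D>\<close>, whence the multiple of \<open>t\<close>; membership of
  \<Omega>^N \<open>D\<^sub>1\<close> in \<open>\<D>\<close> is used a second time, to bound the
  nilpotent part. The horseshoe lemma yields the middle syzygy only up to projective summands, so
  maps and modules are compared stably, and Krull-Schmidt translates stable isomorphism into
  equality of classes. The extra one in the bound comes from cokernels: if the first map of a short
  exact sequence is a stable isomorphism, cancelling the common part leaves a presentation of the
  cokernel by two projectives.\<close>

text \<open>Identities in an abelian group are checked by computing in the free abelian group on its
  carrier: \<open>represents G t x\<close> says that the formal combination \<open>t\<close> evaluates to \<open>x\<close>.\<close>

definition represents :: "('b, 'm) ring_scheme \<Rightarrow> ('b \<Rightarrow>\<^sub>0 int) \<Rightarrow> 'b \<Rightarrow> bool" where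
  "represents G t x \<longleftrightarrow> Poly_Mapping.keys t \<subseteq> carrier G \<and>
    (\<forall>h \<in> hom (free_Abelian_group (carrier G)) (add_monoid G).
      (\<forall>y \<in> carrier G. h (frag_of y) = y) \<longrightarrow> h t = x)"

lemma represents_add:
  "\<lbrakk>represents G s x; represents G t y\<rbrakk> \<Longrightarrow> represents G (s + t) (x \<oplus>\<^bsub>G\<^esub> y)"
  using keys_add[of s t] by (auto simp: represents_def hom_def)

lemma represents_neg:
  assumes "abelian_group G" "represents G s x" shows "represents G (- s) (\<ominus>\<^bsub>G\<^esub> x)"
proof -
  have "h (- s) = \<ominus>\<^bsub>G\<^esub> h s" if "h \<in> hom (free_Abelian_group (carrier G)) (add_monoid G)" for h
  proof -
    interpret group_hom "free_Abelian_group (carrier G)" "add_monoid G" h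
      using that assms(1) by (intro group_hom.intro group_hom_axioms.intro)
        (auto intro: abelian_group.a_group)
    show ?thesis using hom_inv[of s] assms(2) by (simp add: represents_def a_inv_def)
  qed
  then show ?thesis using assms(2) by (auto simp: represents_def)
qed

lemma represents_minus:
  "\<lbrakk>abelian_group G; represents G s x; represents G t y\<rbrakk> \<Longrightarrow> represents G (s - t) (x \<ominus>\<^bsub>G\<^esub> y)"
  using represents_add[of G s x "- t" "\<ominus>\<^bsub>G\<^esub> y"] represents_neg[of G t y] by (simp add: a_minus_def)

lemma represents_zero:
  assumes "abelian_group G" shows "represents G 0 \<zero>\<^bsub>G\<^esub>"
proof -
  have "h 0 = \<zero>\<^bsub>G\<^esub>" if "h \<in> hom (free_Abelian_group (carrier G)) (add_monoid G)" for h
  proof -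
    interpret group_hom "free_Abelian_group (carrier G)" "add_monoid G" h
      using that assms by (intro group_hom.intro group_hom_axioms.intro)
        (auto intro: abelian_group.a_group)
    show ?thesis using hom_one by simp
  qed
  then show ?thesis by (auto simp: represents_def)
qed

lemma represents_base: "x \<in> carrier G \<Longrightarrow> represents G (frag_of x) x"
  by (simp add: represents_def)

text \<open>The universal property of the free abelian group supplies an evaluation map
  \<open>h\<close>. The premise \<open>s = t\<close> is an identity of finitely supported functions,
  within reach of \<open>algebra_simps\<close>; together with \<open>represents_intros\<close> this
  proves the additive identities in carriers below.\<close>

lemma represents_eqI:
  assumes "represents G s x" "represents G t y" "abelian_group G" "s = t"
  shows "x = y"
proof -
  interpret G: comm_group "add_monoid G" using assms(3) by (rule abelian_group.a_comm_group)
  obtain h where "h \<in> hom (free_Abelian_group (carrier G)) (add_monoid G)"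
      "\<And>y. y \<in> carrier G \<Longrightarrow> h (frag_of y) = y"
    using G.free_Abelian_group_universal[of "\<lambda>x. x" "carrier G"] by auto
  then show ?thesis using assms by (auto simp: represents_def)
qed

lemmas represents_intros =
  represents_add represents_neg represents_minus represents_zero represents_base

lemma (in abelian_group) minus_eq_zero_iff:
  assumes "x \<in> carrier G" "y \<in> carrier G"
  shows "x \<ominus> y = \<zero> \<longleftrightarrow> x = y"
proof
  have "x = (x \<ominus> y) \<oplus> y"
    using assms abelian_group_axioms
    by - (rule represents_eqI, (rule represents_intros | simp add: algebra_simps)+)
  then show "x = y" if "x \<ominus> y = \<zero>" using that assms by simp
qed (use assms in \<open>simp add: a_minus_def r_neg\<close>)

section \<open>Chain conditions on families of sets\<close>

text \<open>Ascending and descending chains are treated together, so that one proof passes both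
  conditions through extensions.\<close>

definition chain_cond :: "'s set set \<Rightarrow> bool" where
  "chain_cond S \<longleftrightarrow>
    (\<forall>A :: nat \<Rightarrow> 's set. range A \<subseteq> S \<and> (mono A \<or> antimono A) \<longrightarrow> (\<exists>n. \<forall>m \<ge> n. A m = A n))"

lemma chain_cond_subset: "chain_cond S \<Longrightarrow> T \<subseteq> S \<Longrightarrow> chain_cond T"
  unfolding chain_cond_def by (meson subset_trans)

lemma chain_cond_finite:
  assumes "finite S" shows "chain_cond S"
  unfolding chain_cond_def
proof (intro allI impI)
  fix A :: "nat \<Rightarrow> 'a set" assume A: "range A \<subseteq> S \<and> (mono A \<or> antimono A)"
  have fin: "finite (range A)" using A assms finite_subset by blast
  consider "mono A" | "antimono A" using A by blast
  then show "\<exists>n. \<forall>m \<ge> n. A m = A n"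
  proof cases
    case 1
    obtain M where "M \<in> range A" "\<forall>b \<in> range A. M \<le> b \<longrightarrow> M = b"
      using finite_has_maximal[OF fin] by blast
    then show ?thesis using 1 by (metis monoD rangeE rangeI)
  next
    case 2
    obtain M where "M \<in> range A" "\<forall>b \<in> range A. b \<le> M \<longrightarrow> M = b"
      using finite_has_minimal[OF fin] by blast
    then show ?thesis using 2 by (metis antimonoD rangeE rangeI)
  qed
qed

text \<open>The model is a module with a submodule: \<open>\<phi>\<close> intersects with the
  submodule, \<open>\<psi>\<close> takes the image in the quotient, and the last premise is the
  modular law. Along a chain both traces become constant, and comparable members with equal traces
  coincide.\<close>

lemma chain_cond_transfer:
  fixes S :: "'a set set"
  assumes "chain_cond S1" "chain_cond S2"
    and S: "\<And>A. A \<in> S \<Longrightarrow> \<phi> A \<in> S1" "\<And>A. A \<in> S \<Longrightarrow> \<psi> A \<in> S2"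
    and mon: "\<And>A B. \<lbrakk>A \<in> S; B \<in> S; A \<subseteq> B\<rbrakk> \<Longrightarrow> \<phi> A \<subseteq> \<phi> B \<and> \<psi> A \<subseteq> \<psi> B"
    and eq: "\<And>A B. \<lbrakk>A \<in> S; B \<in> S; A \<subseteq> B; \<phi> A = \<phi> B; \<psi> A = \<psi> B\<rbrakk> \<Longrightarrow> A = B"
  shows "chain_cond S"
  unfolding chain_cond_def
proof (intro allI impI)
  fix A :: "nat \<Rightarrow> 'a set" assume A: "range A \<subseteq> S \<and> (mono A \<or> antimono A)"
  then have in_S: "A n \<in> S" for n by blast
  have 1: "range (\<lambda>n. \<phi> (A n)) \<subseteq> S1" "range (\<lambda>n. \<psi> (A n)) \<subseteq> S2" using S in_S by auto
  have 2: "mono (\<lambda>n. \<phi> (A n)) \<or> antimono (\<lambda>n. \<phi> (A n))"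
     "mono (\<lambda>n. \<psi> (A n)) \<or> antimono (\<lambda>n. \<psi> (A n))"
    using A mon[OF in_S in_S] unfolding mono_def antimono_def by meson+
  obtain n where n: "\<forall>m\<ge>n. \<phi> (A m) = \<phi> (A n)"
    using assms(1) 1(1) 2(1) unfolding chain_cond_def by meson
  obtain k where k: "\<forall>m\<ge>k. \<psi> (A m) = \<psi> (A k)"
    using assms(2) 1(2) 2(2) unfolding chain_cond_def by meson
  have "A m = A (max n k)" if "m \<ge> max n k" for m
  proof -
    have "\<phi> (A m) = \<phi> (A (max n k))" "\<psi> (A m) = \<psi> (A (max n k))"
      using n k that by (metis max.bounded_iff max.cobounded1 max.cobounded2)+
    moreover have "A m \<subseteq> A (max n k) \<or> A (max n k) \<subseteq> A m"
      using A that unfolding mono_def antimono_def by blast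
    ultimately show ?thesis using eq in_S by metis
  qed
  then show "\<exists>n. \<forall>m \<ge> n. A m = A n" by blast
qed

lemma chain_cond_minimal:
  assumes "chain_cond S" "T \<subseteq> S" "T \<noteq> {}"
  shows "\<exists>M \<in> T. \<forall>N \<in> T. N \<subseteq> M \<longrightarrow> N = M"
proof (rule ccontr)
  assume "\<not> ?thesis"
  then have *: "\<forall>M \<in> T. \<exists>N \<in> T. N \<subset> M" by blast
  have "\<exists>A. \<forall>n :: nat. A n \<in> T \<and> A (Suc n) \<subset> A n"
    by (rule dependent_nat_choice) (use * assms(3) in auto)
  then obtain A :: "nat \<Rightarrow> 'a set" where A: "\<And>n. A n \<in> T" "\<And>n. A (Suc n) \<subset> A n" by blast
  then have "antimono A" by (metis antimono_iff_le_Suc psubsetE)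
  moreover have "range A \<subseteq> S" using A(1) assms(2) by blast
  ultimately show False using assms(1) A(2) unfolding chain_cond_def
    by (metis le_add2 plus_1_eq_Suc psubsetE)
qed

lemma chain_cond_maximal:
  assumes "chain_cond S" "T \<subseteq> S" "T \<noteq> {}"
  shows "\<exists>M \<in> T. \<forall>N \<in> T. M \<subseteq> N \<longrightarrow> N = M"
proof (rule ccontr)
  assume "\<not> ?thesis"
  then have *: "\<forall>M \<in> T. \<exists>N \<in> T. M \<subset> N" by blast
  have "\<exists>A. \<forall>n :: nat. A n \<in> T \<and> A n \<subset> A (Suc n)"
    by (rule dependent_nat_choice) (use * assms(3) in auto)
  then obtain A :: "nat \<Rightarrow> 'a set" where A: "\<And>n. A n \<in> T" "\<And>n. A n \<subset> A (Suc n)" by blast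
  then have "mono A" by (metis mono_iff_le_Suc psubsetE)
  moreover have "range A \<subseteq> S" using A(1) assms(2) by blast
  ultimately show False using assms(1) A(2) unfolding chain_cond_def
    by (metis le_add2 plus_1_eq_Suc psubsetE)
qed

section \<open>Ideals of a commutative artinian ring\<close>

text \<open>Negatives come from multiplication by \<open>\<ominus> \<one>\<close>, which is how
  \<open>left_ideal_imp_ideal\<close> recovers the additive subgroup.\<close>

definition left_ideal :: "'a set \<Rightarrow> ('a, 'r) ring_scheme \<Rightarrow> bool" where
  "left_ideal I R \<longleftrightarrow> I \<subseteq> carrier R \<and> \<zero>\<^bsub>R\<^esub> \<in> I \<and> (\<forall>a \<in> I. \<forall>b \<in> I. a \<oplus>\<^bsub>R\<^esub> b \<in> I) \<and>
    (\<forall>r \<in> carrier R. \<forall>a \<in> I. r \<otimes>\<^bsub>R\<^esub> a \<in> I)"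

lemma (in cring) left_ideal_imp_ideal:
  assumes "left_ideal I R" shows "ideal I R"
proof (rule idealI[OF ring_axioms])
  have *: "\<ominus> x \<in> I" if "x \<in> I" for x
  proof -
    have "(\<ominus> \<one>) \<otimes> x \<in> I" using assms that by (auto simp: left_ideal_def)
    then show ?thesis using assms that by (auto simp: left_ideal_def l_minus subset_iff)
  qed
  show "subgroup I (add_monoid R)"
    using assms * by (intro subgroup.intro) (auto simp: left_ideal_def a_inv_def)
  fix a x assume "a \<in> I" "x \<in> carrier R"
  moreover have "a \<in> carrier R" using assms \<open>a \<in> I\<close> by (auto simp: left_ideal_def)
  ultimately show "x \<otimes> a \<in> I" "a \<otimes> x \<in> I" using assms m_comm[of a x] by (auto simp: left_ideal_def)
qed

context cring begin

abbreviation ideals_below :: "'a set \<Rightarrow> 'a set set" where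
  "ideals_below J \<equiv> {I. left_ideal I R \<and> I \<subseteq> J}"

lemma left_ideal_diff:
  assumes "left_ideal I R" "x \<in> I" "y \<in> I" shows "x \<ominus> y \<in> I"
proof -
  have "(\<ominus> \<one>) \<otimes> y \<in> I" using assms by (auto simp: left_ideal_def)
  then show ?thesis using assms by (auto simp: left_ideal_def l_minus a_minus_def subset_iff)
qed

lemma left_ideal_image:
  assumes "left_ideal J R" "x \<in> carrier R" shows "left_ideal ((\<otimes>) x ` J) R"
proof -
  have "x \<otimes> a \<oplus> x \<otimes> b \<in> (\<otimes>) x ` J" if "a \<in> J" "b \<in> J" for a b
    using assms that by (intro image_eqI[of _ _ "a \<oplus> b"]) (auto simp: left_ideal_def r_distr
        subset_iff)
  moreover have "r \<otimes> (x \<otimes> a) \<in> (\<otimes>) x ` J" if "a \<in> J" "r \<in> carrier R" for r a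
    using assms that by (intro image_eqI[of _ _ "r \<otimes> a"]) (auto simp: left_ideal_def m_lcomm
        subset_iff)
  moreover have "\<zero> \<in> (\<otimes>) x ` J" using assms by (intro image_eqI[of _ _ \<zero>]) (auto simp:
      left_ideal_def)
  ultimately show ?thesis using assms unfolding left_ideal_def by auto
qed

lemma left_ideal_ann:
  assumes "left_ideal J R" "x \<in> carrier R" shows "left_ideal {j \<in> J. x \<otimes> j = \<zero>} R"
  using assms by (auto simp: left_ideal_def r_distr subset_iff m_lcomm)

text \<open>A minimal ideal \<open>J\<close> violating the chain conditions is either annihilated or reproduced by
  each ring element, so its annihilator is maximal and \<open>J\<close> is a vector space over the residue
  field; it then has a maximal subspace, which satisfies the chain conditions.\<close>

lemma artinian_chain_cond:
  assumes dcc: "\<And>I. \<lbrakk>\<And>n. ideal (I n) R; \<And>n. I (Suc n) \<subseteq> I n\<rbrakk> \<Longrightarrow> \<exists>n. \<forall>m \<ge> n. (I :: nat \<Rightarrow> 'a set) m =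
      I n"
  shows "chain_cond {I. left_ideal I R}"
proof (rule ccontr)
  assume no: "\<not> ?thesis"
  define T where "T = {J. left_ideal J R \<and> \<not> chain_cond (ideals_below J)}"
  have "{I. left_ideal I R} = ideals_below (carrier R)" by (auto simp: left_ideal_def)
  moreover have "left_ideal (carrier R) R" by (auto simp: left_ideal_def)
  ultimately have T: "T \<noteq> {}" using no T_def by auto
  \<comment> \<open>A minimal member exists by the descending condition alone;
    \<open>chain_cond_minimal\<close> would presuppose the claim.\<close>
  have "\<exists>J \<in> T. \<forall>N \<in> T. N \<subseteq> J \<longrightarrow> N = J"
  proof (rule ccontr)
    assume "\<not> ?thesis"
    then have *: "\<forall>M \<in> T. \<exists>N \<in> T. N \<subset> M" by blast
    have "\<exists>A. \<forall>n :: nat. A n \<in> T \<and> A (Suc n) \<subset> A n"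
      by (rule dependent_nat_choice) (use * T in auto)
    then obtain A :: "nat \<Rightarrow> 'a set" where A: "\<And>n. A n \<in> T" "\<And>n. A (Suc n) \<subset> A n" by blast
    then have "\<exists>n. \<forall>m \<ge> n. A m = A n"
      by (intro dcc left_ideal_imp_ideal) (auto simp: T_def)
    then show False using A(2) by (metis le_add2 plus_1_eq_Suc psubsetE)
  qed
  then obtain J where J: "left_ideal J R" "\<not> chain_cond (ideals_below J)"
    and min: "\<And>N. left_ideal N R \<Longrightarrow> N \<subset> J \<Longrightarrow> chain_cond (ideals_below N)"
    unfolding T_def by blast
  have JR: "j \<in> carrier R" if "j \<in> J" for j using J that by (auto simp: left_ideal_def)
  have J_mult: "r \<otimes> j \<in> J" if "j \<in> J" "r \<in> carrier R" for j r using J that by (auto simp: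
      left_ideal_def)
  have J_diff: "i \<ominus> j \<in> J" if "i \<in> J" "j \<in> J" for i j using left_ideal_diff J that by blast
  \<comment> \<open>Otherwise both the image of \<open>x\<close> on \<open>J\<close> and its kernel
    in \<open>J\<close> are proper, hence satisfy the chain conditions, and so does their extension
    \<open>J\<close>.\<close>
  have onto: "(\<otimes>) x ` J = J" if x: "x \<in> carrier R" "j0 \<in> J" "x \<otimes> j0 \<noteq> \<zero>" for x j0
  proof (rule ccontr)
    assume ne: "\<not> ?thesis"
    have "(\<otimes>) x ` J \<subset> J" using ne J_mult x by auto
    then have 1: "chain_cond (ideals_below ((\<otimes>) x ` J))" using min left_ideal_image J(1) x by blast
    have "{j \<in> J. x \<otimes> j = \<zero>} \<subset> J" using x by blast
    then have 2: "chain_cond (ideals_below {j \<in> J. x \<otimes> j = \<zero>})"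
      using min left_ideal_ann J(1) x(1) by blast
    have "chain_cond (ideals_below J)"
    proof (rule chain_cond_transfer[OF 1 2, where \<phi> = "\<lambda>I. (\<otimes>) x ` I" and \<psi> = "\<lambda>I. {j \<in> I. x \<otimes> j =
        \<zero>}"])
      fix A B assume AB: "A \<in> ideals_below J" "B \<in> ideals_below J" "A \<subseteq> B"
        "(\<otimes>) x ` A = (\<otimes>) x ` B" "{j \<in> A. x \<otimes> j = \<zero>} = {j \<in> B. x \<otimes> j = \<zero>}"
      have "b \<in> A" if b: "b \<in> B" for b
      proof -
        obtain a where a: "a \<in> A" "x \<otimes> a = x \<otimes> b" using AB(4) b by (metis imageE imageI)
        have R: "a \<in> carrier R" "b \<in> carrier R" using a b AB JR by auto
        have "b \<ominus> a \<in> B" using left_ideal_diff AB a b by blast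
        moreover have "x \<otimes> (b \<ominus> a) = \<zero>"
          using R x a by (simp add: a_minus_def r_distr r_minus r_neg)
        ultimately have "b \<ominus> a \<in> A" using AB(5) by blast
        then have "(b \<ominus> a) \<oplus> a \<in> A" using a AB by (auto simp: left_ideal_def)
        then show ?thesis using R by (simp add: a_minus_def a_assoc l_neg)
      qed
      then show "A = B" using AB by blast
    qed (use left_ideal_image left_ideal_ann x in auto)
    then show False using J by blast
  qed
  have "J \<noteq> {\<zero>}"
  proof
    assume "J = {\<zero>}"
    then have "ideals_below J \<subseteq> Pow {\<zero>}" by blast
    then have "finite (ideals_below J)" by (rule finite_subset) simp
    then show False using J chain_cond_finite by blast
  qed
  then obtain v where v: "v \<in> J" "v \<noteq> \<zero>" using J by (auto simp: left_ideal_def)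
  have inv: "\<exists>r \<in> carrier R. \<forall>j \<in> J. r \<otimes> (x \<otimes> j) = j" if x: "x \<in> carrier R" "j0 \<in> J" "x \<otimes> j0 \<noteq> \<zero>"
      for x j0
  proof -
    have pow: "(\<lambda>j. (x [^] n) \<otimes> j) ` J = J" for n :: nat
    proof (induction n)
      case 0
      have "(\<lambda>j. (x [^] (0::nat)) \<otimes> j) ` J = (\<lambda>j. j) ` J" by (intro image_cong) (auto simp: JR)
      then show ?case by simp
    next
      case (Suc n)
      have "(\<lambda>j. (x [^] Suc n) \<otimes> j) ` J = (\<lambda>j. (x [^] n) \<otimes> j) ` (\<otimes>) x ` J"
        unfolding image_image by (intro image_cong) (auto simp: JR x m_assoc)
      then show ?case using Suc onto[OF x] by simp
    qed
    \<comment> \<open>The ring elements that act on \<open>J\<close> like multiples of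
      \<open>x [^] n\<close>. Where this descending chain stops, \<open>x [^] n\<close> acts like
      \<open>x [^] Suc n \<otimes> s\<close>, and \<open>s\<close> is the candidate inverse.\<close>
    define I where "I n = {r \<in> carrier R. \<exists>s \<in> carrier R. \<forall>j \<in> J. r \<otimes> j = (x [^] n) \<otimes> (s \<otimes> j)}"
        for n :: nat
    have "left_ideal (I n) R" for n
      unfolding left_ideal_def
    proof (intro conjI ballI)
      show "\<zero> \<in> I n" unfolding I_def using x JR by (auto intro!: bexI[of _ \<zero>])
      fix a assume "a \<in> I n"
      then obtain s where s: "s \<in> carrier R" "a \<in> carrier R" "\<forall>j \<in> J. a \<otimes> j = (x [^] n) \<otimes> (s \<otimes> j)"
        unfolding I_def by blast
      { fix b assume "b \<in> I n"
        then obtain s' where s': "s' \<in> carrier R" "b \<in> carrier R" "\<forall>j \<in> J. b \<otimes> j = (x [^] n) \<otimes> (s'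
            \<otimes> j)"
          unfolding I_def by blast
        show "a \<oplus> b \<in> I n" unfolding I_def using s s' x JR
          by (auto intro!: bexI[of _ "s \<oplus> s'"] simp: l_distr r_distr) }
      { fix r assume r: "r \<in> carrier R"
        show "r \<otimes> a \<in> I n" unfolding I_def using s r x JR
          by (auto intro!: bexI[of _ "r \<otimes> s"] simp: m_assoc m_lcomm) }
    qed (auto simp: I_def)
    moreover have "I (Suc n) \<subseteq> I n" for n
      unfolding I_def
    proof clarify
      fix r s assume "r \<in> carrier R" "s \<in> carrier R" "\<forall>j\<in>J. r \<otimes> j = x [^] Suc n \<otimes> (s \<otimes> j)"
      then show "\<exists>s\<in>carrier R. \<forall>j\<in>J. r \<otimes> j = x [^] n \<otimes> (s \<otimes> j)" using x JR
        by (intro bexI[of _ "x \<otimes> s"]) (auto simp: m_assoc)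
    qed
    ultimately have "\<exists>n. \<forall>m \<ge> n. I m = I n" by (intro dcc left_ideal_imp_ideal)
    then obtain n where n: "\<forall>m \<ge> n. I m = I n" by blast
    have "x [^] n \<in> I n" unfolding I_def using x JR by (auto intro!: bexI[of _ \<one>])
    then have "x [^] n \<in> I (Suc n)" using n[rule_format, of "Suc n"] by simp
    then obtain s where s: "s \<in> carrier R" "\<forall>j \<in> J. x [^] n \<otimes> j = x [^] Suc n \<otimes> (s \<otimes> j)"
      unfolding I_def by blast
    have "s \<otimes> (x \<otimes> j) = j" if j: "j \<in> J" for j
    proof (rule ccontr)
      assume *: "\<not> ?thesis"
      \<comment> \<open>If \<open>y\<close> acted nontrivially it would map \<open>J\<close> onto
        itself. But \<open>x [^] n\<close> kills the image of \<open>y\<close> and maps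
        \<open>J\<close> onto \<open>J\<close>, so \<open>J\<close> would vanish.\<close>
      define y where "y = \<one> \<ominus> s \<otimes> x"
      have y: "y \<in> carrier R" using x s by (simp add: y_def)
      have yj: "y \<otimes> j = j \<ominus> s \<otimes> (x \<otimes> j)" if "j \<in> J" for j using x s JR[OF that]
        by (simp add: y_def a_minus_def l_distr l_minus m_assoc)
      have "y \<otimes> j \<noteq> \<zero>" using yj[OF j] * JR[OF j] x s by (metis m_closed minus_eq_zero_iff)
      then have y_onto: "(\<otimes>) y ` J = J" using onto y j by blast
      have "x [^] n \<otimes> (y \<otimes> i) = \<zero>" if i: "i \<in> J" for i
      proof -
        have "x [^] n \<otimes> (y \<otimes> i) = x [^] n \<otimes> i \<ominus> x [^] n \<otimes> (s \<otimes> (x \<otimes> i))"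
          using yj[OF i] JR[OF i] x s by (simp add: a_minus_def r_distr r_minus)
        also have "x [^] n \<otimes> (s \<otimes> (x \<otimes> i)) = x [^] n \<otimes> i"
        proof -
          have "x [^] n \<otimes> i = (x [^] n \<otimes> x) \<otimes> (s \<otimes> i)" using s i by simp
          then show ?thesis using s(1) JR[OF i] x by (simp only: m_assoc m_lcomm nat_pow_closed
              m_closed)
        qed
        finally show ?thesis using JR[OF i] x by (simp add: a_minus_def r_neg)
      qed
      then have "x [^] n \<otimes> i = \<zero>" if "i \<in> J" for i using y_onto that by (metis imageE)
      then show False using pow[of n] v by (metis imageE)
    qed
    then show ?thesis using s by blast
  qed
  \<comment> \<open>A maximal member of \<open>Z\<close> plays the role of a hyperplane in the
    vector space \<open>J\<close>, complementary to the line through \<open>v\<close>.\<close>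
  define Z where "Z = {C. left_ideal C R \<and> C \<subseteq> J \<and> v \<notin> C}"
  have "\<exists>C \<in> Z. \<forall>X \<in> Z. C \<subseteq> X \<longrightarrow> X = C"
  proof (rule subset_Zorn_nonempty)
    have "{\<zero>} \<in> Z" using v J by (auto simp: Z_def left_ideal_def)
    then show "Z \<noteq> {}" by blast
    fix \<C> assume C: "\<C> \<noteq> {}" "subset.chain Z \<C>"
    have tot: "X \<subseteq> Y \<or> Y \<subseteq> X" if "X \<in> \<C>" "Y \<in> \<C>" for X Y
      using C that by (meson subset_chain_def)
    have in_Z: "X \<in> Z" if "X \<in> \<C>" for X using C that by (meson subsetD subset_chain_def)
    have W: "left_ideal X R" "X \<subseteq> J" "v \<notin> X" if "X \<in> \<C>" for X
      using in_Z[OF that] by (auto simp: Z_def)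
    have "a \<oplus> b \<in> \<Union>\<C>" if ab: "a \<in> \<Union>\<C>" "b \<in> \<Union>\<C>" for a b
    proof -
      obtain X Y where XY: "X \<in> \<C>" "a \<in> X" "Y \<in> \<C>" "b \<in> Y" using ab by blast
      then obtain U where U: "U \<in> \<C>" "a \<in> U" "b \<in> U" using tot[of X Y] by blast
      then have "a \<oplus> b \<in> U" using W(1)[OF U(1)] by (simp add: left_ideal_def)
      then show ?thesis using U(1) by blast
    qed
    moreover have "r \<otimes> a \<in> \<Union>\<C>" if ab: "a \<in> \<Union>\<C>" "r \<in> carrier R" for a r
    proof -
      obtain U where U: "U \<in> \<C>" "a \<in> U" using ab by blast
      then have "r \<otimes> a \<in> U" using W(1)[OF U(1)] ab by (simp add: left_ideal_def)
      then show ?thesis using U(1) by blast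
    qed
    moreover obtain X0 where "X0 \<in> \<C>" using C(1) by blast
    then have "\<zero> \<in> \<Union>\<C>" using W(1) unfolding left_ideal_def by blast
    moreover have "\<Union>\<C> \<subseteq> carrier R" using W(2) JR by blast
    ultimately have "left_ideal (\<Union>\<C>) R" by (simp add: left_ideal_def)
    then show "\<Union>\<C> \<in> Z" using W(2,3) unfolding Z_def by blast
  qed
  then obtain C where C0: "C \<in> Z" "\<forall>X \<in> Z. C \<subseteq> X \<longrightarrow> X = C" by (elim bexE)
  then have C: "left_ideal C R" "C \<subseteq> J" "v \<notin> C" by (simp_all add: Z_def)
  have max: "X = C" if "left_ideal X R" "X \<subseteq> J" "v \<notin> X" "C \<subseteq> X" for X
    using C0(2) that by (simp add: Z_def)
  have sum: "\<exists>i \<in> I. \<exists>c \<in> C. j = i \<oplus> c" if I: "left_ideal I R" "I \<subseteq> J" "\<not> I \<subseteq> C" and j: "j \<in> J"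
      for I j
  proof -
    define X where "X I = {i \<oplus> c | i c. i \<in> I \<and> c \<in> C}" for I
    have X: "left_ideal (X I) R" "X I \<subseteq> J" "C \<subseteq> X I" "I \<subseteq> X I" if I: "left_ideal I R" "I \<subseteq> J" for I
    proof -
      have IR: "a \<in> carrier R" if "a \<in> I" for a using that I by (auto simp: left_ideal_def)
      have CR: "a \<in> carrier R" if "a \<in> C" for a using that C by (auto simp: left_ideal_def)
      have "x \<oplus> y \<in> X I" if xy: "x \<in> X I" "y \<in> X I" for x y
      proof -
        obtain a b c d where *: "a \<in> I" "b \<in> C" "x = a \<oplus> b" "c \<in> I" "d \<in> C" "y = c \<oplus> d"
          using xy unfolding X_def by blast
        then have "x \<oplus> y = (a \<oplus> c) \<oplus> (b \<oplus> d)" using IR CR by (simp add: a_ac)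
        then show ?thesis using * C(1) I(1) unfolding X_def left_ideal_def by blast
      qed
      moreover have "r \<otimes> x \<in> X I" if xy: "x \<in> X I" "r \<in> carrier R" for r x
      proof -
        obtain a b where *: "a \<in> I" "b \<in> C" "x = a \<oplus> b"
          using xy unfolding X_def by blast
        then have "r \<otimes> x = r \<otimes> a \<oplus> r \<otimes> b" using IR CR xy by (simp add: r_distr)
        then show ?thesis using * xy C(1) I(1) unfolding X_def left_ideal_def by blast
      qed
      moreover have "\<zero> = \<zero> \<oplus> \<zero>" by simp
      then have "\<zero> \<in> X I" using C(1) I(1) unfolding X_def left_ideal_def by blast
      moreover have "X I \<subseteq> carrier R" using IR CR unfolding X_def by blast
      ultimately show "left_ideal (X I) R" by (simp add: left_ideal_def)
      have "i \<oplus> c \<in> J" if "i \<in> I" "c \<in> C" for i c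
        using J(1) I(2) C(2) that unfolding left_ideal_def by blast
      then show "X I \<subseteq> J" unfolding X_def by blast
      have "c = \<zero> \<oplus> c" if "c \<in> C" for c using CR that by simp
      then show "C \<subseteq> X I" using I unfolding X_def left_ideal_def by blast
      have "c = c \<oplus> \<zero>" if "c \<in> I" for c using IR that by simp
      then show "I \<subseteq> X I" using C unfolding X_def left_ideal_def by blast
    qed
    have "X I \<noteq> C" using X(4)[OF I(1,2)] I(3) by blast
    then have "v \<in> X I" using max X[OF I(1,2)] by blast
    have "j \<in> X I"
    proof (cases "j \<in> C")
      case True then show ?thesis using X[OF I(1,2)] by blast
    next
      case False
      define Rj where "Rj = (\<lambda>r. r \<otimes> j) ` carrier R"
      have Rj: "left_ideal Rj R" "Rj \<subseteq> J" "j \<in> Rj"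
      proof -
        have "r \<otimes> j \<oplus> s \<otimes> j = (r \<oplus> s) \<otimes> j" "r \<otimes> (s \<otimes> j) = (r \<otimes> s) \<otimes> j"
          if "r \<in> carrier R" "s \<in> carrier R" for r s using JR[OF j] that by (auto simp: l_distr
              m_assoc)
        moreover have "\<zero> \<in> Rj" "j \<in> Rj" unfolding Rj_def using JR[OF j]
          by (intro image_eqI[of _ _ \<zero>] image_eqI[of _ _ \<one>]; simp)+
        ultimately show "left_ideal Rj R" "Rj \<subseteq> J" "j \<in> Rj"
          using JR[OF j] J_mult[OF j] unfolding Rj_def left_ideal_def by auto
      qed
      have "X Rj \<noteq> C" using X(4)[OF Rj(1,2)] Rj(3) False by blast
      then have "v \<in> X Rj" using max X[OF Rj(1,2)] by blast
      \<comment> \<open>Now the relation can be solved for \<open>j\<close>: the coefficient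
        \<open>r\<close> acts invertibly, so \<open>j\<close> is a combination of \<open>v\<close>
        and an element of \<open>C\<close>, both of which lie in \<open>X I\<close>.\<close>
      then obtain r c where rc: "r \<in> carrier R" "c \<in> C" "v = r \<otimes> j \<oplus> c" unfolding X_def Rj_def by
          blast
      have "r \<otimes> j \<noteq> \<zero>" using rc C by (auto simp: left_ideal_def subset_iff)
      then obtain s where s: "s \<in> carrier R" "\<forall>j \<in> J. s \<otimes> (r \<otimes> j) = j" using inv rc j by blast
      have "s \<otimes> v = j \<oplus> s \<otimes> c" using rc s j JR C(2) by (simp add: r_distr subset_iff)
      then have "j = s \<otimes> v \<ominus> s \<otimes> c" using rc s j JR[OF j] JR[OF v(1)] JR C(2)
        by (simp add: a_minus_def a_assoc r_neg subset_iff)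
      moreover have "s \<otimes> v \<in> X I" "s \<otimes> c \<in> X I"
        using X[OF I(1,2)] rc s \<open>v \<in> X I\<close> unfolding left_ideal_def by blast+
      ultimately show ?thesis using left_ideal_diff X[OF I(1,2)] by simp
    qed
    then show ?thesis unfolding X_def by blast
  qed
  have 1: "chain_cond (ideals_below C)" using min C v by blast
  \<comment> \<open>The quotient of \<open>J\<close> by \<open>C\<close> is simple, so the trace in
    it has only two values, encoded as \<open>C\<close> and \<open>J\<close>.\<close>
  have 2: "chain_cond {C, J}" by (rule chain_cond_finite) simp
  have "chain_cond (ideals_below J)"
  proof (rule chain_cond_transfer[OF 1 2, where \<phi> = "\<lambda>I. I \<inter> C" and \<psi> = "\<lambda>I. if I \<subseteq> C then C else
      J"])
    fix A B assume AB: "A \<in> ideals_below J" "B \<in> ideals_below J" "A \<subseteq> B" "A \<inter> C = B \<inter> C"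
      "(if A \<subseteq> C then C else J) = (if B \<subseteq> C then C else J)"
    have CJ: "C \<noteq> J" using C v by blast
    show "A = B"
    proof (cases "A \<subseteq> C")
      case True
      then show ?thesis using AB CJ by (auto split: if_splits)
    next
      case False
      have "b \<in> A" if b: "b \<in> B" for b
      proof -
        obtain a c where ac: "a \<in> A" "c \<in> C" "b = a \<oplus> c" using sum[of A b] AB b False by blast
        have R: "a \<in> carrier R" "c \<in> carrier R" using ac AB C JR by auto
        have "b \<ominus> a \<in> B" using left_ideal_diff AB ac b by blast
        moreover have "b \<ominus> a = c" unfolding ac(3) using R abelian_group_axioms
          by - (rule represents_eqI, (rule represents_intros | simp add: algebra_simps)+)
        ultimately have "c \<in> A" using AB(4) ac by blast
        then show ?thesis using ac AB by (auto simp: left_ideal_def)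
      qed
      then show ?thesis using AB by blast
    qed
  qed (use C in \<open>auto simp: left_ideal_def\<close>)
  then show False using J by blast
qed

end

section \<open>Submodules of finitely generated modules\<close>

context left_module
begin

lemma submodule_iff:
  "submodule N R M \<longleftrightarrow> N \<subseteq> carrier M \<and> \<zero>\<^bsub>M\<^esub> \<in> N \<and> (\<forall>x \<in> N. \<forall>y \<in> N. x \<oplus>\<^bsub>M\<^esub> y \<in> N) \<and>
    (\<forall>a \<in> carrier R. \<forall>x \<in> N. a \<odot>\<^bsub>M\<^esub> x \<in> N)" (is "_ \<longleftrightarrow> ?r")
proof
  assume "submodule N R M"
  then interpret submodule N R M .
  show ?r using subset m_closed one_closed by auto
next
  assume r: ?r
  have "\<ominus>\<^bsub>M\<^esub> x \<in> N" if "x \<in> N" for x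
  proof -
    have "(\<ominus> \<one>) \<odot>\<^bsub>M\<^esub> x \<in> N" using r that by blast
    moreover have "x \<in> carrier M" using r that by blast
    ultimately show ?thesis by (simp add: smult_minus_one)
  qed
  then show "submodule N R M"
    using r by (intro submodule.intro subgroup.intro submodule_axioms.intro) (auto simp: a_inv_def)
qed

lemma submoduleI:
  assumes "N \<subseteq> carrier M" "\<zero>\<^bsub>M\<^esub> \<in> N" "\<And>x y. \<lbrakk>x \<in> N; y \<in> N\<rbrakk> \<Longrightarrow> x \<oplus>\<^bsub>M\<^esub> y \<in> N"
    "\<And>a x. \<lbrakk>a \<in> carrier R; x \<in> N\<rbrakk> \<Longrightarrow> a \<odot>\<^bsub>M\<^esub> x \<in> N"
  shows "submodule N R M"
  using assms by (auto simp: submodule_iff)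

lemma submoduleD:
  assumes "submodule N R M"
  shows "N \<subseteq> carrier M" "\<zero>\<^bsub>M\<^esub> \<in> N" "\<And>x y. \<lbrakk>x \<in> N; y \<in> N\<rbrakk> \<Longrightarrow> x \<oplus>\<^bsub>M\<^esub> y \<in> N"
    "\<And>a x. \<lbrakk>a \<in> carrier R; x \<in> N\<rbrakk> \<Longrightarrow> a \<odot>\<^bsub>M\<^esub> x \<in> N"
    "\<And>x. x \<in> N \<Longrightarrow> \<ominus>\<^bsub>M\<^esub> x \<in> N"
proof -
  show *: "N \<subseteq> carrier M" "\<zero>\<^bsub>M\<^esub> \<in> N" "\<And>x y. \<lbrakk>x \<in> N; y \<in> N\<rbrakk> \<Longrightarrow> x \<oplus>\<^bsub>M\<^esub> y \<in> N"
    "\<And>a x. \<lbrakk>a \<in> carrier R; x \<in> N\<rbrakk> \<Longrightarrow> a \<odot>\<^bsub>M\<^esub> x \<in> N"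
    using assms by (auto simp: submodule_iff)
  show "\<ominus>\<^bsub>M\<^esub> x \<in> N" if "x \<in> N" for x
    using *(4)[of "\<ominus> \<one>" x] that *(1) smult_minus_one[of x] by auto
qed

text \<open>One generator at a time, so that \<open>span xs\<close> sits in
  \<open>span (x # xs)\<close> with a cyclic quotient.\<close>

fun span :: "'b list \<Rightarrow> 'b set" where
  "span [] = {\<zero>\<^bsub>M\<^esub>}"
| "span (x # xs) = {r \<odot>\<^bsub>M\<^esub> x \<oplus>\<^bsub>M\<^esub> s | r s. r \<in> carrier R \<and> s \<in> span xs}"

lemma span_submodule:
  "set xs \<subseteq> carrier M \<Longrightarrow> submodule (span xs) R M"
proof (induction xs)
  case Nil then show ?case by (auto simp: submodule_iff)
next
  case (Cons x xs)
  then have x: "x \<in> carrier M" and xs: "submodule (span xs) R M" by auto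
  note xs = submoduleD[OF xs]
  show ?case
  proof (rule submoduleI)
    show "span (x # xs) \<subseteq> carrier M" using x xs(1) by auto
    have "\<zero>\<^bsub>M\<^esub> = \<zero> \<odot>\<^bsub>M\<^esub> x \<oplus>\<^bsub>M\<^esub> \<zero>\<^bsub>M\<^esub>" using x by simp
    then show "\<zero>\<^bsub>M\<^esub> \<in> span (x # xs)" using xs(2) by force
    fix y assume "y \<in> span (x # xs)"
    then obtain r s where rs: "y = r \<odot>\<^bsub>M\<^esub> x \<oplus>\<^bsub>M\<^esub> s" "r \<in> carrier R" "s \<in> span xs" by auto
    have sM: "s \<in> carrier M" using rs xs(1) by blast
    { fix z assume "z \<in> span (x # xs)"
      then obtain r' s' where rs': "z = r' \<odot>\<^bsub>M\<^esub> x \<oplus>\<^bsub>M\<^esub> s'" "r' \<in> carrier R" "s' \<in> span xs" by auto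
      have "s' \<in> carrier M" using rs' xs(1) by blast
      then have "y \<oplus>\<^bsub>M\<^esub> z = (r \<oplus> r') \<odot>\<^bsub>M\<^esub> x \<oplus>\<^bsub>M\<^esub> (s \<oplus>\<^bsub>M\<^esub> s')"
        using rs rs' x sM by (simp add: smult_l_distr M.a_ac)
      then show "y \<oplus>\<^bsub>M\<^esub> z \<in> span (x # xs)" using rs rs' xs(3) R.a_closed unfolding span.simps by
          blast }
    fix a assume a: "a \<in> carrier R"
    have "a \<odot>\<^bsub>M\<^esub> y = (a \<otimes> r) \<odot>\<^bsub>M\<^esub> x \<oplus>\<^bsub>M\<^esub> a \<odot>\<^bsub>M\<^esub> s"
      using rs x sM a by (simp add: smult_r_distr smult_assoc1)
    then show "a \<odot>\<^bsub>M\<^esub> y \<in> span (x # xs)" using rs a xs(4) R.m_closed unfolding span.simps by blast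
  qed
qed

lemma span_superset: "set xs \<subseteq> carrier M \<Longrightarrow> set xs \<subseteq> span xs"
proof (induction xs)
  case (Cons x xs)
  then have x: "x \<in> carrier M" and xs: "submodule (span xs) R M" by (auto intro: span_submodule)
  note xs = submoduleD[OF xs]
  have "x = \<one> \<odot>\<^bsub>M\<^esub> x \<oplus>\<^bsub>M\<^esub> \<zero>\<^bsub>M\<^esub>" using x by simp
  then have "x \<in> span (x # xs)" using xs(2) unfolding span.simps by blast
  moreover have "s = \<zero> \<odot>\<^bsub>M\<^esub> x \<oplus>\<^bsub>M\<^esub> s" if "s \<in> span xs" for s using x that xs(1) by auto
  then have "span xs \<subseteq> span (x # xs)" unfolding span.simps by blast
  ultimately show ?case using Cons by auto
qed simp

lemma span_subset:
  "\<lbrakk>submodule N R M; set xs \<subseteq> N\<rbrakk> \<Longrightarrow> span xs \<subseteq> N"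
proof (induction xs)
  case Nil then show ?case using submoduleD by auto
next
  case (Cons x xs)
  then show ?case using submoduleD(3,4)[OF Cons(2)] by auto
qed

lemma fin_gen_iff_span: "fin_gen R M \<longleftrightarrow> (\<exists>xs. set xs \<subseteq> carrier M \<and> span xs = carrier M)"
proof
  assume "fin_gen R M"
  then obtain S where S: "finite S" "S \<subseteq> carrier M"
      "\<And>N. submodule N R M \<Longrightarrow> S \<subseteq> N \<Longrightarrow> N = carrier M"
    unfolding fin_gen_def by blast
  then obtain xs where xs: "set xs = S" using finite_list by blast
  then have "span xs = carrier M" using S(2) span_submodule[of xs] span_superset[of xs] by (intro
      S(3)) simp_all
  then show "\<exists>xs. set xs \<subseteq> carrier M \<and> span xs = carrier M" using xs S by blast
next
  assume "\<exists>xs. set xs \<subseteq> carrier M \<and> span xs = carrier M"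
  then obtain xs where xs: "set xs \<subseteq> carrier M" "span xs = carrier M" by blast
  have "N = carrier M" if "submodule N R M" "set xs \<subseteq> N" for N
    using span_subset[OF that] xs(2) submoduleD(1)[OF that(1)] by blast
  then show "fin_gen R M" unfolding fin_gen_def using xs(1) by (intro exI[of _ "set xs"]) auto
qed

text \<open>The quotient of \<open>span (x # xs)\<close> by \<open>span xs\<close> is cyclic on
  \<open>x\<close>, so the trace of \<open>N\<close> there is measured by the left ideal
  \<open>\<psi> N\<close> of coefficients of \<open>x\<close> that occur in \<open>N\<close>; the
  trace in \<open>span xs\<close> is covered by induction.\<close>

lemma chain_cond_span:
  assumes "chain_cond {I. left_ideal I R}" "set xs \<subseteq> carrier M"
  shows "chain_cond {N. submodule N R M \<and> N \<subseteq> span xs}"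
  using assms(2)
proof (induction xs)
  case Nil
  have "{N. submodule N R M \<and> N \<subseteq> span []} \<subseteq> Pow {\<zero>\<^bsub>M\<^esub>}" by auto
  then show ?case using chain_cond_finite finite_subset by (metis finite.emptyI finite.insertI
      finite_Pow_iff)
next
  case (Cons x xs)
  then have x: "x \<in> carrier M" and sx: "submodule (span xs) R M"
    and IH: "chain_cond {N. submodule N R M \<and> N \<subseteq> span xs}" by (auto intro: span_submodule)
  note xs = submoduleD[OF sx]
  define \<psi> where "\<psi> N = {r \<in> carrier R. \<exists>s \<in> span xs. r \<odot>\<^bsub>M\<^esub> x \<oplus>\<^bsub>M\<^esub> s \<in> N}" for N
  show ?case
  proof (rule chain_cond_transfer[OF IH assms(1), where \<phi> = "\<lambda>N. N \<inter> span xs" and \<psi> = \<psi>])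
    fix N assume N: "N \<in> {N. submodule N R M \<and> N \<subseteq> span (x # xs)}"
    then have N': "submodule N R M" by simp
    note N' = submoduleD[OF this]
    show "N \<inter> span xs \<in> {N. submodule N R M \<and> N \<subseteq> span xs}"
      using xs N' by (auto simp: submodule_iff)
    show "\<psi> N \<in> {I. left_ideal I R}"
      unfolding mem_Collect_eq left_ideal_def
    proof (intro conjI ballI)
      show "\<zero> \<in> \<psi> N" unfolding \<psi>_def using xs(2) N'(2) x by (auto intro!: bexI[of _ "\<zero>\<^bsub>M\<^esub>"])
      fix a assume "a \<in> \<psi> N"
      then obtain s where s: "a \<in> carrier R" "s \<in> span xs" "a \<odot>\<^bsub>M\<^esub> x \<oplus>\<^bsub>M\<^esub> s \<in> N" unfolding \<psi>_def
          by blast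
      have sM: "s \<in> carrier M" using s xs(1) by blast
      { fix b assume "b \<in> \<psi> N"
        then obtain t where t: "b \<in> carrier R" "t \<in> span xs" "b \<odot>\<^bsub>M\<^esub> x \<oplus>\<^bsub>M\<^esub> t \<in> N" unfolding \<psi>_def
            by blast
        have tM: "t \<in> carrier M" using t xs(1) by blast
        have "(a \<oplus> b) \<odot>\<^bsub>M\<^esub> x \<oplus>\<^bsub>M\<^esub> (s \<oplus>\<^bsub>M\<^esub> t) = (a \<odot>\<^bsub>M\<^esub> x \<oplus>\<^bsub>M\<^esub> s) \<oplus>\<^bsub>M\<^esub> (b \<odot>\<^bsub>M\<^esub> x \<oplus>\<^bsub>M\<^esub> t)"
          using s t x sM tM by (simp add: smult_l_distr M.a_ac)
        then have "(a \<oplus> b) \<odot>\<^bsub>M\<^esub> x \<oplus>\<^bsub>M\<^esub> (s \<oplus>\<^bsub>M\<^esub> t) \<in> N" using s t N'(3) by simp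
        then show "a \<oplus> b \<in> \<psi> N" unfolding \<psi>_def using s t xs(3)[of s t] by blast }
      fix r assume r: "r \<in> carrier R"
      have "(r \<otimes> a) \<odot>\<^bsub>M\<^esub> x \<oplus>\<^bsub>M\<^esub> r \<odot>\<^bsub>M\<^esub> s = r \<odot>\<^bsub>M\<^esub> (a \<odot>\<^bsub>M\<^esub> x \<oplus>\<^bsub>M\<^esub> s)"
        using s r x sM by (simp add: smult_r_distr smult_assoc1)
      then have "(r \<otimes> a) \<odot>\<^bsub>M\<^esub> x \<oplus>\<^bsub>M\<^esub> r \<odot>\<^bsub>M\<^esub> s \<in> N" using s r N'(4) by simp
      then show "r \<otimes> a \<in> \<psi> N" unfolding \<psi>_def using s r xs(4)[of r s] by blast
    qed (auto simp: \<psi>_def)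
  next
    fix A B assume A: "A \<in> {N. submodule N R M \<and> N \<subseteq> span (x # xs)}"
      and B: "B \<in> {N. submodule N R M \<and> N \<subseteq> span (x # xs)}"
      and AB: "A \<subseteq> B" "A \<inter> span xs = B \<inter> span xs" "\<psi> A = \<psi> B"
    note A' = submoduleD[of A] and B' = submoduleD[of B]
    have "b \<in> A" if b: "b \<in> B" for b
    proof -
      have "b \<in> span (x # xs)" using b B by blast
      then obtain r s where rs: "b = r \<odot>\<^bsub>M\<^esub> x \<oplus>\<^bsub>M\<^esub> s" "r \<in> carrier R" "s \<in> span xs" by auto
      then have "r \<in> \<psi> B" unfolding \<psi>_def using b by blast
      then obtain t where t: "t \<in> span xs" "r \<odot>\<^bsub>M\<^esub> x \<oplus>\<^bsub>M\<^esub> t \<in> A" using AB(3) unfolding \<psi>_def by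
          blast
      have M: "s \<in> carrier M" "t \<in> carrier M" using rs t xs(1) by auto
      \<comment> \<open>Elements of \<open>B\<close> and of \<open>A\<close> with the same
        coefficient of \<open>x\<close> differ by an element of \<open>span xs\<close>, where
        \<open>A\<close> and \<open>B\<close> agree.\<close>
      have eq: "s \<oplus>\<^bsub>M\<^esub> \<ominus>\<^bsub>M\<^esub> t = b \<oplus>\<^bsub>M\<^esub> \<ominus>\<^bsub>M\<^esub> (r \<odot>\<^bsub>M\<^esub> x \<oplus>\<^bsub>M\<^esub> t)"
        unfolding rs(1) using M rs(2) x M.abelian_group_axioms
        by - (rule represents_eqI, (rule represents_intros | simp add: algebra_simps)+)
      have "s \<oplus>\<^bsub>M\<^esub> \<ominus>\<^bsub>M\<^esub> t \<in> span xs" using xs(3,5) rs t by blast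
      moreover have "s \<oplus>\<^bsub>M\<^esub> \<ominus>\<^bsub>M\<^esub> t \<in> B"
        unfolding eq using B'(3,5) B b t AB(1) by blast
      ultimately have "s \<oplus>\<^bsub>M\<^esub> \<ominus>\<^bsub>M\<^esub> t \<in> A" using AB(2) by blast
      then have "(r \<odot>\<^bsub>M\<^esub> x \<oplus>\<^bsub>M\<^esub> t) \<oplus>\<^bsub>M\<^esub> (s \<oplus>\<^bsub>M\<^esub> \<ominus>\<^bsub>M\<^esub> t) \<in> A" using A'(3) A t by blast
      moreover have "(r \<odot>\<^bsub>M\<^esub> x \<oplus>\<^bsub>M\<^esub> t) \<oplus>\<^bsub>M\<^esub> (s \<oplus>\<^bsub>M\<^esub> \<ominus>\<^bsub>M\<^esub> t) = b"
        unfolding rs(1) using M rs(2) x M.abelian_group_axioms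
        by - (rule represents_eqI, (rule represents_intros | simp add: algebra_simps)+)
      ultimately show ?thesis by simp
    qed
    then show "A = B" using AB(1) by blast
  qed (auto simp: \<psi>_def)
qed

lemma chain_cond_submodules:
  assumes "chain_cond {I. left_ideal I R}" "fin_gen R M"
  shows "chain_cond {N. submodule N R M}"
proof -
  obtain xs where xs: "set xs \<subseteq> carrier M" "span xs = carrier M" using assms fin_gen_iff_span by
      blast
  have "{N. submodule N R M} \<subseteq> {N. submodule N R M \<and> N \<subseteq> span xs}"
    using xs(2) submoduleD(1) by auto
  then show ?thesis using chain_cond_span[OF assms(1) xs(1)] chain_cond_subset by blast
qed

end

text \<open>A scalar of \<open>K\<close> acts on the algebra as left multiplication by its product
  with \<open>\<one>\<close>, so left ideals are \<open>K\<close>-submodules of a finitely generated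
  module over an artinian commutative ring.\<close>

lemma (in artin_algebra) chain_cond_left_ideals: "chain_cond {I. left_ideal I L}"
proof -
  have K: "chain_cond {I. left_ideal I K}"
    by (rule R.artinian_chain_cond) (rule artinian)
  interpret KL: left_module K L
    by (intro left_module.intro left_module_axioms.intro R.ring_axioms M.abelian_group_axioms)
      (auto simp: smult_l_distr smult_r_distr smult_assoc1)
  have "submodule I K L" if I: "left_ideal I L" for I
  proof (rule KL.submoduleI)
    fix a x assume a: "a \<in> carrier K" "x \<in> I"
    have x: "x \<in> carrier L" using I a by (auto simp: left_ideal_def)
    have "a \<odot>\<^bsub>L\<^esub> x = (a \<odot>\<^bsub>L\<^esub> \<one>\<^bsub>L\<^esub>) \<otimes>\<^bsub>L\<^esub> x" using a x smult_mult_left[of a "\<one>\<^bsub>L\<^esub>" x] by simp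
    then show "a \<odot>\<^bsub>L\<^esub> x \<in> I" using I a by (simp add: left_ideal_def)
  qed (use I in \<open>auto simp: left_ideal_def\<close>)
  then show ?thesis
    using KL.chain_cond_submodules[OF K fin_gen] chain_cond_subset by (metis (no_types, lifting)
        mem_Collect_eq subsetI)
qed

section \<open>Biproducts and Fitting's lemma\<close>

text \<open>Records what the argument takes from the Artin algebra: finite length of the ring as a
  left module over itself.\<close>

locale finite_length_ring = ring R for R :: "('a, 'r) ring_scheme" (structure) +
  assumes chain_cond_left_ideals: "chain_cond {I. left_ideal I R}"
begin

abbreviation Ob :: "('a, 'a list) module set" where "Ob \<equiv> fmod R"

abbreviation Hom ::
  "('a, 'b, 'm) module_scheme \<Rightarrow> ('a, 'c, 'n) module_scheme \<Rightarrow> ('b \<Rightarrow> 'c) set" where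
  "Hom \<equiv> module_hom R"

abbreviation LMod :: "('a, 'b, 'm) module_scheme \<Rightarrow> bool" where "LMod \<equiv> left_module R"

lemma Ob_iff: "A \<in> Ob \<longleftrightarrow> LMod A \<and> fin_gen R A"
  by (simp add: fmod_def)

lemma Ob_Mod [simp]: "A \<in> Ob \<Longrightarrow> LMod A"
  by (simp add: fmod_def)

lemma Mod_abelian_group [simp]: "LMod A \<Longrightarrow> abelian_group A"
  by (simp add: left_module_def)

lemma Mod_simps [simp]:
  fixes A (structure)
  assumes "LMod A"
  shows "\<zero>\<^bsub>A\<^esub> \<in> carrier A"
    "\<lbrakk>x \<in> carrier A; y \<in> carrier A\<rbrakk> \<Longrightarrow> x \<oplus>\<^bsub>A\<^esub> y \<in> carrier A"
    "\<lbrakk>x \<in> carrier A; y \<in> carrier A\<rbrakk> \<Longrightarrow> x \<ominus>\<^bsub>A\<^esub> y \<in> carrier A"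
    "x \<in> carrier A \<Longrightarrow> \<ominus>\<^bsub>A\<^esub> x \<in> carrier A"
    "\<lbrakk>r \<in> carrier R; x \<in> carrier A\<rbrakk> \<Longrightarrow> r \<odot>\<^bsub>A\<^esub> x \<in> carrier A"
    "x \<in> carrier A \<Longrightarrow> x \<oplus>\<^bsub>A\<^esub> \<zero>\<^bsub>A\<^esub> = x"
    "x \<in> carrier A \<Longrightarrow> \<zero>\<^bsub>A\<^esub> \<oplus>\<^bsub>A\<^esub> x = x"
    "x \<in> carrier A \<Longrightarrow> x \<ominus>\<^bsub>A\<^esub> x = \<zero>\<^bsub>A\<^esub>"
    "x \<in> carrier A \<Longrightarrow> x \<ominus>\<^bsub>A\<^esub> \<zero>\<^bsub>A\<^esub> = x"
    "r \<in> carrier R \<Longrightarrow> r \<odot>\<^bsub>A\<^esub> \<zero>\<^bsub>A\<^esub> = \<zero>\<^bsub>A\<^esub>"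
    "\<ominus>\<^bsub>A\<^esub> \<zero>\<^bsub>A\<^esub> = \<zero>\<^bsub>A\<^esub>"
proof -
  interpret left_module R A by fact
  note i = M.abelian_group_axioms represents_intros
  show "\<zero>\<^bsub>A\<^esub> \<in> carrier A"
    "\<lbrakk>x \<in> carrier A; y \<in> carrier A\<rbrakk> \<Longrightarrow> x \<oplus>\<^bsub>A\<^esub> y \<in> carrier A"
    "\<lbrakk>x \<in> carrier A; y \<in> carrier A\<rbrakk> \<Longrightarrow> x \<ominus>\<^bsub>A\<^esub> y \<in> carrier A"
    "x \<in> carrier A \<Longrightarrow> \<ominus>\<^bsub>A\<^esub> x \<in> carrier A"
    "\<lbrakk>r \<in> carrier R; x \<in> carrier A\<rbrakk> \<Longrightarrow> r \<odot>\<^bsub>A\<^esub> x \<in> carrier A"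
    "x \<in> carrier A \<Longrightarrow> x \<oplus>\<^bsub>A\<^esub> \<zero>\<^bsub>A\<^esub> = x"
    "x \<in> carrier A \<Longrightarrow> \<zero>\<^bsub>A\<^esub> \<oplus>\<^bsub>A\<^esub> x = x"
    "r \<in> carrier R \<Longrightarrow> r \<odot>\<^bsub>A\<^esub> \<zero>\<^bsub>A\<^esub> = \<zero>\<^bsub>A\<^esub>"
    by simp_all
  show "x \<in> carrier A \<Longrightarrow> x \<ominus>\<^bsub>A\<^esub> x = \<zero>\<^bsub>A\<^esub>"
    by (rule represents_eqI, (rule i | simp add: algebra_simps)+)
  show "x \<in> carrier A \<Longrightarrow> x \<ominus>\<^bsub>A\<^esub> \<zero>\<^bsub>A\<^esub> = x"
    by (rule represents_eqI, (rule i | simp add: algebra_simps)+)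
  show "\<ominus>\<^bsub>A\<^esub> \<zero>\<^bsub>A\<^esub> = \<zero>\<^bsub>A\<^esub>"
    by (rule represents_eqI, (rule i | simp add: algebra_simps)+)
qed

lemma module_homI:
  assumes "\<And>x. x \<in> carrier A \<Longrightarrow> f x \<in> carrier B"
    "\<And>x y. \<lbrakk>x \<in> carrier A; y \<in> carrier A\<rbrakk> \<Longrightarrow> f (x \<oplus>\<^bsub>A\<^esub> y) = f x \<oplus>\<^bsub>B\<^esub> f y"
    "\<And>r x. \<lbrakk>r \<in> carrier R; x \<in> carrier A\<rbrakk> \<Longrightarrow> f (r \<odot>\<^bsub>A\<^esub> x) = r \<odot>\<^bsub>B\<^esub> f x"
  shows "f \<in> Hom A B"
  using assms by (auto simp: module_hom_def hom_def)

lemma hom_simps: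
  assumes "f \<in> Hom A B"
  shows "x \<in> carrier A \<Longrightarrow> f x \<in> carrier B"
    "\<lbrakk>x \<in> carrier A; y \<in> carrier A\<rbrakk> \<Longrightarrow> f (x \<oplus>\<^bsub>A\<^esub> y) = f x \<oplus>\<^bsub>B\<^esub> f y"
    "\<lbrakk>r \<in> carrier R; x \<in> carrier A\<rbrakk> \<Longrightarrow> f (r \<odot>\<^bsub>A\<^esub> x) = r \<odot>\<^bsub>B\<^esub> f x"
    "\<lbrakk>LMod A; LMod B; x \<in> carrier A\<rbrakk> \<Longrightarrow> f (\<ominus>\<^bsub>A\<^esub> x) = \<ominus>\<^bsub>B\<^esub> f x"
    "\<lbrakk>LMod A; LMod B; x \<in> carrier A; y \<in> carrier A\<rbrakk> \<Longrightarrow> f (x \<ominus>\<^bsub>A\<^esub> y) = f x \<ominus>\<^bsub>B\<^esub> f y"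
    "\<lbrakk>LMod A; LMod B\<rbrakk> \<Longrightarrow> f \<zero>\<^bsub>A\<^esub> = \<zero>\<^bsub>B\<^esub>"
proof -
  show 1: "x \<in> carrier A \<Longrightarrow> f x \<in> carrier B"
    "\<lbrakk>x \<in> carrier A; y \<in> carrier A\<rbrakk> \<Longrightarrow> f (x \<oplus>\<^bsub>A\<^esub> y) = f x \<oplus>\<^bsub>B\<^esub> f y"
    "\<lbrakk>r \<in> carrier R; x \<in> carrier A\<rbrakk> \<Longrightarrow> f (r \<odot>\<^bsub>A\<^esub> x) = r \<odot>\<^bsub>B\<^esub> f x" for x y r
    using assms by (auto simp: module_hom_def hom_def)
  show 2: "\<lbrakk>LMod A; LMod B; x \<in> carrier A\<rbrakk> \<Longrightarrow> f (\<ominus>\<^bsub>A\<^esub> x) = \<ominus>\<^bsub>B\<^esub> f x" for x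
    using 1(1)[of x] 1(3)[of "\<ominus> \<one>" x] by (simp add: left_module.smult_minus_one)
  show "\<lbrakk>LMod A; LMod B; x \<in> carrier A; y \<in> carrier A\<rbrakk> \<Longrightarrow> f (x \<ominus>\<^bsub>A\<^esub> y) = f x \<ominus>\<^bsub>B\<^esub> f y"
    using 1(2)[of x "\<ominus>\<^bsub>A\<^esub> y"] 2[of y] by (simp add: a_minus_def)
  show "\<lbrakk>LMod A; LMod B\<rbrakk> \<Longrightarrow> f \<zero>\<^bsub>A\<^esub> = \<zero>\<^bsub>B\<^esub>"
    using 1(1)[of "\<zero>\<^bsub>A\<^esub>"] 1(3)[of \<zero> "\<zero>\<^bsub>A\<^esub>"] left_module.smult_l_null by force
qed

lemma hom_id: "(\<lambda>x. x) \<in> Hom A A"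
  by (rule module_homI) auto

lemma hom_comp: "\<lbrakk>f \<in> Hom A B; g \<in> Hom B C\<rbrakk> \<Longrightarrow> (\<lambda>x. g (f x)) \<in> Hom A C"
  by (rule module_homI) (simp_all add: hom_simps)

lemma hom_zero: "LMod B \<Longrightarrow> (\<lambda>x. \<zero>\<^bsub>B\<^esub>) \<in> Hom A B"
  by (rule module_homI) auto

lemma hom_add:
  assumes "LMod B" "f \<in> Hom A B" "g \<in> Hom A B"
  shows "(\<lambda>x. f x \<oplus>\<^bsub>B\<^esub> g x) \<in> Hom A B"
proof -
  note [simp] = hom_simps[OF assms(2)] hom_simps[OF assms(3)] assms(1)
  show ?thesis
  proof (rule module_homI)
    fix x y assume [simp]: "x \<in> carrier A" "y \<in> carrier A"
    show "f (x \<oplus>\<^bsub>A\<^esub> y) \<oplus>\<^bsub>B\<^esub> g (x \<oplus>\<^bsub>A\<^esub> y) = (f x \<oplus>\<^bsub>B\<^esub> g x) \<oplus>\<^bsub>B\<^esub> (f y \<oplus>\<^bsub>B\<^esub> g y)"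
      by simp (rule represents_eqI, (rule represents_intros | simp add: algebra_simps)+)
  qed (simp_all add: left_module.smult_r_distr[OF assms(1)])
qed

lemma hom_neg:
  assumes "LMod A" "LMod B" "f \<in> Hom A B"
  shows "(\<lambda>x. \<ominus>\<^bsub>B\<^esub> f x) \<in> Hom A B"
proof -
  note [simp] = hom_simps[OF assms(3)] assms(1,2)
  show ?thesis
  proof (rule module_homI)
    fix x y assume [simp]: "x \<in> carrier A" "y \<in> carrier A"
    show "\<ominus>\<^bsub>B\<^esub> f (x \<oplus>\<^bsub>A\<^esub> y) = \<ominus>\<^bsub>B\<^esub> f x \<oplus>\<^bsub>B\<^esub> \<ominus>\<^bsub>B\<^esub> f y"
      by simp (rule represents_eqI, (rule represents_intros | simp add: algebra_simps)+)
    fix r assume [simp]: "r \<in> carrier R"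
    have "r \<odot>\<^bsub>B\<^esub> (\<ominus>\<^bsub>B\<^esub> f x) = r \<odot>\<^bsub>B\<^esub> f (\<ominus>\<^bsub>A\<^esub> x)" by simp
    also have "\<dots> = f (r \<odot>\<^bsub>A\<^esub> (\<ominus>\<^bsub>A\<^esub> x))" by (simp del: hom_simps(4)[OF assms(3)])
    also have "r \<odot>\<^bsub>A\<^esub> (\<ominus>\<^bsub>A\<^esub> x) = \<ominus>\<^bsub>A\<^esub> (r \<odot>\<^bsub>A\<^esub> x)"
    proof -
      interpret A: left_module R A by simp
      have "(r \<otimes> (\<ominus> \<one>)) \<odot>\<^bsub>A\<^esub> x = ((\<ominus> \<one>) \<otimes> r) \<odot>\<^bsub>A\<^esub> x" by (simp add: l_minus r_minus)
      then show ?thesis by (simp add: A.smult_assoc1 A.smult_minus_one)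
    qed
    finally show "\<ominus>\<^bsub>B\<^esub> f (r \<odot>\<^bsub>A\<^esub> x) = r \<odot>\<^bsub>B\<^esub> (\<ominus>\<^bsub>B\<^esub> f x)" by simp
  qed simp
qed

lemma hom_minus:
  assumes "LMod A" "LMod B" "f \<in> Hom A B" "g \<in> Hom A B"
  shows "(\<lambda>x. f x \<ominus>\<^bsub>B\<^esub> g x) \<in> Hom A B"
  using hom_add[OF assms(2,3) hom_neg[OF assms(1,2,4)]] by (simp add: a_minus_def)

lemma hom_funpow: "f \<in> Hom A A \<Longrightarrow> f ^^ n \<in> Hom A A"
proof (induction n)
  case 0 then show ?case using hom_id[of A] by (simp add: id_def)
next
  case (Suc n) then show ?case using hom_comp[of "f ^^ n" A A f A] by (simp add: comp_def)
qed

lemma chain_cond_Ob: "A \<in> Ob \<Longrightarrow> chain_cond {N. submodule N R A}"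
  unfolding Ob_iff using left_module.chain_cond_submodules chain_cond_left_ideals by blast

text \<open>Finite generation is the noetherian half of the chain condition: a maximal finitely
  generated submodule of \<open>N\<close> cannot be enlarged by any element of \<open>N\<close>.
  Restricting the carrier keeps lists as elements, so kernels and images are again objects of
  \<open>fmod R\<close>.\<close>

lemma sub_Ob:
  assumes M: "M \<in> Ob" and N: "submodule N R M"
  shows "M\<lparr>carrier := N\<rparr> \<in> Ob"
proof -
  interpret M: left_module R M using M by simp
  interpret N: submodule N R M by fact
  note N' = M.submoduleD[OF N]
  have NM: "x \<in> carrier M" if "x \<in> N" for x using N'(1) that by blast
  let ?N = "M\<lparr>carrier := N\<rparr>"
  have "abelian_group ?N"
  proof (rule abelian_groupI)
    fix x assume x: "x \<in> carrier ?N"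
    then show "\<exists>y\<in>carrier ?N. y \<oplus>\<^bsub>?N\<^esub> x = \<zero>\<^bsub>?N\<^esub>"
      by (intro bexI[of _ "\<ominus>\<^bsub>M\<^esub> x"]) (simp_all add: M.l_neg N' NM)
  qed (simp_all add: M.a_ac N' NM)
  then have mod: "LMod ?N"
    by (intro left_module.intro left_module_axioms.intro)
      (simp_all add: M.smult_l_distr M.smult_r_distr M.smult_assoc1 ring_axioms N' NM)
  then interpret N0: left_module R ?N .
  define T where "T = {M.span xs | xs. set xs \<subseteq> N}"
  have "\<exists>H \<in> T. \<forall>H' \<in> T. H \<subseteq> H' \<longrightarrow> H' = H"
  proof (rule chain_cond_maximal[OF chain_cond_Ob[OF M]])
    show "T \<subseteq> {N. submodule N R M}" using M.span_submodule N'(1) unfolding T_def by blast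
    show "T \<noteq> {}" unfolding T_def by (auto intro: exI[of _ "[]"])
  qed
  then obtain H where H: "H \<in> T" "\<forall>H' \<in> T. H \<subseteq> H' \<longrightarrow> H' = H" by (elim bexE)
  then obtain xs where xs: "set xs \<subseteq> N" "H = M.span xs" unfolding T_def by blast
  have max: "M.span ys = M.span xs" if "set ys \<subseteq> N" "M.span xs \<subseteq> M.span ys" for ys
    using H(2) that xs(2) unfolding T_def by blast
  have xsM: "set xs \<subseteq> carrier M" using xs N' by blast
  have "x \<in> M.span xs" if x: "x \<in> N" for x
  proof -
    have s: "submodule (M.span (x # xs)) R M" "set (x # xs) \<subseteq> M.span (x # xs)"
      using M.span_submodule[of "x # xs"] M.span_superset[of "x # xs"] xsM x N' by auto
    have "M.span xs \<subseteq> M.span (x # xs)" using M.span_subset[OF s(1)] s(2) by auto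
    then have "M.span (x # xs) = M.span xs" using xs(1) x by (intro max) simp_all
    then show ?thesis using s(2) by auto
  qed
  moreover have "N0.span ys = M.span ys" for ys by (induction ys) auto
  moreover have "M.span xs \<subseteq> N" using M.span_subset[OF N] xs by blast
  ultimately have "set xs \<subseteq> carrier ?N \<and> N0.span xs = carrier ?N" using xs by auto
  then have "fin_gen R ?N" using N0.fin_gen_iff_span by blast
  with mod show ?thesis unfolding Ob_iff by blast
qed

lemma kernel_submodule:
  assumes "LMod A" "LMod B" "f \<in> Hom A B"
  shows "submodule {x \<in> carrier A. f x = \<zero>\<^bsub>B\<^esub>} R A"
  by (rule left_module.submoduleI) (auto simp: assms(1,2) hom_simps[OF assms(3)])

lemma preimage_submodule:
  assumes "LMod A" "LMod B" "f \<in> Hom A B" "submodule N R B"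
  shows "submodule {x \<in> carrier A. f x \<in> N} R A"
  by (rule left_module.submoduleI)
    (auto simp: assms(1,2) hom_simps[OF assms(3)] left_module.submoduleD[OF assms(2,4)])

lemma image_submodule:
  assumes "LMod A" "LMod B" "f \<in> Hom A B"
  shows "submodule (f ` carrier A) R B"
proof (rule left_module.submoduleI[OF assms(2)])
  note [simp] = hom_simps[OF assms(3)] assms(1,2)
  show "f ` carrier A \<subseteq> carrier B" by auto
  show "\<zero>\<^bsub>B\<^esub> \<in> f ` carrier A" by (rule image_eqI[of _ _ "\<zero>\<^bsub>A\<^esub>"]) auto
  fix x assume "x \<in> f ` carrier A"
  then obtain a where a: "a \<in> carrier A" "x = f a" by blast
  { fix y assume "y \<in> f ` carrier A"
    then obtain b where b: "b \<in> carrier A" "y = f b" by blast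
    show "x \<oplus>\<^bsub>B\<^esub> y \<in> f ` carrier A" using a b by (intro image_eqI[of _ _ "a \<oplus>\<^bsub>A\<^esub> b"]) auto }
  fix r assume "r \<in> carrier R"
  then show "r \<odot>\<^bsub>B\<^esub> x \<in> f ` carrier A" using a by (intro image_eqI[of _ _ "r \<odot>\<^bsub>A\<^esub> a"]) auto
qed

definition iso_pair ::
  "('a, 'b) module \<Rightarrow> ('a, 'c) module \<Rightarrow> ('b \<Rightarrow> 'c) \<Rightarrow> ('c \<Rightarrow> 'b) \<Rightarrow> bool" where
  "iso_pair A B f g \<longleftrightarrow> f \<in> Hom A B \<and> g \<in> Hom B A \<and>
    (\<forall>x \<in> carrier A. g (f x) = x) \<and> (\<forall>y \<in> carrier B. f (g y) = y)"

lemma iso_pairD: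
  assumes "iso_pair A B f g"
  shows "f \<in> Hom A B" "g \<in> Hom B A" "\<And>x. x \<in> carrier A \<Longrightarrow> g (f x) = x"
    "\<And>y. y \<in> carrier B \<Longrightarrow> f (g y) = y"
  using assms by (auto simp: iso_pair_def)

lemma iso_pair_sym: "iso_pair A B f g \<Longrightarrow> iso_pair B A g f"
  by (auto simp: iso_pair_def)

lemma iso_pair_trans: "\<lbrakk>iso_pair A B f g; iso_pair B C f' g'\<rbrakk> \<Longrightarrow> iso_pair A C (\<lambda>x. f' (f x)) (\<lambda>y. g
    (g' y))"
  unfolding iso_pair_def by (auto intro: hom_comp simp: hom_simps)

lemma iso_pair_refl: "iso_pair A A (\<lambda>x. x) (\<lambda>x. x)"
  by (auto simp: iso_pair_def hom_id)

lemma hom_inverse: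
  assumes "LMod A" "f \<in> Hom A B" "\<And>y. y \<in> carrier B \<Longrightarrow> g y \<in> carrier A"
    "\<And>x. x \<in> carrier A \<Longrightarrow> g (f x) = x" "\<And>y. y \<in> carrier B \<Longrightarrow> f (g y) = y"
  shows "iso_pair A B f g"
proof -
  note f = hom_simps[OF assms(2)]
  have "g \<in> Hom B A"
  proof (rule module_homI)
    fix x y assume xy: "x \<in> carrier B" "y \<in> carrier B"
    have "g (f (g x \<oplus>\<^bsub>A\<^esub> g y)) = g x \<oplus>\<^bsub>A\<^esub> g y" using assms xy by (intro assms(4)) simp
    then show "g (x \<oplus>\<^bsub>B\<^esub> y) = g x \<oplus>\<^bsub>A\<^esub> g y" using assms xy f by simp
  next
    fix r x assume xy: "x \<in> carrier B" "r \<in> carrier R"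
    have "g (f (r \<odot>\<^bsub>A\<^esub> g x)) = r \<odot>\<^bsub>A\<^esub> g x" using assms xy by (intro assms(4)) simp
    then show "g (r \<odot>\<^bsub>B\<^esub> x) = r \<odot>\<^bsub>A\<^esub> g x" using assms xy f by simp
  qed (use assms in auto)
  then show ?thesis using assms by (auto simp: iso_pair_def)
qed

lemma module_iso_iff: "LMod A \<Longrightarrow> module_iso R A B \<longleftrightarrow> (\<exists>f g. iso_pair A B f g)"
proof
  assume A: "LMod A" "module_iso R A B"
  then obtain f where f: "f \<in> Hom A B" "bij_betw f (carrier A) (carrier B)" unfolding
      module_iso_def by blast
  have "iso_pair A B f (the_inv_into (carrier A) f)"
  proof (rule hom_inverse[OF A(1) f(1)])
    have "inj_on f (carrier A)" "f ` carrier A = carrier B" using f(2) by (auto simp: bij_betw_def)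
    then show "\<And>y. y \<in> carrier B \<Longrightarrow> the_inv_into (carrier A) f y \<in> carrier A"
      "\<And>x. x \<in> carrier A \<Longrightarrow> the_inv_into (carrier A) f (f x) = x"
      "\<And>y. y \<in> carrier B \<Longrightarrow> f (the_inv_into (carrier A) f y) = y"
      by (simp_all add: the_inv_into_into the_inv_into_f_f f_the_inv_into_f)
  qed
  then show "\<exists>f g. iso_pair A B f g" by blast
next
  assume "\<exists>f g. iso_pair A B f g"
  then obtain f g where fg: "iso_pair A B f g" by blast
  note fg = iso_pairD[OF fg]
  have "bij_betw f (carrier A) (carrier B)"
    using fg(3,4) hom_simps(1)[OF fg(1)] hom_simps(1)[OF fg(2)]
    by (intro bij_betw_byWitness[where f' = g]) auto
  then show "module_iso R A B" unfolding module_iso_def using fg(1) by blast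
qed

section \<open>Direct sums given by inclusions and projections\<close>

text \<open>The sum \<open>A \<boxplus> B\<close> lives on pairs and hence outside
  \<open>fmod R\<close>. The four maps describe a direct sum on any carrier, and decompositions can
  be composed without a change of type.\<close>

definition biproduct ::
  "('a, 'b) module \<Rightarrow> ('a, 'c) module \<Rightarrow> ('a, 'd) module \<Rightarrow>
    ('b \<Rightarrow> 'd) \<Rightarrow> ('c \<Rightarrow> 'd) \<Rightarrow> ('d \<Rightarrow> 'b) \<Rightarrow> ('d \<Rightarrow> 'c) \<Rightarrow> bool" where
  "biproduct A B X i j p q \<longleftrightarrow> i \<in> Hom A X \<and> j \<in> Hom B X \<and> p \<in> Hom X A \<and> q \<in> Hom X B \<and>
    (\<forall>a \<in> carrier A. p (i a) = a \<and> q (i a) = \<zero>\<^bsub>B\<^esub>) \<and>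
    (\<forall>b \<in> carrier B. p (j b) = \<zero>\<^bsub>A\<^esub> \<and> q (j b) = b) \<and>
    (\<forall>x \<in> carrier X. i (p x) \<oplus>\<^bsub>X\<^esub> j (q x) = x)"

lemma biproductD:
  assumes "biproduct A B X i j p q"
  shows "i \<in> Hom A X" "j \<in> Hom B X" "p \<in> Hom X A" "q \<in> Hom X B"
    "\<And>a. a \<in> carrier A \<Longrightarrow> p (i a) = a" "\<And>a. a \<in> carrier A \<Longrightarrow> q (i a) = \<zero>\<^bsub>B\<^esub>"
    "\<And>b. b \<in> carrier B \<Longrightarrow> p (j b) = \<zero>\<^bsub>A\<^esub>" "\<And>b. b \<in> carrier B \<Longrightarrow> q (j b) = b"
    "\<And>x. x \<in> carrier X \<Longrightarrow> i (p x) \<oplus>\<^bsub>X\<^esub> j (q x) = x"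
  using assms by (auto simp: biproduct_def)

lemma biproduct_simps:
  assumes "biproduct A B X i j p q"
  shows "\<And>a. a \<in> carrier A \<Longrightarrow> p (i a) = a" "\<And>a. a \<in> carrier A \<Longrightarrow> q (i a) = \<zero>\<^bsub>B\<^esub>"
    "\<And>b. b \<in> carrier B \<Longrightarrow> p (j b) = \<zero>\<^bsub>A\<^esub>" "\<And>b. b \<in> carrier B \<Longrightarrow> q (j b) = b"
    "\<And>x. x \<in> carrier X \<Longrightarrow> i (p x) \<oplus>\<^bsub>X\<^esub> j (q x) = x"
    and "x \<in> carrier A \<Longrightarrow> i x \<in> carrier X"
    "\<lbrakk>x \<in> carrier A; x' \<in> carrier A\<rbrakk> \<Longrightarrow> i (x \<oplus>\<^bsub>A\<^esub> x') = i x \<oplus>\<^bsub>X\<^esub> i x'"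
    "\<lbrakk>LMod A; LMod X; x \<in> carrier A\<rbrakk> \<Longrightarrow> i (\<ominus>\<^bsub>A\<^esub> x) = \<ominus>\<^bsub>X\<^esub> i x"
    "\<lbrakk>LMod A; LMod X; x \<in> carrier A; x' \<in> carrier A\<rbrakk> \<Longrightarrow> i (x \<ominus>\<^bsub>A\<^esub> x') = i x \<ominus>\<^bsub>X\<^esub> i x'"
    "\<lbrakk>LMod A; LMod X\<rbrakk> \<Longrightarrow> i \<zero>\<^bsub>A\<^esub> = \<zero>\<^bsub>X\<^esub>"
    "y \<in> carrier B \<Longrightarrow> j y \<in> carrier X"
    "\<lbrakk>y \<in> carrier B; y' \<in> carrier B\<rbrakk> \<Longrightarrow> j (y \<oplus>\<^bsub>B\<^esub> y') = j y \<oplus>\<^bsub>X\<^esub> j y'"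
    "\<lbrakk>LMod B; LMod X; y \<in> carrier B\<rbrakk> \<Longrightarrow> j (\<ominus>\<^bsub>B\<^esub> y) = \<ominus>\<^bsub>X\<^esub> j y"
    "\<lbrakk>LMod B; LMod X; y \<in> carrier B; y' \<in> carrier B\<rbrakk> \<Longrightarrow> j (y \<ominus>\<^bsub>B\<^esub> y') = j y \<ominus>\<^bsub>X\<^esub> j y'"
    "\<lbrakk>LMod B; LMod X\<rbrakk> \<Longrightarrow> j \<zero>\<^bsub>B\<^esub> = \<zero>\<^bsub>X\<^esub>"
    "z \<in> carrier X \<Longrightarrow> p z \<in> carrier A"
    "\<lbrakk>z \<in> carrier X; z' \<in> carrier X\<rbrakk> \<Longrightarrow> p (z \<oplus>\<^bsub>X\<^esub> z') = p z \<oplus>\<^bsub>A\<^esub> p z'"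
    "\<lbrakk>LMod X; LMod A; z \<in> carrier X\<rbrakk> \<Longrightarrow> p (\<ominus>\<^bsub>X\<^esub> z) = \<ominus>\<^bsub>A\<^esub> p z"
    "\<lbrakk>LMod X; LMod A; z \<in> carrier X; z' \<in> carrier X\<rbrakk> \<Longrightarrow> p (z \<ominus>\<^bsub>X\<^esub> z') = p z \<ominus>\<^bsub>A\<^esub> p z'"
    "\<lbrakk>LMod X; LMod A\<rbrakk> \<Longrightarrow> p \<zero>\<^bsub>X\<^esub> = \<zero>\<^bsub>A\<^esub>"
    "z \<in> carrier X \<Longrightarrow> q z \<in> carrier B"
    "\<lbrakk>z \<in> carrier X; z' \<in> carrier X\<rbrakk> \<Longrightarrow> q (z \<oplus>\<^bsub>X\<^esub> z') = q z \<oplus>\<^bsub>B\<^esub> q z'"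
    "\<lbrakk>LMod X; LMod B; z \<in> carrier X\<rbrakk> \<Longrightarrow> q (\<ominus>\<^bsub>X\<^esub> z) = \<ominus>\<^bsub>B\<^esub> q z"
    "\<lbrakk>LMod X; LMod B; z \<in> carrier X; z' \<in> carrier X\<rbrakk> \<Longrightarrow> q (z \<ominus>\<^bsub>X\<^esub> z') = q z \<ominus>\<^bsub>B\<^esub> q z'"
    "\<lbrakk>LMod X; LMod B\<rbrakk> \<Longrightarrow> q \<zero>\<^bsub>X\<^esub> = \<zero>\<^bsub>B\<^esub>"
  by (fact biproductD[OF assms] hom_simps[OF biproductD(1)[OF assms]] hom_simps[OF
      biproductD(2)[OF assms]]
      hom_simps[OF biproductD(3)[OF assms]] hom_simps[OF biproductD(4)[OF assms]])+

lemma biproduct_swap: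
  assumes "biproduct A B X i j p q" "LMod X"
  shows "biproduct B A X j i q p"
proof -
  note [simp] = biproduct_simps[OF assms(1)] assms(2)
  have "j (q x) \<oplus>\<^bsub>X\<^esub> i (p x) = x" if "x \<in> carrier X" for x
  proof -
    have "j (q x) \<oplus>\<^bsub>X\<^esub> i (p x) = i (p x) \<oplus>\<^bsub>X\<^esub> j (q x)"
      using that by - (rule represents_eqI, (rule represents_intros | simp add: algebra_simps)+)
    then show ?thesis using that by simp
  qed
  then show ?thesis using biproductD[OF assms(1)] by (auto simp: biproduct_def)
qed

lemma biproduct_iso:
  assumes "biproduct A B X i j p q" "iso_pair X Y f g"
  shows "biproduct A B Y (\<lambda>a. f (i a)) (\<lambda>b. f (j b)) (\<lambda>y. p (g y)) (\<lambda>y. q (g y))"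
proof -
  note [simp] = iso_pairD(3,4)[OF assms(2)] hom_simps(1)[OF iso_pairD(1)[OF assms(2)]]
    hom_simps(1)[OF iso_pairD(2)[OF assms(2)]] biproduct_simps[OF assms(1)]
  have "f (i (p (g y))) \<oplus>\<^bsub>Y\<^esub> f (j (q (g y))) = y" if "y \<in> carrier Y" for y
  proof -
    have "f (i (p (g y))) \<oplus>\<^bsub>Y\<^esub> f (j (q (g y))) = f (i (p (g y)) \<oplus>\<^bsub>X\<^esub> j (q (g y)))"
      using that by (subst hom_simps(2)[OF iso_pairD(1)[OF assms(2)]]) auto
    then show ?thesis using that by simp
  qed
  then show ?thesis
    unfolding biproduct_def using biproductD(1-4)[OF assms(1)] iso_pairD(1,2)[OF assms(2)] by
        (auto intro: hom_comp)
qed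

lemma biproduct_iso_right:
  assumes "biproduct A B X i j p q" "iso_pair B C f g" "LMod B" "LMod C"
  shows "biproduct A C X i (\<lambda>b. j (g b)) p (\<lambda>y. f (q y))"
proof -
  note [simp] = iso_pairD(3,4)[OF assms(2)] hom_simps[OF iso_pairD(1)[OF assms(2)]]
    hom_simps[OF iso_pairD(2)[OF assms(2)]] biproduct_simps[OF assms(1)] assms(3,4)
  show ?thesis
    unfolding biproduct_def using biproductD(1-4)[OF assms(1)] iso_pairD(1,2)[OF assms(2)]
    by (auto intro: hom_comp)
qed

lemma biproduct_unique:
  assumes "biproduct A B X i j p q" "biproduct A B Y i' j' p' q'" "LMod A" "LMod B" "LMod X" "LMod
      Y"
  shows "iso_pair X Y (\<lambda>x. i' (p x) \<oplus>\<^bsub>Y\<^esub> j' (q x)) (\<lambda>x. i (p' x) \<oplus>\<^bsub>X\<^esub> j (q' x))"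
proof -
  note [simp] = biproduct_simps[OF assms(1)] biproduct_simps[OF assms(2)] assms(3-)
  note h = biproductD(1-4)[OF assms(1)] biproductD(1-4)[OF assms(2)]
  show ?thesis unfolding iso_pair_def using h by (auto intro!: hom_add intro: hom_comp)
qed

lemma fin_gen_biproduct:
  assumes "biproduct A B X i j p q" "LMod A" "LMod B" "LMod X" "fin_gen R A" "fin_gen R B"
  shows "fin_gen R X"
proof -
  note [simp] = biproduct_simps[OF assms(1)] assms(2-4)
  obtain S T where S: "finite S" "S \<subseteq> carrier A" "\<And>N. submodule N R A \<Longrightarrow> S \<subseteq> N \<Longrightarrow> N = carrier A"
    and T: "finite T" "T \<subseteq> carrier B" "\<And>N. submodule N R B \<Longrightarrow> T \<subseteq> N \<Longrightarrow> N = carrier B"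
    using assms(5,6) unfolding fin_gen_def by metis
  have "N = carrier X" if N: "submodule N R X" "i ` S \<union> j ` T \<subseteq> N" for N
  proof -
    note N' = left_module.submoduleD[OF assms(4) N(1)]
    have "{a \<in> carrier A. i a \<in> N} = carrier A"
      using N S by (intro S(3) preimage_submodule[where f = i and B = X]) (use biproductD(1)[OF
          assms(1)] in auto)
    moreover have "{b \<in> carrier B. j b \<in> N} = carrier B"
      using N T by (intro T(3) preimage_submodule[where f = j and B = X]) (use biproductD(2)[OF
          assms(1)] in auto)
    ultimately have "i (p x) \<in> N" "j (q x) \<in> N" if "x \<in> carrier X" for x
      using that by (auto simp: set_eq_iff)
    then have "x \<in> N" if "x \<in> carrier X" for x
      using N'(3)[of "i (p x)" "j (q x)"] that by simp
    then show ?thesis using N' by blast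
  qed
  moreover have "i ` S \<union> j ` T \<subseteq> carrier X" using S T by auto
  ultimately show ?thesis using S(1) T(1) unfolding fin_gen_def by (intro exI[of _ "i ` S \<union> j `
      T"]) simp
qed

lemma dsum_biproduct:
  assumes "LMod A" "LMod B"
  shows "LMod (A \<boxplus> B)" "biproduct A B (A \<boxplus> B) (\<lambda>a. (a, \<zero>\<^bsub>B\<^esub>)) (\<lambda>b. (\<zero>\<^bsub>A\<^esub>, b)) fst snd"
proof -
  interpret A: left_module R A by fact
  interpret B: left_module R B by fact
  have s: "carrier (A \<boxplus> B) = carrier A \<times> carrier B" "\<zero>\<^bsub>A \<boxplus> B\<^esub> = (\<zero>\<^bsub>A\<^esub>, \<zero>\<^bsub>B\<^esub>)"
     "(a, b) \<oplus>\<^bsub>A \<boxplus> B\<^esub> (a', b') = (a \<oplus>\<^bsub>A\<^esub> a', b \<oplus>\<^bsub>B\<^esub> b')" "r \<odot>\<^bsub>A \<boxplus> B\<^esub> (a, b) = (r \<odot>\<^bsub>A\<^esub> a, r \<odot>\<^bsub>B\<^esub> b)"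
     for a b a' b' r by (simp_all add: dsum_def)
  have "abelian_group (A \<boxplus> B)"
  proof (rule abelian_groupI)
    fix x assume "x \<in> carrier (A \<boxplus> B)"
    then obtain a b where "x = (a, b)" "a \<in> carrier A" "b \<in> carrier B" by (auto simp: s)
    then show "\<exists>y\<in>carrier (A \<boxplus> B). y \<oplus>\<^bsub>A \<boxplus> B\<^esub> x = \<zero>\<^bsub>A \<boxplus> B\<^esub>"
      by (intro bexI[of _ "(\<ominus>\<^bsub>A\<^esub> a, \<ominus>\<^bsub>B\<^esub> b)"]) (auto simp: s A.l_neg B.l_neg)
  qed (auto simp: s A.a_ac B.a_ac)
  then show "LMod (A \<boxplus> B)"
    by (intro left_module.intro left_module_axioms.intro)
      (auto simp: s A.smult_l_distr B.smult_l_distr A.smult_r_distr B.smult_r_distr A.smult_assoc1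
          B.smult_assoc1 ring_axioms)
  show "biproduct A B (A \<boxplus> B) (\<lambda>a. (a, \<zero>\<^bsub>B\<^esub>)) (\<lambda>b. (\<zero>\<^bsub>A\<^esub>, b)) fst snd"
    unfolding biproduct_def by (intro conjI module_homI) (auto simp: s)
qed

text \<open>\<open>ex_iso_fmod\<close> brings the sum on pairs back to a module on lists.\<close>

lemma biproduct_ex:
  assumes "A \<in> Ob" "B \<in> Ob"
  shows "\<exists>X \<in> Ob. \<exists>i j p q. biproduct A B X i j p q"
proof -
  have "LMod (A \<boxplus> B)" and b: "biproduct A B (A \<boxplus> B) (\<lambda>a. (a, \<zero>\<^bsub>B\<^esub>)) (\<lambda>b. (\<zero>\<^bsub>A\<^esub>, b)) fst snd"
    using dsum_biproduct[of A B] assms by simp_all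
  moreover have "fin_gen R (A \<boxplus> B)" using assms calculation
    unfolding Ob_iff by (intro fin_gen_biproduct[OF b]) blast+
  ultimately obtain X where "X \<in> Ob" "module_iso R (A \<boxplus> B) X" using ex_iso_fmod by blast
  then obtain f g where "iso_pair (A \<boxplus> B) X f g" using module_iso_iff \<open>LMod (A \<boxplus> B)\<close> by blast
  then show ?thesis using biproduct_iso[OF b] \<open>X \<in> Ob\<close> by blast
qed

lemma module_iso_dsum_iff:
  assumes "LMod A" "LMod B" "LMod X"
  shows "module_iso R X (A \<boxplus> B) \<longleftrightarrow> (\<exists>i j p q. biproduct A B X i j p q)"
proof
  note d = dsum_biproduct[OF assms(1,2)]
  assume "module_iso R X (A \<boxplus> B)"
  then obtain f g where "iso_pair X (A \<boxplus> B) f g" using module_iso_iff assms by blast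
  then show "\<exists>i j p q. biproduct A B X i j p q" using biproduct_iso[OF d(2) iso_pair_sym] by blast
next
  note d = dsum_biproduct[OF assms(1,2)]
  assume "\<exists>i j p q. biproduct A B X i j p q"
  then obtain i j p q where "biproduct A B X i j p q" by metis
  then have "\<exists>f g. iso_pair X (A \<boxplus> B) f g" using biproduct_unique[OF _ d(2) assms d(1)] by blast
  then show "module_iso R X (A \<boxplus> B)" using module_iso_iff[OF assms(3)] by blast
qed

definition summand :: "('a, 'a list) module \<Rightarrow> ('a, 'b) module \<Rightarrow> bool" where
  "summand Z X \<longleftrightarrow> (\<exists>Y \<in> Ob. \<exists>i j p q. biproduct Z Y X i j p q)"

lemma direct_summand_iff:
  "\<lbrakk>Z \<in> Ob; LMod X\<rbrakk> \<Longrightarrow> direct_summand R Z X \<longleftrightarrow> summand Z X"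
  unfolding direct_summand_def summand_def by (intro bex_cong refl module_iso_dsum_iff) simp_all

lemma indecomposable_iff:
  assumes "X \<in> Ob"
  shows "indecomposable R X \<longleftrightarrow> \<not> zero_module X \<and>
    (\<forall>A \<in> Ob. \<forall>B \<in> Ob. \<forall>i j p q. biproduct A B X i j p q \<longrightarrow> zero_module A \<or> zero_module B)"
proof -
  have "module_iso R X (A \<boxplus> B) \<longleftrightarrow> (\<exists>i j p q. biproduct A B X i j p q)" if "A \<in> Ob" "B \<in> Ob" for A B
    using that assms by (intro module_iso_dsum_iff) simp_all
  then show ?thesis unfolding indecomposable_def by (metis (no_types, lifting))
qed

text \<open>The complement is the kernel of \<open>p\<close>, and the projection onto it subtracts
  \<open>i (p x)\<close> from \<open>x\<close>.\<close>

lemma retract_biproduct: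
  assumes "X \<in> Ob" "Z \<in> Ob" "i \<in> Hom Z X" "p \<in> Hom X Z" "\<And>z. z \<in> carrier Z \<Longrightarrow> p (i z) = z"
  shows "\<exists>Y \<in> Ob. \<exists>j q. biproduct Z Y X i j p q"
proof -
  note [simp] = hom_simps[OF assms(3)] hom_simps[OF assms(4)] assms(1,2,5)
  define Y where "Y = X\<lparr>carrier := {x \<in> carrier X. p x = \<zero>\<^bsub>Z\<^esub>}\<rparr>"
  have Y: "Y \<in> Ob" unfolding Y_def using assms by (intro sub_Ob kernel_submodule) auto
  have h: "(\<lambda>x. x \<ominus>\<^bsub>X\<^esub> i (p x)) \<in> Hom X X"
    using assms by (intro hom_minus hom_id hom_comp[of p X Z i X]) auto
  have "biproduct Z Y X i (\<lambda>x. x) p (\<lambda>x. x \<ominus>\<^bsub>X\<^esub> i (p x))"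
    unfolding biproduct_def
  proof (intro conjI ballI)
    show "(\<lambda>x. x \<ominus>\<^bsub>X\<^esub> i (p x)) \<in> Hom X Y"
      using hom_simps[OF h] by (intro module_homI) (simp_all add: Y_def)
    show "(\<lambda>x. x) \<in> Hom Y X" by (rule module_homI) (auto simp: Y_def)
    show "i (p x) \<oplus>\<^bsub>X\<^esub> (x \<ominus>\<^bsub>X\<^esub> i (p x)) = x" if "x \<in> carrier X" for x
      using that by - (rule represents_eqI, (rule represents_intros | simp add: algebra_simps)+)
  qed (use assms in \<open>auto simp: Y_def\<close>)
  then show ?thesis using Y by blast
qed

lemma retract_summand:
  assumes "X \<in> Ob" "Z \<in> Ob" "i \<in> Hom Z X" "p \<in> Hom X Z" "\<And>z. z \<in> carrier Z \<Longrightarrow> p (i z) = z"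
  shows "summand Z X"
  using retract_biproduct[OF assms] unfolding summand_def by blast

lemma summand_trans:
  assumes "summand A B" "summand B C" "A \<in> Ob" "B \<in> Ob" "C \<in> Ob"
  shows "summand A C"
proof -
  obtain Y i j p q where b1: "Y \<in> Ob" "biproduct A Y B i j p q" using assms(1) unfolding
      summand_def by blast
  obtain Y' i' j' p' q' where b2: "Y' \<in> Ob" "biproduct B Y' C i' j' p' q'" using assms(2)
      unfolding summand_def by blast
  note b = b1(2) b2(2)
  note [simp] = biproduct_simps[OF b(1)] biproduct_simps[OF b(2)]
  show ?thesis
    by (rule retract_summand[of _ _ "\<lambda>x. i' (i x)" "\<lambda>x. p (p' x)"])
      (use b assms in \<open>auto intro: hom_comp biproductD\<close>)
qed

lemma idempotent_split:
  assumes "X \<in> Ob" "e \<in> Hom X X" "\<And>x. x \<in> carrier X \<Longrightarrow> e (e x) = e x"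
  shows "\<exists>Z \<in> Ob. \<exists>i \<in> Hom Z X. \<exists>p \<in> Hom X Z. (\<forall>z \<in> carrier Z. p (i z) = z) \<and> (\<forall>x \<in> carrier X. i
      (p x) = e x)"
proof -
  let ?Z = "X\<lparr>carrier := e ` carrier X\<rparr>"
  have "?Z \<in> Ob" using assms by (intro sub_Ob image_submodule) auto
  moreover have "(\<lambda>x. x) \<in> Hom ?Z X" using hom_simps[OF assms(2)] by (intro module_homI) auto
  moreover have "e \<in> Hom X ?Z" using hom_simps[OF assms(2)] by (intro module_homI) auto
  ultimately show ?thesis using assms(3) by (intro bexI[of _ ?Z] bexI[of _ "\<lambda>x. x"] bexI[of _ e])
      auto
qed

text \<open>Fitting's lemma in the form of a Drazin inverse: \<open>e\<close> projects onto the part of \<open>X\<close> on which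
  \<open>a\<close> is nilpotent, and \<open>g\<close> inverts \<open>a\<close> on the complement.\<close>

lemma fitting:
  assumes X: "X \<in> Ob" and a: "a \<in> Hom X X"
  shows "\<exists>e \<in> Hom X X. \<exists>g \<in> Hom X X. \<exists>n. \<forall>x \<in> carrier X.
    e (e x) = e x \<and> g (a x) \<oplus>\<^bsub>X\<^esub> e x = x \<and> a (g x) \<oplus>\<^bsub>X\<^esub> e x = x \<and> (a ^^ n) (e x) = \<zero>\<^bsub>X\<^esub>"
proof -
  note [simp] = hom_simps[OF hom_funpow[OF a]] hom_simps[OF a] X
  define K where "K n = {x \<in> carrier X. (a ^^ n) x = \<zero>\<^bsub>X\<^esub>}" for n
  define I where "I n = (a ^^ n) ` carrier X" for n
  have "K n \<subseteq> K (Suc n)" for n by (auto simp: K_def)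
  then have "mono K" by (simp add: mono_iff_le_Suc)
  moreover have "range K \<subseteq> {N. submodule N R X}"
    unfolding K_def using kernel_submodule[OF _ _ hom_funpow[OF a]] by auto
  ultimately obtain n1 where n1: "\<forall>m \<ge> n1. K m = K n1"
    using chain_cond_Ob[OF X] unfolding chain_cond_def by blast
  have "I (Suc n) \<subseteq> I n" for n
  proof
    fix y assume "y \<in> I (Suc n)"
    then obtain x where "x \<in> carrier X" "y = (a ^^ n) (a x)" by (auto simp: I_def funpow_swap1)
    then show "y \<in> I n" unfolding I_def by (intro image_eqI[of _ _ "a x"]) auto
  qed
  then have "antimono I" by (simp add: antimono_iff_le_Suc)
  moreover have "range I \<subseteq> {N. submodule N R X}"
    unfolding I_def using image_submodule[OF _ _ hom_funpow[OF a]] by auto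
  ultimately obtain n2 where n2: "\<forall>m \<ge> n2. I m = I n2"
    using chain_cond_Ob[OF X] unfolding chain_cond_def by blast
  \<comment> \<open>From \<open>n\<close> on, both the kernels and the images of the powers of
    \<open>a\<close> are constant.\<close>
  define n where "n = max n1 n2"
  have "K (2 * n + 1) = K n" "I (2 * n + 1) = I n"
    using n1[rule_format, of n] n1[rule_format, of "2 * n + 1"] n2[rule_format, of n]
        n2[rule_format, of "2 * n + 1"]
    by (simp_all add: n_def)
  define b where "b = a ^^ n"
  \<comment> \<open>With \<open>b = a ^^ n\<close> this is \<open>b a b\<close>. As \<open>c\<close>
    and \<open>b\<close> have the same kernel and the same image, \<open>g = b c^-1 b\<close> is
    well defined even where \<open>c\<close> is not invertible; this is the classical formula for
    the Drazin inverse.\<close>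
  define c where "c = a ^^ (2 * n + 1)"
  have bc_hom: "b \<in> Hom X X" "c \<in> Hom X X" unfolding b_def c_def using hom_funpow[OF a] by blast+
  note [simp] = hom_simps[OF bc_hom(1)] hom_simps[OF bc_hom(2)]
  have c_ba: "c x = b (a (b x))" for x
  proof -
    have "2 * n + 1 = n + (1 + n)" by simp
    then show ?thesis unfolding c_def b_def by (simp only: funpow_add comp_def) simp
  qed
  have ab: "b (a x) = a (b x)" for x unfolding b_def by (simp add: funpow_swap1)
  have ker: "b x = \<zero>\<^bsub>X\<^esub>" if "x \<in> carrier X" "c x = \<zero>\<^bsub>X\<^esub>" for x
    using \<open>K (2 * n + 1) = K n\<close> that unfolding K_def b_def c_def by blast
  have "\<exists>y. y \<in> carrier X \<and> c y = b x" if "x \<in> carrier X" for x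
  proof -
    have "b x \<in> I (2 * n + 1)" using \<open>I (2 * n + 1) = I n\<close> that unfolding I_def b_def by blast
    then show ?thesis unfolding I_def c_def by (metis image_iff)
  qed
  then obtain s where s: "\<And>x. x \<in> carrier X \<Longrightarrow> s x \<in> carrier X" "\<And>x. x \<in> carrier X \<Longrightarrow> c (s x) = b x"
    by metis
  define g where "g x = b (s x)" for x
  have g: "g x = b y" if "x \<in> carrier X" "y \<in> carrier X" "c y = b x" for x y
  proof -
    have "c (s x \<ominus>\<^bsub>X\<^esub> y) = \<zero>\<^bsub>X\<^esub>" using that s by simp
    then have "b (s x \<ominus>\<^bsub>X\<^esub> y) = \<zero>\<^bsub>X\<^esub>" using that s by (intro ker) auto
    then have "b (s x) \<ominus>\<^bsub>X\<^esub> b y = \<zero>\<^bsub>X\<^esub>" using that s by simp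
    then show ?thesis unfolding g_def using that s abelian_group.minus_eq_zero_iff[of X] by simp
  qed
  have g_hom: "g \<in> Hom X X"
  proof (rule module_homI)
    show "g x \<in> carrier X" if "x \<in> carrier X" for x using that s by (simp add: g_def)
    show "g (x \<oplus>\<^bsub>X\<^esub> y) = g x \<oplus>\<^bsub>X\<^esub> g y" if "x \<in> carrier X" "y \<in> carrier X" for x y
      using g[of "x \<oplus>\<^bsub>X\<^esub> y" "s x \<oplus>\<^bsub>X\<^esub> s y"] that s by (simp add: g_def)
    show "g (r \<odot>\<^bsub>X\<^esub> x) = r \<odot>\<^bsub>X\<^esub> g x" if "r \<in> carrier R" "x \<in> carrier X" for x r
      using g[of "r \<odot>\<^bsub>X\<^esub> x" "r \<odot>\<^bsub>X\<^esub> s x"] that s by (simp add: g_def)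
  qed
  define e where "e x = x \<ominus>\<^bsub>X\<^esub> a (g x)" for x
  have e_hom: "e \<in> Hom X X"
    unfolding e_def using hom_minus[OF _ _ hom_id hom_comp[OF g_hom a]] by simp
  note [simp] = hom_simps[OF g_hom] hom_simps[OF e_hom]
  have ga: "g (a x) = a (g x)" if "x \<in> carrier X" for x
  proof -
    have "g (a x) = b (a (s x))"
    proof (rule g)
      have "c (a (s x)) = a (c (s x))" by (simp add: c_ba ab)
      then show "c (a (s x)) = b (a x)" using s that by (simp add: ab)
    qed (use s that in auto)
    then show ?thesis by (simp add: g_def ab)
  qed
  have be: "b (e x) = \<zero>\<^bsub>X\<^esub>" if x: "x \<in> carrier X" for x
  proof -
    have "b (a (g x)) = b x" unfolding g_def using s(2)[OF x] by (simp add: c_ba)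
    then show ?thesis unfolding e_def using x by simp
  qed
  \<comment> \<open>\<open>e x\<close> is killed by \<open>b\<close>, so zero solves the equation
    that defines \<open>g (e x)\<close>. This is what makes \<open>e\<close> idempotent.\<close>
  have ge: "g (e x) = \<zero>\<^bsub>X\<^esub>" if "x \<in> carrier X" for x
    using g[of "e x" "\<zero>\<^bsub>X\<^esub>"] be that by simp
  have ee: "e (e x) = e x" if "x \<in> carrier X" for x
    unfolding e_def[of "e x"] using ge that by simp
  have age: "a (g x) \<oplus>\<^bsub>X\<^esub> e x = x" if "x \<in> carrier X" for x
    unfolding e_def using that by - (rule represents_eqI, (rule represents_intros | simp add:
        algebra_simps)+)
  show ?thesis
    using e_hom g_hom ee age ga be unfolding b_def by (intro bexI[of _ e] bexI[of _ g] exI[of _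
        n]) auto
qed

section \<open>Endomorphisms of indecomposable modules\<close>

lemma zero_moduleD: "\<lbrakk>zero_module A; x \<in> carrier A\<rbrakk> \<Longrightarrow> x = \<zero>\<^bsub>A\<^esub>"
  by (auto simp: zero_module_def)

lemma zero_moduleI: "\<lbrakk>LMod A; \<And>x. x \<in> carrier A \<Longrightarrow> x = \<zero>\<^bsub>A\<^esub>\<rbrakk> \<Longrightarrow> zero_module A"
  using Mod_simps(1) unfolding zero_module_def by blast

lemma indecomposable_idempotent:
  assumes M: "M \<in> Ob" "indecomposable R M" and e: "e \<in> Hom M M" "\<And>x. x \<in> carrier M \<Longrightarrow> e (e x) = e x"
  shows "(\<forall>x \<in> carrier M. e x = \<zero>\<^bsub>M\<^esub>) \<or> (\<forall>x \<in> carrier M. e x = x)"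
proof -
  obtain Z i p where Z: "Z \<in> Ob" "i \<in> Hom Z M" "p \<in> Hom M Z" "\<forall>z \<in> carrier Z. p (i z) = z"
    "\<forall>x \<in> carrier M. i (p x) = e x"
    using idempotent_split[OF M(1) e] by blast
  obtain Y j q where Y: "Y \<in> Ob" "biproduct Z Y M i j p q" using retract_biproduct[OF M(1) Z(1-3)]
      Z(4) by blast
  note [simp] = biproduct_simps[OF Y(2)] M(1) Y(1) Z(1)
  from M Z Y consider "zero_module Z" | "zero_module Y" using indecomposable_iff by blast
  then show ?thesis
  proof cases
    case 1
    have "e x = \<zero>\<^bsub>M\<^esub>" if "x \<in> carrier M" for x
    proof -
      have "p x = \<zero>\<^bsub>Z\<^esub>" using zero_moduleD[OF 1] that by simp
      then have "i (p x) = i \<zero>\<^bsub>Z\<^esub>" by simp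
      then show ?thesis using Z(5) that by simp
    qed
    then show ?thesis by blast
  next
    case 2
    have "e x = x" if "x \<in> carrier M" for x
    proof -
      have "q x = \<zero>\<^bsub>Y\<^esub>" using zero_moduleD[OF 2] that by simp
      then have "i (p x) \<oplus>\<^bsub>M\<^esub> \<zero>\<^bsub>M\<^esub> = x" using biproduct_simps(5)[OF Y(2), of x] that by simp
      then show ?thesis using Z(5)[rule_format, of x] hom_simps(1)[OF e(1)] that by simp
    qed
    then show ?thesis by blast
  qed
qed

text \<open>The Fitting idempotent \<open>e\<close> of \<open>a\<close> is zero or the identity: in
  the first case \<open>g\<close> is inverse to \<open>a\<close>, in the second \<open>a\<close> is
  nilpotent.\<close>

lemma indecomposable_endo:
  assumes M: "M \<in> Ob" "indecomposable R M" and a: "a \<in> Hom M M"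
  shows "(\<exists>g. iso_pair M M a g) \<or> (\<exists>n. \<forall>x \<in> carrier M. (a ^^ n) x = \<zero>\<^bsub>M\<^esub>)"
proof -
  obtain e g n where *: "e \<in> Hom M M" "g \<in> Hom M M" "\<forall>x \<in> carrier M.
      e (e x) = e x \<and> g (a x) \<oplus>\<^bsub>M\<^esub> e x = x \<and> a (g x) \<oplus>\<^bsub>M\<^esub> e x = x \<and> (a ^^ n) (e x) = \<zero>\<^bsub>M\<^esub>"
    using fitting[OF M(1) a] by blast
  note [simp] = hom_simps[OF *(2)] hom_simps[OF a] M(1)
  consider "\<forall>x \<in> carrier M. e x = \<zero>\<^bsub>M\<^esub>" | "\<forall>x \<in> carrier M. e x = x"
    using indecomposable_idempotent[OF M *(1)] *(3) by blast
  then show ?thesis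
  proof cases
    case 1
    have "g (a x) = x \<and> a (g x) = x" if "x \<in> carrier M" for x
      using *(3)[rule_format, OF that] 1 that by simp
    then show ?thesis using a *(2) unfolding iso_pair_def by blast
  next
    case 2 then show ?thesis using *(3) by metis
  qed
qed

text \<open>Locality of the endomorphism ring, the input of Krull-Schmidt. If both \<open>a\<close>
  and \<open>b\<close> were nilpotent, then \<open>b\<close> would fix a nonzero element of the
  kernel of \<open>a\<close>.\<close>

lemma indecomposable_local:
  assumes M: "M \<in> Ob" "indecomposable R M" and a: "a \<in> Hom M M" and b: "b \<in> Hom M M"
    and ab: "\<And>x. x \<in> carrier M \<Longrightarrow> a x \<oplus>\<^bsub>M\<^esub> b x = x"
  shows "(\<exists>g. iso_pair M M a g) \<or> (\<exists>g. iso_pair M M b g)"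
proof (rule ccontr)
  assume no: "\<not> ?thesis"
  note [simp] = hom_simps[OF hom_funpow[OF a]] hom_simps[OF hom_funpow[OF b]] hom_simps[OF a]
      hom_simps[OF b] M(1)
  obtain n where n: "\<forall>x \<in> carrier M. (a ^^ n) x = \<zero>\<^bsub>M\<^esub>" using indecomposable_endo[OF M a] no by
      blast
  obtain m where m: "\<forall>x \<in> carrier M. (b ^^ m) x = \<zero>\<^bsub>M\<^esub>" using indecomposable_endo[OF M b] no by
      blast
  have "\<exists>x \<in> carrier M. x \<noteq> \<zero>\<^bsub>M\<^esub>"
    using M zero_moduleI[of M] indecomposable_iff by (metis Ob_Mod)
  then obtain x where x: "x \<in> carrier M" "x \<noteq> \<zero>\<^bsub>M\<^esub>" by blast
  have "\<exists>z \<in> carrier M. z \<noteq> \<zero>\<^bsub>M\<^esub> \<and> a z = \<zero>\<^bsub>M\<^esub>"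
  proof -
    have "\<exists>k. (a ^^ k) x = \<zero>\<^bsub>M\<^esub>" using n x by blast
    then obtain k where k: "(a ^^ k) x = \<zero>\<^bsub>M\<^esub>" "\<And>l. l < k \<Longrightarrow> (a ^^ l) x \<noteq> \<zero>\<^bsub>M\<^esub>"
      using exists_least_iff[of "\<lambda>k. (a ^^ k) x = \<zero>\<^bsub>M\<^esub>"] by blast
    then obtain l where "k = Suc l" using x by (cases k) auto
    then show ?thesis using k x by (intro bexI[of _ "(a ^^ l) x"]) auto
  qed
  then obtain z where z: "z \<in> carrier M" "z \<noteq> \<zero>\<^bsub>M\<^esub>" "a z = \<zero>\<^bsub>M\<^esub>" by blast
  have "b z = z" using ab[OF z(1)] z by simp
  then have "(b ^^ m) z = z" by (induction m) auto
  then show False using m z by simp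
qed

section \<open>The Krull--Schmidt theorem\<close>

lemma biproduct_minus:
  assumes "biproduct A B X i j p q" "LMod X" "x \<in> carrier X"
  shows "j (q x) = x \<ominus>\<^bsub>X\<^esub> i (p x)" "i (p x) = x \<ominus>\<^bsub>X\<^esub> j (q x)"
proof -
  note [simp] = biproduct_simps[OF assms(1)] assms(2,3)
  have x: "x = i (p x) \<oplus>\<^bsub>X\<^esub> j (q x)" by simp
  have "j (q x) = (i (p x) \<oplus>\<^bsub>X\<^esub> j (q x)) \<ominus>\<^bsub>X\<^esub> i (p x)"
    by - (rule represents_eqI[of X], (rule represents_intros | simp add: algebra_simps del:
        biproduct_simps(5)[OF assms(1)])+)
  then show "j (q x) = x \<ominus>\<^bsub>X\<^esub> i (p x)" by simp
  have "i (p x) = (i (p x) \<oplus>\<^bsub>X\<^esub> j (q x)) \<ominus>\<^bsub>X\<^esub> j (q x)"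
    by - (rule represents_eqI[of X], (rule represents_intros | simp add: algebra_simps del:
        biproduct_simps(5)[OF assms(1)])+)
  then show "i (p x) = x \<ominus>\<^bsub>X\<^esub> j (q x)" by simp
qed

lemma biproduct_zero_left:
  assumes "biproduct A B X i j p q" "zero_module A" "LMod A" "LMod B" "LMod X"
  shows "iso_pair B X j q"
proof -
  note [simp] = biproduct_simps[OF assms(1)] assms(3-)
  have "j (q x) = x" if "x \<in> carrier X" for x
  proof -
    have "p x = \<zero>\<^bsub>A\<^esub>" using zero_moduleD[OF assms(2)] that by simp
    then show ?thesis using biproduct_minus(1)[OF assms(1)] that by simp
  qed
  then show ?thesis using biproductD(2,4)[OF assms(1)] unfolding iso_pair_def by simp
qed

text \<open>Azumaya's exchange step. Under the hypothesis \<open>M\<close> embeds into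
  \<open>A\<close> as a direct summand with complement \<open>A'\<close>, and inside
  \<open>X\<close> the given copy of \<open>M\<close> can replace this one: \<open>X\<close> is the
  direct sum of \<open>M\<close>, \<open>A'\<close> and \<open>B\<close>. Dividing by
  \<open>M\<close> identifies \<open>Y\<close> with the sum of \<open>A'\<close> and
  \<open>B\<close>.\<close>

lemma biproduct_exchange:
  assumes b1: "biproduct M Y X i1 j1 p1 q1" and b2: "biproduct A B X i j p q"
    and Ob: "M \<in> Ob" "Y \<in> Ob" "X \<in> Ob" "A \<in> Ob" "B \<in> Ob"
    and iso: "iso_pair M M (\<lambda>m. p1 (i (p (i1 m)))) \<theta>"
  shows "\<exists>A' \<in> Ob. (\<exists>i j p q. biproduct M A' A i j p q) \<and> (\<exists>i j p q. biproduct A' B Y i j p q)"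
proof -
  note h = biproductD(1-4)[OF b1] biproductD(1-4)[OF b2]
  note th = iso_pairD[OF iso]
  note [simp] = biproduct_simps[OF b1] biproduct_simps[OF b2] hom_simps[OF th(2)] th(3,4) Ob
  define u where "u m = p (i1 m)" for m
  define r where "r a = p1 (i a)" for a
  define v where "v m = q (i1 m)" for m
  have u: "u \<in> Hom M A" unfolding u_def by (rule hom_comp[OF h(1) h(7)])
  have v: "v \<in> Hom M B" unfolding v_def by (rule hom_comp[OF h(1) h(8)])
  have r: "r \<in> Hom A M" unfolding r_def by (rule hom_comp[OF h(5) h(3)])
  have tr: "(\<lambda>a. \<theta> (r a)) \<in> Hom A M" using hom_comp[OF r th(2)] .
  note [simp] = hom_simps[OF u] hom_simps[OF v] hom_simps[OF r]
  have tru: "\<theta> (r (u m)) = m" "r (u (\<theta> m)) = m" if "m \<in> carrier M" for m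
    using th(3,4)[OF that] by (simp_all add: r_def u_def)
  obtain A' j' q' where A': "A' \<in> Ob" and b3: "biproduct M A' A u j' (\<lambda>a. \<theta> (r a)) q'"
    using retract_biproduct[OF Ob(4,1) u tr] tru by blast
  note [simp] = biproduct_simps[OF b3] A'
  have rj: "r (j' a) = \<zero>\<^bsub>M\<^esub>" if "a \<in> carrier A'" for a
    using tru(2)[of "r (j' a)"] biproduct_simps(3)[OF b3 that] that by simp
  have jq1: "j1 (q1 x) = x \<ominus>\<^bsub>X\<^esub> i1 (p1 x)" if "x \<in> carrier X" for x using biproduct_minus[OF b1]
      that by simp
  have uv: "i (u m) \<oplus>\<^bsub>X\<^esub> j (v m) = i1 m" if "m \<in> carrier M" for m unfolding u_def v_def using that
      by simp
  \<comment> \<open>\<open>I\<close> and \<open>J\<close> include into \<open>X\<close> and project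
    along \<open>M\<close>. In the other direction \<open>j1 y\<close> is decomposed along
    \<open>M\<close>, \<open>A'\<close> and \<open>B\<close>: its \<open>M\<close>-part is
    \<open>m = \<theta> (r (p (j1 y)))\<close>, and since \<open>i1 m\<close> has the component
    \<open>v m\<close> in \<open>B\<close>, \<open>Q\<close> subtracts it.\<close>
  define I where "I a = q1 (i (j' a))" for a
  define J where "J b = q1 (j b)" for b
  define P where "P y = q' (p (j1 y))" for y
  define Q where "Q y = q (j1 y) \<ominus>\<^bsub>B\<^esub> v (\<theta> (r (p (j1 y))))" for y
  have I: "I \<in> Hom A' Y" unfolding I_def
    using hom_comp[OF hom_comp[OF biproductD(2)[OF b3] h(5)] h(4)] .
  have J: "J \<in> Hom B Y" unfolding J_def using hom_comp[OF h(6) h(4)] .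
  have P: "P \<in> Hom Y A'" unfolding P_def using hom_comp[OF hom_comp[OF h(2) h(7)] biproductD(4)[OF
      b3]] .
  have Q: "Q \<in> Hom Y B" unfolding Q_def
    using hom_comp[OF h(2) h(8)] hom_comp[OF hom_comp[OF hom_comp[OF h(2) h(7)] tr] v] by (intro
        hom_minus) simp_all
  have "P (I a) = a \<and> Q (I a) = \<zero>\<^bsub>B\<^esub>" if a: "a \<in> carrier A'" for a
  proof -
    have "p1 (i (j' a)) = \<zero>\<^bsub>M\<^esub>" using rj[OF a] by (simp add: r_def)
    then have "j1 (I a) = i (j' a)" unfolding I_def using jq1[of "i (j' a)"] a by simp
    then show ?thesis unfolding P_def Q_def using a rj[OF a] by simp
  qed
  moreover have "P (J b) = \<zero>\<^bsub>A'\<^esub> \<and> Q (J b) = b" if b: "b \<in> carrier B" for b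
  proof -
    define m where "m = p1 (j b)"
    have m: "m \<in> carrier M" using b by (simp add: m_def)
    have "j1 (J b) = j b \<ominus>\<^bsub>X\<^esub> i1 m" unfolding J_def m_def using jq1[of "j b"] b by simp
    then have 1: "p (j1 (J b)) = \<ominus>\<^bsub>A\<^esub> u m" "q (j1 (J b)) = b \<ominus>\<^bsub>B\<^esub> v m"
      using m b by (simp_all add: u_def v_def a_minus_def)
    have "q' (u m) = \<zero>\<^bsub>A'\<^esub>" "\<theta> (r (u m)) = m" using m tru by simp_all
    then have "P (J b) = \<zero>\<^bsub>A'\<^esub>" "Q (J b) = (b \<ominus>\<^bsub>B\<^esub> v m) \<ominus>\<^bsub>B\<^esub> (\<ominus>\<^bsub>B\<^esub> v m)"
      unfolding P_def Q_def 1 using m by simp_all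
    moreover have "(b \<ominus>\<^bsub>B\<^esub> v m) \<ominus>\<^bsub>B\<^esub> (\<ominus>\<^bsub>B\<^esub> v m) = b"
      using m b by - (rule represents_eqI, (rule represents_intros | simp add: algebra_simps)+)
    ultimately show ?thesis by simp
  qed
  moreover have "I (P y) \<oplus>\<^bsub>Y\<^esub> J (Q y) = y" if y: "y \<in> carrier Y" for y
  proof -
    define a where "a = p (j1 y)"
    define b where "b = q (j1 y)"
    define m where "m = \<theta> (r a)"
    have [simp]: "a \<in> carrier A" "b \<in> carrier B" "m \<in> carrier M" using y by (simp_all add: a_def
        b_def m_def)
    have ab: "i a \<oplus>\<^bsub>X\<^esub> j b = j1 y" unfolding a_def b_def using y by simp
    have "j' (q' a) = a \<ominus>\<^bsub>A\<^esub> u m" unfolding m_def using biproduct_minus(1)[OF b3] by simp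
    then have "I (P y) \<oplus>\<^bsub>Y\<^esub> J (Q y) = q1 ((i a \<ominus>\<^bsub>X\<^esub> i (u m)) \<oplus>\<^bsub>X\<^esub> (j b \<ominus>\<^bsub>X\<^esub> j (v m)))"
      unfolding I_def P_def J_def Q_def a_def[symmetric] b_def[symmetric] m_def[symmetric] by simp
    also have "(i a \<ominus>\<^bsub>X\<^esub> i (u m)) \<oplus>\<^bsub>X\<^esub> (j b \<ominus>\<^bsub>X\<^esub> j (v m)) = (i a \<oplus>\<^bsub>X\<^esub> j b) \<ominus>\<^bsub>X\<^esub> (i (u m) \<oplus>\<^bsub>X\<^esub> j (v
        m))"
      by (rule represents_eqI, (rule represents_intros | simp add: algebra_simps)+)
    finally show ?thesis unfolding ab uv[OF \<open>m \<in> carrier M\<close>] using y by simp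
  qed
  ultimately have "biproduct A' B Y I J P Q" using I J P Q unfolding biproduct_def by blast
  then show ?thesis using A' b3 by blast
qed

lemma biproduct_assoc:
  assumes b1: "biproduct M Y A i1 j1 p1 q1" and b2: "biproduct A B X i2 j2 p2 q2" and b3:
      "biproduct Y B W i3 j3 p3 q3"
    and Ob: "M \<in> Ob" "Y \<in> Ob" "X \<in> Ob" "A \<in> Ob" "B \<in> Ob" "W \<in> Ob"
  shows "biproduct M W X (\<lambda>m. i2 (i1 m)) (\<lambda>w. i2 (j1 (p3 w)) \<oplus>\<^bsub>X\<^esub> j2 (q3 w))
    (\<lambda>x. p1 (p2 x)) (\<lambda>x. i3 (q1 (p2 x)) \<oplus>\<^bsub>W\<^esub> j3 (q2 x))"
  unfolding biproduct_def
proof (intro conjI ballI)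
  note h = biproductD(1-4)[OF b1] biproductD(1-4)[OF b2] biproductD(1-4)[OF b3]
  note [simp] = biproduct_simps[OF b1] biproduct_simps[OF b2] biproduct_simps[OF b3] Ob
  show "(\<lambda>m. i2 (i1 m)) \<in> Hom M X" "(\<lambda>x. p1 (p2 x)) \<in> Hom X M"
    by (rule hom_comp[OF h(1) h(5)], rule hom_comp[OF h(7) h(3)])
  show "(\<lambda>w. i2 (j1 (p3 w)) \<oplus>\<^bsub>X\<^esub> j2 (q3 w)) \<in> Hom W X"
    by (rule hom_add) (simp, rule hom_comp[OF hom_comp[OF h(11) h(2)] h(5)], rule hom_comp[OF
        h(12) h(6)])
  show "(\<lambda>x. i3 (q1 (p2 x)) \<oplus>\<^bsub>W\<^esub> j3 (q2 x)) \<in> Hom X W"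
    by (rule hom_add) (simp, rule hom_comp[OF hom_comp[OF h(7) h(4)] h(9)], rule hom_comp[OF h(8)
        h(10)])
  fix x assume x: "x \<in> carrier X"
  have "i2 (i1 (p1 (p2 x))) \<oplus>\<^bsub>X\<^esub> (i2 (j1 (q1 (p2 x))) \<oplus>\<^bsub>X\<^esub> j2 (q2 x))
      = i2 (i1 (p1 (p2 x)) \<oplus>\<^bsub>A\<^esub> j1 (q1 (p2 x))) \<oplus>\<^bsub>X\<^esub> j2 (q2 x)"
    using x by (simp del: biproduct_simps(5)[OF b1])
      (rule represents_eqI, (rule represents_intros | simp add: algebra_simps del:
          biproduct_simps(5)[OF b1])+)
  then show "i2 (i1 (p1 (p2 x))) \<oplus>\<^bsub>X\<^esub> (i2 (j1 (p3 (i3 (q1 (p2 x)) \<oplus>\<^bsub>W\<^esub> j3 (q2 x)))) \<oplus>\<^bsub>X\<^esub>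
        j2 (q3 (i3 (q1 (p2 x)) \<oplus>\<^bsub>W\<^esub> j3 (q2 x)))) = x" using x by simp
qed (simp_all add: biproduct_simps[OF b1] biproduct_simps[OF b2] biproduct_simps[OF b3] Ob)

text \<open>A relation rather than an isomorphism with \<open>dsum_list Ms\<close>: the successive
  complements stay in \<open>fmod R\<close>, so inductions on the list meet only biproducts. The two
  forms are linked by \<open>decomp_iso_pair_dsum_list\<close> and
  \<open>iso_pair_dsum_list_decomp\<close>.\<close>

fun decomp :: "('a, 'a list) module \<Rightarrow> ('a, 'a list) module list \<Rightarrow> bool" where
  "decomp X [] \<longleftrightarrow> zero_module X"
| "decomp X (M # Ms) \<longleftrightarrow> (\<exists>Y \<in> Ob. (\<exists>i j p q. biproduct M Y X i j p q) \<and> decomp Y Ms)"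

definition indecs :: "('a, 'a list) module set" where
  "indecs = {M \<in> Ob. indecomposable R M}"

lemma indecsD: "M \<in> indecs \<Longrightarrow> M \<in> Ob" "M \<in> indecs \<Longrightarrow> indecomposable R M" "M \<in> indecs \<Longrightarrow> \<not> zero_module
    M"
  by (auto simp: indecs_def indecomposable_def)

lemma decomp_ConsI: "\<lbrakk>Y \<in> Ob; biproduct M Y X i j p q; decomp Y Ms\<rbrakk> \<Longrightarrow> decomp X (M # Ms)"
  unfolding decomp.simps by blast

lemma decomp_ConsE:
  assumes "decomp X (M # Ms)"
  obtains Y i j p q where "Y \<in> Ob" "biproduct M Y X i j p q" "decomp Y Ms"
  using assms unfolding decomp.simps by blast

lemma indecs_Ob: "S \<subseteq> indecs \<Longrightarrow> S \<subseteq> Ob"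
  using indecsD(1) by blast

lemma zero_module_iso: "\<lbrakk>iso_pair X Y f g; zero_module X; LMod X; LMod Y\<rbrakk> \<Longrightarrow> zero_module Y"
proof (rule zero_moduleI)
  fix y assume a: "iso_pair X Y f g" "zero_module X" "LMod X" "LMod Y" "y \<in> carrier Y"
  note [simp] = hom_simps[OF iso_pairD(1)[OF a(1)]] hom_simps[OF iso_pairD(2)[OF a(1)]]
  have "g y = \<zero>\<^bsub>X\<^esub>" using zero_moduleD[OF a(2)] a by simp
  then have "f (g y) = f \<zero>\<^bsub>X\<^esub>" by simp
  then show "y = \<zero>\<^bsub>Y\<^esub>" using iso_pairD(4)[OF a(1)] a by simp
qed

lemma zero_module_summand:
  assumes "biproduct A B X i j p q" "zero_module X" "LMod A" "LMod X"
  shows "zero_module A"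
proof (rule zero_moduleI)
  fix a assume a: "a \<in> carrier A"
  have "i a = \<zero>\<^bsub>X\<^esub>" using zero_moduleD[OF assms(2)] biproduct_simps(6)[OF assms(1) a] .
  then have "p (i a) = p \<zero>\<^bsub>X\<^esub>" by simp
  then show "a = \<zero>\<^bsub>A\<^esub>" using biproduct_simps(1,20)[OF assms(1)] a assms(3,4) by simp
qed fact

lemma decomp_iso: "\<lbrakk>decomp X Ms; iso_pair X Y f g; X \<in> Ob; Y \<in> Ob\<rbrakk> \<Longrightarrow> decomp Y Ms"
proof (cases Ms)
  case Nil
  assume "decomp X Ms" "iso_pair X Y f g" "X \<in> Ob" "Y \<in> Ob"
  then show ?thesis using zero_module_iso[of X Y f g] Nil by simp
next
  case (Cons M Ns)
  assume a: "decomp X Ms" "iso_pair X Y f g"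
  then obtain Z i j p q where "Z \<in> Ob" "biproduct M Z X i j p q" "decomp Z Ns" using Cons by auto
  then show ?thesis unfolding Cons using biproduct_iso[OF _ a(2)] by (metis decomp.simps(2))
qed

lemma decomp_append:
  "\<lbrakk>decomp A Ms; decomp B Ns; biproduct A B X i j p q; A \<in> Ob; B \<in> Ob; X \<in> Ob; set Ms \<subseteq> Ob\<rbrakk> \<Longrightarrow>
      decomp X (Ms @ Ns)"
proof (induction Ms arbitrary: A X i j p q)
  case Nil
  then have "iso_pair B X j q" by (intro biproduct_zero_left[OF Nil(3)]) auto
  then show ?case using decomp_iso Nil by auto
next
  case (Cons M Ms)
  obtain Y i1 j1 p1 q1 where Y: "Y \<in> Ob" "biproduct M Y A i1 j1 p1 q1" "decomp Y Ms"
    using decomp_ConsE[OF Cons.prems(1)] .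
  obtain W i3 j3 p3 q3 where W: "W \<in> Ob" "biproduct Y B W i3 j3 p3 q3" using biproduct_ex[OF Y(1)
      Cons.prems(5)] by blast
  have "decomp W (Ms @ Ns)" using Cons.IH[OF Y(3) Cons.prems(2) W(2) Y(1)] Cons.prems W(1) by simp
  moreover have "M \<in> Ob" using Cons.prems(7) by simp
  note biproduct_assoc[OF Y(2) Cons.prems(3) W(2) this Y(1) Cons.prems(6,4,5) W(1)]
  ultimately show ?case using W(1) by (simp only: append_Cons) (rule decomp_ConsI)
qed

text \<open>The identity of \<open>M\<close> is the sum of its parts through the first term
  \<open>N\<close> and through the rest \<open>W\<close>; by locality one part is an automorphism,
  and the exchange step applies to it. Multisets are used because the term matched with
  \<open>M\<close> may stand anywhere in the list.\<close>

lemma decomp_exchange: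
  "\<lbrakk>decomp X Ns; set Ns \<subseteq> indecs; M \<in> indecs; biproduct M Y X i1 j1 p1 q1; X \<in> Ob; Y \<in> Ob\<rbrakk> \<Longrightarrow>
    \<exists>N Ns'. mset Ns = add_mset N (mset Ns') \<and> (\<exists>f g. iso_pair M N f g) \<and> decomp Y Ns'"
proof (induction Ns arbitrary: X Y i1 j1 p1 q1)
  case Nil
  note b = Nil(4)
  have "zero_module M" using zero_module_summand[OF b] indecsD(1)[OF Nil(3)] Nil by simp
  then show ?case using indecsD(3)[OF Nil(3)] by blast
next
  case (Cons N Ns)
  obtain W i j p q where W: "W \<in> Ob" "biproduct N W X i j p q" "decomp W Ns" using decomp_ConsE[OF
      Cons.prems(1)] .
  note b1 = Cons.prems(4) and b2 = W(2)
  have M: "M \<in> Ob" "indecomposable R M" "N \<in> Ob" "indecomposable R N" using indecsD Cons.prems by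
      auto
  note Ob = M(1) Cons.prems(6,5) M(3) W(1)
  note h = biproductD(1-4)[OF b1] biproductD(1-4)[OF b2]
  have a: "(\<lambda>m. p1 (i (p (i1 m)))) \<in> Hom M M" "(\<lambda>m. p1 (j (q (i1 m)))) \<in> Hom M M"
    by (rule hom_comp[OF hom_comp[OF hom_comp[OF h(1) h(7)] h(5)] h(3)],
        rule hom_comp[OF hom_comp[OF hom_comp[OF h(1) h(8)] h(6)] h(3)])
  have "p1 (i (p (i1 m))) \<oplus>\<^bsub>M\<^esub> p1 (j (q (i1 m))) = m" if "m \<in> carrier M" for m
  proof -
    have [simp]: "i1 m \<in> carrier X" using biproduct_simps(6)[OF b1 that] .
    have "p1 (i (p (i1 m)) \<oplus>\<^bsub>X\<^esub> j (q (i1 m))) = m" using that biproduct_simps(1)[OF b1]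
        biproduct_simps(5)[OF b2] by simp
    moreover have "i (p (i1 m)) \<in> carrier X" "j (q (i1 m)) \<in> carrier X"
      by (simp_all add: biproduct_simps[OF b2])
    ultimately show ?thesis using biproduct_simps(17)[OF b1] by metis
  qed
  from indecomposable_local[OF M(1,2) a this]
  consider \<theta> where "iso_pair M M (\<lambda>m. p1 (i (p (i1 m)))) \<theta>" | \<theta> where "iso_pair M M (\<lambda>m. p1 (j (q
      (i1 m)))) \<theta>" by blast
  then show ?case
  proof cases
    case 1
    obtain A' i' j' p' q' i'' j'' p'' q'' where A': "A' \<in> Ob" "biproduct M A' N i' j' p' q'"
        "biproduct A' W Y i'' j'' p'' q''"
      using biproduct_exchange[OF b1 b2 Ob 1] by blast
    \<comment> \<open>\<open>M\<close> is nonzero and \<open>N\<close> is indecomposable, so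
      \<open>M\<close> fills \<open>N\<close>, and \<open>Y\<close> is isomorphic to
      \<open>W\<close>.\<close>
    have z: "zero_module A'" using A' M indecsD(3)[OF Cons.prems(3)] indecomposable_iff[OF M(3)]
        by blast
    have "iso_pair M N i' p'"
      using biproduct_zero_left[OF biproduct_swap[OF A'(2)] z] A' M by simp
    moreover have "iso_pair W Y j'' q''" using biproduct_zero_left[OF A'(3) z] A' W Cons.prems by
        simp
    then have "decomp Y Ns" using decomp_iso[OF W(3)] W(1) Cons.prems(6) by blast
    moreover have "mset (N # Ns) = add_mset N (mset Ns)" by simp
    ultimately show ?thesis using \<open>iso_pair M N i' p'\<close> by blast
  next
    case 2
    \<comment> \<open>Here \<open>M\<close> splits off \<open>W\<close>: the term matched with it is
      found inside \<open>W\<close> by induction, and \<open>N\<close> stays in the decomposition of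
      \<open>Y\<close>.\<close>
    have b2': "biproduct W N X j i q p" using biproduct_swap[OF b2] Cons.prems(5) by simp
    obtain A' i' j' p' q' i'' j'' p'' q'' where A': "A' \<in> Ob" "biproduct M A' W i' j' p' q'"
        "biproduct A' N Y i'' j'' p'' q''"
      using biproduct_exchange[OF b1 b2' Ob(1-3) Ob(5,4) 2] by blast
    obtain N' Ns' where N': "mset Ns = add_mset N' (mset Ns')" "\<exists>f g. iso_pair M N' f g" "decomp
        A' Ns'"
      using Cons.IH[OF W(3) _ Cons.prems(3) A'(2) W(1) A'(1)] Cons.prems(2) by auto
    have "biproduct N A' Y j'' i'' q'' p''" using biproduct_swap[OF A'(3)] Cons.prems by simp
    then have "decomp Y (N # Ns')" using A' N' by (intro decomp_ConsI)
    moreover have "mset (N # Ns) = add_mset N' (mset (N # Ns'))" using N'(1) by simp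
    ultimately show ?thesis using N'(2) by blast
  qed
qed

lemma iso_class_eq_iff:
  assumes "A \<in> Ob" "B \<in> Ob"
  shows "iso_class R A = iso_class R B \<longleftrightarrow> (\<exists>f g. iso_pair A B f g)"
proof
  assume "iso_class R A = iso_class R B"
  moreover have "module_iso R B B" using module_iso_iff[of B B] iso_pair_refl[of B] assms by auto
  then have "B \<in> iso_class R B" unfolding iso_class_def using assms by simp
  ultimately show "\<exists>f g. iso_pair A B f g" unfolding iso_class_def using module_iso_iff[of A B]
      assms by auto
next
  assume "\<exists>f g. iso_pair A B f g"
  then obtain f g where fg: "iso_pair A B f g" by blast
  have "module_iso R A Z \<longleftrightarrow> module_iso R B Z" if "Z \<in> Ob" for Z :: "('a, 'a list) module"
    using module_iso_iff[of A Z] module_iso_iff[of B Z] assms iso_pair_trans[OF fg]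
        iso_pair_trans[OF iso_pair_sym[OF fg]]
    by (metis Ob_Mod)
  then show "iso_class R A = iso_class R B" unfolding iso_class_def by auto
qed

text \<open>Splitting off the first term of one list removes an isomorphic term from the
  other.\<close>

theorem Krull_Schmidt:
  "\<lbrakk>decomp X Ms; decomp X Ns; set Ms \<subseteq> indecs; set Ns \<subseteq> indecs; X \<in> Ob\<rbrakk> \<Longrightarrow>
    image_mset (iso_class R) (mset Ms) = image_mset (iso_class R) (mset Ns)"
proof (induction Ms arbitrary: X Ns)
  case Nil
  then show ?case
  proof (cases Ns)
    case (Cons N Ns')
    then obtain Y i j p q where "Y \<in> Ob" "biproduct N Y X i j p q" using Nil by auto
    moreover have "N \<in> Ob" "\<not> zero_module N" using Nil(4) Cons indecsD by auto
    ultimately show ?thesis using zero_module_summand Nil by (metis decomp.simps(1) Ob_Mod)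
  qed simp
next
  case (Cons M Ms)
  obtain Y i j p q where Y: "Y \<in> Ob" "biproduct M Y X i j p q" "decomp Y Ms"
    using decomp_ConsE[OF Cons.prems(1)] .
  then obtain N Ns' where N: "mset Ns = add_mset N (mset Ns')" "\<exists>f g. iso_pair M N f g" "decomp Y
      Ns'"
    using decomp_exchange[OF Cons.prems(2,4) _ Y(2) Cons.prems(5) Y(1)] Cons.prems(3) by (metis
        list.set_intros(1) subsetD)
  have sub: "insert N (set Ns') = set Ns" using N(1) by (metis set_mset_add_mset_insert
      set_mset_mset)
  then have "image_mset (iso_class R) (mset Ms) = image_mset (iso_class R) (mset Ns')"
    using Cons.prems(3,4) Y N by (intro Cons.IH[of Y]) auto
  moreover have "iso_class R M = iso_class R N" using N(2) iso_class_eq_iff[of M N]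
      Cons.prems(3,4) sub indecsD(1) by auto
  ultimately show ?case using N(1) by simp
qed

lemma decomp_self: "X \<in> Ob \<Longrightarrow> decomp X [X]"
proof -
  assume X: "X \<in> Ob"
  obtain Y j q where Y: "Y \<in> Ob" "biproduct X Y X (\<lambda>x. x) j (\<lambda>x. x) q"
    using retract_biproduct[OF X X hom_id hom_id] by blast
  have "y = \<zero>\<^bsub>Y\<^esub>" if "y \<in> carrier Y" for y
    using biproduct_simps(3,4)[OF Y(2) that] biproduct_simps(25)[OF Y(2)] X Y(1) by simp
  then have "zero_module Y" using zero_moduleI[of Y] Y by simp
  then show ?thesis using Y by (intro decomp_ConsI) simp_all
qed

text \<open>A minimal submodule without a decomposition is neither zero nor indecomposable, so it
  splits into two proper parts, and these decompose by minimality.\<close>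

lemma decomp_exists:
  assumes "X \<in> Ob" shows "\<exists>Ms. set Ms \<subseteq> indecs \<and> decomp X Ms"
proof (rule ccontr)
  assume no: "\<not> ?thesis"
  define T where "T = {N. submodule N R X \<and> \<not> (\<exists>Ms. set Ms \<subseteq> indecs \<and> decomp (X\<lparr>carrier := N\<rparr>) Ms)}"
  have "submodule (carrier X) R X" using assms by (intro left_module.submoduleI) simp_all
  then have "carrier X \<in> T" using no unfolding T_def by simp
  then have "\<exists>N \<in> T. \<forall>N' \<in> T. N' \<subseteq> N \<longrightarrow> N' = N"
    using chain_cond_Ob[OF assms] by (intro chain_cond_minimal) (auto simp: T_def)
  then obtain N where N: "N \<in> T" "\<forall>N' \<in> T. N' \<subseteq> N \<longrightarrow> N' = N" by (elim bexE)
  define Z where "Z = X\<lparr>carrier := N\<rparr>"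
  have sub: "submodule N R X" using N(1) by (simp add: T_def)
  have Z: "Z \<in> Ob" unfolding Z_def by (rule sub_Ob[OF assms sub])
  have noZ: "\<not> (\<exists>Ms. set Ms \<subseteq> indecs \<and> decomp Z Ms)" using N(1) by (simp add: T_def Z_def)
  have "\<not> zero_module Z" using noZ by (metis decomp.simps(1) empty_set empty_subsetI)
  moreover have "\<not> indecomposable R Z"
  proof
    assume ind: "indecomposable R Z"
    have "decomp Z [Z]" by (rule decomp_self[OF Z])
    moreover have "set [Z] \<subseteq> indecs" using Z ind by (simp add: indecs_def)
    ultimately show False using noZ by blast
  qed
  ultimately obtain A B i j p q where AB: "A \<in> Ob" "B \<in> Ob" "biproduct A B Z i j p q" "\<not>
      zero_module A" "\<not> zero_module B"
    using indecomposable_iff[OF Z] by blast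
  have part: "\<exists>Ms. set Ms \<subseteq> indecs \<and> decomp A Ms"
    if AB: "A \<in> Ob" "B \<in> Ob" "biproduct A B Z i j p q" "\<not> zero_module B" for A B :: "('a, 'a list)
        module" and i j p q
  proof -
    note [simp] = biproduct_simps[OF AB(3)] AB(1,2) Z
    have sub': "submodule (i ` carrier A) R Z" using image_submodule[OF _ _ biproductD(1)[OF
        AB(3)]] by simp
    have Zs: "carrier Z = N" "\<zero>\<^bsub>Z\<^esub> = \<zero>\<^bsub>X\<^esub>" "ring.add Z = ring.add X" "smult Z = smult X"
      by (simp_all add: Z_def)
    note s1 = left_module.submoduleD(1-4)[OF Ob_Mod[OF Z] sub', unfolded Zs]
    have "submodule (i ` carrier A) R X"
    proof (rule left_module.submoduleI[OF Ob_Mod[OF assms]])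
      show "i ` carrier A \<subseteq> carrier X" using s1(1) left_module.submoduleD(1)[OF Ob_Mod[OF assms]
          sub] by (rule subset_trans)
    qed (fact s1)+
    moreover note s1(1)
    moreover have "i ` carrier A \<noteq> N"
    proof
      assume eq: "i ` carrier A = N"
      have "y = \<zero>\<^bsub>B\<^esub>" if y: "y \<in> carrier B" for y
      proof -
        have "j y \<in> i ` carrier A" using eq biproduct_simps(11)[OF AB(3) y] by (simp add: Z_def)
        then obtain a where "a \<in> carrier A" "j y = i a" by blast
        then show ?thesis using biproduct_simps(2)[OF AB(3)] biproduct_simps(4)[OF AB(3)] y by metis
      qed
      then show False using AB(4) zero_moduleI[of B] by simp
    qed
    ultimately have "i ` carrier A \<notin> T" using N(2) by blast
    then obtain Ms where Ms: "set Ms \<subseteq> indecs" "decomp (X\<lparr>carrier := i ` carrier A\<rparr>) Ms"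
      using \<open>submodule (i ` carrier A) R X\<close> unfolding T_def by blast
    have "iso_pair A (X\<lparr>carrier := i ` carrier A\<rparr>) i p"
    proof (rule hom_inverse)
      show "i \<in> Hom A (X\<lparr>carrier := i ` carrier A\<rparr>)"
        using hom_simps(2,3)[OF biproductD(1)[OF AB(3)]] by (intro module_homI) (simp_all add: Zs)
      show "p y \<in> carrier A" if "y \<in> carrier (X\<lparr>carrier := i ` carrier A\<rparr>)" for y
        using that by auto
      show "i (p y) = y" if "y \<in> carrier (X\<lparr>carrier := i ` carrier A\<rparr>)" for y
        using that by auto
    qed simp_all
    then show ?thesis using decomp_iso[OF Ms(2) iso_pair_sym] sub_Ob[OF assms \<open>submodule (i `
        carrier A) R X\<close>] AB(1) Ms(1) by blast
  qed
  obtain Ms where "set Ms \<subseteq> indecs" "decomp A Ms" using part[OF AB(1-3,5)] by blast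
  moreover obtain Ns where "set Ns \<subseteq> indecs" "decomp B Ns" using part[OF AB(2,1) biproduct_swap[OF
      AB(3)] AB(4)] Z by auto
  ultimately have "decomp Z (Ms @ Ns)" "set (Ms @ Ns) \<subseteq> indecs"
    using decomp_append[OF _ _ AB(3,1,2) Z] indecs_Ob by simp_all
  then show False using noZ by blast
qed

section \<open>Decompositions and external direct sums of lists\<close>

lemma dsum_list_simps:
  "carrier (dsum_list []) = {[]}"
  "carrier (dsum_list (M # Ms)) = {x # xs | x xs. x \<in> carrier M \<and> xs \<in> carrier (dsum_list Ms)}"
  "\<zero>\<^bsub>dsum_list (M # Ms)\<^esub> = \<zero>\<^bsub>M\<^esub> # \<zero>\<^bsub>dsum_list Ms\<^esub>"
  "\<zero>\<^bsub>dsum_list []\<^esub> = []" "us \<oplus>\<^bsub>dsum_list []\<^esub> vs = []" "r \<odot>\<^bsub>dsum_list []\<^esub> us = []"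
  "(x # xs) \<oplus>\<^bsub>dsum_list (M # Ms)\<^esub> (y # ys) = (x \<oplus>\<^bsub>M\<^esub> y) # (xs \<oplus>\<^bsub>dsum_list Ms\<^esub> ys)"
  "r \<odot>\<^bsub>dsum_list (M # Ms)\<^esub> (x # xs) = (r \<odot>\<^bsub>M\<^esub> x) # (r \<odot>\<^bsub>dsum_list Ms\<^esub> xs)"
proof -
  show "carrier (dsum_list (M # Ms)) = {x # xs | x xs. x \<in> carrier M \<and> xs \<in> carrier (dsum_list Ms)}"
  proof (intro equalityI subsetI)
    fix l assume l: "l \<in> carrier (dsum_list (M # Ms))"
    then obtain x xs where "l = x # xs" by (cases l) (auto simp: dsum_list_def)
    then show "l \<in> {x # xs | x xs. x \<in> carrier M \<and> xs \<in> carrier (dsum_list Ms)}"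
      using l by (fastforce simp: dsum_list_def)
  next
    fix l assume "l \<in> {x # xs | x xs. x \<in> carrier M \<and> xs \<in> carrier (dsum_list Ms)}"
    then show "l \<in> carrier (dsum_list (M # Ms))" by (auto simp: dsum_list_def nth_Cons split:
        nat.split)
  qed
qed (auto simp: dsum_list_def map_upt_Suc simp del: upt_Suc)

lemma dsum_list_Mod: "(\<And>M. M \<in> set Ms \<Longrightarrow> LMod M) \<Longrightarrow> LMod (dsum_list Ms)"
proof (induction Ms)
  case Nil
  have "abelian_group (dsum_list [])" by (rule abelian_groupI) (auto simp: dsum_list_simps)
  then show ?case
    by (intro left_module.intro left_module_axioms.intro) (auto simp: dsum_list_simps ring_axioms)
next
  case (Cons M Ms)
  then interpret M: left_module R M by simp
  interpret D: left_module R "dsum_list Ms" using Cons by simp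
  have "abelian_group (dsum_list (M # Ms))"
  proof (rule abelian_groupI)
    fix l assume "l \<in> carrier (dsum_list (M # Ms))"
    then obtain x xs where "l = x # xs" "x \<in> carrier M" "xs \<in> carrier (dsum_list Ms)" by (auto
        simp: dsum_list_simps)
    then show "\<exists>y\<in>carrier (dsum_list (M # Ms)). y \<oplus>\<^bsub>dsum_list (M # Ms)\<^esub> l = \<zero>\<^bsub>dsum_list (M # Ms)\<^esub>"
      by (intro bexI[of _ "(\<ominus>\<^bsub>M\<^esub> x) # (\<ominus>\<^bsub>dsum_list Ms\<^esub> xs)"]) (auto simp: dsum_list_simps M.l_neg
          D.l_neg)
  qed (auto simp: dsum_list_simps M.a_ac D.a_ac)
  then show ?case
    by (intro left_module.intro left_module_axioms.intro) (auto simp: dsum_list_simps ring_axioms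
        M.smult_l_distr D.smult_l_distr M.smult_r_distr D.smult_r_distr M.smult_assoc1
            D.smult_assoc1)
qed

lemma dsum_list_biproduct:
  assumes "LMod M" "\<And>M. M \<in> set Ms \<Longrightarrow> LMod M"
  shows "biproduct M (dsum_list Ms) (dsum_list (M # Ms)) (\<lambda>x. x # \<zero>\<^bsub>dsum_list Ms\<^esub>) (\<lambda>xs. \<zero>\<^bsub>M\<^esub> #
      xs) hd tl"
proof -
  note [simp] = assms(1) dsum_list_Mod[OF assms(2)]
  show ?thesis unfolding biproduct_def by (intro conjI module_homI) (auto simp: dsum_list_simps)
qed

lemma dsum_list_fin_gen:
  "set Ms \<subseteq> Ob \<Longrightarrow> fin_gen R (dsum_list Ms)"
proof (induction Ms)
  case Nil
  show ?case unfolding fin_gen_def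
  proof (intro exI[of _ "{}"] conjI allI impI)
    fix N assume "submodule N R (dsum_list []) \<and> {} \<subseteq> N"
    then show "N = carrier (dsum_list [])"
      using left_module.submoduleD(1,2)[OF dsum_list_Mod[of "[]"]] by (fastforce simp:
          dsum_list_simps)
  qed simp_all
next
  case (Cons M Ms)
  have m: "LMod M" "\<And>M. M \<in> set Ms \<Longrightarrow> LMod M" using Cons.prems by auto
  show ?case
    using fin_gen_biproduct[OF dsum_list_biproduct[OF m]] m dsum_list_Mod[of Ms] dsum_list_Mod[of
        "M # Ms"] Cons
    by (auto simp: Ob_iff)
qed

lemma decomp_iso_pair_dsum_list:
  "\<lbrakk>decomp X Ms; X \<in> Ob; set Ms \<subseteq> Ob\<rbrakk> \<Longrightarrow> \<exists>f g. iso_pair X (dsum_list Ms) f g"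
proof (induction Ms arbitrary: X)
  case Nil
  have "iso_pair X (dsum_list []) (\<lambda>_. []) (\<lambda>_. \<zero>\<^bsub>X\<^esub>)"
    using zero_moduleD[of X] Nil
    by (intro hom_inverse module_homI) (auto simp: dsum_list_simps)
  then show ?case by blast
next
  case (Cons M Ms)
  have m: "LMod M" "\<And>M. M \<in> set Ms \<Longrightarrow> LMod M" using Cons.prems by auto
  obtain Y i j p q where Y: "Y \<in> Ob" "biproduct M Y X i j p q" "decomp Y Ms"
    using decomp_ConsE[OF Cons.prems(1)] .
  obtain f g where "iso_pair Y (dsum_list Ms) f g" using Cons.IH[OF Y(3,1)] Cons.prems by auto
  from biproduct_iso_right[OF Y(2) this] have "biproduct M (dsum_list Ms) X i (\<lambda>b. j (g b)) p (\<lambda>y.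
      f (q y))"
    using Y(1) dsum_list_Mod[of Ms] m by simp
  from biproduct_unique[OF this dsum_list_biproduct[OF m]] show ?case
    using m dsum_list_Mod[of Ms] dsum_list_Mod[of "M # Ms"] Cons.prems(2) by auto
qed

lemma iso_pair_dsum_list_decomp:
  "\<lbrakk>iso_pair X (dsum_list Ms) f g; X \<in> Ob; set Ms \<subseteq> Ob\<rbrakk> \<Longrightarrow> decomp X Ms"
proof (induction Ms arbitrary: X f g)
  case Nil
  have "zero_module (dsum_list [])" by (simp add: zero_module_def dsum_list_simps)
  then show ?case using zero_module_iso[OF iso_pair_sym[OF Nil(1)]] Nil(2) dsum_list_Mod[of "[]"]
      by simp
next
  case (Cons M Ms)
  have m: "LMod M" "\<And>M. M \<in> set Ms \<Longrightarrow> LMod M" using Cons.prems by auto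
  note b = biproduct_iso[OF dsum_list_biproduct[OF m] iso_pair_sym[OF Cons.prems(1)]]
  obtain Y where Y: "Y \<in> Ob" "module_iso R (dsum_list Ms) Y"
    using ex_iso_fmod[OF dsum_list_Mod[OF m(2)] dsum_list_fin_gen] Cons.prems(3) by auto
  then obtain f' g' where fg: "iso_pair (dsum_list Ms) Y f' g'"
    using module_iso_iff[OF dsum_list_Mod[OF m(2)]] by blast
  have "decomp Y Ms" using Cons.IH[OF iso_pair_sym[OF fg]] Y Cons.prems by simp
  moreover have "\<exists>i j p q. biproduct M Y X i j p q"
    using biproduct_iso_right[OF b fg dsum_list_Mod[OF m(2)] Ob_Mod[OF Y(1)]] by blast
  ultimately show ?case using Y(1) unfolding decomp.simps by blast
qed

section \<open>Classes in the free abelian group on non-projective indecomposables\<close>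

definition nonproj_class :: "('a, 'a list) module list \<Rightarrow> ('a, 'a list) module set \<Rightarrow>\<^sub>0 int" where
  "nonproj_class Ms = (\<Sum>M \<leftarrow> filter (\<lambda>M. \<not> projective R M) Ms. frag_of (iso_class R M))"

lemma projectiveD:
  assumes "projective R P" "A \<in> Ob" "B \<in> Ob" "g \<in> Hom A B" "h \<in> Hom P B" "g ` carrier A = carrier B"
  shows "\<exists>k \<in> Hom P A. \<forall>x \<in> carrier P. g (k x) = h x"
  by (rule assms(1)[unfolded projective_def, rule_format, OF assms(2-6)])

lemma projective_retract:
  assumes "projective R P" "i \<in> Hom Z P" "p \<in> Hom P Z" "\<And>z. z \<in> carrier Z \<Longrightarrow> p (i z) = z"
  shows "projective R Z"
  unfolding projective_def
proof (intro ballI impI)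
  fix A B :: "('a, 'a list) module" and g h
  assume a: "A \<in> Ob" "B \<in> Ob" "g \<in> Hom A B" "h \<in> Hom Z B" "g ` carrier A = carrier B"
  have "(\<lambda>x. h (p x)) \<in> Hom P B" using hom_comp[OF assms(3) a(4)] .
  then obtain k where k: "k \<in> Hom P A" "\<forall>x \<in> carrier P. g (k x) = h (p x)"
    using projectiveD[OF assms(1) a(1-3) _ a(5)] by blast
  then show "\<exists>k\<in>Hom Z A. \<forall>x\<in>carrier Z. g (k x) = h x"
    using hom_comp[OF assms(2) k(1)] hom_simps(1)[OF assms(2)] assms(4)
    by (intro bexI[of _ "\<lambda>x. k (i x)"]) auto
qed

lemma projective_iso: "\<lbrakk>iso_pair A B f g; projective R A\<rbrakk> \<Longrightarrow> projective R B"
  by (rule projective_retract[of A g B f]) (simp_all add: iso_pairD)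

text \<open>Projectivity is invariant under isomorphism, so the contribution of a term is a function
  \<open>w\<close> of its isomorphism class.\<close>

lemma nonproj_class_cong:
  assumes "image_mset (iso_class R) (mset Ms) = image_mset (iso_class R) (mset Ns)" "set Ms \<subseteq> Ob"
      "set Ns \<subseteq> Ob"
  shows "nonproj_class Ms = nonproj_class Ns"
proof -
  define w where "w c = (if projective R (SOME Z. Z \<in> Ob \<and> iso_class R Z = c) then 0 else frag_of
      c)" for c
  have w: "w (iso_class R M) = (if projective R M then 0 else frag_of (iso_class R M))" if "M \<in>
      Ob" for M
  proof -
    define Z where "Z = (SOME Z. Z \<in> Ob \<and> iso_class R Z = iso_class R M)"
    have "Z \<in> Ob \<and> iso_class R Z = iso_class R M" unfolding Z_def by (rule someI[of _ M]) (use
        that in simp)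
    then have "projective R Z \<longleftrightarrow> projective R M"
      using iso_class_eq_iff[of Z M] that projective_iso iso_pair_sym by metis
    then show ?thesis unfolding w_def Z_def[symmetric] by simp
  qed
  have "nonproj_class Ls = sum_mset (image_mset w (image_mset (iso_class R) (mset Ls)))" if "set
      Ls \<subseteq> Ob" for Ls
    using that by (induction Ls) (auto simp: nonproj_class_def w)
  then show ?thesis using assms by metis
qed

text \<open>Krull-Schmidt makes the choice inside \<open>ind_decomposition\<close> harmless;
  additivity of the class on biproducts follows from this.\<close>

lemma IT_class_eq:
  assumes "X \<in> Ob" "decomp X Ms" "set Ms \<subseteq> indecs"
  shows "IT_class R X = nonproj_class Ms"
proof -
  define P where "P Ns \<longleftrightarrow> set Ns \<subseteq> Ob \<and> (\<forall>M \<in> set Ns. indecomposable R M) \<and> module_iso R X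
      (dsum_list Ns)" for Ns
  have "module_iso R X (dsum_list Ms)"
    using decomp_iso_pair_dsum_list[OF assms(2,1) indecs_Ob[OF assms(3)]] module_iso_iff[OF
        Ob_Mod[OF assms(1)]] by blast
  then have "P Ms" unfolding P_def using assms(3) indecs_Ob indecsD(2) by blast
  then have "P (ind_decomposition R X)" unfolding ind_decomposition_def P_def by (rule someI)
  then have *: "set (ind_decomposition R X) \<subseteq> Ob" "set (ind_decomposition R X) \<subseteq> indecs"
    "\<exists>f g. iso_pair X (dsum_list (ind_decomposition R X)) f g"
    unfolding P_def module_iso_iff[OF Ob_Mod[OF assms(1)]] by (auto simp: indecs_def)
  then have "decomp X (ind_decomposition R X)" using iso_pair_dsum_list_decomp[OF _ assms(1)] by
      blast
  then have "nonproj_class (ind_decomposition R X) = nonproj_class Ms"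
    using Krull_Schmidt[OF _ assms(2) *(2) assms(3,1)] * indecs_Ob[OF assms(3)] by (intro
        nonproj_class_cong) simp_all
  then show ?thesis by (simp add: IT_class_def nonproj_class_def)
qed

lemma nonproj_class_simps [simp]: "nonproj_class [] = 0" "nonproj_class (Ms @ Ns) = nonproj_class
    Ms + nonproj_class Ns"
  "nonproj_class (M # Ms) = (if projective R M then 0 else frag_of (iso_class R M)) +
      nonproj_class Ms"
  by (simp_all add: nonproj_class_def)

lemma IT_class_biproduct:
  assumes "biproduct A B X i j p q" "A \<in> Ob" "B \<in> Ob" "X \<in> Ob"
  shows "IT_class R X = IT_class R A + IT_class R B"
proof -
  obtain Ms Ns where *: "set Ms \<subseteq> indecs" "decomp A Ms" "set Ns \<subseteq> indecs" "decomp B Ns" using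
      decomp_exists assms by metis
  have "decomp X (Ms @ Ns)" using decomp_append[OF *(2,4) assms] *(1) indecsD(1) by blast
  then show ?thesis using IT_class_eq * assms by simp
qed

lemma IT_class_indecs:
  "M \<in> indecs \<Longrightarrow> IT_class R M = (if projective R M then 0 else frag_of (iso_class R M))"
  using IT_class_eq[of M "[M]"] decomp_self[of M] indecsD by simp

lemma decomp_retracts:
  "\<lbrakk>decomp X Ms; M \<in> set Ms; set Ms \<subseteq> Ob; X \<in> Ob\<rbrakk> \<Longrightarrow> summand M X"
proof (induction Ms arbitrary: X)
  case (Cons N Ms)
  obtain Y i j p q where Y: "Y \<in> Ob" "biproduct N Y X i j p q" "decomp Y Ms"
    using decomp_ConsE[OF Cons.prems(1)] .
  show ?case
  proof (cases "M = N")
    case True then show ?thesis using Y unfolding summand_def by blast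
  next
    case False
    then have "summand M Y" using Cons Y by auto
    moreover have "summand Y X" using biproduct_swap[OF Y(2)] Cons.prems(3,4) unfolding
        summand_def by (meson Ob_Mod list.set_intros(1) subsetD)
    moreover have "M \<in> Ob" using Cons.prems by blast
    ultimately show ?thesis using summand_trans Cons.prems(4) Y(1) by blast
  qed
qed simp

lemma summand_projective: "\<lbrakk>summand Z P; projective R P\<rbrakk> \<Longrightarrow> projective R Z"
proof -
  assume a: "summand Z P" "projective R P"
  then obtain Y i j p q where "Y \<in> Ob" "biproduct Z Y P i j p q" unfolding summand_def by blast
  note b = biproductD[OF this(2)]
  show "projective R Z" by (rule projective_retract[OF a(2) b(1,3,5)])
qed

lemma nonproj_class_nonneg: "0 \<le> Poly_Mapping.lookup (nonproj_class Ms) c"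
  by (induction Ms) (auto simp: lookup_add)

text \<open>The coefficients are nonnegative, so nothing cancels and the support of a sum is the
  union of the supports.\<close>

lemma keys_nonproj_class: "Poly_Mapping.keys (nonproj_class Ms) = {iso_class R M | M. M \<in> set Ms \<and>
    \<not> projective R M}"
proof (induction Ms)
  case (Cons M Ms)
  have "Poly_Mapping.keys (f + g) = Poly_Mapping.keys f \<union> Poly_Mapping.keys g"
    if "\<And>c. 0 \<le> Poly_Mapping.lookup f c" "\<And>c. 0 \<le> Poly_Mapping.lookup g c" for f g :: "'z \<Rightarrow>\<^sub>0 int"
    using that by (auto simp: in_keys_iff lookup_add add_nonneg_eq_0_iff)
  from this[of "frag_of (iso_class R M)" "nonproj_class Ms"]
  have "Poly_Mapping.keys (frag_of (iso_class R M) + nonproj_class Ms) = insert (iso_class R M)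
      (Poly_Mapping.keys (nonproj_class Ms))"
    using nonproj_class_nonneg by (simp add: lookup_single when_def)
  then show ?case using Cons by auto
qed simp

lemma IT_class_nonneg: "X \<in> Ob \<Longrightarrow> 0 \<le> Poly_Mapping.lookup (IT_class R X) c"
  using decomp_exists[of X] IT_class_eq nonproj_class_nonneg by metis

text \<open>Thus the support of \<open>[X]\<close> indexes the generators of
  \<open>\<langle>X\<rangle>\<close>. A summand \<open>M\<close> has a positive coefficient because
  splitting it off leaves a class with nonnegative coefficients.\<close>

lemma keys_IT_class:
  assumes "X \<in> Ob"
  shows "Poly_Mapping.keys (IT_class R X) = {iso_class R M | M. M \<in> ind_nonproj R \<and> summand M X}"
      (is "_ = ?S")
proof
  obtain Ms where Ms: "set Ms \<subseteq> indecs" "decomp X Ms" using decomp_exists assms by blast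
  have eq: "IT_class R X = nonproj_class Ms" using IT_class_eq[OF assms Ms(2,1)] .
  have "summand M X" if "M \<in> set Ms" for M using decomp_retracts[OF Ms(2) that _ assms] Ms(1)
      indecsD by blast
  then show "Poly_Mapping.keys (IT_class R X) \<subseteq> ?S"
    unfolding eq keys_nonproj_class using Ms(1) by (auto simp: ind_nonproj_def indecs_def)
  show "?S \<subseteq> Poly_Mapping.keys (IT_class R X)"
  proof
    fix c assume "c \<in> ?S"
    then obtain M where M: "M \<in> indecs" "\<not> projective R M" "summand M X" "c = iso_class R M"
      by (auto simp: ind_nonproj_def indecs_def)
    then obtain Y i j p q where Y: "Y \<in> Ob" "biproduct M Y X i j p q" unfolding summand_def by blast
    have "IT_class R X = frag_of c + IT_class R Y"
      using IT_class_biproduct[OF Y(2) _ Y(1) assms] IT_class_indecs[OF M(1)] M indecsD by simp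
    then have "Poly_Mapping.lookup (IT_class R X) c > 0"
      using IT_class_nonneg[OF Y(1), of c] by (simp add: lookup_add)
    then show "c \<in> Poly_Mapping.keys (IT_class R X)" by (simp add: in_keys_iff)
  qed
qed

section \<open>Projective covers and presentations\<close>

lemma a_kernel_eq: "a_kernel B C g = {x \<in> carrier B. g x = \<zero>\<^bsub>C\<^esub>}"
  by (simp add: a_kernel_def kernel_def)

lemma hom_restrict: "\<lbrakk>f \<in> Hom A B; N \<subseteq> carrier A\<rbrakk> \<Longrightarrow> f \<in> Hom (A\<lparr>carrier := N\<rparr>) B"
  by (rule module_homI) (auto simp: hom_simps[of f A B] subset_iff)

lemma hom_corestrict:
  "\<lbrakk>f \<in> Hom A B; \<And>x. x \<in> carrier A \<Longrightarrow> f x \<in> N\<rbrakk> \<Longrightarrow> f \<in> Hom A (B\<lparr>carrier := N\<rparr>)"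
  by (rule module_homI) (auto simp: hom_simps[of f A B])

lemma hom_expand: "\<lbrakk>f \<in> Hom A (B\<lparr>carrier := N\<rparr>); N \<subseteq> carrier B\<rbrakk> \<Longrightarrow> f \<in> Hom A B"
  using hom_simps[of f A "B\<lparr>carrier := N\<rparr>"] by (intro module_homI) (auto simp: subset_iff)

lemma Ob_zero: "\<exists>Z \<in> Ob. zero_module Z"
proof -
  define Z :: "('a, 'a list) module" where "Z = \<lparr>carrier = {[]}, monoid.mult = (\<lambda>_ _. undefined),
      one = undefined,
      ring.zero = [], ring.add = (\<lambda>_ _. []), smult = (\<lambda>_ _. [])\<rparr>"
  have s: "carrier Z = {[]}" "\<zero>\<^bsub>Z\<^esub> = []" "x \<oplus>\<^bsub>Z\<^esub> y = []" "r \<odot>\<^bsub>Z\<^esub> x = []" for x y r by (simp_all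
      add: Z_def)
  have "abelian_group Z" by (rule abelian_groupI) (auto simp: s)
  then have "LMod Z"
    by (intro left_module.intro left_module_axioms.intro) (auto simp: s ring_axioms)
  moreover have "fin_gen R Z" unfolding fin_gen_def
  proof (intro exI[of _ "{}"] conjI allI impI)
    fix N assume "submodule N R Z \<and> {} \<subseteq> N"
    then show "N = carrier Z"
      using left_module.submoduleD(1,2)[OF \<open>LMod Z\<close>] by (fastforce simp: s)
  qed simp_all
  ultimately have "Z \<in> Ob" unfolding Ob_iff by blast
  moreover have "zero_module Z" by (simp add: zero_module_def s)
  ultimately show ?thesis by blast
qed

lemma projective_zero:
  assumes "zero_module Z" "LMod Z" shows "projective R Z"
  unfolding projective_def
proof (intro ballI impI)
  fix A B :: "('a, 'a list) module" and g h
  assume a: "A \<in> Ob" "B \<in> Ob" "g \<in> Hom A B" "h \<in> Hom Z B"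
  have "(\<lambda>_. \<zero>\<^bsub>A\<^esub>) \<in> Hom Z A" using a by (intro hom_zero) simp
  moreover have "g \<zero>\<^bsub>A\<^esub> = h x" if "x \<in> carrier Z" for x
    using zero_moduleD[OF assms(1) that] hom_simps(6)[OF a(3)] hom_simps(6)[OF a(4)] assms(2) a by
        simp
  ultimately show "\<exists>k\<in>Hom Z A. \<forall>x\<in>carrier Z. g (k x) = h x" by (intro bexI ballI)
qed

lemma projective_biproduct:
  assumes b: "biproduct P Q X i j p q" and P: "projective R P" "projective R Q"
  shows "projective R X"
  unfolding projective_def
proof (intro ballI impI)
  fix A B :: "('a, 'a list) module" and g h
  assume a: "A \<in> Ob" "B \<in> Ob" "g \<in> Hom A B" "h \<in> Hom X B" "g ` carrier A = carrier B"
  note bh = biproductD(1-4)[OF b]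
  obtain k where k: "k \<in> Hom P A" "\<forall>x \<in> carrier P. g (k x) = h (i x)"
    using projectiveD[OF P(1) a(1-3) hom_comp[OF bh(1) a(4)] a(5)] by blast
  obtain l where l: "l \<in> Hom Q A" "\<forall>x \<in> carrier Q. g (l x) = h (j x)"
    using projectiveD[OF P(2) a(1-3) hom_comp[OF bh(2) a(4)] a(5)] by blast
  note [simp] = biproduct_simps[OF b] hom_simps[OF k(1)] hom_simps[OF l(1)] hom_simps(1,2)[OF
      a(3)] k(2)[rule_format] l(2)[rule_format]
  have "(\<lambda>x. k (p x) \<oplus>\<^bsub>A\<^esub> l (q x)) \<in> Hom X A"
    using a by (intro hom_add hom_comp[OF bh(3) k(1)] hom_comp[OF bh(4) l(1)]) simp
  moreover have "g (k (p x) \<oplus>\<^bsub>A\<^esub> l (q x)) = h x" if "x \<in> carrier X" for x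
  proof -
    have "h (i (p x) \<oplus>\<^bsub>X\<^esub> j (q x)) = h (i (p x)) \<oplus>\<^bsub>B\<^esub> h (j (q x))"
      using that by (intro hom_simps(2)[OF a(4)]) simp_all
    then show ?thesis using that by simp
  qed
  ultimately show "\<exists>k\<in>Hom X A. \<forall>x\<in>carrier X. g (k x) = h x" by (intro bexI ballI)
qed

text \<open>\<open>P\<close> is a copy in \<open>fmod R\<close> of the ring as a left module over
  itself; the last clause says that every cyclic submodule is covered by a map from
  \<open>P\<close>.\<close>

lemma regular_module_ex:
  "\<exists>P \<in> Ob. projective R P \<and> (\<forall>X \<in> Ob. \<forall>x \<in> carrier X. \<exists>f \<in> Hom P X. \<forall>r \<in> carrier R. r \<odot>\<^bsub>X\<^esub> x \<in> f
      ` carrier P)"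
proof -
  define F :: "('a, 'a) module" where "F = \<lparr>carrier = carrier R, monoid.mult = (\<lambda>_ _. undefined),
      one = undefined,
      ring.zero = \<zero>, ring.add = ring.add R, smult = monoid.mult R\<rparr>"
  have s: "carrier F = carrier R" "\<zero>\<^bsub>F\<^esub> = \<zero>" "x \<oplus>\<^bsub>F\<^esub> y = x \<oplus> y" "r \<odot>\<^bsub>F\<^esub> x = r \<otimes> x" for x y r by
      (simp_all add: F_def)
  have "abelian_group F"
  proof (rule abelian_groupI)
    fix x assume "x \<in> carrier F"
    then show "\<exists>y\<in>carrier F. y \<oplus>\<^bsub>F\<^esub> x = \<zero>\<^bsub>F\<^esub>" by (intro bexI[of _ "\<ominus> x"]) (auto simp: s l_neg)
  qed (auto simp: s a_ac)
  then have F: "LMod F"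
    by (intro left_module.intro left_module_axioms.intro) (auto simp: s ring_axioms l_distr
        r_distr m_assoc)
  moreover have "fin_gen R F" unfolding fin_gen_def
  proof (intro exI[of _ "{\<one>}"] conjI allI impI)
    fix N assume N: "submodule N R F \<and> {\<one>} \<subseteq> N"
    have "r \<in> N" if "r \<in> carrier R" for r
      using left_module.submoduleD(4)[OF F, of N r \<one>] N that by (simp add: s)
    then show "N = carrier F"
      using left_module.submoduleD(1)[OF F, of N] N by (auto simp: s)
  qed (simp_all add: s)
  ultimately obtain P where P: "P \<in> Ob" "module_iso R F P" using ex_iso_fmod by blast
  then obtain \<phi> \<psi> where iso: "iso_pair F P \<phi> \<psi>" using module_iso_iff[OF F] by blast
  note phi = iso_pairD[OF iso]
  note [simp] = hom_simps(1)[OF phi(1), unfolded s] hom_simps[OF phi(2), unfolded s] P(1)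
      phi(3)[unfolded s] phi(4)
  have ev: "(\<lambda>y. \<psi> y \<odot>\<^bsub>X\<^esub> x) \<in> Hom P X" if "LMod X" "x \<in> carrier X" for X :: "('a, 'a list)
      module" and x
  proof -
    interpret X: left_module R X by fact
    show ?thesis using that by (intro module_homI) (auto simp: X.smult_l_distr X.smult_assoc1)
  qed
  have "projective R P"
    unfolding projective_def
  proof (intro ballI impI)
    fix A B :: "('a, 'a list) module" and g h
    assume a: "A \<in> Ob" "B \<in> Ob" "g \<in> Hom A B" "h \<in> Hom P B" "g ` carrier A = carrier B"
    note [simp] = hom_simps[OF a(3)] hom_simps[OF a(4)] a(1,2)
    have "h (\<phi> \<one>) \<in> g ` carrier A" unfolding a(5) by simp
    \<comment> \<open>On the regular module a lift is determined by the image of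
      \<open>\<one>\<close>.\<close>
    then obtain x where x: "x \<in> carrier A" "g x = h (\<phi> \<one>)" by force
    have "g (\<psi> y \<odot>\<^bsub>A\<^esub> x) = h y" if y: "y \<in> carrier P" for y
    proof -
      have "h (\<psi> y \<odot>\<^bsub>P\<^esub> \<phi> \<one>) = h y" using hom_simps(3)[OF phi(1), unfolded s, of "\<psi> y" \<one>,
          symmetric] y by simp
      then show ?thesis using x y by simp
    qed
    moreover have "(\<lambda>y. \<psi> y \<odot>\<^bsub>A\<^esub> x) \<in> Hom P A" using ev[of A x] x by simp
    ultimately show "\<exists>k\<in>Hom P A. \<forall>x\<in>carrier P. g (k x) = h x" by (intro bexI ballI)
  qed
  moreover have "\<exists>f \<in> Hom P X. \<forall>r \<in> carrier R. r \<odot>\<^bsub>X\<^esub> x \<in> f ` carrier P"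
    if "X \<in> Ob" "x \<in> carrier X" for X :: "('a, 'a list) module" and x
  proof (intro bexI[of _ "\<lambda>y. \<psi> y \<odot>\<^bsub>X\<^esub> x"] ballI)
    show "r \<odot>\<^bsub>X\<^esub> x \<in> (\<lambda>y. \<psi> y \<odot>\<^bsub>X\<^esub> x) ` carrier P" if "r \<in> carrier R" for r
      using that by (intro image_eqI[of _ _ "\<phi> r"]) auto
  qed (use ev[of X x] that in simp)
  ultimately show ?thesis using P(1) by blast
qed

text \<open>One copy of the regular module is added for each generator.\<close>

lemma projective_onto_ex:
  assumes X: "X \<in> Ob"
  shows "\<exists>P \<in> Ob. projective R P \<and> (\<exists>p \<in> Hom P X. p ` carrier P = carrier X)"
proof -
  interpret X: left_module R X using X by simp
  obtain F where F: "F \<in> Ob" "projective R F" "\<And>x. x \<in> carrier X \<Longrightarrow> \<exists>f \<in> Hom F X. \<forall>r \<in> carrier R. r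
      \<odot>\<^bsub>X\<^esub> x \<in> f ` carrier F"
    using regular_module_ex X by metis
  have "\<exists>P \<in> Ob. projective R P \<and> (\<exists>p \<in> Hom P X. X.span xs \<subseteq> p ` carrier P)" if "set xs \<subseteq> carrier
      X" for xs
    using that
  proof (induction xs)
    case Nil
    obtain Z where Z: "Z \<in> Ob" "zero_module Z" using Ob_zero by blast
    then have "projective R Z" "(\<lambda>_. \<zero>\<^bsub>X\<^esub>) \<in> Hom Z X" "X.span [] \<subseteq> (\<lambda>_. \<zero>\<^bsub>X\<^esub>) ` carrier Z"
      using projective_zero[of Z] hom_zero[of X Z] X by (auto simp: zero_module_def)
    then show ?case using Z(1) by blast
  next
    case (Cons x xs)
    then obtain P p where P: "P \<in> Ob" "projective R P" "p \<in> Hom P X" "X.span xs \<subseteq> p ` carrier P"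
        by auto
    obtain f where f: "f \<in> Hom F X" "\<forall>r \<in> carrier R. r \<odot>\<^bsub>X\<^esub> x \<in> f ` carrier F"
      using F(3)[of x] Cons.prems by (meson list.set_intros(1) subsetD)
    obtain Q i j p' q' where Q: "Q \<in> Ob" "biproduct F P Q i j p' q'" using biproduct_ex[OF F(1)
        P(1)] by blast
    note [simp] = biproduct_simps[OF Q(2)] hom_simps[OF f(1)] hom_simps[OF P(3)] P(1) F(1) Q(1)
    let ?h = "\<lambda>x. f (p' x) \<oplus>\<^bsub>X\<^esub> p (q' x)"
    have "?h \<in> Hom Q X" using X by (intro hom_add hom_comp[OF biproductD(3)[OF Q(2)] f(1)]
        hom_comp[OF biproductD(4)[OF Q(2)] P(3)]) simp
    moreover have "X.span (x # xs) \<subseteq> ?h ` carrier Q"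
    proof
      fix y assume "y \<in> X.span (x # xs)"
      then obtain r s where rs: "y = r \<odot>\<^bsub>X\<^esub> x \<oplus>\<^bsub>X\<^esub> s" "r \<in> carrier R" "s \<in> X.span xs" by auto
      obtain a where a: "a \<in> carrier F" "r \<odot>\<^bsub>X\<^esub> x = f a" using f(2) rs(2) by blast
      obtain b where b: "b \<in> carrier P" "s = p b" using P(4) rs(3) by blast
      show "y \<in> ?h ` carrier Q"
        using a b rs(1) by (intro image_eqI[of _ _ "i a \<oplus>\<^bsub>Q\<^esub> j b"]) simp_all
    qed
    ultimately show ?case using projective_biproduct[OF Q(2) F(2) P(2)] Q(1) by blast
  qed
  moreover obtain xs where "set xs \<subseteq> carrier X" "X.span xs = carrier X"
    using X.fin_gen_iff_span X Ob_iff by blast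
  ultimately obtain P p where P: "P \<in> Ob" "projective R P" "p \<in> Hom P X" "carrier X \<subseteq> p ` carrier
      P" by metis
  moreover have "p ` carrier P \<subseteq> carrier X" using hom_simps(1)[OF P(3)] by blast
  ultimately show ?thesis by blast
qed

text \<open>A minimal submodule that is projective and still maps onto \<open>X\<close> gives a projective cover:
  otherwise a lifting into a proper submodule splits off, by Fitting's lemma, a smaller one.\<close>

lemma projective_cover_ex:
  assumes X: "X \<in> Ob"
  shows "\<exists>P p. projective_cover R X P p"
proof -
  obtain P p where P: "P \<in> Ob" "projective R P" "p \<in> Hom P X" "p ` carrier P = carrier X"
    using projective_onto_ex[OF X] by blast
  define T where "T = {N. submodule N R P \<and> projective R (P\<lparr>carrier := N\<rparr>) \<and> p ` N = carrier X}"
  have "submodule (carrier P) R P" using P(1) by (intro left_module.submoduleI) simp_all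
  then have "carrier P \<in> T" using P unfolding T_def by simp
  then have "T \<noteq> {}" by blast
  then have "\<exists>N \<in> T. \<forall>N' \<in> T. N' \<subseteq> N \<longrightarrow> N' = N"
    by (intro chain_cond_minimal[OF chain_cond_Ob[OF P(1)]]) (auto simp: T_def)
  then obtain N where N: "N \<in> T" "\<forall>N' \<in> T. N' \<subseteq> N \<longrightarrow> N' = N" by (elim bexE)
  have sub: "submodule N R P" and NX: "p ` N = carrier X" using N(1) by (simp_all add: T_def)
  note NP = left_module.submoduleD[OF Ob_Mod[OF P(1)] sub]
  define Q where "Q = P\<lparr>carrier := N\<rparr>"
  have Q: "Q \<in> Ob" "projective R Q" unfolding Q_def using sub_Ob[OF P(1) sub] N(1) by (simp_all
      add: T_def)
  have Qs: "carrier Q = N" "\<zero>\<^bsub>Q\<^esub> = \<zero>\<^bsub>P\<^esub>" "ring.add Q = ring.add P" "smult Q = smult P"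
    by (simp_all add: Q_def)
  have pQ: "p \<in> Hom Q X" unfolding Q_def by (rule hom_restrict[OF P(3) NP(1)])
  have "H = carrier Q" if H: "submodule H R Q" "H <+>\<^bsub>Q\<^esub> a_kernel Q X p = carrier Q" for H
  proof -
    note HQ = left_module.submoduleD[OF Ob_Mod[OF Q(1)] H(1)]
    define E where "E = Q\<lparr>carrier := H\<rparr>"
    have E: "E \<in> Ob" unfolding E_def by (rule sub_Ob[OF Q(1) H(1)])
    have pE: "p \<in> Hom E X" unfolding E_def by (rule hom_restrict[OF pQ HQ(1)])
    have "carrier X \<subseteq> p ` carrier E"
    proof
      fix x assume "x \<in> carrier X"
      then have "x \<in> p ` N" by (simp add: NX)
      then obtain y where y: "y \<in> N" "p y = x" by blast
      then have "y \<in> H <+>\<^bsub>Q\<^esub> a_kernel Q X p" using H(2) Qs by simp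
      then obtain h k where hk: "h \<in> H" "k \<in> carrier Q" "p k = \<zero>\<^bsub>X\<^esub>" "y = h \<oplus>\<^bsub>Q\<^esub> k"
        unfolding set_add_def' a_kernel_eq by blast
      have "p y = p h \<oplus>\<^bsub>X\<^esub> p k" unfolding hk(4) using hk HQ(1) by (intro hom_simps(2)[OF pQ]) auto
      moreover have "p h \<in> carrier X" using hk(1) HQ(1) hom_simps(1)[OF pQ] by blast
      ultimately have "p h = x" using y hk(3) X by simp
      then show "x \<in> p ` carrier E" using hk(1) by (auto simp: E_def)
    qed
    then have "p ` carrier E = carrier X" using hom_simps(1)[OF pE] by blast
    \<comment> \<open>Since \<open>H\<close> already maps onto \<open>X\<close>, \<open>p\<close>
      lifts to a map into \<open>H\<close>; as an endomorphism of \<open>Q\<close> it satisfies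
      \<open>p \<circ> a = p\<close>.\<close>
    then obtain a where a: "a \<in> Hom Q E" "\<forall>x \<in> carrier Q. p (a x) = p x"
      using projectiveD[OF Q(2) E X pE pQ] by blast
    have aQ: "a \<in> Hom Q Q" using hom_expand[OF _ HQ(1)] a(1) unfolding E_def .
    obtain e g n where eg: "e \<in> Hom Q Q" "g \<in> Hom Q Q" "\<forall>x \<in> carrier Q.
      e (e x) = e x \<and> g (a x) \<oplus>\<^bsub>Q\<^esub> e x = x \<and> a (g x) \<oplus>\<^bsub>Q\<^esub> e x = x \<and> (a ^^ n) (e x) = \<zero>\<^bsub>Q\<^esub>"
      using fitting[OF Q(1) aQ] by blast
    note [simp] = hom_simps[OF eg(1)] hom_simps[OF eg(2)] hom_simps[OF aQ] hom_simps[OF pQ] Q(1) X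
    \<comment> \<open>The idempotent complementary to \<open>e\<close>. Its image lies in
      \<open>H\<close>, and \<open>p \<circ> \<pi> = p\<close> because
      \<open>p (e x) = p ((a ^^ n) (e x))\<close> is zero; so the image is a projective submodule
      that still maps onto \<open>X\<close>.\<close>
    define \<pi> where "\<pi> x = a (g x)" for x
    have pi: "\<pi> \<in> Hom Q Q" unfolding \<pi>_def by (rule hom_comp[OF eg(2) aQ])
    have pi_e: "\<pi> x = x \<ominus>\<^bsub>Q\<^esub> e x" if "x \<in> carrier Q" for x
    proof -
      have "\<pi> x = (\<pi> x \<oplus>\<^bsub>Q\<^esub> e x) \<ominus>\<^bsub>Q\<^esub> e x" using that unfolding \<pi>_def
        by - (rule represents_eqI[of Q], (rule represents_intros | simp add: algebra_simps)+)
      then show ?thesis using eg(3) that unfolding \<pi>_def by simp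
    qed
    note [simp] = hom_simps[OF pi]
    have idem: "\<pi> (\<pi> x) = \<pi> x" if "x \<in> carrier Q" for x
    proof -
      have "\<pi> (\<pi> x) = \<pi> x \<ominus>\<^bsub>Q\<^esub> e (\<pi> x)" using pi_e that by simp
      also have "e (\<pi> x) = \<zero>\<^bsub>Q\<^esub>" using pi_e[OF that] that eg(3) by simp
      finally show ?thesis using that by simp
    qed
    have p_pow: "p ((a ^^ m) x) = p x \<and> (a ^^ m) x \<in> carrier Q" if "x \<in> carrier Q" for m x
      by (induction m) (use that a(2) in auto)
    have pe: "p (e x) = \<zero>\<^bsub>X\<^esub>" if "x \<in> carrier Q" for x
      using p_pow[of "e x" n] eg(3) that by simp
    define N' where "N' = \<pi> ` carrier Q"
    have N'Q: "submodule N' R Q" unfolding N'_def using image_submodule[OF _ _ pi] by simp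
    note N'D = left_module.submoduleD[OF Ob_Mod[OF Q(1)] N'Q]
    have "submodule N' R P"
    proof (rule left_module.submoduleI[OF Ob_Mod[OF P(1)]])
      show "N' \<subseteq> carrier P" using N'D(1) NP(1) Qs by simp
    qed (fact N'D[unfolded Qs])+
    moreover have "p ` N' = carrier X"
    proof -
      have "p (\<pi> x) = p x" if "x \<in> carrier Q" for x using pi_e[OF that] pe[OF that] that by simp
      then have "p ` N' = p ` N" unfolding N'_def image_image Qs[symmetric] by (rule image_cong[OF
          refl])
      then show ?thesis using NX by simp
    qed
    moreover have "projective R (P\<lparr>carrier := N'\<rparr>)"
    proof (rule projective_retract[OF Q(2)])
      show "(\<lambda>x. x) \<in> Hom (P\<lparr>carrier := N'\<rparr>) Q" using N'D(1) Qs by (intro module_homI) auto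
      show "\<pi> \<in> Hom Q (P\<lparr>carrier := N'\<rparr>)"
        using hom_simps(2,3)[OF pi] by (intro module_homI) (auto simp: Qs N'_def)
      show "\<pi> z = z" if "z \<in> carrier (P\<lparr>carrier := N'\<rparr>)" for z using that idem by (auto simp:
          N'_def)
    qed
    ultimately have "N' = N" using N(2) N'D(1) unfolding T_def Qs by blast
    moreover have "N' \<subseteq> H" unfolding N'_def \<pi>_def using hom_simps(1)[OF a(1)] by (auto simp: E_def)
    ultimately show ?thesis using HQ(1) Qs by blast
  qed
  then have "projective_cover R X Q p"
    unfolding projective_cover_def using Q pQ NX Qs(1) by auto
  then show ?thesis by blast
qed

section \<open>Projective presentations\<close>

text \<open>Arbitrary presentations rather than projective covers, because the sum and horseshoe
  constructions need not yield minimal ones; by \<open>IT_class_proj_pres\<close> the class of the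
  kernel does not depend on the choice.\<close>

definition proj_pres ::
  "('a, 'a list) module \<Rightarrow> ('a, 'a list) module \<Rightarrow> ('a, 'a list) module \<Rightarrow>
    ('a list \<Rightarrow> 'a list) \<Rightarrow> ('a list \<Rightarrow> 'a list) \<Rightarrow> bool" where
  "proj_pres S P X i p \<longleftrightarrow> S \<in> Ob \<and> P \<in> Ob \<and> X \<in> Ob \<and> projective R P \<and> short_exact R S P X i p"

lemma short_exactD:
  assumes "short_exact R A B C f g" "LMod A" "LMod B" "LMod C"
  shows "f \<in> Hom A B" "g \<in> Hom B C" "\<And>a. a \<in> carrier A \<Longrightarrow> g (f a) = \<zero>\<^bsub>C\<^esub>"
    "\<And>b. \<lbrakk>b \<in> carrier B; g b = \<zero>\<^bsub>C\<^esub>\<rbrakk> \<Longrightarrow> \<exists>a \<in> carrier A. f a = b"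
    "\<And>c. c \<in> carrier C \<Longrightarrow> \<exists>b \<in> carrier B. g b = c"
    "\<And>a. \<lbrakk>a \<in> carrier A; f a = \<zero>\<^bsub>B\<^esub>\<rbrakk> \<Longrightarrow> a = \<zero>\<^bsub>A\<^esub>"
proof -
  have *: "f \<in> Hom A B" "g \<in> Hom B C" "inj_on f (carrier A)" "g ` carrier B = carrier C"
    "f ` carrier A = {x \<in> carrier B. g x = \<zero>\<^bsub>C\<^esub>}"
    using assms(1) unfolding short_exact_def a_kernel_eq by blast+
  show "f \<in> Hom A B" "g \<in> Hom B C" by fact+
  show "\<And>a. a \<in> carrier A \<Longrightarrow> g (f a) = \<zero>\<^bsub>C\<^esub>" using *(5) by blast
  show "\<exists>a \<in> carrier A. f a = b" if "b \<in> carrier B" "g b = \<zero>\<^bsub>C\<^esub>" for b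
  proof -
    have "b \<in> f ` carrier A" using that by (simp add: *(5))
    then show ?thesis by blast
  qed
  show "\<exists>b \<in> carrier B. g b = c" if "c \<in> carrier C" for c
  proof -
    have "c \<in> g ` carrier B" using that by (simp add: *(4))
    then show ?thesis by blast
  qed
  show "a = \<zero>\<^bsub>A\<^esub>" if "a \<in> carrier A" "f a = \<zero>\<^bsub>B\<^esub>" for a
    using inj_onD[OF *(3), of a "\<zero>\<^bsub>A\<^esub>"] that hom_simps(6)[OF *(1)] assms(2,3) by simp
qed

lemma short_exactI:
  assumes "LMod A" "LMod B" "LMod C" "f \<in> Hom A B" "g \<in> Hom B C" "\<And>a. a \<in> carrier A \<Longrightarrow> g (f a) =
      \<zero>\<^bsub>C\<^esub>"
    "\<And>b. \<lbrakk>b \<in> carrier B; g b = \<zero>\<^bsub>C\<^esub>\<rbrakk> \<Longrightarrow> \<exists>a \<in> carrier A. f a = b"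
    "\<And>c. c \<in> carrier C \<Longrightarrow> \<exists>b \<in> carrier B. g b = c"
    "\<And>a. \<lbrakk>a \<in> carrier A; f a = \<zero>\<^bsub>B\<^esub>\<rbrakk> \<Longrightarrow> a = \<zero>\<^bsub>A\<^esub>"
  shows "short_exact R A B C f g"
proof -
  note [simp] = hom_simps[OF assms(4)] hom_simps[OF assms(5)] assms(1-3)
  have "inj_on f (carrier A)"
  proof (rule inj_onI)
    fix x y assume xy: "x \<in> carrier A" "y \<in> carrier A" "f x = f y"
    then have "f (x \<ominus>\<^bsub>A\<^esub> y) = \<zero>\<^bsub>B\<^esub>" by simp
    then have "x \<ominus>\<^bsub>A\<^esub> y = \<zero>\<^bsub>A\<^esub>" using assms(9) xy by simp
    then show "x = y" using abelian_group.minus_eq_zero_iff[of A x y] xy by simp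
  qed
  moreover have "f ` carrier A = {x \<in> carrier B. g x = \<zero>\<^bsub>C\<^esub>}"
  proof (intro equalityI subsetI)
    fix b assume "b \<in> {x \<in> carrier B. g x = \<zero>\<^bsub>C\<^esub>}"
    then show "b \<in> f ` carrier A" using assms(7)[of b] by blast
  qed (use assms(6) in auto)
  moreover have "g ` carrier B = carrier C"
  proof (intro equalityI subsetI)
    fix c assume "c \<in> carrier C"
    then show "c \<in> g ` carrier B" using assms(8)[of c] by blast
  qed auto
  ultimately show ?thesis unfolding short_exact_def a_kernel_eq using assms(4,5) by blast
qed

lemma short_exact_factor:
  assumes se: "short_exact R S P X i p" and Ob: "LMod S" "LMod P" "LMod X" "LMod Q"
    and h: "h \<in> Hom Q P" "\<And>y. y \<in> carrier Q \<Longrightarrow> p (h y) = \<zero>\<^bsub>X\<^esub>"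
  shows "\<exists>k \<in> Hom Q S. \<forall>y \<in> carrier Q. i (k y) = h y"
proof -
  note d = short_exactD[OF se Ob(1-3)]
  have inj: "inj_on i (carrier S)" using se unfolding short_exact_def by blast
  note [simp] = hom_simps[OF d(1)] hom_simps[OF h(1)] Ob
  have "\<exists>s. s \<in> carrier S \<and> i s = h y" if "y \<in> carrier Q" for y using d(4)[of "h y"] h(2) that by
      auto
  then obtain k where k: "\<And>y. y \<in> carrier Q \<Longrightarrow> k y \<in> carrier S" "\<And>y. y \<in> carrier Q \<Longrightarrow> i (k y) = h y"
      by metis
  have "k \<in> Hom Q S"
  proof (rule module_homI)
    fix x y assume "x \<in> carrier Q" "y \<in> carrier Q"
    then show "k (x \<oplus>\<^bsub>Q\<^esub> y) = k x \<oplus>\<^bsub>S\<^esub> k y" by - (rule inj_onD[OF inj], simp_all add: k)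
  next
    fix r x assume "r \<in> carrier R" "x \<in> carrier Q"
    then show "k (r \<odot>\<^bsub>Q\<^esub> x) = r \<odot>\<^bsub>S\<^esub> k x" by - (rule inj_onD[OF inj], simp_all add: k)
  qed (use k in simp)
  then show ?thesis using k by blast
qed

lemma kernel_short_exact:
  assumes "P \<in> Ob" "X \<in> Ob" "p \<in> Hom P X" "p ` carrier P = carrier X"
  shows "P\<lparr>carrier := {x \<in> carrier P. p x = \<zero>\<^bsub>X\<^esub>}\<rparr> \<in> Ob"
    "short_exact R (P\<lparr>carrier := {x \<in> carrier P. p x = \<zero>\<^bsub>X\<^esub>}\<rparr>) P X (\<lambda>x. x) p"
proof -
  let ?Y = "P\<lparr>carrier := {x \<in> carrier P. p x = \<zero>\<^bsub>X\<^esub>}\<rparr>"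
  show Y: "?Y \<in> Ob" using assms by (intro sub_Ob kernel_submodule) simp_all
  have "(\<lambda>x. x) \<in> Hom ?Y P" by (intro module_homI) auto
  then show "short_exact R ?Y P X (\<lambda>x. x) p"
    using assms unfolding short_exact_def a_kernel_eq by auto
qed

text \<open>The existence of projective covers makes the choice in \<open>Syz\<close> meaningful;
  all further facts about \<open>Syz\<close> come through this lemma.\<close>

lemma Syz_proj_pres: "X \<in> Ob \<Longrightarrow> \<exists>P i p. proj_pres (Syz R X) P X i p"
proof -
  assume X: "X \<in> Ob"
  obtain P p where P: "projective_cover R X P p" using projective_cover_ex[OF X] by blast
  let ?Q = "\<lambda>Y. Y \<in> Ob \<and> (\<exists>P p i. projective_cover R X P p \<and> short_exact R Y P X i p)"
  have "?Q (P\<lparr>carrier := {x \<in> carrier P. p x = \<zero>\<^bsub>X\<^esub>}\<rparr>)"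
    using kernel_short_exact[of P X p] P X unfolding projective_cover_def by blast
  then have Q: "?Q (Syz R X)" unfolding Syz_def by (rule someI)
  then obtain P p i where P: "projective_cover R X P p" "short_exact R (Syz R X) P X i p" by blast
  have "P \<in> Ob" "projective R P" using P(1) unfolding projective_cover_def by blast+
  then have "proj_pres (Syz R X) P X i p" unfolding proj_pres_def using Q P(2) X by blast
  then show ?thesis by blast
qed

lemma Syz_Ob [simp]: "X \<in> Ob \<Longrightarrow> Syz R X \<in> Ob"
  using Syz_proj_pres unfolding proj_pres_def by blast

lemma Syz_funpow_Ob [simp]: "X \<in> Ob \<Longrightarrow> (Syz R ^^ n) X \<in> Ob"
  by (induction n) auto

lemma proj_presD:
  assumes "proj_pres S P X i p"
  shows "S \<in> Ob" "P \<in> Ob" "X \<in> Ob" "projective R P" "i \<in> Hom S P" "p \<in> Hom P X"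
    "\<And>a. a \<in> carrier S \<Longrightarrow> p (i a) = \<zero>\<^bsub>X\<^esub>"
    "\<And>b. \<lbrakk>b \<in> carrier P; p b = \<zero>\<^bsub>X\<^esub>\<rbrakk> \<Longrightarrow> \<exists>a \<in> carrier S. i a = b"
    "\<And>c. c \<in> carrier X \<Longrightarrow> \<exists>b \<in> carrier P. p b = c"
    "\<And>a. \<lbrakk>a \<in> carrier S; i a = \<zero>\<^bsub>P\<^esub>\<rbrakk> \<Longrightarrow> a = \<zero>\<^bsub>S\<^esub>"
    "p ` carrier P = carrier X" "inj_on i (carrier S)"
proof -
  have "short_exact R S P X i p" and Ob: "S \<in> Ob" "P \<in> Ob" "X \<in> Ob" "projective R P"
    using assms unfolding proj_pres_def by blast+
  then show "S \<in> Ob" "P \<in> Ob" "X \<in> Ob" "projective R P" "p ` carrier P = carrier X" "inj_on i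
      (carrier S)"
    by (simp_all add: short_exact_def)
  note s = short_exactD[OF \<open>short_exact R S P X i p\<close>]
  show "i \<in> Hom S P" "p \<in> Hom P X" "\<And>a. a \<in> carrier S \<Longrightarrow> p (i a) = \<zero>\<^bsub>X\<^esub>"
    "\<And>b. \<lbrakk>b \<in> carrier P; p b = \<zero>\<^bsub>X\<^esub>\<rbrakk> \<Longrightarrow> \<exists>a \<in> carrier S. i a = b"
    "\<And>c. c \<in> carrier X \<Longrightarrow> \<exists>b \<in> carrier P. p b = c"
    "\<And>a. \<lbrakk>a \<in> carrier S; i a = \<zero>\<^bsub>P\<^esub>\<rbrakk> \<Longrightarrow> a = \<zero>\<^bsub>S\<^esub>"
    using s Ob by simp_all
qed

lemma proj_pres_factor:
  assumes "proj_pres S P X i p" "h \<in> Hom Q P" "\<And>y. y \<in> carrier Q \<Longrightarrow> p (h y) = \<zero>\<^bsub>X\<^esub>" "LMod Q"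
  shows "\<exists>k \<in> Hom Q S. \<forall>y \<in> carrier Q. i (k y) = h y"
  using short_exact_factor[of S P X i p Q h] assms unfolding proj_pres_def by simp

section \<open>Stable equality and stable isomorphism\<close>

definition proj_factor :: "('a, 'a list) module \<Rightarrow> ('a, 'a list) module \<Rightarrow> ('a list \<Rightarrow> 'a list) \<Rightarrow>
    bool" where
  "proj_factor A B h \<longleftrightarrow> h \<in> Hom A B \<and> (\<exists>P \<in> Ob. projective R P \<and>
    (\<exists>u \<in> Hom A P. \<exists>v \<in> Hom P B. \<forall>x \<in> carrier A. h x = v (u x)))"

lemma proj_factorI:
  "\<lbrakk>h \<in> Hom A B; P \<in> Ob; projective R P; u \<in> Hom A P; v \<in> Hom P B; \<And>x. x \<in> carrier A \<Longrightarrow> h x = v (u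
      x)\<rbrakk>
    \<Longrightarrow> proj_factor A B h"
  unfolding proj_factor_def by (intro conjI bexI ballI)

lemma proj_factorE:
  assumes "proj_factor A B h"
  obtains P u v where "h \<in> Hom A B" "P \<in> Ob" "projective R P" "u \<in> Hom A P" "v \<in> Hom P B"
    "\<And>x. x \<in> carrier A \<Longrightarrow> h x = v (u x)"
  using assms unfolding proj_factor_def by (elim conjE bexE) simp

lemma proj_factor_cong:
  assumes "proj_factor A B h" "\<And>x. x \<in> carrier A \<Longrightarrow> h' x = h x" "h' \<in> Hom A B" shows "proj_factor A
      B h'"
proof -
  obtain P u v where "h \<in> Hom A B" "P \<in> Ob" "projective R P" "u \<in> Hom A P" "v \<in> Hom P B"
    "\<And>x. x \<in> carrier A \<Longrightarrow> h x = v (u x)" using proj_factorE[OF assms(1)] by blast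
  with assms show ?thesis by (intro proj_factorI[where P = P and u = u and v = v]) simp_all
qed

lemma proj_factor_comp_left:
  assumes "proj_factor A B h" "k \<in> Hom B C" shows "proj_factor A C (\<lambda>x. k (h x))"
proof -
  obtain P u v where *: "h \<in> Hom A B" "P \<in> Ob" "projective R P" "u \<in> Hom A P" "v \<in> Hom P B"
    "\<And>x. x \<in> carrier A \<Longrightarrow> h x = v (u x)" using proj_factorE[OF assms(1)] by blast
  show ?thesis
    by (rule proj_factorI[OF hom_comp[OF *(1) assms(2)] *(2,3,4) hom_comp[OF *(5) assms(2)]])
        (simp add: *(6))
qed

lemma proj_factor_comp_right:
  assumes "proj_factor A B h" "k \<in> Hom C A" shows "proj_factor C B (\<lambda>x. h (k x))"
proof -
  obtain P u v where *: "h \<in> Hom A B" "P \<in> Ob" "projective R P" "u \<in> Hom A P" "v \<in> Hom P B"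
    "\<And>x. x \<in> carrier A \<Longrightarrow> h x = v (u x)" using proj_factorE[OF assms(1)] by blast
  show ?thesis
    by (rule proj_factorI[OF hom_comp[OF assms(2) *(1)] *(2,3) hom_comp[OF assms(2) *(4)] *(5)])
      (simp add: *(6) hom_simps(1)[OF assms(2)])
qed

lemma proj_factor_add:
  assumes "proj_factor A B h" "proj_factor A B h'" "B \<in> Ob" shows "proj_factor A B (\<lambda>x. h x \<oplus>\<^bsub>B\<^esub>
      h' x)"
proof -
  obtain P u v where *: "h \<in> Hom A B" "P \<in> Ob" "projective R P" "u \<in> Hom A P" "v \<in> Hom P B"
    "\<And>x. x \<in> carrier A \<Longrightarrow> h x = v (u x)" using proj_factorE[OF assms(1)] by blast
  obtain Q u' v' where **: "h' \<in> Hom A B" "Q \<in> Ob" "projective R Q" "u' \<in> Hom A Q" "v' \<in> Hom Q B"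
    "\<And>x. x \<in> carrier A \<Longrightarrow> h' x = v' (u' x)" using proj_factorE[OF assms(2)] by blast
  obtain X i j p q where X: "X \<in> Ob" "biproduct P Q X i j p q" using biproduct_ex[OF *(2) **(2)]
      by blast
  note b = biproductD(1-4)[OF X(2)]
  note [simp] = biproduct_simps[OF X(2)] hom_simps[OF *(4)] hom_simps[OF **(4)] hom_simps[OF *(5)]
      hom_simps[OF **(5)]
    X(1) *(2) **(2) assms(3)
  show ?thesis
  proof (rule proj_factorI[OF _ X(1) projective_biproduct[OF X(2) *(3) **(3)]])
    show "(\<lambda>x. h x \<oplus>\<^bsub>B\<^esub> h' x) \<in> Hom A B" by (rule hom_add[OF _ *(1) **(1)]) simp
    show "(\<lambda>x. i (u x) \<oplus>\<^bsub>X\<^esub> j (u' x)) \<in> Hom A X" by (rule hom_add[OF _ hom_comp[OF *(4) b(1)]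
        hom_comp[OF **(4) b(2)]]) simp
    show "(\<lambda>x. v (p x) \<oplus>\<^bsub>B\<^esub> v' (q x)) \<in> Hom X B" by (rule hom_add[OF _ hom_comp[OF b(3) *(5)]
        hom_comp[OF b(4) **(5)]]) simp
  qed (simp add: *(6) **(6))
qed

lemma proj_factor_zero:
  assumes "A \<in> Ob" "B \<in> Ob" shows "proj_factor A B (\<lambda>_. \<zero>\<^bsub>B\<^esub>)"
proof -
  obtain Z where Z: "Z \<in> Ob" "zero_module Z" using Ob_zero by blast
  show ?thesis
    by (rule proj_factorI[OF _ Z(1) projective_zero[OF Z(2)], of _ _ _ "\<lambda>_. \<zero>\<^bsub>Z\<^esub>" "\<lambda>_. \<zero>\<^bsub>B\<^esub>"])
        (use assms Z in \<open>auto intro: hom_zero\<close>)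
qed

lemma proj_factor_neg:
  assumes "proj_factor A B h" "A \<in> Ob" "B \<in> Ob" shows "proj_factor A B (\<lambda>x. \<ominus>\<^bsub>B\<^esub> h x)"
  using proj_factor_comp_left[OF assms(1) hom_neg[OF _ _ hom_id]] assms by simp

text \<open>Equality in the stable category, whose morphisms are represented by module maps.\<close>

definition stable_eq where
  "stable_eq A B f g \<longleftrightarrow> f \<in> Hom A B \<and> g \<in> Hom A B \<and> proj_factor A B (\<lambda>x. f x \<ominus>\<^bsub>B\<^esub> g x)"

lemma stable_eqI:
  assumes "A \<in> Ob" "B \<in> Ob" "f \<in> Hom A B" "g \<in> Hom A B" "\<And>x. x \<in> carrier A \<Longrightarrow> f x = g x"
  shows "stable_eq A B f g"
  unfolding stable_eq_def using assms hom_simps(1)[OF assms(4)]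
  by (auto intro!: proj_factor_cong[OF proj_factor_zero] hom_minus)

lemma stable_eq_refl: "\<lbrakk>A \<in> Ob; B \<in> Ob; f \<in> Hom A B\<rbrakk> \<Longrightarrow> stable_eq A B f f"
  by (rule stable_eqI) simp_all

lemma stable_eq_sym:
  assumes "stable_eq A B f g" "A \<in> Ob" "B \<in> Ob" shows "stable_eq A B g f"
proof -
  have h: "f \<in> Hom A B" "g \<in> Hom A B" "proj_factor A B (\<lambda>x. f x \<ominus>\<^bsub>B\<^esub> g x)" using assms(1)
      unfolding stable_eq_def by blast+
  note [simp] = hom_simps[OF h(1)] hom_simps[OF h(2)] assms(2,3)
  have "proj_factor A B (\<lambda>x. g x \<ominus>\<^bsub>B\<^esub> f x)"
  proof (rule proj_factor_cong[OF proj_factor_neg[OF h(3)]])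
    show "g x \<ominus>\<^bsub>B\<^esub> f x = \<ominus>\<^bsub>B\<^esub> (f x \<ominus>\<^bsub>B\<^esub> g x)" if "x \<in> carrier A" for x using that
      by - (rule represents_eqI, (rule represents_intros | simp add: algebra_simps)+)
  qed (use h in \<open>auto intro: hom_minus\<close>)
  then show ?thesis unfolding stable_eq_def using h by blast
qed

lemma stable_eq_trans [trans]:
  assumes "stable_eq A B f g" "stable_eq A B g h" "A \<in> Ob" "B \<in> Ob" shows "stable_eq A B f h"
proof -
  have h: "f \<in> Hom A B" "g \<in> Hom A B" "proj_factor A B (\<lambda>x. f x \<ominus>\<^bsub>B\<^esub> g x)" using assms(1)
      unfolding stable_eq_def by blast+
  have h': "h \<in> Hom A B" "proj_factor A B (\<lambda>x. g x \<ominus>\<^bsub>B\<^esub> h x)" using assms(2) unfolding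
      stable_eq_def by blast+
  note [simp] = hom_simps[OF h(1)] hom_simps[OF h(2)] hom_simps[OF h'(1)] assms(3,4)
  have "proj_factor A B (\<lambda>x. f x \<ominus>\<^bsub>B\<^esub> h x)"
  proof (rule proj_factor_cong[OF proj_factor_add[OF h(3) h'(2)]])
    show "f x \<ominus>\<^bsub>B\<^esub> h x = (f x \<ominus>\<^bsub>B\<^esub> g x) \<oplus>\<^bsub>B\<^esub> (g x \<ominus>\<^bsub>B\<^esub> h x)" if "x \<in> carrier A" for x using that
      by - (rule represents_eqI, (rule represents_intros | simp add: algebra_simps)+)
  qed (use h h' in \<open>auto intro: hom_minus\<close>)
  then show ?thesis unfolding stable_eq_def using h h' by blast
qed

lemma stable_eq_comp:
  assumes "stable_eq A B f f'" "stable_eq B C g g'" "A \<in> Ob" "B \<in> Ob" "C \<in> Ob"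
  shows "stable_eq A C (\<lambda>x. g (f x)) (\<lambda>x. g' (f' x))"
proof -
  have h: "f \<in> Hom A B" "f' \<in> Hom A B" "proj_factor A B (\<lambda>x. f x \<ominus>\<^bsub>B\<^esub> f' x)" using assms(1)
      unfolding stable_eq_def by blast+
  have h': "g \<in> Hom B C" "g' \<in> Hom B C" "proj_factor B C (\<lambda>x. g x \<ominus>\<^bsub>C\<^esub> g' x)" using assms(2)
      unfolding stable_eq_def by blast+
  note [simp] = hom_simps[OF h(1)] hom_simps[OF h(2)] hom_simps[OF h'(1)] hom_simps[OF h'(2)]
      assms(3-)
  have c: "(\<lambda>x. g (f x)) \<in> Hom A C" "(\<lambda>x. g' (f' x)) \<in> Hom A C"
    by (rule hom_comp[OF h(1) h'(1)], rule hom_comp[OF h(2) h'(2)])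
  have "proj_factor A C (\<lambda>x. g (f x) \<ominus>\<^bsub>C\<^esub> g' (f' x))"
  proof (rule proj_factor_cong[OF proj_factor_add[OF proj_factor_comp_left[OF h(3) h'(1)]
      proj_factor_comp_right[OF h'(3) h(2)]]])
    show "g (f x) \<ominus>\<^bsub>C\<^esub> g' (f' x) = g (f x \<ominus>\<^bsub>B\<^esub> f' x) \<oplus>\<^bsub>C\<^esub> (g (f' x) \<ominus>\<^bsub>C\<^esub> g' (f' x))" if "x \<in>
        carrier A" for x
      using that by simp (rule represents_eqI, (rule represents_intros | simp add: algebra_simps)+)
  qed (use c in \<open>auto intro: hom_minus\<close>)
  then show ?thesis unfolding stable_eq_def using c by blast
qed

lemma stable_eq_add:
  assumes "stable_eq A B f f'" "stable_eq A B g g'" "A \<in> Ob" "B \<in> Ob"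
  shows "stable_eq A B (\<lambda>x. f x \<oplus>\<^bsub>B\<^esub> g x) (\<lambda>x. f' x \<oplus>\<^bsub>B\<^esub> g' x)"
proof -
  have h: "f \<in> Hom A B" "f' \<in> Hom A B" "proj_factor A B (\<lambda>x. f x \<ominus>\<^bsub>B\<^esub> f' x)" using assms(1)
      unfolding stable_eq_def by blast+
  have h': "g \<in> Hom A B" "g' \<in> Hom A B" "proj_factor A B (\<lambda>x. g x \<ominus>\<^bsub>B\<^esub> g' x)" using assms(2)
      unfolding stable_eq_def by blast+
  note [simp] = hom_simps[OF h(1)] hom_simps[OF h(2)] hom_simps[OF h'(1)] hom_simps[OF h'(2)]
      assms(3-)
  have c: "(\<lambda>x. f x \<oplus>\<^bsub>B\<^esub> g x) \<in> Hom A B" "(\<lambda>x. f' x \<oplus>\<^bsub>B\<^esub> g' x) \<in> Hom A B" using h h' assms(4) by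
      (auto intro!: hom_add)
  have "proj_factor A B (\<lambda>x. (f x \<oplus>\<^bsub>B\<^esub> g x) \<ominus>\<^bsub>B\<^esub> (f' x \<oplus>\<^bsub>B\<^esub> g' x))"
  proof (rule proj_factor_cong[OF proj_factor_add[OF h(3) h'(3)]])
    show "(f x \<oplus>\<^bsub>B\<^esub> g x) \<ominus>\<^bsub>B\<^esub> (f' x \<oplus>\<^bsub>B\<^esub> g' x) = (f x \<ominus>\<^bsub>B\<^esub> f' x) \<oplus>\<^bsub>B\<^esub> (g x \<ominus>\<^bsub>B\<^esub> g' x)" if "x \<in>
        carrier A" for x
      using that by - (rule represents_eqI, (rule represents_intros | simp add: algebra_simps)+)
  qed (use c in \<open>auto intro: hom_minus\<close>)
  then show ?thesis unfolding stable_eq_def using c by blast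
qed

lemma proj_factor_projective:
  assumes "h \<in> Hom A B" "projective R A \<or> projective R B" "A \<in> Ob" "B \<in> Ob"
  shows "proj_factor A B h"
proof (cases "projective R A")
  case True
  then show ?thesis by (intro proj_factorI[OF assms(1,3) _ hom_id assms(1)]) simp_all
next
  case False
  then show ?thesis using assms(2) by (intro proj_factorI[OF assms(1,4) _ assms(1) hom_id]) simp_all
qed

lemma stable_eq_zero_iff_proj_factor:
  assumes "A \<in> Ob" "B \<in> Ob" "h \<in> Hom A B"
  shows "stable_eq A B h (\<lambda>_. \<zero>\<^bsub>B\<^esub>) \<longleftrightarrow> proj_factor A B h"
proof -
  note [simp] = hom_simps(1)[OF assms(3)] assms(1,2)
  have z: "(\<lambda>_. \<zero>\<^bsub>B\<^esub>) \<in> Hom A B" by (rule hom_zero) simp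
  have "proj_factor A B (\<lambda>x. h x \<ominus>\<^bsub>B\<^esub> \<zero>\<^bsub>B\<^esub>) \<longleftrightarrow> proj_factor A B h"
    using proj_factor_cong[of A B h "\<lambda>x. h x \<ominus>\<^bsub>B\<^esub> \<zero>\<^bsub>B\<^esub>"] proj_factor_cong[of A B "\<lambda>x. h x \<ominus>\<^bsub>B\<^esub>
        \<zero>\<^bsub>B\<^esub>" h]
      hom_minus[OF _ _ assms(3) z] assms(3) by auto
  then show ?thesis unfolding stable_eq_def using z assms(3) by blast
qed

text \<open>If the identity factors through a projective, the module is a retract of that
  projective.\<close>

lemma projective_iff_stable_eq:
  assumes "A \<in> Ob" shows "projective R A \<longleftrightarrow> stable_eq A A (\<lambda>x. x) (\<lambda>_. \<zero>\<^bsub>A\<^esub>)"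
  unfolding stable_eq_zero_iff_proj_factor[OF assms assms hom_id]
proof
  assume "proj_factor A A (\<lambda>x. x)"
  then obtain P u v where "projective R P" "u \<in> Hom A P" "v \<in> Hom P A"
    "\<And>x. x \<in> carrier A \<Longrightarrow> x = v (u x)" using proj_factorE by metis
  then show "projective R A" using projective_retract[of P u A v] by simp
qed (use proj_factor_projective hom_id assms in blast)

text \<open>\<open>f\<^sub>1\<close> is induced by \<open>f\<close> on the kernels of two given projective presentations.\<close>

definition syzygy_map where
  "syzygy_map S P i p T Q j q f f1 \<longleftrightarrow> f1 \<in> Hom S T \<and>
    (\<exists>f0 \<in> Hom P Q. (\<forall>x \<in> carrier P. q (f0 x) = f (p x)) \<and> (\<forall>s \<in> carrier S. j (f1 s) = f0 (i s)))"

lemma syzygy_mapI: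
  "\<lbrakk>f1 \<in> Hom S T; f0 \<in> Hom P Q; \<And>x. x \<in> carrier P \<Longrightarrow> q (f0 x) = f (p x); \<And>s. s \<in> carrier S \<Longrightarrow> j (f1
      s) = f0 (i s)\<rbrakk>
    \<Longrightarrow> syzygy_map S P i p T Q j q f f1"
  unfolding syzygy_map_def by (intro conjI bexI ballI)

lemma syzygy_mapE:
  assumes "syzygy_map S P i p T Q j q f f1"
  obtains f0 where "f1 \<in> Hom S T" "f0 \<in> Hom P Q" "\<And>x. x \<in> carrier P \<Longrightarrow> q (f0 x) = f (p x)"
    "\<And>s. s \<in> carrier S \<Longrightarrow> j (f1 s) = f0 (i s)"
  using assms unfolding syzygy_map_def by (elim conjE bexE) simp

lemma syzygy_map_ex:
  assumes p1: "proj_pres S P A i p" and p2: "proj_pres T Q B j q" and f: "f \<in> Hom A B"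
  shows "\<exists>f1. syzygy_map S P i p T Q j q f f1"
proof -
  note d1 = proj_presD[OF p1] and d2 = proj_presD[OF p2]
  obtain f0 where f0: "f0 \<in> Hom P Q" "\<forall>x \<in> carrier P. q (f0 x) = f (p x)"
    using projectiveD[OF d1(4) d2(2,3,6) hom_comp[OF d1(6) f] d2(11)] by blast
  have "q (f0 (i s)) = \<zero>\<^bsub>B\<^esub>" if "s \<in> carrier S" for s
    using f0(2) d1(7)[OF that] hom_simps(1)[OF d1(5) that] hom_simps(6)[OF f] d1(3) d2(3) by simp
  then obtain f1 where f1: "f1 \<in> Hom S T" "\<forall>s \<in> carrier S. j (f1 s) = f0 (i s)"
    using proj_pres_factor[OF p2 hom_comp[OF d1(5) f0(1)]] d1(1) by auto
  have "syzygy_map S P i p T Q j q f f1" by (rule syzygy_mapI[OF f1(1) f0(1)]) (simp_all add: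
      f0(2) f1(2))
  then show ?thesis by blast
qed

text \<open>This makes syzygies of maps well defined in the stable category. With
  \<open>f = v \<circ> u\<close> through a projective \<open>V\<close> and \<open>w\<close> a lift
  of \<open>v\<close> to \<open>Q\<close>, the map that subtracts \<open>w (u (p x))\<close> from
  \<open>f0 x\<close> lands in the kernel \<open>T\<close>. On \<open>S\<close> the correction
  vanishes, so \<open>f1\<close> factors through \<open>P\<close>.\<close>

lemma syzygy_map_proj_factor:
  assumes p1: "proj_pres S P A i p" and p2: "proj_pres T Q B j q" and syzygy_map: "syzygy_map S P
      i p T Q j q f f1" and f: "proj_factor A B f"
  shows "proj_factor S T f1"
proof -
  note d1 = proj_presD[OF p1] and d2 = proj_presD[OF p2]
  obtain f0 where f0: "f1 \<in> Hom S T" "f0 \<in> Hom P Q" "\<And>x. x \<in> carrier P \<Longrightarrow> q (f0 x) = f (p x)"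
    "\<And>s. s \<in> carrier S \<Longrightarrow> j (f1 s) = f0 (i s)" using syzygy_mapE[OF syzygy_map] by blast
  obtain V u v where V: "f \<in> Hom A B" "V \<in> Ob" "projective R V" "u \<in> Hom A V" "v \<in> Hom V B"
    "\<And>x. x \<in> carrier A \<Longrightarrow> f x = v (u x)" using proj_factorE[OF f] by blast
  obtain w where w: "w \<in> Hom V Q" "\<forall>x \<in> carrier V. q (w x) = v x"
    using projectiveD[OF V(3) d2(2,3,6) V(5) d2(11)] by blast
  note [simp] = hom_simps[OF d1(5)] hom_simps[OF d1(6)] hom_simps[OF d2(5)] hom_simps[OF d2(6)]
      hom_simps[OF f0(1)]
     hom_simps[OF f0(2)] hom_simps[OF V(1)] hom_simps[OF V(4)] hom_simps[OF V(5)] hom_simps[OF w(1)]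
     d1(1-3) d2(1-3) V(2)
  have h: "(\<lambda>x. f0 x \<ominus>\<^bsub>Q\<^esub> w (u (p x))) \<in> Hom P Q"
    by (rule hom_minus[OF _ _ f0(2) hom_comp[OF hom_comp[OF d1(6) V(4)] w(1)]]) simp_all
  have "q (f0 x \<ominus>\<^bsub>Q\<^esub> w (u (p x))) = \<zero>\<^bsub>B\<^esub>" if "x \<in> carrier P" for x
    using that w(2) f0(3) V(6) by simp
  then obtain k where k: "k \<in> Hom P T" "\<forall>x \<in> carrier P. j (k x) = f0 x \<ominus>\<^bsub>Q\<^esub> w (u (p x))"
    using proj_pres_factor[OF p2 h] by auto
  have "f1 s = k (i s)" if "s \<in> carrier S" for s
  proof (rule inj_onD[OF d2(12)])
    show "j (f1 s) = j (k (i s))" using that k(2) f0(4) d1(7) by simp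
  qed (use that hom_simps(1)[OF k(1)] in simp_all)
  then show ?thesis by (intro proj_factorI[OF f0(1) d1(2,4,5) k(1)])
qed

lemma syzygy_map_add:
  assumes "proj_pres S P A i p" "proj_pres T Q B j q" "syzygy_map S P i p T Q j q f f1"
      "syzygy_map S P i p T Q j q g g1"
    and fg: "f \<in> Hom A B" "g \<in> Hom A B"
  shows "syzygy_map S P i p T Q j q (\<lambda>x. f x \<oplus>\<^bsub>B\<^esub> g x) (\<lambda>x. f1 x \<oplus>\<^bsub>T\<^esub> g1 x)"
proof -
  note d1 = proj_presD[OF assms(1)] and d2 = proj_presD[OF assms(2)]
  obtain f0 where f0: "f1 \<in> Hom S T" "f0 \<in> Hom P Q" "\<And>x. x \<in> carrier P \<Longrightarrow> q (f0 x) = f (p x)"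
    "\<And>s. s \<in> carrier S \<Longrightarrow> j (f1 s) = f0 (i s)" using syzygy_mapE[OF assms(3)] by blast
  obtain g0 where g0: "g1 \<in> Hom S T" "g0 \<in> Hom P Q" "\<And>x. x \<in> carrier P \<Longrightarrow> q (g0 x) = g (p x)"
    "\<And>s. s \<in> carrier S \<Longrightarrow> j (g1 s) = g0 (i s)" using syzygy_mapE[OF assms(4)] by blast
  show ?thesis
  proof (rule syzygy_mapI)
    show "(\<lambda>x. f1 x \<oplus>\<^bsub>T\<^esub> g1 x) \<in> Hom S T" using d2 f0 g0 by (intro hom_add) simp_all
    show "(\<lambda>x. f0 x \<oplus>\<^bsub>Q\<^esub> g0 x) \<in> Hom P Q" using d2 f0 g0 by (intro hom_add) simp_all
  qed (use f0 g0 in \<open>simp_all add: hom_simps(1,2)[OF d2(6)] hom_simps(1,2)[OF d2(5)]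
      hom_simps(1)[OF f0(1)] hom_simps(1)[OF f0(2)] hom_simps(1)[OF g0(1)] hom_simps(1)[OF g0(2)]\<close>)
qed

lemma syzygy_map_minus:
  assumes "proj_pres S P A i p" "proj_pres T Q B j q" "syzygy_map S P i p T Q j q f f1"
      "syzygy_map S P i p T Q j q g g1"
    and fg: "f \<in> Hom A B" "g \<in> Hom A B"
  shows "syzygy_map S P i p T Q j q (\<lambda>x. f x \<ominus>\<^bsub>B\<^esub> g x) (\<lambda>x. f1 x \<ominus>\<^bsub>T\<^esub> g1 x)"
proof -
  note d1 = proj_presD[OF assms(1)] and d2 = proj_presD[OF assms(2)]
  obtain f0 where f0: "f1 \<in> Hom S T" "f0 \<in> Hom P Q" "\<And>x. x \<in> carrier P \<Longrightarrow> q (f0 x) = f (p x)"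
    "\<And>s. s \<in> carrier S \<Longrightarrow> j (f1 s) = f0 (i s)" using syzygy_mapE[OF assms(3)] by blast
  obtain g0 where g0: "g1 \<in> Hom S T" "g0 \<in> Hom P Q" "\<And>x. x \<in> carrier P \<Longrightarrow> q (g0 x) = g (p x)"
    "\<And>s. s \<in> carrier S \<Longrightarrow> j (g1 s) = g0 (i s)" using syzygy_mapE[OF assms(4)] by blast
  show ?thesis
  proof (rule syzygy_mapI)
    show "(\<lambda>x. f1 x \<ominus>\<^bsub>T\<^esub> g1 x) \<in> Hom S T" using d1 d2 f0 g0 by (intro hom_minus) simp_all
    show "(\<lambda>x. f0 x \<ominus>\<^bsub>Q\<^esub> g0 x) \<in> Hom P Q" using d1 d2 f0 g0 by (intro hom_minus) simp_all
  qed (use f0 g0 d1(1-3) d2(1-3) in \<open>simp_all add: hom_simps[OF d2(6)] hom_simps[OF d2(5)]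
      hom_simps(1)[OF f0(1)] hom_simps(1)[OF f0(2)] hom_simps(1)[OF g0(1)] hom_simps(1)[OF g0(2)]\<close>)
qed

lemma syzygy_map_stable_eq:
  assumes "proj_pres S P A i p" "proj_pres T Q B j q" "syzygy_map S P i p T Q j q f f1"
      "syzygy_map S P i p T Q j q g g1" "stable_eq A B f g"
  shows "stable_eq S T f1 g1"
proof -
  have fg: "f \<in> Hom A B" "g \<in> Hom A B" "proj_factor A B (\<lambda>x. f x \<ominus>\<^bsub>B\<^esub> g x)" using assms(5)
      unfolding stable_eq_def by blast+
  then have "proj_factor S T (\<lambda>x. f1 x \<ominus>\<^bsub>T\<^esub> g1 x)"
    using syzygy_map_proj_factor[OF assms(1,2) syzygy_map_minus[OF assms(1-4)]] by blast
  then show ?thesis unfolding stable_eq_def using assms(3,4) unfolding syzygy_map_def by blast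
qed

lemma syzygy_map_comp:
  assumes "syzygy_map S P i p T Q j q f f1" "syzygy_map T Q j q U V k r g g1" "i \<in> Hom S P"
  shows "syzygy_map S P i p U V k r (\<lambda>x. g (f x)) (\<lambda>x. g1 (f1 x))"
proof -
  obtain f0 where f0: "f1 \<in> Hom S T" "f0 \<in> Hom P Q" "\<And>x. x \<in> carrier P \<Longrightarrow> q (f0 x) = f (p x)"
    "\<And>s. s \<in> carrier S \<Longrightarrow> j (f1 s) = f0 (i s)" using syzygy_mapE[OF assms(1)] by blast
  obtain g0 where g0: "g1 \<in> Hom T U" "g0 \<in> Hom Q V" "\<And>x. x \<in> carrier Q \<Longrightarrow> r (g0 x) = g (q x)"
    "\<And>s. s \<in> carrier T \<Longrightarrow> k (g1 s) = g0 (j s)" using syzygy_mapE[OF assms(2)] by blast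
  show ?thesis
    by (rule syzygy_mapI[OF hom_comp[OF f0(1) g0(1)] hom_comp[OF f0(2) g0(2)]])
      (simp_all add: f0(3,4) g0(3,4) hom_simps(1)[OF f0(1)] hom_simps(1)[OF f0(2)])
qed

lemma syzygy_map_id: "syzygy_map S P i p S P i p (\<lambda>x. x) (\<lambda>x. x)"
  by (rule syzygy_mapI[OF hom_id hom_id]) simp_all

section \<open>Stable isomorphisms\<close>

definition stable_iso where
  "stable_iso A B f \<longleftrightarrow> f \<in> Hom A B \<and>
    (\<exists>g \<in> Hom B A. stable_eq A A (\<lambda>x. g (f x)) (\<lambda>x. x) \<and> stable_eq B B (\<lambda>x. f (g x)) (\<lambda>x. x))"

lemma stable_iso_syzygy_map:
  assumes p1: "proj_pres S P A i p" and p2: "proj_pres T Q B j q" and syzygy_map: "syzygy_map S P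
      i p T Q j q f f1" and f: "stable_iso A B f"
  shows "stable_iso S T f1"
proof -
  obtain g where g: "g \<in> Hom B A" "stable_eq A A (\<lambda>x. g (f x)) (\<lambda>x. x)" "stable_eq B B (\<lambda>x. f (g
      x)) (\<lambda>x. x)"
    using f unfolding stable_iso_def by blast
  obtain g1 where g1: "syzygy_map T Q j q S P i p g g1" using syzygy_map_ex[OF p2 p1 g(1)] by blast
  have "stable_eq S S (\<lambda>x. g1 (f1 x)) (\<lambda>x. x)"
    by (rule syzygy_map_stable_eq[OF p1 p1 syzygy_map_comp[OF syzygy_map g1 proj_presD(5)[OF p1]]
        syzygy_map_id g(2)])
  moreover have "stable_eq T T (\<lambda>x. f1 (g1 x)) (\<lambda>x. x)"
    by (rule syzygy_map_stable_eq[OF p2 p2 syzygy_map_comp[OF g1 syzygy_map proj_presD(5)[OF p2]]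
        syzygy_map_id g(3)])
  moreover have "g1 \<in> Hom T S" "f1 \<in> Hom S T" using g1 syzygy_map unfolding syzygy_map_def by blast+
  ultimately show ?thesis unfolding stable_iso_def by blast
qed

lemma stable_isoE:
  assumes "stable_iso A B f"
  obtains g where "f \<in> Hom A B" "g \<in> Hom B A" "stable_eq A A (\<lambda>x. g (f x)) (\<lambda>x. x)" "stable_eq B B
      (\<lambda>x. f (g x)) (\<lambda>x. x)"
  using assms unfolding stable_iso_def by (elim conjE bexE)

lemma stable_isoI:
  "\<lbrakk>f \<in> Hom A B; g \<in> Hom B A; stable_eq A A (\<lambda>x. g (f x)) (\<lambda>x. x); stable_eq B B (\<lambda>x. f (g x))
      (\<lambda>x. x)\<rbrakk> \<Longrightarrow> stable_iso A B f"
  unfolding stable_iso_def by (intro conjI bexI)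

lemma stable_iso_comp:
  assumes "stable_iso A B f" "stable_iso B C g" "A \<in> Ob" "B \<in> Ob" "C \<in> Ob"
  shows "stable_iso A C (\<lambda>x. g (f x))"
proof -
  obtain f' where f: "f \<in> Hom A B" "f' \<in> Hom B A" "stable_eq A A (\<lambda>x. f' (f x)) (\<lambda>x. x)"
      "stable_eq B B (\<lambda>x. f (f' x)) (\<lambda>x. x)"
    using stable_isoE[OF assms(1)] .
  obtain g' where g: "g \<in> Hom B C" "g' \<in> Hom C B" "stable_eq B B (\<lambda>x. g' (g x)) (\<lambda>x. x)"
      "stable_eq C C (\<lambda>x. g (g' x)) (\<lambda>x. x)"
    using stable_isoE[OF assms(2)] .
  have "stable_eq A A (\<lambda>x. f' (g' (g (f x)))) (\<lambda>x. f' (f x))"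
    using stable_eq_comp[OF stable_eq_comp[OF stable_eq_refl[OF _ _ f(1)] g(3)] stable_eq_refl[OF
        _ _ f(2)]] assms by blast
  then have 1: "stable_eq A A (\<lambda>x. f' (g' (g (f x)))) (\<lambda>x. x)" by (rule stable_eq_trans[OF _ f(3)
      assms(3,3)])
  have "stable_eq C C (\<lambda>x. g (f (f' (g' x)))) (\<lambda>x. g (g' x))"
    using stable_eq_comp[OF stable_eq_comp[OF stable_eq_refl[OF _ _ g(2)] f(4)] stable_eq_refl[OF
        _ _ g(1)]] assms by blast
  then have 2: "stable_eq C C (\<lambda>x. g (f (f' (g' x)))) (\<lambda>x. x)" by (rule stable_eq_trans[OF _ g(4)
      assms(5,5)])
  show ?thesis by (rule stable_isoI[OF hom_comp[OF f(1) g(1)] hom_comp[OF g(2) f(2)] 1 2])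
qed

lemma stable_iso_stable_eq:
  assumes "stable_iso A B f" "stable_eq A B f f'" "A \<in> Ob" "B \<in> Ob"
  shows "stable_iso A B f'"
proof -
  obtain g where g: "f \<in> Hom A B" "g \<in> Hom B A" "stable_eq A A (\<lambda>x. g (f x)) (\<lambda>x. x)" "stable_eq B
      B (\<lambda>x. f (g x)) (\<lambda>x. x)"
    using stable_isoE[OF assms(1)] .
  have s: "stable_eq A B f' f" by (rule stable_eq_sym[OF assms(2,3,4)])
  have 1: "stable_eq A A (\<lambda>x. g (f' x)) (\<lambda>x. g (f x))"
    by (rule stable_eq_comp[OF s stable_eq_refl[OF assms(4,3) g(2)] assms(3,4,3)])
  have 2: "stable_eq B B (\<lambda>x. f' (g x)) (\<lambda>x. f (g x))"
    by (rule stable_eq_comp[OF stable_eq_refl[OF assms(4,3) g(2)] s assms(4,3,4)])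
  have "f' \<in> Hom A B" using assms(2) unfolding stable_eq_def by blast
  then show ?thesis using g(2) stable_eq_trans[OF 1 g(3) assms(3,3)] stable_eq_trans[OF 2 g(4)
      assms(4,4)] by (intro stable_isoI)
qed

lemma stable_iso_inverse:
  assumes "stable_iso A B f"
  shows "\<exists>g. stable_iso B A g \<and> stable_eq A A (\<lambda>x. g (f x)) (\<lambda>x. x) \<and> stable_eq B B (\<lambda>x. f (g x))
      (\<lambda>x. x)"
proof -
  obtain g where g: "f \<in> Hom A B" "g \<in> Hom B A" "stable_eq A A (\<lambda>x. g (f x)) (\<lambda>x. x)" "stable_eq B
      B (\<lambda>x. f (g x)) (\<lambda>x. x)"
    using stable_isoE[OF assms(1)] .
  then have "stable_iso B A g" by (intro stable_isoI)
  then show ?thesis using g by blast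
qed

lemma stable_iso_cancel:
  assumes "stable_iso A C (\<lambda>x. g (f x))" "stable_iso B C g" "f \<in> Hom A B" "A \<in> Ob" "B \<in> Ob" "C \<in> Ob"
  shows "stable_iso A B f"
proof -
  obtain g' where g': "stable_iso C B g'" "stable_eq B B (\<lambda>x. g' (g x)) (\<lambda>x. x)" using
      stable_iso_inverse[OF assms(2)] by blast
  have 1: "stable_iso A B (\<lambda>x. g' (g (f x)))" by (rule stable_iso_comp[OF assms(1) g'(1)
      assms(4,6,5)])
  have "stable_eq A B (\<lambda>x. g' (g (f x))) f"
    by (rule stable_eq_comp[OF stable_eq_refl[OF assms(4,5,3)] g'(2) assms(4,5,5)])
  then show ?thesis by (rule stable_iso_stable_eq[OF 1 _ assms(4,5)])
qed

lemma stable_iso_iso_pair: "\<lbrakk>iso_pair A B f g; A \<in> Ob; B \<in> Ob\<rbrakk> \<Longrightarrow> stable_iso A B f"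
  by (rule stable_isoI[of f A B g]) (auto simp: iso_pairD hom_id intro!: stable_eqI hom_comp[of
      f A B g A] hom_comp[of g B A f B])

lemma stable_iso_id: "A \<in> Ob \<Longrightarrow> stable_iso A A (\<lambda>x. x)"
  using stable_iso_iso_pair[OF iso_pair_refl] by blast

lemma stable_iso_projectives:
  assumes "projective R A" "projective R B" "A \<in> Ob" "B \<in> Ob"
  shows "stable_iso A B (\<lambda>_. \<zero>\<^bsub>B\<^esub>)"
proof (rule stable_isoI)
  show "(\<lambda>_. \<zero>\<^bsub>B\<^esub>) \<in> Hom A B" "(\<lambda>_. \<zero>\<^bsub>A\<^esub>) \<in> Hom B A" using assms by (auto intro: hom_zero)
  show "stable_eq A A (\<lambda>x. \<zero>\<^bsub>A\<^esub>) (\<lambda>x. x)" "stable_eq B B (\<lambda>x. \<zero>\<^bsub>B\<^esub>) (\<lambda>x. x)"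
    using stable_eq_sym projective_iff_stable_eq assms by blast+
qed

lemma stable_iso_sum:
  assumes b: "biproduct M Y A i j p q" "biproduct N Y' B i' j' p' q'" and f: "stable_iso M N f"
      "stable_iso Y Y' g"
    and Ob: "M \<in> Ob" "Y \<in> Ob" "A \<in> Ob" "N \<in> Ob" "Y' \<in> Ob" "B \<in> Ob"
  shows "stable_iso A B (\<lambda>x. i' (f (p x)) \<oplus>\<^bsub>B\<^esub> j' (g (q x)))"
proof -
  obtain f' where f': "f \<in> Hom M N" "f' \<in> Hom N M" "stable_eq M M (\<lambda>x. f' (f x)) (\<lambda>x. x)"
      "stable_eq N N (\<lambda>x. f (f' x)) (\<lambda>x. x)"
    using stable_isoE[OF f(1)] .
  obtain g' where g': "g \<in> Hom Y Y'" "g' \<in> Hom Y' Y" "stable_eq Y Y (\<lambda>x. g' (g x)) (\<lambda>x. x)"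
      "stable_eq Y' Y' (\<lambda>x. g (g' x)) (\<lambda>x. x)"
    using stable_isoE[OF f(2)] .
  \<comment> \<open>Stated for arbitrary data, so that exchanging the two sides gives the statement
    for the inverse map.\<close>
  have comb: "(\<lambda>x. i' (f (p x)) \<oplus>\<^bsub>B\<^esub> j' (g (q x))) \<in> Hom A B"
      "stable_eq A A (\<lambda>x. i (f' (p' (i' (f (p x)) \<oplus>\<^bsub>B\<^esub> j' (g (q x))))) \<oplus>\<^bsub>A\<^esub> j (g' (q' (i' (f (p
          x)) \<oplus>\<^bsub>B\<^esub> j' (g (q x)))))) (\<lambda>x. x)"
    if b: "biproduct M Y A i j p q" "biproduct N Y' B i' j' p' q'"
      and f': "f \<in> Hom M N" "f' \<in> Hom N M" "stable_eq M M (\<lambda>x. f' (f x)) (\<lambda>x. x)"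
      and g': "g \<in> Hom Y Y'" "g' \<in> Hom Y' Y" "stable_eq Y Y (\<lambda>x. g' (g x)) (\<lambda>x. x)"
      and Ob: "M \<in> Ob" "Y \<in> Ob" "A \<in> Ob" "N \<in> Ob" "Y' \<in> Ob" "B \<in> Ob"
    for M Y A N Y' B :: "('a, 'a list) module" and i j p q i' j' p' q' f f' g g'
  proof -
    note h = biproductD(1-4)[OF b(1)] biproductD(1-4)[OF b(2)]
    note [simp] = biproduct_simps[OF b(1)] biproduct_simps[OF b(2)] hom_simps[OF f'(1)]
        hom_simps[OF f'(2)]
      hom_simps[OF g'(1)] hom_simps[OF g'(2)] Ob
    show F: "(\<lambda>x. i' (f (p x)) \<oplus>\<^bsub>B\<^esub> j' (g (q x))) \<in> Hom A B"
      by (rule hom_add[OF _ hom_comp[OF hom_comp[OF h(3) f'(1)] h(5)] hom_comp[OF hom_comp[OF h(4)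
          g'(1)] h(6)]]) simp
    have G: "(\<lambda>x. i (f' (p' x)) \<oplus>\<^bsub>A\<^esub> j (g' (q' x))) \<in> Hom B A"
      by (rule hom_add[OF _ hom_comp[OF hom_comp[OF h(7) f'(2)] h(1)] hom_comp[OF hom_comp[OF h(8)
          g'(2)] h(2)]]) simp
    have "stable_eq A A (\<lambda>x. i (f' (f (p x)))) (\<lambda>x. i (p x))"
      using stable_eq_comp[OF stable_eq_comp[OF stable_eq_refl[OF _ _ h(3)] f'(3)]
          stable_eq_refl[OF _ _ h(1)]] Ob by blast
    moreover have "stable_eq A A (\<lambda>x. j (g' (g (q x)))) (\<lambda>x. j (q x))"
      using stable_eq_comp[OF stable_eq_comp[OF stable_eq_refl[OF _ _ h(4)] g'(3)]
          stable_eq_refl[OF _ _ h(2)]] Ob by blast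
    ultimately have 1: "stable_eq A A (\<lambda>x. i (f' (f (p x))) \<oplus>\<^bsub>A\<^esub> j (g' (g (q x)))) (\<lambda>x. i (p x)
        \<oplus>\<^bsub>A\<^esub> j (q x))"
      using stable_eq_add Ob by blast
    have 2: "stable_eq A A (\<lambda>x. i (p x) \<oplus>\<^bsub>A\<^esub> j (q x)) (\<lambda>x. x)"
      by (rule stable_eqI[OF Ob(3,3) hom_add[OF _ hom_comp[OF h(3,1)] hom_comp[OF h(4,2)]]
          hom_id]) simp_all
    have 3: "stable_eq A A (\<lambda>x. i (f' (p' (i' (f (p x)) \<oplus>\<^bsub>B\<^esub> j' (g (q x))))) \<oplus>\<^bsub>A\<^esub> j (g' (q' (i' (f
        (p x)) \<oplus>\<^bsub>B\<^esub> j' (g (q x))))))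
       (\<lambda>x. i (f' (f (p x))) \<oplus>\<^bsub>A\<^esub> j (g' (g (q x))))"
      using 1 by (intro stable_eqI[OF Ob(3,3) hom_comp[OF F G]]) (simp_all add: stable_eq_def)
    show "stable_eq A A (\<lambda>x. i (f' (p' (i' (f (p x)) \<oplus>\<^bsub>B\<^esub> j' (g (q x))))) \<oplus>\<^bsub>A\<^esub> j (g' (q' (i' (f (p
        x)) \<oplus>\<^bsub>B\<^esub> j' (g (q x)))))) (\<lambda>x. x)"
      using stable_eq_trans[OF 3 stable_eq_trans[OF 1 2]] Ob by blast
  qed
  show ?thesis
    by (rule stable_isoI[OF comb(1)[OF b f'(1-3) g'(1-3) Ob] comb(1)[OF b(2,1) f'(2,1,4) g'(2,1,4)
        Ob(4-6,1-3)]
        comb(2)[OF b f'(1-3) g'(1-3) Ob] comb(2)[OF b(2,1) f'(2,1,4) g'(2,1,4) Ob(4-6,1-3)]])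
qed

text \<open>Stably isomorphic modules become isomorphic after adding projectives. As
  \<open>1 - g f = v u\<close> factors through a projective \<open>Q\<close>, the map
  \<open>(f, u)\<close> from \<open>A\<close> to \<open>B \<oplus> Q\<close> is split by
  \<open>(g, v)\<close>, and the complement \<open>E\<close> is projective because it vanishes
  stably. The last clause keeps track of the component \<open>f\<close> for
  \<open>projective_Syz_coker\<close>.\<close>

lemma stable_iso_biproduct:
  assumes f: "stable_iso A B f" and Ob: "A \<in> Ob" "B \<in> Ob"
  shows "\<exists>Q \<in> Ob. \<exists>E \<in> Ob. \<exists>X \<in> Ob. projective R Q \<and> projective R E \<and>
    (\<exists>i j p q i' j' p' q'. biproduct B Q X i j p q \<and> biproduct A E X i' j' p' q' \<and> (\<forall>a \<in> carrier
        A. p (i' a) = f a))"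
proof -
  obtain g where g: "f \<in> Hom A B" "g \<in> Hom B A" "stable_eq A A (\<lambda>x. g (f x)) (\<lambda>x. x)" "stable_eq B
      B (\<lambda>x. f (g x)) (\<lambda>x. x)"
    using stable_isoE[OF f] .
  have "proj_factor A A (\<lambda>x. x \<ominus>\<^bsub>A\<^esub> g (f x))" using stable_eq_sym[OF g(3)] Ob unfolding
      stable_eq_def by blast
  then obtain Q u v where Q: "Q \<in> Ob" "projective R Q" "u \<in> Hom A Q" "v \<in> Hom Q A"
    "\<And>x. x \<in> carrier A \<Longrightarrow> x \<ominus>\<^bsub>A\<^esub> g (f x) = v (u x)" by (elim proj_factorE) blast
  obtain X i j p q where X: "X \<in> Ob" "biproduct B Q X i j p q" using biproduct_ex[OF Ob(2) Q(1)]
      by blast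
  note h = biproductD(1-4)[OF X(2)]
  note [simp] = biproduct_simps[OF X(2)] hom_simps[OF g(1)] hom_simps[OF g(2)] hom_simps[OF Q(3)]
      hom_simps[OF Q(4)] X(1) Q(1) Ob
  define i' where "i' a = i (f a) \<oplus>\<^bsub>X\<^esub> j (u a)" for a
  define p' where "p' x = g (p x) \<oplus>\<^bsub>A\<^esub> v (q x)" for x
  have i': "i' \<in> Hom A X" unfolding i'_def
    by (rule hom_add[OF _ hom_comp[OF g(1) h(1)] hom_comp[OF Q(3) h(2)]]) simp
  have p': "p' \<in> Hom X A" unfolding p'_def
    by (rule hom_add[OF _ hom_comp[OF h(3) g(2)] hom_comp[OF h(4) Q(4)]]) simp
  have "p' (i' a) = a" if a: "a \<in> carrier A" for a
  proof -
    have "p' (i' a) = g (f a) \<oplus>\<^bsub>A\<^esub> (a \<ominus>\<^bsub>A\<^esub> g (f a))" unfolding p'_def i'_def using a Q(5)[OF a] by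
        simp
    also have "\<dots> = a" using a by - (rule represents_eqI, (rule represents_intros | simp add:
        algebra_simps)+)
    finally show ?thesis .
  qed
  then obtain E j' q' where E: "E \<in> Ob" "biproduct A E X i' j' p' q'" using retract_biproduct[OF
      X(1) Ob(1) i' p'] by blast
  note h' = biproductD(1-4)[OF E(2)]
  have j: "proj_factor A X (\<lambda>a. j (u a))"
    by (rule proj_factorI[OF hom_comp[OF Q(3) h(2)] Q(1,2,3) h(2)]) simp
  have vq: "proj_factor X A (\<lambda>x. v (q x))"
    by (rule proj_factorI[OF hom_comp[OF h(4) Q(4)] Q(1,2) h(4) Q(4)]) simp
  have z: "stable_eq A X (\<lambda>a. j (u a)) (\<lambda>_. \<zero>\<^bsub>X\<^esub>)" using j stable_eq_zero_iff_proj_factor[OF Ob(1)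
      X(1)] unfolding proj_factor_def by blast
  have "stable_eq A X (\<lambda>a. i (f a) \<oplus>\<^bsub>X\<^esub> j (u a)) (\<lambda>a. i (f a) \<oplus>\<^bsub>X\<^esub> \<zero>\<^bsub>X\<^esub>)"
    by (rule stable_eq_add[OF stable_eq_refl[OF _ _ hom_comp[OF g(1) h(1)]] z]) simp_all
  moreover have "stable_eq A X (\<lambda>a. i (f a) \<oplus>\<^bsub>X\<^esub> \<zero>\<^bsub>X\<^esub>) (\<lambda>a. i (f a))"
    by (rule stable_eqI[OF Ob(1) X(1) hom_add[OF _ hom_comp[OF g(1) h(1)] hom_zero] hom_comp[OF
        g(1) h(1)]]) simp_all
  ultimately have 1: "stable_eq A X i' (\<lambda>a. i (f a))" unfolding i'_def using stable_eq_trans Ob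
      X(1) by blast
  have z: "stable_eq X A (\<lambda>x. v (q x)) (\<lambda>_. \<zero>\<^bsub>A\<^esub>)" using vq stable_eq_zero_iff_proj_factor[OF X(1)
      Ob(1)] unfolding proj_factor_def by blast
  have "stable_eq X A (\<lambda>x. g (p x) \<oplus>\<^bsub>A\<^esub> v (q x)) (\<lambda>x. g (p x) \<oplus>\<^bsub>A\<^esub> \<zero>\<^bsub>A\<^esub>)"
    by (rule stable_eq_add[OF stable_eq_refl[OF _ _ hom_comp[OF h(3) g(2)]] z]) simp_all
  moreover have "stable_eq X A (\<lambda>x. g (p x) \<oplus>\<^bsub>A\<^esub> \<zero>\<^bsub>A\<^esub>) (\<lambda>x. g (p x))"
    by (rule stable_eqI[OF X(1) Ob(1) hom_add[OF _ hom_comp[OF h(3) g(2)] hom_zero] hom_comp[OF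
        h(3) g(2)]]) simp_all
  ultimately have 2: "stable_eq X A p' (\<lambda>x. g (p x))" unfolding p'_def using stable_eq_trans Ob
      X(1) by blast
  \<comment> \<open>The idempotent \<open>i' p'\<close> onto \<open>A\<close> is stably
    \<open>i f g p\<close>, hence \<open>i p\<close>, hence the identity, since \<open>j q\<close>
    factors through \<open>Q\<close>. On \<open>E\<close>, where \<open>p'\<close> vanishes, this
    makes the identity stably zero.\<close>
  have 3: "stable_eq X X (\<lambda>x. i' (p' x)) (\<lambda>x. i (f (g (p x))))" using stable_eq_comp[OF 2 1] Ob
      X(1) by blast
  have 4: "stable_eq X X (\<lambda>x. i (f (g (p x)))) (\<lambda>x. i (p x))"
    using stable_eq_comp[OF stable_eq_comp[OF stable_eq_refl[OF _ _ h(3)] g(4)] stable_eq_refl[OF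
        _ _ h(1)]] Ob X(1) by blast
  have 5: "stable_eq X X (\<lambda>x. i' (p' x)) (\<lambda>x. i (p x))" using stable_eq_trans[OF 3 4] X(1) by blast
  have "proj_factor X X (\<lambda>x. i' (p' x) \<ominus>\<^bsub>X\<^esub> i (p x))" using 5 unfolding stable_eq_def by blast
  moreover have "proj_factor X X (\<lambda>x. j (q x))"
    by (rule proj_factorI[OF hom_comp[OF h(4) h(2)] Q(1,2) h(4) h(2)]) simp
  ultimately have "proj_factor X X (\<lambda>x. (i' (p' x) \<ominus>\<^bsub>X\<^esub> i (p x)) \<oplus>\<^bsub>X\<^esub> \<ominus>\<^bsub>X\<^esub> j (q x))"
    using proj_factor_add proj_factor_neg X(1) by blast
  note F = proj_factor_comp_right[OF proj_factor_comp_left[OF this h'(4)] h'(2)]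
  note [simp] = biproduct_simps[OF E(2)] E(1)
  have "proj_factor E E (\<lambda>x. \<ominus>\<^bsub>E\<^esub> x)"
  proof (rule proj_factor_cong[OF F])
    fix x assume x: "x \<in> carrier E"
    have "i (p (j' x)) = j' x \<ominus>\<^bsub>X\<^esub> j (q (j' x))" using biproduct_minus(2)[OF X(2)] x by simp
    then have "(i' (p' (j' x)) \<ominus>\<^bsub>X\<^esub> i (p (j' x))) \<oplus>\<^bsub>X\<^esub> \<ominus>\<^bsub>X\<^esub> j (q (j' x)) = (\<zero>\<^bsub>X\<^esub> \<ominus>\<^bsub>X\<^esub> (j' x \<ominus>\<^bsub>X\<^esub> j
        (q (j' x)))) \<oplus>\<^bsub>X\<^esub> \<ominus>\<^bsub>X\<^esub> j (q (j' x))"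
      using x by simp
    also have "\<dots> = \<ominus>\<^bsub>X\<^esub> j' x" using x by - (rule represents_eqI, (rule represents_intros | simp
        add: algebra_simps)+)
    finally show "\<ominus>\<^bsub>E\<^esub> x = q' ((i' (p' (j' x)) \<ominus>\<^bsub>X\<^esub> i (p (j' x))) \<oplus>\<^bsub>X\<^esub> \<ominus>\<^bsub>X\<^esub> j (q (j' x)))" using x
        by simp
  qed (use hom_neg[OF _ _ hom_id, of E] E(1) in simp)
  from proj_factor_neg[OF this E(1,1)] have "proj_factor E E (\<lambda>x. x)"
    by (rule proj_factor_cong) (simp_all add: hom_id, rule sym, rule represents_eqI[of E], (rule
        represents_intros | simp add: algebra_simps)+)
  then have "projective R E" using projective_iff_stable_eq stable_eq_zero_iff_proj_factor hom_id
      E(1) by blast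
  moreover have "p (i' a) = f a" if "a \<in> carrier A" for a unfolding i'_def using that by simp
  ultimately show ?thesis using Q(1,2) E X by blast
qed

section \<open>Classes as invariants of stable isomorphism\<close>

lemma IT_class_projective: "\<lbrakk>projective R P; P \<in> Ob\<rbrakk> \<Longrightarrow> IT_class R P = 0"
  using keys_IT_class[of P] summand_projective by (auto simp: ind_nonproj_def
      keys_eq_empty[symmetric])

lemma IT_class_stable_iso:
  assumes "stable_iso A B f" "A \<in> Ob" "B \<in> Ob" shows "IT_class R A = IT_class R B"
proof -
  obtain Q E X i j p q i' j' p' q' where *: "Q \<in> Ob" "E \<in> Ob" "X \<in> Ob" "projective R Q"
      "projective R E"
    "biproduct B Q X i j p q" "biproduct A E X i' j' p' q'" using stable_iso_biproduct[OF assms]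
        by blast
  then show ?thesis using IT_class_biproduct[OF *(6)] IT_class_biproduct[OF *(7)]
      IT_class_projective assms by simp
qed

lemma decomp_projective:
  "\<lbrakk>decomp X Ms; X \<in> Ob; \<forall>M \<in> set Ms. projective R M\<rbrakk> \<Longrightarrow> projective R X"
proof (induction Ms arbitrary: X)
  case Nil then show ?case using projective_zero[of X] by simp
next
  case (Cons M Ms)
  obtain Y i j p q where Y: "Y \<in> Ob" "biproduct M Y X i j p q" "decomp Y Ms"
    using decomp_ConsE[OF Cons.prems(1)] .
  then show ?case using projective_biproduct[OF Y(2)] Cons.IH[OF Y(3,1)] Cons.prems(3) by simp
qed

lemma IT_class_eq_0_iff:
  assumes "X \<in> Ob" shows "IT_class R X = 0 \<longleftrightarrow> projective R X"
proof
  assume 0: "IT_class R X = 0"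
  obtain Ms where Ms: "set Ms \<subseteq> indecs" "decomp X Ms" using decomp_exists assms by blast
  have "nonproj_class Ms = 0" using IT_class_eq[OF assms Ms(2,1)] 0 by simp
  then have "\<forall>M \<in> set Ms. projective R M" using keys_nonproj_class[of Ms] by auto
  then show "projective R X" using decomp_projective Ms assms by blast
qed (use IT_class_projective assms in blast)

text \<open>Induction on the terms of \<open>A\<close>. A projective term is stably zero; a
  non-projective one lies in the support of \<open>[B]\<close>, hence splits off \<open>B\<close>
  too, and its class cancels on both sides.\<close>

lemma IT_class_eq_imp_stable_iso:
  "\<lbrakk>decomp A Ms; set Ms \<subseteq> indecs; A \<in> Ob; B \<in> Ob; IT_class R A = IT_class R B\<rbrakk> \<Longrightarrow> \<exists>f. stable_iso A
      B f"
proof (induction Ms arbitrary: A B)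
  case Nil
  then have "projective R A" using projective_zero[of A] by simp
  moreover have "projective R B" using IT_class_eq_0_iff Nil \<open>projective R A\<close> by metis
  ultimately show ?case using stable_iso_projectives Nil by blast
next
  case (Cons M Ms)
  obtain Y i j p q where Y: "Y \<in> Ob" "biproduct M Y A i j p q" "decomp Y Ms"
    using decomp_ConsE[OF Cons.prems(1)] .
  have M: "M \<in> indecs" "M \<in> Ob" using Cons.prems(2) indecsD by auto
  have cA: "IT_class R A = IT_class R M + IT_class R Y" using IT_class_biproduct[OF Y(2) M(2) Y(1)
      Cons.prems(3)] .
  show ?case
  proof (cases "projective R M")
    case True
    then have "IT_class R Y = IT_class R B" using cA IT_class_projective M(2) Cons.prems(5) by simp
    then obtain f where f: "stable_iso Y B f" using Cons.IH[OF Y(3) _ Y(1)] Cons.prems by auto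
    \<comment> \<open>The zero module stands opposite the projective term \<open>M\<close>, so that
      \<open>stable_iso_sum\<close> applies to \<open>M \<oplus> Y\<close> and
      \<open>Z \<oplus> B\<close>.\<close>
    obtain Z where Z: "Z \<in> Ob" "zero_module Z" using Ob_zero by blast
    obtain W i' j' p' q' where W: "W \<in> Ob" "biproduct Z B W i' j' p' q'" using biproduct_ex[OF
        Z(1) Cons.prems(4)] by blast
    have "stable_iso A W (\<lambda>x. i' ((\<lambda>_. \<zero>\<^bsub>Z\<^esub>) (p x)) \<oplus>\<^bsub>W\<^esub> j' (f (q x)))"
      using True projective_zero[OF Z(2)] M Y Z W Cons.prems f by (intro stable_iso_sum[OF Y(2)
          W(2) stable_iso_projectives]) simp_all
    moreover have "iso_pair B W j' q'" using biproduct_zero_left[OF W(2) Z(2)] Z W Cons.prems by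
        simp
    then have "stable_iso W B q'" using stable_iso_iso_pair[OF iso_pair_sym] W(1) Cons.prems(4) by
        blast
    ultimately show ?thesis using stable_iso_comp Cons.prems(3,4) W(1) by blast
  next
    case False
    have "Poly_Mapping.lookup (IT_class R A) (iso_class R M) > 0"
      using IT_class_nonneg[OF Y(1), of "iso_class R M"] cA IT_class_indecs[OF M(1)] False by
          (simp add: lookup_add)
    then have "iso_class R M \<in> Poly_Mapping.keys (IT_class R B)" using Cons.prems(5) by (simp add:
        in_keys_iff)
    then obtain N where N: "N \<in> ind_nonproj R" "summand N B" "iso_class R M = iso_class R N"
      unfolding keys_IT_class[OF Cons.prems(4)] by blast
    have N': "N \<in> indecs" "N \<in> Ob" "\<not> projective R N" using N(1) by (auto simp: ind_nonproj_def
        indecs_def)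
    obtain Y' i' j' p' q' where Y': "Y' \<in> Ob" "biproduct N Y' B i' j' p' q'" using N(2) unfolding
        summand_def by blast
    have "IT_class R B = IT_class R N + IT_class R Y'" using IT_class_biproduct[OF Y'(2) N'(2)
        Y'(1) Cons.prems(4)] .
    then have "IT_class R Y = IT_class R Y'"
      using cA Cons.prems(5) IT_class_indecs[OF M(1)] IT_class_indecs[OF N'(1)] False N'(3) N(3)
          by simp
    then obtain f where f: "stable_iso Y Y' f" using Cons.IH[OF Y(3) _ Y(1) Y'(1)] Cons.prems(2)
        by auto
    obtain \<phi> \<psi> where "iso_pair M N \<phi> \<psi>" using N(3) iso_class_eq_iff M(2) N'(2) by blast
    then have "stable_iso M N \<phi>" using stable_iso_iso_pair M N' by blast
    then show ?thesis using stable_iso_sum[OF Y(2) Y'(2) _ f] M(2) Y(1) N'(2) Y'(1)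
        Cons.prems(3,4) by blast
  qed
qed

lemma stable_iso_iff_IT_class: "\<lbrakk>A \<in> Ob; B \<in> Ob\<rbrakk> \<Longrightarrow> (\<exists>f. stable_iso A B f) \<longleftrightarrow> IT_class R A =
    IT_class R B"
  using IT_class_stable_iso IT_class_eq_imp_stable_iso decomp_exists by metis

lemma proj_pres_stable_iso:
  assumes "proj_pres S P A i p" "proj_pres T Q B j q" "stable_iso A B f"
  shows "\<exists>f1. stable_iso S T f1"
proof -
  have "f \<in> Hom A B" using assms(3) unfolding stable_iso_def by blast
  then obtain f1 where "syzygy_map S P i p T Q j q f f1" using syzygy_map_ex[OF assms(1,2)] by blast
  then show ?thesis using stable_iso_syzygy_map[OF assms(1,2) _ assms(3)] by blast
qed

text \<open>A stable form of Schanuel's lemma: a lift of the identity of \<open>X\<close> induces a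
  stable isomorphism between the two kernels.\<close>

lemma IT_class_proj_pres:
  assumes "proj_pres S P X i p" shows "IT_class R (Syz R X) = IT_class R S"
proof -
  note d = proj_presD[OF assms]
  obtain P' i' p' where 1: "proj_pres (Syz R X) P' X i' p'" using Syz_proj_pres[OF d(3)] by blast
  then obtain f where "stable_iso (Syz R X) S f" using proj_pres_stable_iso[OF 1 assms
      stable_iso_id[OF d(3)]] by blast
  then show ?thesis using IT_class_stable_iso d by simp
qed

lemma IT_class_Syz_stable_iso:
  assumes "stable_iso A B f" "A \<in> Ob" "B \<in> Ob" shows "IT_class R (Syz R A) = IT_class R (Syz R B)"
proof -
  obtain P i p where 1: "proj_pres (Syz R A) P A i p" using Syz_proj_pres[OF assms(2)] by blast
  obtain Q j q where 2: "proj_pres (Syz R B) Q B j q" using Syz_proj_pres[OF assms(3)] by blast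
  show ?thesis using proj_pres_stable_iso[OF 1 2 assms(1)] IT_class_stable_iso assms by auto
qed

lemma Syz_projective:
  assumes "projective R X" "X \<in> Ob" shows "projective R (Syz R X)"
proof -
  obtain P i p where 1: "proj_pres (Syz R X) P X i p" using Syz_proj_pres[OF assms(2)] by blast
  have "proj_factor (Syz R X) (Syz R X) (\<lambda>x. x)"
    using syzygy_map_proj_factor[OF 1 1 syzygy_map_id] proj_factor_projective[OF hom_id] assms by
        blast
  then show ?thesis using projective_iff_stable_eq stable_eq_zero_iff_proj_factor hom_id assms(2)
      Syz_Ob by blast
qed

lemma proj_pres_sum:
  assumes p1: "proj_pres S P A i1 p1" and p2: "proj_pres T Q B i2 p2"
    and b: "biproduct A B X iX jX pX qX" "biproduct S T U iU jU pU qU" "biproduct P Q V iV jV pV qV"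
    and Ob: "X \<in> Ob" "U \<in> Ob" "V \<in> Ob"
  shows "proj_pres U V X (\<lambda>u. iV (i1 (pU u)) \<oplus>\<^bsub>V\<^esub> jV (i2 (qU u))) (\<lambda>v. iX (p1 (pV v)) \<oplus>\<^bsub>X\<^esub> jX (p2
      (qV v)))"
proof -
  note d1 = proj_presD[OF p1] and d2 = proj_presD[OF p2]
  note h1 = biproductD(1-4)[OF b(1)] and h2 = biproductD(1-4)[OF b(2)] and h3 = biproductD(1-4)[OF
      b(3)]
  note [simp] = biproduct_simps[OF b(1)] biproduct_simps[OF b(2)] biproduct_simps[OF b(3)]
      hom_simps[OF d1(5)] hom_simps[OF d1(6)]
    hom_simps[OF d2(5)] hom_simps[OF d2(6)] d1(1-3,7) d2(1-3,7) Ob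
  have "short_exact R U V X (\<lambda>u. iV (i1 (pU u)) \<oplus>\<^bsub>V\<^esub> jV (i2 (qU u))) (\<lambda>v. iX (p1 (pV v)) \<oplus>\<^bsub>X\<^esub> jX
      (p2 (qV v)))"
  proof (rule short_exactI)
    show "(\<lambda>u. iV (i1 (pU u)) \<oplus>\<^bsub>V\<^esub> jV (i2 (qU u))) \<in> Hom U V"
      by (rule hom_add[OF _ hom_comp[OF hom_comp[OF h2(3) d1(5)] h3(1)] hom_comp[OF hom_comp[OF
          h2(4) d2(5)] h3(2)]]) simp
    show "(\<lambda>v. iX (p1 (pV v)) \<oplus>\<^bsub>X\<^esub> jX (p2 (qV v))) \<in> Hom V X"
      by (rule hom_add[OF _ hom_comp[OF hom_comp[OF h3(3) d1(6)] h1(1)] hom_comp[OF hom_comp[OF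
          h3(4) d2(6)] h1(2)]]) simp
  next
    fix v assume v: "v \<in> carrier V" and 0: "iX (p1 (pV v)) \<oplus>\<^bsub>X\<^esub> jX (p2 (qV v)) = \<zero>\<^bsub>X\<^esub>"
    have "pX (iX (p1 (pV v)) \<oplus>\<^bsub>X\<^esub> jX (p2 (qV v))) = p1 (pV v)" "qX (iX (p1 (pV v)) \<oplus>\<^bsub>X\<^esub> jX (p2 (qV
        v))) = p2 (qV v)"
      using v by simp_all
    then have "p1 (pV v) = \<zero>\<^bsub>A\<^esub>" "p2 (qV v) = \<zero>\<^bsub>B\<^esub>" unfolding 0 by simp_all
    then obtain s t where "s \<in> carrier S" "i1 s = pV v" "t \<in> carrier T" "i2 t = qV v"
      using d1(8)[of "pV v"] d2(8)[of "qV v"] v by auto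
    then show "\<exists>a\<in>carrier U. iV (i1 (pU a)) \<oplus>\<^bsub>V\<^esub> jV (i2 (qU a)) = v"
      using v by (intro bexI[of _ "iU s \<oplus>\<^bsub>U\<^esub> jU t"]) simp_all
  next
    fix c assume c: "c \<in> carrier X"
    obtain a b where "a \<in> carrier P" "p1 a = pX c" "b \<in> carrier Q" "p2 b = qX c"
      using d1(9)[of "pX c"] d2(9)[of "qX c"] c by auto
    then show "\<exists>b\<in>carrier V. iX (p1 (pV b)) \<oplus>\<^bsub>X\<^esub> jX (p2 (qV b)) = c"
      using c by (intro bexI[of _ "iV a \<oplus>\<^bsub>V\<^esub> jV b"]) simp_all
  next
    fix u assume u: "u \<in> carrier U" and 0: "iV (i1 (pU u)) \<oplus>\<^bsub>V\<^esub> jV (i2 (qU u)) = \<zero>\<^bsub>V\<^esub>"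
    have "pV (iV (i1 (pU u)) \<oplus>\<^bsub>V\<^esub> jV (i2 (qU u))) = i1 (pU u)" "qV (iV (i1 (pU u)) \<oplus>\<^bsub>V\<^esub> jV (i2 (qU
        u))) = i2 (qU u)"
      using u by simp_all
    then have "i1 (pU u) = \<zero>\<^bsub>P\<^esub>" "i2 (qU u) = \<zero>\<^bsub>Q\<^esub>" unfolding 0 by simp_all
    then have z: "pU u = \<zero>\<^bsub>S\<^esub>" "qU u = \<zero>\<^bsub>T\<^esub>" using d1(10)[of "pU u"] d2(10)[of "qU u"] u by simp_all
    then show "u = \<zero>\<^bsub>U\<^esub>" using biproduct_simps(5)[OF b(2) u] by (simp add: z del:
        biproduct_simps(5)[OF b(2)])
  qed simp_all
  then show ?thesis unfolding proj_pres_def using Ob projective_biproduct[OF b(3) d1(4) d2(4)] by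
      blast
qed

lemma IT_class_Syz_biproduct:
  assumes "biproduct A B X i j p q" "A \<in> Ob" "B \<in> Ob" "X \<in> Ob"
  shows "IT_class R (Syz R X) = IT_class R (Syz R A) + IT_class R (Syz R B)"
proof -
  obtain P i1 p1 where 1: "proj_pres (Syz R A) P A i1 p1" using Syz_proj_pres[OF assms(2)] by blast
  obtain Q i2 p2 where 2: "proj_pres (Syz R B) Q B i2 p2" using Syz_proj_pres[OF assms(3)] by blast
  obtain U iU jU pU qU where U: "U \<in> Ob" "biproduct (Syz R A) (Syz R B) U iU jU pU qU"
    using biproduct_ex[OF Syz_Ob[OF assms(2)] Syz_Ob[OF assms(3)]] by blast
  obtain V iV jV pV qV where V: "V \<in> Ob" "biproduct P Q V iV jV pV qV"
    using biproduct_ex[OF proj_presD(2)[OF 1] proj_presD(2)[OF 2]] by blast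
  have "IT_class R (Syz R X) = IT_class R U"
    by (rule IT_class_proj_pres[OF proj_pres_sum[OF 1 2 assms(1) U(2) V(2) assms(4) U(1) V(1)]])
  then show ?thesis using IT_class_biproduct[OF U(2)] assms U(1) by simp
qed

section \<open>The endomorphism induced by the syzygy operator\<close>

lemma IT_L_add: "IT_L R (x + y) = IT_L R x + IT_L R y"
  by (simp add: IT_L_def frag_extend_add)

lemma IT_L_0: "IT_L R 0 = 0"
  by (simp add: IT_L_def)

text \<open>The representative chosen inside \<open>IT_L\<close> is isomorphic to \<open>M\<close>,
  so its syzygy has the same class.\<close>

lemma IT_L_frag_of:
  assumes "M \<in> Ob" shows "IT_L R (frag_of (iso_class R M)) = IT_class R (Syz R M)"
proof -
  define X where "X = (SOME X. X \<in> iso_class R M)"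
  have "module_iso R M M" using module_iso_iff[of M M] iso_pair_refl[of M] assms by auto
  then have "M \<in> iso_class R M" using assms by (simp add: iso_class_def)
  then have "X \<in> iso_class R M" unfolding X_def by (rule someI)
  then have "X \<in> Ob" "module_iso R M X" by (simp_all add: iso_class_def)
  then obtain f g where "iso_pair M X f g" using module_iso_iff[of M X] assms by auto
  then have "IT_class R (Syz R M) = IT_class R (Syz R X)" using IT_class_Syz_stable_iso
      stable_iso_iso_pair assms \<open>X \<in> Ob\<close> by blast
  then show ?thesis by (simp add: IT_L_def X_def)
qed

lemma IT_L_IT_class:
  assumes "X \<in> Ob" shows "IT_L R (IT_class R X) = IT_class R (Syz R X)"
proof -
  have "IT_L R (nonproj_class Ms) = IT_class R (Syz R X)" if "decomp X Ms" "set Ms \<subseteq> indecs" "X \<in>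
      Ob" for Ms X
    using that
  proof (induction Ms arbitrary: X)
    case Nil
    then have "projective R (Syz R X)" using Syz_projective projective_zero[of X] by simp
    then show ?case using IT_class_projective Nil by (simp add: IT_L_0)
  next
    case (Cons M Ms)
    obtain Y i j p q where Y: "Y \<in> Ob" "biproduct M Y X i j p q" "decomp Y Ms"
      using decomp_ConsE[OF Cons.prems(1)] .
    have M: "M \<in> Ob" using Cons.prems(2) indecsD by auto
    have "IT_class R (Syz R M) = 0" if "projective R M"
      using that IT_class_projective Syz_projective M by simp
    then show ?case
      using IT_class_Syz_biproduct[OF Y(2) M Y(1) Cons.prems(3)] Cons.IH[OF Y(3) _ Y(1)]
          Cons.prems(2) IT_L_frag_of[OF M]
      by (auto simp: IT_L_add IT_L_0)
  qed
  then show ?thesis using decomp_exists[OF assms] IT_class_eq[OF assms] assms by metis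
qed

lemma IT_L_funpow_IT_class:
  "X \<in> Ob \<Longrightarrow> (IT_L R ^^ k) (IT_class R X) = IT_class R ((Syz R ^^ k) X)"
  by (induction k) (simp_all add: IT_L_IT_class)

section \<open>Syzygies of maps and projective dimension\<close>

text \<open>A fixed presentation for each module turns the syzygy of a map into the function
  \<open>Omega_map\<close>, functorial and additive up to \<open>stable_eq\<close>.\<close>

definition Syz_cover :: "('a, 'a list) module \<Rightarrow> ('a, 'a list) module \<times> ('a list \<Rightarrow> 'a list) \<times> ('a
    list \<Rightarrow> 'a list)" where
  "Syz_cover X = (SOME t. proj_pres (Syz R X) (fst t) X (fst (snd t)) (snd (snd t)))"

definition Syz_map where
  "Syz_map A B = syzygy_map (Syz R A) (fst (Syz_cover A)) (fst (snd (Syz_cover A))) (snd (snd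
      (Syz_cover A)))
    (Syz R B) (fst (Syz_cover B)) (fst (snd (Syz_cover B))) (snd (snd (Syz_cover B)))"

definition Omega_map where "Omega_map A B f = (SOME f1. Syz_map A B f f1)"

fun Omega_pow where
  "Omega_pow 0 A B f = f"
| "Omega_pow (Suc k) A B f = Omega_map ((Syz R ^^ k) A) ((Syz R ^^ k) B) (Omega_pow k A B f)"

lemma Syz_cover_proj_pres:
  assumes "X \<in> Ob" shows "proj_pres (Syz R X) (fst (Syz_cover X)) X (fst (snd (Syz_cover X))) (snd
      (snd (Syz_cover X)))"
proof -
  obtain P i p where "proj_pres (Syz R X) P X i p" using Syz_proj_pres[OF assms] by blast
  then have "proj_pres (Syz R X) (fst (P, i, p)) X (fst (snd (P, i, p))) (snd (snd (P, i, p)))" by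
      simp
  then show ?thesis unfolding Syz_cover_def by (rule someI)
qed

lemma Omega_map_Syz_map:
  assumes "A \<in> Ob" "B \<in> Ob" "f \<in> Hom A B" shows "Syz_map A B f (Omega_map A B f)"
  unfolding Omega_map_def using syzygy_map_ex[OF Syz_cover_proj_pres[OF assms(1)]
      Syz_cover_proj_pres[OF assms(2)] assms(3)]
  unfolding Syz_map_def by (rule someI_ex)

lemma Omega_map_hom: "\<lbrakk>A \<in> Ob; B \<in> Ob; f \<in> Hom A B\<rbrakk> \<Longrightarrow> Omega_map A B f \<in> Hom (Syz R A) (Syz R B)"
  using Omega_map_Syz_map unfolding Syz_map_def syzygy_map_def by blast

lemma Syz_map_stable_eq:
  assumes "Syz_map A B f f1" "Syz_map A B g g1" "stable_eq A B f g" "A \<in> Ob" "B \<in> Ob"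
  shows "stable_eq (Syz R A) (Syz R B) f1 g1"
  by (rule syzygy_map_stable_eq[OF Syz_cover_proj_pres[OF assms(4)] Syz_cover_proj_pres[OF
      assms(5)] assms(1,2)[unfolded Syz_map_def] assms(3)])

lemma Omega_map_stable_eq:
  assumes "stable_eq A B f g" "A \<in> Ob" "B \<in> Ob"
  shows "stable_eq (Syz R A) (Syz R B) (Omega_map A B f) (Omega_map A B g)"
proof -
  have "f \<in> Hom A B" "g \<in> Hom A B" using assms(1) unfolding stable_eq_def by blast+
  then show ?thesis using Syz_map_stable_eq Omega_map_Syz_map assms by blast
qed

lemma Omega_map_comp:
  assumes "f \<in> Hom A B" "g \<in> Hom B C" "A \<in> Ob" "B \<in> Ob" "C \<in> Ob"
  shows "stable_eq (Syz R A) (Syz R C) (Omega_map A C (\<lambda>x. g (f x))) (\<lambda>x. Omega_map B C g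
      (Omega_map A B f x))"
proof -
  have "Syz_map A C (\<lambda>x. g (f x)) (\<lambda>x. Omega_map B C g (Omega_map A B f x))"
    using syzygy_map_comp Omega_map_Syz_map[OF assms(3,4,1)] Omega_map_Syz_map[OF assms(4,5,2)]
        proj_presD(5)[OF Syz_cover_proj_pres[OF assms(3)]]
    unfolding Syz_map_def by blast
  then show ?thesis using Syz_map_stable_eq[OF Omega_map_Syz_map] hom_comp[OF assms(1,2)]
      stable_eq_refl assms by blast
qed

lemma Omega_map_id:
  assumes "A \<in> Ob" shows "stable_eq (Syz R A) (Syz R A) (Omega_map A A (\<lambda>x. x)) (\<lambda>x. x)"
proof -
  have "Syz_map A A (\<lambda>x. x) (\<lambda>x. x)" unfolding Syz_map_def by (rule syzygy_map_id)
  then show ?thesis using Syz_map_stable_eq[OF Omega_map_Syz_map] hom_id stable_eq_refl assms by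
      blast
qed

lemma Omega_map_add:
  assumes "f \<in> Hom A B" "g \<in> Hom A B" "A \<in> Ob" "B \<in> Ob"
  shows "stable_eq (Syz R A) (Syz R B) (Omega_map A B (\<lambda>x. f x \<oplus>\<^bsub>B\<^esub> g x)) (\<lambda>x. Omega_map A B f x
      \<oplus>\<^bsub>Syz R B\<^esub> Omega_map A B g x)"
proof -
  have "Syz_map A B (\<lambda>x. f x \<oplus>\<^bsub>B\<^esub> g x) (\<lambda>x. Omega_map A B f x \<oplus>\<^bsub>Syz R B\<^esub> Omega_map A B g x)"
    using syzygy_map_add[OF Syz_cover_proj_pres[OF assms(3)] Syz_cover_proj_pres[OF assms(4)]]
        Omega_map_Syz_map[OF assms(3,4,1)] Omega_map_Syz_map[OF assms(3,4,2)] assms(1,2)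
    unfolding Syz_map_def by blast
  moreover have "(\<lambda>x. f x \<oplus>\<^bsub>B\<^esub> g x) \<in> Hom A B" using assms by (intro hom_add) simp_all
  ultimately show ?thesis using Syz_map_stable_eq[OF Omega_map_Syz_map] stable_eq_refl assms(3,4)
      by blast
qed

lemma Omega_map_proj_factor:
  assumes "proj_factor A B f" "A \<in> Ob" "B \<in> Ob" shows "proj_factor (Syz R A) (Syz R B) (Omega_map
      A B f)"
proof -
  have "f \<in> Hom A B" using assms(1) unfolding proj_factor_def by blast
  then show ?thesis
    using syzygy_map_proj_factor[OF Syz_cover_proj_pres[OF assms(2)] Syz_cover_proj_pres[OF
        assms(3)] _ assms(1)] Omega_map_Syz_map[OF assms(2,3)] unfolding Syz_map_def by blast
qed

lemma Omega_pow_hom: "\<lbrakk>A \<in> Ob; B \<in> Ob; f \<in> Hom A B\<rbrakk> \<Longrightarrow> Omega_pow k A B f \<in> Hom ((Syz R ^^ k) A)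
    ((Syz R ^^ k) B)"
  by (induction k) (simp_all add: Omega_map_hom)

lemma Omega_pow_stable_eq:
  "\<lbrakk>stable_eq A B f g; A \<in> Ob; B \<in> Ob\<rbrakk> \<Longrightarrow> stable_eq ((Syz R ^^ k) A) ((Syz R ^^ k) B) (Omega_pow k
      A B f) (Omega_pow k A B g)"
  by (induction k) (simp_all add: Omega_map_stable_eq)

lemma Omega_pow_proj_factor:
  "\<lbrakk>proj_factor A B f; A \<in> Ob; B \<in> Ob\<rbrakk> \<Longrightarrow> proj_factor ((Syz R ^^ k) A) ((Syz R ^^ k) B) (Omega_pow
      k A B f)"
  by (induction k) (simp_all add: Omega_map_proj_factor)

lemma Omega_pow_comp:
  assumes "f \<in> Hom A B" "g \<in> Hom B C" "A \<in> Ob" "B \<in> Ob" "C \<in> Ob"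
  shows "stable_eq ((Syz R ^^ k) A) ((Syz R ^^ k) C) (Omega_pow k A C (\<lambda>x. g (f x))) (\<lambda>x.
      Omega_pow k B C g (Omega_pow k A B f x))"
proof (induction k)
  case 0 show ?case using stable_eq_refl hom_comp[OF assms(1,2)] assms by simp
next
  case (Suc k)
  note Ob = Syz_funpow_Ob[OF assms(3), of k] Syz_funpow_Ob[OF assms(4), of k] Syz_funpow_Ob[OF
      assms(5), of k]
  have 1: "stable_eq (Syz R ((Syz R ^^ k) A)) (Syz R ((Syz R ^^ k) C)) (Omega_pow (Suc k) A C (\<lambda>x.
      g (f x)))
      (Omega_map ((Syz R ^^ k) A) ((Syz R ^^ k) C) (\<lambda>x. Omega_pow k B C g (Omega_pow k A B f x)))"
    unfolding Omega_pow.simps by (rule Omega_map_stable_eq[OF Suc Ob(1,3)])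
  have 2: "stable_eq (Syz R ((Syz R ^^ k) A)) (Syz R ((Syz R ^^ k) C))
     (Omega_map ((Syz R ^^ k) A) ((Syz R ^^ k) C) (\<lambda>x. Omega_pow k B C g (Omega_pow k A B f x)))
     (\<lambda>x. Omega_pow (Suc k) B C g (Omega_pow (Suc k) A B f x))"
    unfolding Omega_pow.simps by (rule Omega_map_comp[OF Omega_pow_hom[OF assms(3,4,1)]
        Omega_pow_hom[OF assms(4,5,2)] Ob])
  show ?case using stable_eq_trans[OF 1 2] Ob by simp
qed

lemma Omega_pow_id:
  assumes "A \<in> Ob" shows "stable_eq ((Syz R ^^ k) A) ((Syz R ^^ k) A) (Omega_pow k A A (\<lambda>x. x))
      (\<lambda>x. x)"
proof (induction k)
  case 0 show ?case using stable_eq_refl[OF assms assms hom_id] by simp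
next
  case (Suc k)
  note Ob = Syz_funpow_Ob[OF assms(1), of k]
  show ?case using stable_eq_trans[OF Omega_map_stable_eq[OF Suc Ob Ob] Omega_map_id[OF Ob]] Ob by
      simp
qed

lemma Omega_pow_add:
  assumes "f \<in> Hom A B" "g \<in> Hom A B" "A \<in> Ob" "B \<in> Ob"
  shows "stable_eq ((Syz R ^^ k) A) ((Syz R ^^ k) B) (Omega_pow k A B (\<lambda>x. f x \<oplus>\<^bsub>B\<^esub> g x))
    (\<lambda>x. Omega_pow k A B f x \<oplus>\<^bsub>(Syz R ^^ k) B\<^esub> Omega_pow k A B g x)"
proof (induction k)
  case 0
  have "(\<lambda>x. f x \<oplus>\<^bsub>B\<^esub> g x) \<in> Hom A B" using assms by (intro hom_add) simp_all
  then show ?case using stable_eq_refl assms by simp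
next
  case (Suc k)
  note Ob = Syz_funpow_Ob[OF assms(3), of k] Syz_funpow_Ob[OF assms(4), of k]
  show ?case
    using stable_eq_trans[OF Omega_map_stable_eq[OF Suc Ob] Omega_map_add[OF Omega_pow_hom[OF
        assms(3,4,1)] Omega_pow_hom[OF assms(3,4,2)] Ob]] Ob by simp
qed

section \<open>Short exact sequences of syzygies\<close>

text \<open>The middle presentation is built on \<open>PA \<oplus> PY\<close>. That
  \<open>f1\<close> is induced by \<open>f\<close> on the kernels is what later identifies it stably
  with a syzygy of \<open>f\<close>.\<close>

lemma horseshoe:
  assumes se: "short_exact R A B Y f g" and Ob: "A \<in> Ob" "B \<in> Ob" "Y \<in> Ob"
    and pA: "proj_pres SA PA A iA pA" and pY: "proj_pres SY PY Y iY pY"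
  shows "\<exists>B1 Q j q f1 g1. proj_pres B1 Q B j q \<and> short_exact R SA B1 SY f1 g1 \<and> syzygy_map SA PA
      iA pA B1 Q j q f f1"
proof -
  note d = short_exactD[OF se Ob[THEN Ob_Mod]] and dA = proj_presD[OF pA] and dY = proj_presD[OF pY]
  have "g ` carrier B = carrier Y" using se unfolding short_exact_def by blast
  then obtain h where h: "h \<in> Hom PY B" "\<forall>x \<in> carrier PY. g (h x) = pY x"
    using projectiveD[OF dY(4) Ob(2,3) d(2) dY(6)] by blast
  obtain Q i j p q where Q: "Q \<in> Ob" "biproduct PA PY Q i j p q" using biproduct_ex[OF dA(2)
      dY(2)] by blast
  note b = biproductD(1-4)[OF Q(2)]
  note [simp] = biproduct_simps[OF Q(2)] hom_simps[OF d(1)] hom_simps[OF d(2)] hom_simps[OF dA(5)]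
      hom_simps[OF dA(6)]
    hom_simps[OF dY(5)] hom_simps[OF dY(6)] hom_simps[OF h(1)] d(3) dA(7) dY(7) h(2)[rule_format]
        Ob dA(1,2) dY(1,2) Q(1)
  \<comment> \<open>On \<open>PA\<close> the given presentation followed by \<open>f\<close>, on
    \<open>PY\<close> the lift \<open>h\<close> of \<open>pY\<close> through
    \<open>g\<close>.\<close>
  define r where "r x = f (pA (p x)) \<oplus>\<^bsub>B\<^esub> h (q x)" for x
  have r: "r \<in> Hom Q B" unfolding r_def
    by (rule hom_add[OF _ hom_comp[OF hom_comp[OF b(3) dA(6)] d(1)] hom_comp[OF b(4) h(1)]]) simp
  note [simp] = hom_simps[OF r]
  have r_onto: "r ` carrier Q = carrier B"
  proof (intro equalityI subsetI)
    fix z assume z: "z \<in> carrier B"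
    obtain y where y: "y \<in> carrier PY" "pY y = g z" using dY(9)[of "g z"] z by auto
    then have "g (z \<ominus>\<^bsub>B\<^esub> h y) = \<zero>\<^bsub>Y\<^esub>" using z by simp
    then obtain a where a: "a \<in> carrier A" "f a = z \<ominus>\<^bsub>B\<^esub> h y" using d(4)[of "z \<ominus>\<^bsub>B\<^esub> h y"] z y by
        auto
    obtain x where x: "x \<in> carrier PA" "pA x = a" using dA(9)[OF a(1)] by blast
    have "r (i x \<oplus>\<^bsub>Q\<^esub> j y) = (z \<ominus>\<^bsub>B\<^esub> h y) \<oplus>\<^bsub>B\<^esub> h y" unfolding r_def using x y a by simp
    also have "\<dots> = z" using z y by - (rule represents_eqI, (rule represents_intros | simp add:
        algebra_simps)+)
    finally show "z \<in> r ` carrier Q" using x y by (intro image_eqI[of _ _ "i x \<oplus>\<^bsub>Q\<^esub> j y"]) simp_all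
  qed auto
  define B1 where "B1 = Q\<lparr>carrier := {x \<in> carrier Q. r x = \<zero>\<^bsub>B\<^esub>}\<rparr>"
  have B1: "B1 \<in> Ob" "short_exact R B1 Q B (\<lambda>x. x) r"
    unfolding B1_def using kernel_short_exact[OF Q(1) Ob(2) r r_onto] by blast+
  have B1s: "\<And>x. x \<in> carrier B1 \<longleftrightarrow> x \<in> carrier Q \<and> r x = \<zero>\<^bsub>B\<^esub>" "\<zero>\<^bsub>B1\<^esub> = \<zero>\<^bsub>Q\<^esub>" by (simp_all add:
      B1_def)
  have pB: "proj_pres B1 Q B (\<lambda>x. x) r" unfolding proj_pres_def using B1 Q Ob
      projective_biproduct[OF Q(2) dA(4) dY(4)] by blast
  have incl: "(\<lambda>x. x) \<in> Hom B1 Q" using proj_presD(5)[OF pB] .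
  have qB: "q \<in> Hom B1 PY" using hom_comp[OF incl b(4)] .
  have "pY (q x) = \<zero>\<^bsub>Y\<^esub>" if x: "x \<in> carrier B1" for x
  proof -
    have "g (r x) = pY (q x)" unfolding r_def using x B1s by simp
    then show ?thesis using x B1s by simp
  qed
  then obtain g1 where g1: "g1 \<in> Hom B1 SY" "\<forall>x \<in> carrier B1. iY (g1 x) = q x"
    using proj_pres_factor[OF pY qB] B1(1) by auto
  define f1 where "f1 s = i (iA s)" for s
  have rf: "r (f1 s) = \<zero>\<^bsub>B\<^esub>" if "s \<in> carrier SA" for s unfolding r_def f1_def using that by simp
  have "f1 \<in> Hom SA Q" unfolding f1_def by (rule hom_comp[OF dA(5) b(1)])
  then have f1: "f1 \<in> Hom SA B1" unfolding B1_def by (rule hom_corestrict) (simp add: f1_def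
      rf[unfolded f1_def])
  have "short_exact R SA B1 SY f1 g1"
  proof (rule short_exactI)
    show "g1 (f1 s) = \<zero>\<^bsub>SY\<^esub>" if s: "s \<in> carrier SA" for s
    proof (rule dY(10))
      show "g1 (f1 s) \<in> carrier SY" using hom_simps(1)[OF g1(1)] hom_simps(1)[OF f1] s by blast
      show "iY (g1 (f1 s)) = \<zero>\<^bsub>PY\<^esub>" using g1(2) hom_simps(1)[OF f1 s] s by (simp add: f1_def)
    qed
  next
    fix x assume x: "x \<in> carrier B1" "g1 x = \<zero>\<^bsub>SY\<^esub>"
    have q0: "q x = \<zero>\<^bsub>PY\<^esub>" using g1(2) x by force
    have xQ: "x \<in> carrier Q" "r x = \<zero>\<^bsub>B\<^esub>" using x B1s by auto
    have "f (pA (p x)) = \<zero>\<^bsub>B\<^esub>" using xQ q0 unfolding r_def by simp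
    then have "pA (p x) = \<zero>\<^bsub>A\<^esub>" using d(6)[of "pA (p x)"] xQ by simp
    then obtain s where s: "s \<in> carrier SA" "iA s = p x" using dA(8)[of "p x"] xQ by auto
    have "f1 s = x" unfolding f1_def s(2) using biproduct_simps(5)[OF Q(2) xQ(1)] xQ(1) by (simp
        add: q0 del: biproduct_simps(5)[OF Q(2)])
    then show "\<exists>a\<in>carrier SA. f1 a = x" using s(1) by blast
  next
    fix s assume s: "s \<in> carrier SY"
    have "g (h (iY s)) = \<zero>\<^bsub>Y\<^esub>" using s by simp
    then obtain a where a: "a \<in> carrier A" "f a = h (iY s)" using d(4)[of "h (iY s)"] s by auto
    obtain x where x: "x \<in> carrier PA" "pA x = a" using dA(9)[OF a(1)] by blast
    \<comment> \<open>\<open>h (iY s)\<close> comes from \<open>A\<close> because \<open>g\<close>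
      kills it; the correction by \<open>x\<close> moves \<open>j (iY s)\<close> into the kernel of
      \<open>r\<close>.\<close>
    define z where "z = i (\<ominus>\<^bsub>PA\<^esub> x) \<oplus>\<^bsub>Q\<^esub> j (iY s)"
    have zQ: "z \<in> carrier Q" "q z = iY s" using x s by (simp_all add: z_def)
    have "r z = \<ominus>\<^bsub>B\<^esub> h (iY s) \<oplus>\<^bsub>B\<^esub> h (iY s)" unfolding r_def z_def using x s a by simp
    also have "\<dots> = \<zero>\<^bsub>B\<^esub>" using s by - (rule represents_eqI, (rule represents_intros | simp add:
        algebra_simps)+)
    finally have zB: "z \<in> carrier B1" using zQ B1s by simp
    have "g1 z = s"
      by (rule inj_onD[OF dY(12)]) (use g1(2) zB zQ s hom_simps(1)[OF g1(1)] in auto)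
    then show "\<exists>b\<in>carrier B1. g1 b = s" using zB by blast
  next
    fix s assume s: "s \<in> carrier SA" "f1 s = \<zero>\<^bsub>B1\<^esub>"
    then have "p (i (iA s)) = \<zero>\<^bsub>PA\<^esub>" unfolding f1_def B1s by simp
    then show "s = \<zero>\<^bsub>SA\<^esub>" using s dA(10)[of s] by simp
  qed (use f1 g1 B1 in simp_all)
  moreover have "syzygy_map SA PA iA pA B1 Q (\<lambda>x. x) r f f1"
  proof (rule syzygy_mapI[OF f1 b(1)])
    show "r (i x) = f (pA x)" if "x \<in> carrier PA" for x unfolding r_def using that by simp
  qed (simp add: f1_def)
  ultimately show ?thesis using pB by blast
qed

text \<open>Iterating the horseshoe lemma keeps the chosen syzygies as outer terms, while the middle
  term is only stably isomorphic to \<Omega>^k B. Hence the comparison map \<open>\<beta>\<close>,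
  through which \<open>fk\<close> becomes stably the k-th syzygy of \<open>f\<close>.\<close>

lemma short_exact_Syz_funpow:
  assumes se: "short_exact R A B Y f g" and Ob: "A \<in> Ob" "B \<in> Ob" "Y \<in> Ob"
  shows "\<exists>Bk \<in> Ob. \<exists>fk gk \<beta>. short_exact R ((Syz R ^^ k) A) Bk ((Syz R ^^ k) Y) fk gk \<and>
    stable_iso Bk ((Syz R ^^ k) B) \<beta> \<and>
    stable_eq ((Syz R ^^ k) A) ((Syz R ^^ k) B) (\<lambda>x. \<beta> (fk x)) (Omega_pow k A B f)"
proof (induction k)
  case 0
  have "f \<in> Hom A B" using short_exactD(1)[OF se] Ob by simp
  then show ?case using se Ob stable_iso_id stable_eq_refl by (intro bexI[of _ B] exI[of _ f]
      exI[of _ g] exI[of _ "\<lambda>x. x"]) simp_all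
next
  case (Suc k)
  let ?A = "(Syz R ^^ k) A" and ?B = "(Syz R ^^ k) B" and ?Y = "(Syz R ^^ k) Y"
  note ObK = Syz_funpow_Ob[OF Ob(1), of k] Syz_funpow_Ob[OF Ob(2), of k] Syz_funpow_Ob[OF Ob(3),
      of k]
  obtain Bk fk gk \<beta> where IH: "Bk \<in> Ob" "short_exact R ?A Bk ?Y fk gk" "stable_iso Bk ?B \<beta>"
    "stable_eq ?A ?B (\<lambda>x. \<beta> (fk x)) (Omega_pow k A B f)" using Suc by blast
  obtain B1 Q j q f1 g1 where H: "proj_pres B1 Q Bk j q" "short_exact R (Syz R ?A) B1 (Syz R ?Y)
      f1 g1"
    "syzygy_map (Syz R ?A) (fst (Syz_cover ?A)) (fst (snd (Syz_cover ?A))) (snd (snd (Syz_cover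
        ?A))) B1 Q j q fk f1"
    using horseshoe[OF IH(2) ObK(1) IH(1) ObK(3) Syz_cover_proj_pres[OF ObK(1)]
        Syz_cover_proj_pres[OF ObK(3)]] by blast
  have b_hom: "\<beta> \<in> Hom Bk ?B" using IH(3) unfolding stable_iso_def by blast
  obtain \<beta>1 where b1: "syzygy_map B1 Q j q (Syz R ?B) (fst (Syz_cover ?B)) (fst (snd (Syz_cover
      ?B))) (snd (snd (Syz_cover ?B))) \<beta> \<beta>1"
    using syzygy_map_ex[OF H(1) Syz_cover_proj_pres[OF ObK(2)] b_hom] by blast
  have "stable_iso B1 (Syz R ?B) \<beta>1" by (rule stable_iso_syzygy_map[OF H(1) Syz_cover_proj_pres[OF
      ObK(2)] b1 IH(3)])
  moreover have "Syz_map ?A ?B (\<lambda>x. \<beta> (fk x)) (\<lambda>x. \<beta>1 (f1 x))"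
    unfolding Syz_map_def by (rule syzygy_map_comp[OF H(3) b1 proj_presD(5)[OF
        Syz_cover_proj_pres[OF ObK(1)]]])
  then have "stable_eq (Syz R ?A) (Syz R ?B) (\<lambda>x. \<beta>1 (f1 x)) (Omega_map ?A ?B (Omega_pow k A B f))"
    using Syz_map_stable_eq[OF _ Omega_map_Syz_map[OF ObK(1,2) Omega_pow_hom] IH(4) ObK(1,2)] Ob
        short_exactD(1)[OF se] by simp
  ultimately show ?case using H(2) proj_presD(1)[OF H(1)] by (intro bexI[of _ B1] exI[of _ f1]
      exI[of _ g1] exI[of _ \<beta>1]) simp_all
qed

text \<open>The sequence splits, and the complement of \<open>A\<close> in \<open>B\<close> is a
  copy of the projective \<open>Y\<close>.\<close>

lemma stable_iso_if_projective_coker: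
  assumes se: "short_exact R A B Y f g" and Ob: "A \<in> Ob" "B \<in> Ob" "Y \<in> Ob" and Y: "projective R Y"
  shows "stable_iso A B f"
proof -
  note d = short_exactD[OF se Ob[THEN Ob_Mod]]
  have inj: "inj_on f (carrier A)" and "g ` carrier B = carrier Y" using se unfolding
      short_exact_def by blast+
  then obtain s where s: "s \<in> Hom Y B" "\<forall>y \<in> carrier Y. g (s y) = y"
    using projectiveD[OF Y Ob(2,3) d(2) hom_id] by blast
  note [simp] = hom_simps[OF d(1)] hom_simps[OF d(2)] hom_simps[OF s(1)] s(2)[rule_format] d(3) Ob
  have h: "(\<lambda>b. b \<ominus>\<^bsub>B\<^esub> s (g b)) \<in> Hom B B" using hom_minus[OF _ _ hom_id hom_comp[OF d(2) s(1)]]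
      by simp
  obtain r where r: "r \<in> Hom B A" "\<forall>b \<in> carrier B. f (r b) = b \<ominus>\<^bsub>B\<^esub> s (g b)"
    using short_exact_factor[OF se _ _ _ _ h] by auto
  have rf: "r (f a) = a" if "a \<in> carrier A" for a
    by (rule inj_onD[OF inj]) (use that r hom_simps(1)[OF r(1)] in simp_all)
  show ?thesis
  proof (rule stable_isoI[OF d(1) r(1)])
    show "stable_eq A A (\<lambda>x. r (f x)) (\<lambda>x. x)"
      by (rule stable_eqI[OF Ob(1,1) hom_comp[OF d(1) r(1)] hom_id rf])
    have "proj_factor B B (\<lambda>b. s (g b))" by (rule proj_factorI[OF hom_comp[OF d(2) s(1)] Ob(3) Y
        d(2) s(1)]) simp
    from proj_factor_neg[OF this Ob(2,2)] have "proj_factor B B (\<lambda>b. f (r b) \<ominus>\<^bsub>B\<^esub> b)"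
    proof (rule proj_factor_cong)
      show "(\<lambda>b. f (r b) \<ominus>\<^bsub>B\<^esub> b) \<in> Hom B B" using hom_minus[OF _ _ hom_comp[OF r(1) d(1)] hom_id]
          by simp
      show "f (r x) \<ominus>\<^bsub>B\<^esub> x = \<ominus>\<^bsub>B\<^esub> s (g x)" if "x \<in> carrier B" for x
        unfolding r(2)[rule_format, OF that] using that
        by - (rule represents_eqI, (rule represents_intros | simp add: algebra_simps)+)
    qed
    then show "stable_eq B B (\<lambda>x. f (r x)) (\<lambda>x. x)" unfolding stable_eq_def using hom_comp[OF r(1)
        d(1)] hom_id by blast
  qed
qed

text \<open>Inside \<open>X\<close>, which is both \<open>B \<oplus> Q\<close> and
  \<open>A \<oplus> E\<close>, the composite of \<open>p\<close> and \<open>g\<close> maps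
  \<open>X\<close> onto \<open>Y\<close> with kernel the sum of \<open>A\<close> and
  \<open>Q\<close>. Dividing by \<open>A\<close> leaves a short exact sequence from \<open>Q\<close>
  through \<open>E\<close> to \<open>Y\<close> with \<open>Q\<close> and \<open>E\<close>
  projective, so \<open>Y\<close> has projective dimension at most one.\<close>

lemma projective_Syz_coker:
  assumes se: "short_exact R A B Y f g" and Ob: "A \<in> Ob" "B \<in> Ob" "Y \<in> Ob" and f: "stable_iso A B f"
  shows "projective R (Syz R Y)"
proof -
  note d = short_exactD[OF se Ob[THEN Ob_Mod]]
  obtain Q E X i j p q i' j' p' q' where *: "Q \<in> Ob" "E \<in> Ob" "X \<in> Ob" "projective R Q"
      "projective R E"
    "biproduct B Q X i j p q" "biproduct A E X i' j' p' q'" "\<forall>a \<in> carrier A. p (i' a) = f a"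
    using stable_iso_biproduct[OF f Ob(1,2)] by blast
  note b = biproductD(1-4)[OF *(6)] and b' = biproductD(1-4)[OF *(7)]
  note [simp] = biproduct_simps[OF *(6)] biproduct_simps[OF *(7)] *(1-3) *(8)[rule_format]
      hom_simps[OF d(1)] hom_simps[OF d(2)] d(3) Ob
  have jq': "j' (q' x) = x \<ominus>\<^bsub>X\<^esub> i' (p' x)" if "x \<in> carrier X" for x using biproduct_minus(1)[OF
      *(7)] that by simp
  have "short_exact R Q E Y (\<lambda>y. q' (j y)) (\<lambda>e. g (p (j' e)))"
  proof (rule short_exactI)
    show "(\<lambda>y. q' (j y)) \<in> Hom Q E" by (rule hom_comp[OF b(2) b'(4)])
    show "(\<lambda>e. g (p (j' e))) \<in> Hom E Y" by (rule hom_comp[OF hom_comp[OF b'(2) b(3)] d(2)])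
    show "g (p (j' (q' (j y)))) = \<zero>\<^bsub>Y\<^esub>" if "y \<in> carrier Q" for y using that by (simp add: jq')
  next
    fix e assume e: "e \<in> carrier E" "g (p (j' e)) = \<zero>\<^bsub>Y\<^esub>"
    then obtain a where a: "a \<in> carrier A" "f a = p (j' e)" using d(4)[of "p (j' e)"] by auto
    \<comment> \<open>\<open>i' a\<close> and \<open>j' e\<close> have the same component in
      \<open>B\<close>; the difference lies in the kernel of \<open>p\<close>, which is
      \<open>Q\<close>, and still projects to \<open>e\<close>.\<close>
    define x where "x = j' e \<ominus>\<^bsub>X\<^esub> i' a"
    have x: "x \<in> carrier X" "p x = \<zero>\<^bsub>B\<^esub>" "q' x = e" using e a by (simp_all add: x_def)
    have "j (q x) = x" using biproduct_minus(1)[OF *(6)] x by simp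
    then show "\<exists>a\<in>carrier Q. q' (j a) = e" using x by (intro bexI[of _ "q x"]) simp_all
  next
    fix c assume [simp]: "c \<in> carrier Y"
    then obtain z where z: "z \<in> carrier B" "g z = c" using d(5) by blast
    then show "\<exists>b\<in>carrier E. g (p (j' b)) = c"
      by (intro bexI[of _ "q' (i z)"]) (simp_all add: jq')
  next
    fix y assume y: "y \<in> carrier Q" "q' (j y) = \<zero>\<^bsub>E\<^esub>"
    \<comment> \<open>An element of \<open>Q\<close> that dies in \<open>E\<close> lies in the copy
      of \<open>A\<close>, where its component \<open>f (p' (j y))\<close> vanishes; injectivity of
      \<open>f\<close> finishes.\<close>
    have jy: "j y = i' (p' (j y))" using biproduct_minus(2)[OF *(7), of "j y"] y by simp
    have "p (j y) = f (p' (j y))" by (subst jy) (use y in simp)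
    then have "f (p' (j y)) = \<zero>\<^bsub>B\<^esub>" using y by simp
    then have "p' (j y) = \<zero>\<^bsub>A\<^esub>" using d(6)[of "p' (j y)"] y by simp
    then have "j y = \<zero>\<^bsub>X\<^esub>" using jy by simp
    then have "q (j y) = q \<zero>\<^bsub>X\<^esub>" by simp
    then show "y = \<zero>\<^bsub>Q\<^esub>" using y by simp
  qed simp_all
  then have "proj_pres Q E Y (\<lambda>y. q' (j y)) (\<lambda>e. g (p (j' e)))" unfolding proj_pres_def using * Ob
      by blast
  then have "IT_class R (Syz R Y) = 0" using IT_class_proj_pres IT_class_projective *(1,4) by simp
  then show ?thesis using IT_class_eq_0_iff Ob by simp
qed

section \<open>Projective dimension in terms of syzygies\<close>

text \<open>Shortening the resolution replaces \<open>X\<close> by the kernel \<open>K\<close> of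
  its first map. \<open>K\<close> may differ from the chosen syzygy of \<open>X\<close>, but it has
  the same class, and the class of a module is zero exactly when the module is projective.\<close>

lemma projective_resolution_imp_projective_Syz:
  "\<lbrakk>projective_resolution R X n Q d; X \<in> Ob\<rbrakk> \<Longrightarrow> projective R ((Syz R ^^ n) X)"
proof (induction n arbitrary: X Q d)
  case 0
  have h: "Q 1 \<in> Ob" "projective R (Q 1)" "d 0 \<in> Hom (Q 1) X" "d 0 ` carrier (Q 1) = carrier X"
      "inj_on (d 0) (carrier (Q 1))"
    using 0 unfolding projective_resolution_def by auto
  have "iso_pair (Q 1) X (d 0) (the_inv_into (carrier (Q 1)) (d 0))"
    using h by (intro hom_inverse) (auto simp: the_inv_into_f_f f_the_inv_into_f intro!:
        the_inv_into_into)
  then show ?case using projective_iso h(2) by simp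
next
  case (Suc n)
  have h: "\<And>i. i \<le> Suc n \<Longrightarrow> Q (Suc i) \<in> Ob" "\<And>i. i \<le> Suc n \<Longrightarrow> projective R (Q (Suc i))"
    "\<And>i. i \<le> Suc n \<Longrightarrow> d i \<in> Hom (Q (Suc i)) (Q i)" "Q 0 = X"
    "d 0 ` carrier (Q 1) = carrier X" "inj_on (d (Suc n)) (carrier (Q (Suc (Suc n))))"
    "\<And>i. i < Suc n \<Longrightarrow> d (Suc i) ` carrier (Q (Suc (Suc i))) = a_kernel (Q (Suc i)) (Q i) (d i)"
    using Suc.prems(1) unfolding projective_resolution_def by simp_all
  have h1: "Q 1 \<in> Ob" "projective R (Q 1)" "d 0 \<in> Hom (Q 1) X" using h(1)[of 0] h(2)[of 0] h(3)[of
      0] h(4) by simp_all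
  define K where "K = (Q 1)\<lparr>carrier := {x \<in> carrier (Q 1). d 0 x = \<zero>\<^bsub>X\<^esub>}\<rparr>"
  have K: "K \<in> Ob" "short_exact R K (Q 1) X (\<lambda>x. x) (d 0)"
    unfolding K_def using kernel_short_exact[OF h1(1) Suc.prems(2) h1(3) h(5)] by blast+
  have d1: "d 1 ` carrier (Q 2) = carrier K"
    using h(7)[of 0] h(4) by (simp add: a_kernel_eq K_def numeral_2_eq_2)
  \<comment> \<open>The indices drop by one, and \<open>K\<close> takes the place of the module at
    position zero.\<close>
  have "projective_resolution R K n (case_nat K (\<lambda>i. Q (Suc (Suc i)))) (\<lambda>i. d (Suc i))"
    unfolding projective_resolution_def
  proof (intro conjI allI impI)
    fix i assume i: "i \<le> n"
    show "case_nat K (\<lambda>i. Q (Suc (Suc i))) (Suc i) \<in> Ob" "projective R (case_nat K (\<lambda>i. Q (Suc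
        (Suc i))) (Suc i))"
      using h(1,2)[of "Suc i"] i by simp_all
    show "d (Suc i) \<in> Hom (case_nat K (\<lambda>i. Q (Suc (Suc i))) (Suc i)) (case_nat K (\<lambda>i. Q (Suc (Suc
        i))) i)"
    proof (cases i)
      case 0
      have "d 1 \<in> Hom (Q 2) K" unfolding K_def
        by (rule hom_corestrict) (use h(3)[of 1] d1 K_def in \<open>auto simp: numeral_2_eq_2\<close>)
      then show ?thesis using 0 by (simp add: numeral_2_eq_2)
    next
      case (Suc m)
      then show ?thesis using h(3)[of "Suc i"] i by simp
    qed
  next
    fix i assume i: "i < n"
    show "d (Suc (Suc i)) ` carrier (case_nat K (\<lambda>i. Q (Suc (Suc i))) (Suc (Suc i))) =
        a_kernel (case_nat K (\<lambda>i. Q (Suc (Suc i))) (Suc i)) (case_nat K (\<lambda>i. Q (Suc (Suc i))) i)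
            (d (Suc i))"
      using h(7)[of "Suc i"] i by (cases i) (auto simp: a_kernel_eq K_def)
  qed (use d1 h(6) in \<open>simp_all add: numeral_2_eq_2\<close>)
  then have "projective R ((Syz R ^^ n) K)" using Suc.IH K(1) by blast
  then have "(IT_L R ^^ n) (IT_class R K) = 0" using IT_L_funpow_IT_class K(1) IT_class_eq_0_iff
      by simp
  moreover have "proj_pres K (Q 1) X (\<lambda>x. x) (d 0)" unfolding proj_pres_def using K h1
      Suc.prems(2) by blast
  then have "IT_class R (Syz R X) = IT_class R K" by (rule IT_class_proj_pres)
  ultimately have "IT_class R ((Syz R ^^ n) (Syz R X)) = 0" using IT_L_funpow_IT_class
      Suc.prems(2) by (metis Syz_Ob)
  then show ?case using IT_class_eq_0_iff[of "(Syz R ^^ n) (Syz R X)"] Suc.prems(2) by (simp add: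
      funpow_swap1)
qed

lemma projective_Syz_imp_projective_resolution:
  "\<lbrakk>projective R ((Syz R ^^ n) X); X \<in> Ob\<rbrakk> \<Longrightarrow> \<exists>Q d. projective_resolution R X n Q d"
proof (induction n arbitrary: X)
  case 0
  then have "projective_resolution R X 0 (\<lambda>_. X) (\<lambda>_ x. x)"
    unfolding projective_resolution_def by (auto simp: hom_id)
  then show ?case by blast
next
  case (Suc n)
  obtain P i p where pr: "proj_pres (Syz R X) P X i p" using Syz_proj_pres Suc.prems by blast
  note d = proj_presD[OF pr]
  have "projective R ((Syz R ^^ n) (Syz R X))" using Suc.prems(1) by (simp add: funpow_swap1)
  then obtain Q e where "projective_resolution R (Syz R X) n Q e" using Suc.IH d(1) by blast
  then have h: "\<And>i. i \<le> n \<Longrightarrow> Q (Suc i) \<in> Ob" "\<And>i. i \<le> n \<Longrightarrow> projective R (Q (Suc i))"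
    "\<And>i. i \<le> n \<Longrightarrow> e i \<in> Hom (Q (Suc i)) (Q i)" "Q 0 = Syz R X"
    "e 0 ` carrier (Q 1) = carrier (Syz R X)" "inj_on (e n) (carrier (Q (Suc n)))"
    "\<And>i. i < n \<Longrightarrow> e (Suc i) ` carrier (Q (Suc (Suc i))) = a_kernel (Q (Suc i)) (Q i) (e i)"
    unfolding projective_resolution_def by simp_all
  have e0: "e 0 \<in> Hom (Q 1) (Syz R X)" using h(3)[of 0] h(4) by simp
  \<comment> \<open>The resolution of the syzygy is spliced to \<open>P\<close> by the composite of
    \<open>e 0\<close> with the inclusion \<open>i\<close>.\<close>
  define Q' where "Q' = case_nat X (case_nat P (\<lambda>i. Q (Suc i)))"
  define d' where "d' = case_nat p (case_nat (\<lambda>x. i (e 0 x)) (\<lambda>i. e (Suc i)))"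
  have Q': "Q' 0 = X" "Q' (Suc 0) = P" "\<And>i. Q' (Suc (Suc i)) = Q (Suc i)" by (simp_all add: Q'_def)
  have d': "d' 0 = p" "d' (Suc 0) = (\<lambda>x. i (e 0 x))" "\<And>i. d' (Suc (Suc i)) = e (Suc i)" by
      (simp_all add: d'_def)
  have ker: "{x \<in> carrier P. p x = \<zero>\<^bsub>X\<^esub>} = i ` carrier (Syz R X)"
    using d(7) d(8) hom_simps(1)[OF d(5)] by blast
  have "projective_resolution R X (Suc n) Q' d'"
    unfolding projective_resolution_def
  proof (intro conjI allI impI)
    fix k assume k: "k \<le> Suc n"
    show "Q' (Suc k) \<in> Ob" "projective R (Q' (Suc k))"
      using k h(1,2)[of "k - 1"] d(2,4) by (cases k; simp add: Q')+
    show "d' k \<in> Hom (Q' (Suc k)) (Q' k)"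
    proof (cases k)
      case 0 then show ?thesis using d(6) by (simp add: Q' d')
    next
      case (Suc l)
      then show ?thesis using hom_comp[OF e0 d(5)] h(3)[of l] k by (cases l) (simp_all add: Q' d')
    qed
  next
    fix k assume k: "k < Suc n"
    show "d' (Suc k) ` carrier (Q' (Suc (Suc k))) = a_kernel (Q' (Suc k)) (Q' k) (d' k)"
    proof (cases k)
      case 0
      have "(\<lambda>x. i (e 0 x)) ` carrier (Q 1) = i ` carrier (Syz R X)" using h(5) by (metis
          image_image)
      then show ?thesis using 0 by (simp add: Q' d' a_kernel_eq ker)
    next
      case (Suc l)
      show ?thesis
      proof (cases l)
        case 0
        have "i (e 0 x) = \<zero>\<^bsub>P\<^esub> \<longleftrightarrow> e 0 x = \<zero>\<^bsub>Syz R X\<^esub>" if "x \<in> carrier (Q 1)" for x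
          using d(10)[of "e 0 x"] hom_simps(1)[OF e0 that] hom_simps(6)[OF d(5)] d(1,2) by auto
        then show ?thesis using h(7)[of 0] k Suc 0 h(4) by (auto simp: Q' d' a_kernel_eq)
      next
        case (Suc m)
        then show ?thesis using h(7)[of l] k \<open>k = Suc l\<close> by (simp add: Q' d' a_kernel_eq)
      qed
    qed
  next
    show "inj_on (d' (Suc n)) (carrier (Q' (Suc (Suc n))))"
    proof (cases n)
      case 0
      have "inj_on i (e 0 ` carrier (Q 1))" using d(12) h(5) by simp
      then have "inj_on (i \<circ> e 0) (carrier (Q 1))" using h(6) 0 by (intro comp_inj_on) simp_all
      then show ?thesis using 0 by (simp add: Q' d' comp_def)
    next
      case (Suc m) then show ?thesis using h(6) by (simp add: Q' d')
    qed
  qed (use d(11) in \<open>simp_all add: Q' d'\<close>)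
  then show ?case by blast
qed

text \<open>\<open>pd\<close> is an infimum in \<open>enat\<close>: over the empty set it is
  \<open>\<infinity>\<close>, and otherwise it is attained.\<close>

lemma pd_le_iff:
  assumes "X \<in> Ob" shows "pd R X \<le> enat n \<longleftrightarrow> (\<exists>m \<le> n. projective R ((Syz R ^^ m) X))"
proof -
  have *: "(\<exists>Q d. projective_resolution R X m Q d) \<longleftrightarrow> projective R ((Syz R ^^ m) X)" for m
    using projective_resolution_imp_projective_Syz projective_Syz_imp_projective_resolution assms
        by blast
  define S where "S = {enat m | m. projective R ((Syz R ^^ m) X)}"
  have pd: "pd R X = Inf S" unfolding pd_def S_def using * by simp
  show ?thesis
  proof
    assume le: "pd R X \<le> enat n"
    have "S \<noteq> {}"
    proof
      assume "S = {}"
      then have "pd R X = \<infinity>" unfolding pd by (simp add: top_enat_def)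
      then show False using le by simp
    qed
    then have "Inf S \<in> S" unfolding Inf_enat_def by (auto intro: LeastI)
    then show "\<exists>m \<le> n. projective R ((Syz R ^^ m) X)" using le pd unfolding S_def by auto
  next
    assume "\<exists>m \<le> n. projective R ((Syz R ^^ m) X)"
    then obtain m where "m \<le> n" "enat m \<in> S" unfolding S_def by blast
    then show "pd R X \<le> enat n" unfolding pd by (meson Inf_lower enat_ord_simps(1) order_trans)
  qed
qed

end

section \<open>Free abelian groups with an endomorphism\<close>

lemma frag_module: "Modules.module (frag_cmul :: int \<Rightarrow> ('c \<Rightarrow>\<^sub>0 int) \<Rightarrow> _)"
  by (rule Modules.module.intro) (simp_all add: frag_cmul_distrib frag_cmul_distrib2)

locale frag_endo =
  fixes L :: "('c \<Rightarrow>\<^sub>0 int) \<Rightarrow> ('c \<Rightarrow>\<^sub>0 int)"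
  assumes L_diff: "L (x - y) = L x - L y"
begin

lemma L_zero [simp]: "L 0 = 0"
  using L_diff[of 0 0] by simp

lemma L_neg: "L (- x) = - L x"
  using L_diff[of 0 x] by simp

lemma L_add: "L (x + y) = L x + L y"
  using L_diff[of x "- y"] by (simp add: L_neg)

lemma L_cmul: "L (frag_cmul k x) = frag_cmul k (L x)"
proof -
  have nat: "L (frag_cmul (int n) x) = frag_cmul (int n) (L x)" for n
    by (induction n) (simp_all add: frag_cmul_distrib L_add)
  show ?thesis
  proof (cases "0 \<le> k")
    case True then show ?thesis using nat[of "nat k"] by simp
  next
    case False
    then have "frag_cmul k x = - frag_cmul (int (nat (- k))) x" "frag_cmul k (L x) = - frag_cmul
        (int (nat (- k))) (L x)"
      by simp_all
    then show ?thesis using nat[of "nat (- k)"] L_neg by metis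
  qed
qed

lemma L_sum: "L (sum f I) = (\<Sum>i\<in>I. L (f i))"
  by (induction I rule: infinite_finite_induct) (simp_all add: L_add)

lemma L_eq_0:
  assumes "\<And>c. c \<in> Poly_Mapping.keys x \<Longrightarrow> L (frag_of c) = 0" shows "L x = 0"
proof -
  have "Poly_Mapping.keys x \<subseteq> {c. L (frag_of c) = 0}" using assms by blast
  then show ?thesis by (induction x rule: frag_induction) (simp_all add: L_diff)
qed

lemma keys_L_subset:
  assumes "Poly_Mapping.keys x \<subseteq> S"
  shows "Poly_Mapping.keys (L x) \<subseteq> (\<Union>c \<in> S. Poly_Mapping.keys (L (frag_of c)))"
  using assms
proof (induction x rule: frag_induction)
  case (diff a b)
  then show ?case using keys_diff[of "L a" "L b"] L_diff[of a b] by auto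
qed auto

lemma frag_endo_funpow: "frag_endo (L ^^ n)"
  by (induction n) (simp_all add: frag_endo_def L_diff)

end

definition frag_subgroup :: "('c \<Rightarrow>\<^sub>0 int) set \<Rightarrow> bool" where
  "frag_subgroup K \<longleftrightarrow> 0 \<in> K \<and> (\<forall>x \<in> K. \<forall>y \<in> K. x - y \<in> K)"

lemma frag_subgroup_closed:
  assumes "frag_subgroup K" "x \<in> K"
  shows "frag_cmul n x \<in> K" "y \<in> K \<Longrightarrow> x + y \<in> K" "y \<in> K \<Longrightarrow> x - y \<in> K"
proof -
  show "frag_cmul n x \<in> K" for n
    by (rule frag_closure_minus_cmul[where P = "\<lambda>x. x \<in> K"]) (use assms in \<open>auto simp:
        frag_subgroup_def\<close>)
  then have "- y \<in> K" if "y \<in> K" for y using assms that unfolding frag_subgroup_def by (metis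
      diff_0)
  then show "x + y \<in> K" if "y \<in> K"
    using assms that unfolding frag_subgroup_def by (metis diff_minus_eq_add)
  show "x - y \<in> K" if "y \<in> K" using assms that by (simp add: frag_subgroup_def)
qed

lemma frag_subgroup_keys:
  assumes "frag_subgroup K" "frag_of ` Poly_Mapping.keys x \<subseteq> K" shows "x \<in> K"
  using subset_refl[of "Poly_Mapping.keys x"]
  by (induction x rule: frag_induction) (use assms in \<open>auto simp: frag_subgroup_def\<close>)

context frag_endo begin

text \<open>One exponent for all elements of \<open>K\<close> that some power kills; for the classes
  from a family of modules this is what a bound on \<Phi> provides.\<close>

definition bounded_kernel :: "('c \<Rightarrow>\<^sub>0 int) set \<Rightarrow> bool" where
  "bounded_kernel K \<longleftrightarrow> (\<exists>N. \<forall>x \<in> K. (\<exists>m. (L ^^ m) x = 0) \<longrightarrow> (L ^^ N) x = 0)"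

lemma funpow_zero_mono:
  assumes "(L ^^ m) x = 0" "m \<le> n" shows "(L ^^ n) x = 0"
proof -
  interpret Ln: frag_endo "L ^^ (n - m)" by (rule frag_endo_funpow)
  have "(L ^^ n) x = (L ^^ (n - m)) ((L ^^ m) x)"
    using assms(2) by (metis comp_apply funpow_add le_add_diff_inverse2)
  then show ?thesis using assms(1) by simp
qed

text \<open>Adjoining one generator \<open>s\<close> adds at most one nilpotent direction modulo torsion: if \<open>e s +
  k\<close> with \<open>e \<noteq> 0\<close> is killed eventually, any other such element is, up to a nonzero multiple, a
  multiple of it plus an element of \<open>K\<close>.\<close>

lemma bounded_kernel_adjoin:
  assumes K: "frag_subgroup K" "bounded_kernel K"
  shows "\<exists>K'. frag_subgroup K' \<and> bounded_kernel K' \<and> K \<subseteq> K' \<and> s \<in> K'"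
proof -
  define K' where "K' = {frag_cmul e s + k | e k. k \<in> K}"
  have "frag_subgroup K'" unfolding frag_subgroup_def
  proof (intro conjI ballI)
    have "0 = frag_cmul 0 s + 0" by simp
    then show "0 \<in> K'" unfolding K'_def using K(1) unfolding frag_subgroup_def by blast
    fix x y assume "x \<in> K'" "y \<in> K'"
    then obtain e k e' k' where *: "x = frag_cmul e s + k" "k \<in> K" "y = frag_cmul e' s + k'" "k' \<in>
        K"
      unfolding K'_def by blast
    then have "x - y = frag_cmul (e - e') s + (k - k')" by (simp add: frag_cmul_diff_distrib)
    then show "x - y \<in> K'" unfolding K'_def using frag_subgroup_closed(3)[OF K(1) *(2,4)] by blast
  qed
  moreover have "K \<subseteq> K'"
  proof
    fix k assume "k \<in> K"
    then show "k \<in> K'" unfolding K'_def by (intro CollectI exI[of _ 0] exI[of _ k]) simp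
  qed
  moreover have "s \<in> K'" unfolding K'_def using K(1)
    by (intro CollectI exI[of _ 1] exI[of _ 0]) (simp add: frag_subgroup_def)
  moreover have "bounded_kernel K'"
  proof -
    obtain N where N: "\<And>x m. x \<in> K \<Longrightarrow> (L ^^ m) x = 0 \<Longrightarrow> (L ^^ N) x = 0"
      using K(2) unfolding bounded_kernel_def by blast
    show ?thesis
    proof (cases "\<exists>c k m. c \<noteq> 0 \<and> k \<in> K \<and> (L ^^ m) (frag_cmul c s + k) = 0")
      case True
      then obtain c k0 m0 where c: "c \<noteq> 0" "k0 \<in> K" "(L ^^ m0) (frag_cmul c s + k0) = 0" by blast
      define M where "M = max N m0"
      interpret LM: frag_endo "L ^^ M" by (rule frag_endo_funpow)
      have "(L ^^ M) x = 0" if "x \<in> K'" "(L ^^ m) x = 0" for x m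
      proof -
        obtain e k where x: "x = frag_cmul e s + k" "k \<in> K" using \<open>x \<in> K'\<close> unfolding K'_def by blast
        define x0 where "x0 = frag_cmul c s + k0"
        \<comment> \<open>Cross-multiplication eliminates \<open>s\<close>. The result lies in
          \<open>K\<close> and is killed by some power, hence by \<open>L ^^ N\<close>.\<close>
        define y where "y = frag_cmul c k - frag_cmul e k0"
        have y: "frag_cmul c x = frag_cmul e x0 + y"
          unfolding x x0_def y_def by (simp add: frag_cmul_distrib2 mult.commute)
        interpret Lm: frag_endo "L ^^ max m m0" by (rule frag_endo_funpow)
        have "(L ^^ max m m0) y = (L ^^ max m m0) (frag_cmul c x - frag_cmul e x0)" unfolding y by
            simp
        also have "\<dots> = 0" using funpow_zero_mono[OF that(2), of "max m m0"] funpow_zero_mono[OF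
            c(3), of "max m m0"]
          by (simp add: Lm.L_diff Lm.L_cmul x0_def)
        finally have "(L ^^ N) y = 0" using N[of y] x(2) c(2) frag_subgroup_closed[OF K(1)]
            unfolding y_def by blast
        then have "(L ^^ M) y = 0" using funpow_zero_mono unfolding M_def by simp
        moreover have "(L ^^ M) x0 = 0" using funpow_zero_mono[OF c(3), of M] unfolding M_def
            x0_def by simp
        ultimately have "(L ^^ M) (frag_cmul c x) = 0" unfolding y by (simp add: LM.L_add LM.L_cmul)
        \<comment> \<open>The factor \<open>c\<close> cancels because the free abelian group is
          torsion-free.\<close>
        then show ?thesis using c(1) by (simp add: LM.L_cmul)
      qed
      then show ?thesis unfolding bounded_kernel_def by blast
    next
      case False
      have "(L ^^ N) x = 0" if "x \<in> K'" "(L ^^ m) x = 0" for x m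
      proof -
        obtain e k where x: "x = frag_cmul e s + k" "k \<in> K" using \<open>x \<in> K'\<close> unfolding K'_def by blast
        then have "e = 0" using False that(2) by blast
        then show ?thesis using N x that(2) by simp
      qed
      then show ?thesis unfolding bounded_kernel_def by blast
    qed
  qed
  ultimately show ?thesis by blast
qed

lemma bounded_kernel_adjoin_finite:
  assumes "finite S" "frag_subgroup K" "bounded_kernel K"
  shows "\<exists>K'. frag_subgroup K' \<and> bounded_kernel K' \<and> K \<subseteq> K' \<and> S \<subseteq> K'"
  using assms
proof (induction S)
  case (insert s S)
  then obtain K' where K': "frag_subgroup K'" "bounded_kernel K'" "K \<subseteq> K'" "S \<subseteq> K'" by blast
  then show ?case using bounded_kernel_adjoin[OF K'(1,2), of s] by (metis insert_subset order_trans)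
qed blast

end

section \<open>Ranks of subgroups\<close>

text \<open>Indexed families, so that a family and its image under a map can be compared index by
  index before injectivity is known.\<close>

definition indep_family :: "'i set \<Rightarrow> ('i \<Rightarrow> ('c \<Rightarrow>\<^sub>0 int)) \<Rightarrow> bool" where
  "indep_family I v \<longleftrightarrow> finite I \<and> (\<forall>u. (\<Sum>i\<in>I. frag_cmul (u i) (v i)) = 0 \<longrightarrow> (\<forall>i \<in> I. u i = 0))"

lemma independent_iff_indep_family:
  "finite B \<Longrightarrow> \<not> module.dependent frag_cmul B \<longleftrightarrow> indep_family B (\<lambda>x. x)"
  using module.dependent_finite[OF frag_module, of B] unfolding indep_family_def by blast

lemma indep_family_image:
  assumes "indep_family I v" shows "inj_on v I" "\<not> module.dependent frag_cmul (v ` I)"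
proof -
  have fin: "finite I" using assms by (simp add: indep_family_def)
  show inj: "inj_on v I"
  proof (rule inj_onI, rule ccontr)
    fix i j assume ij: "i \<in> I" "j \<in> I" "v i = v j" "i \<noteq> j"
    define u where "u k = (if k = i then 1 else if k = j then -1 else 0 :: int)" for k
    have "(\<Sum>k\<in>I. frag_cmul (u k) (v k)) = (\<Sum>k\<in>{i, j}. frag_cmul (u k) (v k))"
      using fin ij by (intro sum.mono_neutral_right) (auto simp: u_def)
    also have "\<dots> = 0" using ij by (simp add: u_def)
    finally have "u i = 0" using assms ij unfolding indep_family_def by blast
    then show False by (simp add: u_def)
  qed
  have "indep_family (v ` I) (\<lambda>x. x)"
    unfolding indep_family_def
  proof (intro conjI allI impI)
    fix u assume "(\<Sum>i\<in>v ` I. frag_cmul (u i) i) = 0"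
    then have "(\<Sum>i\<in>I. frag_cmul (u (v i)) (v i)) = 0"
      unfolding sum.reindex[OF inj] by (simp add: comp_def)
    then have "\<forall>i \<in> I. u (v i) = 0"
      using assms unfolding indep_family_def by (elim conjE allE[of _ "\<lambda>i. u (v i)"]) simp
    then show "\<forall>i\<in>v ` I. u i = 0" by blast
  qed (use fin in simp)
  then show "\<not> module.dependent frag_cmul (v ` I)" using independent_iff_indep_family fin by blast
qed

text \<open>Gaussian elimination without division: a pivot vector \<open>v i0\<close> clears the
  coordinate \<open>c\<close> from all the others by cross-multiplication.\<close>

lemma card_indep_family_le:
  assumes "finite F" "indep_family I v" "\<And>i. i \<in> I \<Longrightarrow> Poly_Mapping.keys (v i) \<subseteq> F"
  shows "card I \<le> card F"
  using assms
proof (induction F arbitrary: I v)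
  case empty
  have "I = {}"
  proof (rule ccontr)
    assume "I \<noteq> {}"
    then obtain i where i: "i \<in> I" by blast
    have "\<forall>j \<in> I. v j = 0" using empty(2) by simp
    then have "(\<Sum>i\<in>I. frag_cmul 1 (v i)) = 0" by simp
    then have "(1 :: int) = 0"
      using empty(1) i unfolding indep_family_def by (elim conjE allE[of _ "\<lambda>_. 1"]) simp
    then show False by simp
  qed
  then show ?case by simp
next
  case (insert c F)
  have fin: "finite I" using insert.prems(1) by (simp add: indep_family_def)
  define e where "e i = Poly_Mapping.lookup (v i) c" for i
  show ?case
  proof (cases "\<forall>i \<in> I. e i = 0")
    case True
    then have "Poly_Mapping.keys (v i) \<subseteq> F" if "i \<in> I" for i
      using insert.prems(2)[OF that] that by (auto simp: e_def in_keys_iff)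
    then have "card I \<le> card F" using insert.IH insert.prems(1) by blast
    then show ?thesis using insert.hyps by simp
  next
    case False
    then obtain i0 where i0: "i0 \<in> I" "e i0 \<noteq> 0" by blast
    define w where "w i = frag_cmul (e i0) (v i) - frag_cmul (e i) (v i0)" for i
    let ?I = "I - {i0}"
    have "Poly_Mapping.keys (w i) \<subseteq> F" if "i \<in> ?I" for i
    proof
      fix x assume x: "x \<in> Poly_Mapping.keys (w i)"
      then have "x \<noteq> c" by (auto simp: w_def in_keys_iff lookup_minus e_def)
      moreover have "x \<in> insert c F"
        using x keys_diff[of "frag_cmul (e i0) (v i)" "frag_cmul (e i) (v i0)"] insert.prems(2)[of
            i] insert.prems(2)[OF i0(1)] that
        unfolding w_def by fastforce
      ultimately show "x \<in> F" by blast
    qed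
    moreover have "indep_family ?I w"
      unfolding indep_family_def
    proof (intro conjI allI impI)
      fix u assume 0: "(\<Sum>i\<in>?I. frag_cmul (u i) (w i)) = 0"
      \<comment> \<open>A relation among the cleared vectors, rewritten for the original ones; the
        coefficient of the pivot collects all its contributions.\<close>
      define u' where "u' i = (if i = i0 then - (\<Sum>j\<in>?I. u j * e j) else u i * e i0)" for i
      have w_eq: "frag_cmul (u i) (w i) = frag_cmul (u i * e i0) (v i) - frag_cmul (u i * e i) (v
          i0)" for i
        by (intro poly_mapping_eqI) (simp add: w_def lookup_minus algebra_simps)
      have cs: "frag_cmul (\<Sum>j\<in>?I. u j * e j) (v i0) = (\<Sum>j\<in>?I. frag_cmul (u j * e j) (v i0))"
        using fin by (intro poly_mapping_eqI) (simp add: lookup_sum sum_distrib_right)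
      have "(\<Sum>i\<in>I. frag_cmul (u' i) (v i)) = frag_cmul (u' i0) (v i0) + (\<Sum>i\<in>?I. frag_cmul (u' i)
          (v i))"
        using fin i0 by (simp add: sum.remove)
      also have "(\<Sum>i\<in>?I. frag_cmul (u' i) (v i)) = (\<Sum>i\<in>?I. frag_cmul (u i * e i0) (v i))"
        by (intro sum.cong) (auto simp: u'_def)
      also have "frag_cmul (u' i0) (v i0) = - (\<Sum>j\<in>?I. frag_cmul (u j * e j) (v i0))"
        unfolding cs[symmetric] u'_def by simp
      finally have "(\<Sum>i\<in>I. frag_cmul (u' i) (v i)) = (\<Sum>i\<in>?I. frag_cmul (u i) (w i))"
        by (simp add: w_eq sum_subtractf)
      then have "\<forall>i \<in> I. u' i = 0" using 0 insert.prems(1) unfolding indep_family_def by simp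
      then show "\<forall>i \<in> ?I. u i = 0" using i0 by (auto simp: u'_def split: if_splits)
    qed (use fin in simp)
    ultimately have "card ?I \<le> card F" using insert.IH by blast
    then show ?thesis using insert.hyps fin i0 by (simp add: card_Diff_singleton)
  qed
qed

lemma int_rank_ge:
  assumes "indep_family I v" "v ` I \<subseteq> H" shows "enat (card I) \<le> int_rank H"
  unfolding int_rank_def
proof (rule Sup_upper, intro CollectI exI conjI)
  show "enat (card I) = enat (card (v ` I))" using indep_family_image(1)[OF assms(1)] by (simp
      add: card_image)
  show "finite (v ` I)" using assms(1) by (simp add: indep_family_def)
qed (fact assms(2) indep_family_image(2)[OF assms(1)])+

lemma int_rank_le:
  assumes "\<And>B. \<lbrakk>B \<subseteq> H; indep_family B (\<lambda>x. x)\<rbrakk> \<Longrightarrow> enat (card B) \<le> r"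
  shows "int_rank H \<le> r"
  unfolding int_rank_def
  by (rule Sup_least) (use assms independent_iff_indep_family in blast)

context frag_endo begin

lemma indep_family_lift:
  assumes "indep_family I (\<lambda>i. L (v i))" shows "indep_family I v"
  unfolding indep_family_def
proof (intro conjI allI impI)
  show "finite I" using assms by (simp add: indep_family_def)
  fix u assume "(\<Sum>i\<in>I. frag_cmul (u i) (v i)) = 0"
  then have "L (\<Sum>i\<in>I. frag_cmul (u i) (v i)) = 0" by simp
  then have "(\<Sum>i\<in>I. frag_cmul (u i) (L (v i))) = 0" by (simp add: L_sum L_cmul)
  then show "\<forall>i\<in>I. u i = 0" using assms unfolding indep_family_def by blast
qed

lemma int_rank_image_le: "int_rank (L ` H) \<le> int_rank H"
proof (rule int_rank_le)
  fix B assume B: "B \<subseteq> L ` H" "indep_family B (\<lambda>x. x)"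
  then have "\<forall>b \<in> B. \<exists>h. h \<in> H \<and> L h = b" by blast
  then obtain v where v: "\<forall>b \<in> B. v b \<in> H \<and> L (v b) = b" by (rule bchoice[THEN exE])
  have "(\<Sum>b\<in>B. frag_cmul (u b) (L (v b))) = (\<Sum>b\<in>B. frag_cmul (u b) b)" for u
    using v by (intro sum.cong) simp_all
  then have "indep_family B (\<lambda>b. L (v b))" using B(2) unfolding indep_family_def by simp
  from int_rank_ge[OF indep_family_lift[OF this]] show "enat (card B) \<le> int_rank H" using v by blast
qed

text \<open>A nonzero kernel element, joined to preimages of an independent set of maximal size in
  the image, would give an independent family in \<open>H\<close> that exceeds its rank.\<close>

lemma int_rank_eq_imp_injective:
  assumes eq: "int_rank (L ` H) = int_rank H" and fin: "int_rank H \<noteq> \<infinity>" and x: "x \<in> H" "L x = 0"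
  shows "x = 0"
proof (rule ccontr)
  assume x0: "x \<noteq> 0"
  obtain n where n: "int_rank (L ` H) = enat n" using eq fin by auto
  \<comment> \<open>A finite supremum of a nonempty set of extended naturals is attained, so the
    rank of the image is the size of an actual independent set \<open>B\<close>.\<close>
  let ?S = "{enat (card B) | B. B \<subseteq> L ` H \<and> finite B \<and> \<not> module.dependent frag_cmul B}"
  have "\<not> module.dependent frag_cmul ({} :: ('c \<Rightarrow>\<^sub>0 int) set)"
    using independent_iff_indep_family[of "{}"] by (simp add: indep_family_def)
  then have ne: "?S \<noteq> {}" by blast
  have "Sup ?S = enat n" using n by (simp add: int_rank_def)
  then have "finite ?S" using ne unfolding Sup_enat_def by (auto split: if_splits)
  then have "Max ?S \<in> ?S" using ne by (rule Max_in)
  moreover have "Sup ?S = Max ?S" unfolding Sup_enat_def using \<open>finite ?S\<close> ne by (simp only: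
      if_True if_False)
  ultimately have "Max ?S \<in> ?S" "Sup ?S = Max ?S" by blast+
  then have "Sup ?S \<in> ?S" by simp
  then obtain B where B: "B \<subseteq> L ` H" "finite B" "\<not> module.dependent frag_cmul B" "card B = n"
    using \<open>Sup ?S = enat n\<close> by auto
  have iB: "indep_family B (\<lambda>x. x)" using B independent_iff_indep_family by blast
  have "\<forall>b \<in> B. \<exists>h. h \<in> H \<and> L h = b" using B(1) by blast
  then obtain v where v: "\<forall>b \<in> B. v b \<in> H \<and> L (v b) = b" by (rule bchoice[THEN exE])
  \<comment> \<open>\<open>None\<close> indexes the kernel element, \<open>Some b\<close> the
    preimage of \<open>b\<close>.\<close>
  define I where "I = insert None (Some ` B)"
  define w where "w = case_option x v"
  have "indep_family I w"
    unfolding indep_family_def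
  proof (intro conjI allI impI)
    show "finite I" using B(2) by (simp add: I_def)
    fix u assume "(\<Sum>i\<in>I. frag_cmul (u i) (w i)) = 0"
    then have 0: "frag_cmul (u None) x + (\<Sum>b\<in>B. frag_cmul (u (Some b)) (v b)) = 0"
      unfolding I_def w_def using B(2) by (simp add: sum.reindex comp_def)
    then have "L (frag_cmul (u None) x + (\<Sum>b\<in>B. frag_cmul (u (Some b)) (v b))) = 0" by simp
    then have "(\<Sum>b\<in>B. frag_cmul (u (Some b)) (L (v b))) = 0" using x(2) by (simp add: L_add L_cmul
        L_sum)
    moreover have "(\<Sum>b\<in>B. frag_cmul (u (Some b)) (L (v b))) = (\<Sum>b\<in>B. frag_cmul (u (Some b)) b)"
      using v by (intro sum.cong) simp_all
    ultimately have "(\<Sum>b\<in>B. frag_cmul (u (Some b)) b) = 0" by simp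
    then have "\<forall>b \<in> B. u (Some b) = 0" using iB unfolding indep_family_def by (elim conjE allE[of
        _ "\<lambda>b. u (Some b)"]) simp
    then show "\<forall>i\<in>I. u i = 0" using 0 x0 unfolding I_def by auto
  qed
  moreover have "w ` I \<subseteq> H" using v x(1) by (auto simp: I_def w_def)
  moreover have "card I = Suc n" using B by (simp add: I_def card_image)
  ultimately have "enat (Suc n) \<le> enat n" using int_rank_ge[of I w H] eq n by simp
  then show False by simp
qed

end

section \<open>GLIT classes\<close>

context finite_length_ring begin

sublocale IT: frag_endo "IT_L R"
  by unfold_locales (simp add: IT_L_def frag_extend_diff)

text \<open>Integer combinations of basis elements are the elements supported on them; membership in
  \<open>\<langle>X\<rangle>\<close> can thus be tested on supports.\<close>

lemma IT_span_eq:
  assumes "X \<in> Ob"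
  shows "IT_span R X = {c. Poly_Mapping.keys c \<subseteq> Poly_Mapping.keys (IT_class R X)}"
proof -
  let ?S = "Poly_Mapping.keys (IT_class R X)"
  define G where "G = IT_group R"
  define F where "F = {frag_of (iso_class R Z) | Z. Z \<in> ind_nonproj R \<and> direct_summand R Z X}"
  have "direct_summand R Z X \<longleftrightarrow> summand Z X" if "Z \<in> ind_nonproj R" for Z
    using direct_summand_iff[of Z X] that assms by (simp add: ind_nonproj_def)
  then have F: "F = frag_of ` ?S" unfolding F_def keys_IT_class[OF assms] by auto
  have S: "?S \<subseteq> iso_class R ` ind_nonproj R" unfolding keys_IT_class[OF assms] by blast
  have span: "IT_span R X = generate G F" by (simp add: IT_span_def G_def F_def)
  have G: "x \<otimes>\<^bsub>G\<^esub> y = x + y" "\<one>\<^bsub>G\<^esub> = 0" for x y by (simp_all add: G_def IT_group_def)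
  \<comment> \<open>The condition on the support puts \<open>x\<close> into the carrier of
    \<open>G\<close>, where the group inverse is \<open>- x\<close>.\<close>
  have inv: "inv\<^bsub>G\<^esub> x = - x" if "Poly_Mapping.keys x \<subseteq> ?S" for x
    using that S by (simp add: G_def IT_group_def)
  have 1: "Poly_Mapping.keys c \<subseteq> ?S" if "c \<in> generate G F" for c
    using that
  proof (induction rule: generate.induct)
    case (inv h)
    then have "Poly_Mapping.keys h \<subseteq> ?S" using F by auto
    then show ?case using \<open>\<And>x. Poly_Mapping.keys x \<subseteq> ?S \<Longrightarrow> inv\<^bsub>G\<^esub> x = - x\<close> by simp
  next
    case (eng h1 h2)
    then show ?case using keys_add[of h1 h2] by (auto simp: G)
  qed (auto simp: G F)
  have neg: "- c \<in> generate G F" if "c \<in> generate G F" for c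
    using that
  proof (induction rule: generate.induct)
    case one then show ?case using generate.one[of G F] by (simp add: G)
  next
    case (incl h)
    then have "inv\<^bsub>G\<^esub> h = - h" using inv F by auto
    then show ?case using generate.inv[OF incl, of G] by simp
  next
    case (inv h)
    then have "inv\<^bsub>G\<^esub> h = - h" using \<open>\<And>x. Poly_Mapping.keys x \<subseteq> ?S \<Longrightarrow> inv\<^bsub>G\<^esub> x = - x\<close> F by auto
    then show ?case using generate.incl[OF inv, of G] by simp
  next
    case (eng h1 h2)
    then show ?case using generate.eng[OF eng.IH] by (simp add: G)
  qed
  have "c \<in> generate G F" if "Poly_Mapping.keys c \<subseteq> ?S" for c
    using that
  proof (induction c rule: frag_induction)
    case zero then show ?case using generate.one[of G F] by (simp add: G)
  next
    case (one x) then show ?case using generate.incl[of "frag_of x" F G] F by simp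
  next
    case (diff a b)
    then show ?case using generate.eng[OF diff(1) neg[OF diff(2)]] by (simp add: G)
  qed
  then show ?thesis using 1 span by blast
qed

text \<open>From \<Phi>(X) on the ranks are constant and finite, so \<open>L\<close> is injective on
  each later image of \<open>\<langle>X\<rangle>\<close>; whatever some power kills is therefore
  killed by \<open>L ^^ d\<close>.\<close>

lemma IT_span_kernel:
  assumes X: "X \<in> Ob" and x: "x \<in> IT_span R X" "(IT_L R ^^ m) x = 0" and d: "IT_Phi R X \<le> d"
  shows "(IT_L R ^^ d) x = 0"
proof -
  let ?L = "IT_L R"
  define r where "r k = int_rank ((?L ^^ k) ` IT_span R X)" for k
  define F where "F = Poly_Mapping.keys (IT_class R X)"
  have step: "?L ` (?L ^^ k) ` IT_span R X = (?L ^^ Suc k) ` IT_span R X" for k by (simp add: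
      image_image)
  have dec: "r (Suc k) \<le> r k" for k
    unfolding r_def step[symmetric] by (rule IT.int_rank_image_le)
  have anti: "r k \<le> r l" if "l \<le> k" for k l
    using that by (induction k rule: dec_induct) (auto intro: order_trans[OF dec])
  have "r 0 \<le> enat (card F)" unfolding r_def
  proof (rule int_rank_le)
    fix B assume B: "B \<subseteq> (?L ^^ 0) ` IT_span R X" "indep_family B (\<lambda>x. x)"
    have "card B \<le> card F"
      by (rule card_indep_family_le[OF _ B(2)]) (use B(1) IT_span_eq[OF X] in \<open>auto simp: F_def\<close>)
    then show "enat (card B) \<le> enat (card F)" by simp
  qed
  then have fin: "r k \<noteq> \<infinity>" for k using anti[of 0 k] by (metis enat_ord_simps(5) infinity_ileE le0
      order_trans)
  \<comment> \<open>Without a stabilising index the \<open>LEAST\<close> in \<open>IT_Phi\<close>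
    would be unspecified.\<close>
  have "\<exists>n. \<forall>k \<ge> n. r k = r (Suc k)"
  proof -
    define n where "n = (LEAST n. \<exists>k. r k = n)"
    have "\<exists>k. r k = n" unfolding n_def by (rule LeastI_ex) blast
    then obtain k where k: "r k = n" by blast
    have "n \<le> r l" for l unfolding n_def by (rule Least_le) blast
    then have "r l = n" if "l \<ge> k" for l using anti[OF that] k by (simp add: order_antisym)
    then show ?thesis by (metis le_Suc_eq)
  qed
  then have stable: "\<forall>k \<ge> IT_Phi R X. r k = r (Suc k)"
    unfolding IT_Phi_def r_def by (rule LeastI_ex)
  have eq: "r (Suc k) = r k" if "d \<le> k" for k
    using stable order_trans[OF d that] by metis
  have inj: "y = 0" if "d \<le> k" "y \<in> (?L ^^ k) ` IT_span R X" "?L y = 0" for k y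
    using IT.int_rank_eq_imp_injective[of "(?L ^^ k) ` IT_span R X" y] eq[OF that(1)] fin[of k]
        that(2,3)
    unfolding r_def step by simp
  \<comment> \<open>Powers are removed one at a time, down to \<open>d\<close>.\<close>
  have "(?L ^^ d) x = 0" if "(?L ^^ (d + j)) x = 0" for j
    using that
  proof (induction j)
    case (Suc j)
    have "?L ((?L ^^ (d + j)) x) = 0" using Suc.prems by simp
    then have "(?L ^^ (d + j)) x = 0" using inj[of "d + j" "(?L ^^ (d + j)) x"] x(1) by simp
    then show ?case by (rule Suc.IH)
  qed simp
  moreover have "(?L ^^ (d + m)) x = 0" using IT.funpow_zero_mono[OF x(2), of "d + m"] by simp
  ultimately show ?thesis by blast
qed

text \<open>Replaces the external sum of the definition, whose elements are lists of lists, by a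
  module \<open>W\<close> in \<open>fmod R\<close>.\<close>

lemma add_class_iff:
  assumes "C \<subseteq> Ob"
  shows "X \<in> add_class R C \<longleftrightarrow> X \<in> Ob \<and> (\<exists>W Ms. W \<in> Ob \<and> set Ms \<subseteq> C \<and> decomp W Ms \<and> summand X W)"
proof
  assume "X \<in> add_class R C"
  then obtain Ms where X: "X \<in> Ob" and Ms: "set Ms \<subseteq> C" "direct_summand R X (dsum_list Ms)"
    unfolding add_class_def by blast
  have Ob: "set Ms \<subseteq> Ob" using Ms assms by blast
  have m: "LMod (dsum_list Ms)" using Ob by (intro dsum_list_Mod) auto
  obtain W where W: "W \<in> Ob" "module_iso R (dsum_list Ms) W" using ex_iso_fmod[OF m
      dsum_list_fin_gen[OF Ob]] by blast
  then obtain f g where fg: "iso_pair (dsum_list Ms) W f g" using module_iso_iff[OF m] by blast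
  obtain Y i j p q where Y: "Y \<in> Ob" "biproduct X Y (dsum_list Ms) i j p q"
    using Ms(2) direct_summand_iff[OF X m] unfolding summand_def by blast
  have "summand X W" unfolding summand_def using biproduct_iso[OF Y(2) fg] Y(1) by blast
  moreover have "decomp W Ms" using iso_pair_dsum_list_decomp[OF iso_pair_sym[OF fg] W(1) Ob] .
  ultimately show "X \<in> Ob \<and> (\<exists>W Ms. W \<in> Ob \<and> set Ms \<subseteq> C \<and> decomp W Ms \<and> summand X W)"
    using X W(1) Ms(1) by blast
next
  assume "X \<in> Ob \<and> (\<exists>W Ms. W \<in> Ob \<and> set Ms \<subseteq> C \<and> decomp W Ms \<and> summand X W)"
  then obtain W Ms where *: "X \<in> Ob" "W \<in> Ob" "set Ms \<subseteq> C" "decomp W Ms" "summand X W" by blast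
  have Ob: "set Ms \<subseteq> Ob" using * assms by blast
  have m: "LMod (dsum_list Ms)" using Ob by (intro dsum_list_Mod) auto
  obtain f g where fg: "iso_pair W (dsum_list Ms) f g" using decomp_iso_pair_dsum_list[OF *(4,2)
      Ob] by blast
  obtain Y i j p q where Y: "Y \<in> Ob" "biproduct X Y W i j p q" using *(5) unfolding summand_def by
      blast
  have "summand X (dsum_list Ms)" unfolding summand_def using biproduct_iso[OF Y(2) fg] Y(1) by
      blast
  then have "direct_summand R X (dsum_list Ms)" using direct_summand_iff[OF *(1) m] by blast
  then show "X \<in> add_class R C" unfolding add_class_def using *(1,3) by blast
qed

lemma keys_IT_class_summand:
  assumes "summand Z X" "Z \<in> Ob" "X \<in> Ob"
  shows "Poly_Mapping.keys (IT_class R Z) \<subseteq> Poly_Mapping.keys (IT_class R X)"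
proof
  fix c assume "c \<in> Poly_Mapping.keys (IT_class R Z)"
  then obtain M where M: "M \<in> ind_nonproj R" "summand M Z" "c = iso_class R M"
    unfolding keys_IT_class[OF assms(2)] by blast
  then have "summand M X" using summand_trans assms unfolding ind_nonproj_def by blast
  then show "c \<in> Poly_Mapping.keys (IT_class R X)" unfolding keys_IT_class[OF assms(3)] using M by
      blast
qed

lemma keys_IT_class_biproduct:
  assumes "biproduct A B X i j p q" "A \<in> Ob" "B \<in> Ob" "X \<in> Ob"
  shows "Poly_Mapping.keys (IT_class R X) = Poly_Mapping.keys (IT_class R A) \<union> Poly_Mapping.keys
      (IT_class R B)"
proof -
  have "c \<in> Poly_Mapping.keys (IT_class R X) \<longleftrightarrow> c \<in> Poly_Mapping.keys (IT_class R A) \<or> c \<in>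
      Poly_Mapping.keys (IT_class R B)" for c
    using IT_class_biproduct[OF assms] IT_class_nonneg[OF assms(2), of c] IT_class_nonneg[OF
        assms(3), of c]
    by (simp add: in_keys_iff lookup_add add_nonneg_eq_0_iff)
  then show ?thesis by blast
qed

lemma keys_IT_class_decomp:
  "\<lbrakk>decomp W Ms; W \<in> Ob; set Ms \<subseteq> Ob\<rbrakk> \<Longrightarrow>
    Poly_Mapping.keys (IT_class R W) = (\<Union>M \<in> set Ms. Poly_Mapping.keys (IT_class R M))"
proof (induction Ms arbitrary: W)
  case Nil
  then show ?case using IT_class_projective projective_zero[of W] by simp
next
  case (Cons M Ms)
  obtain Y i j p q where Y: "Y \<in> Ob" "biproduct M Y W i j p q" "decomp Y Ms"
    using decomp_ConsE[OF Cons.prems(1)] .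
  then show ?case using keys_IT_class_biproduct[OF Y(2)] Cons.IH[OF Y(3,1)] Cons.prems by auto
qed

section \<open>Cokernels of stable endomorphisms\<close>

lemma Omega_pow_stable_iso:
  assumes "stable_iso A B f" "A \<in> Ob" "B \<in> Ob"
  shows "stable_iso ((Syz R ^^ k) A) ((Syz R ^^ k) B) (Omega_pow k A B f)"
proof -
  obtain g where g: "f \<in> Hom A B" "g \<in> Hom B A" "stable_eq A A (\<lambda>x. g (f x)) (\<lambda>x. x)" "stable_eq B
      B (\<lambda>x. f (g x)) (\<lambda>x. x)"
    using stable_isoE[OF assms(1)] .
  note Ob = Syz_funpow_Ob[OF assms(2), of k] Syz_funpow_Ob[OF assms(3), of k]
  have c: "stable_eq ((Syz R ^^ k) A) ((Syz R ^^ k) A) (\<lambda>x. Omega_pow k B A g (Omega_pow k A B f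
      x)) (\<lambda>x. x)"
    if "f \<in> Hom A B" "g \<in> Hom B A" "stable_eq A A (\<lambda>x. g (f x)) (\<lambda>x. x)" "A \<in> Ob" "B \<in> Ob" for A B
        f g
  proof -
    note ObA = Syz_funpow_Ob[OF that(4), of k]
    have 1: "stable_eq ((Syz R ^^ k) A) ((Syz R ^^ k) A) (\<lambda>x. Omega_pow k B A g (Omega_pow k A B f
        x)) (Omega_pow k A A (\<lambda>x. g (f x)))"
      by (rule stable_eq_sym[OF Omega_pow_comp[OF that(1,2,4,5,4)] ObA ObA])
    have 2: "stable_eq ((Syz R ^^ k) A) ((Syz R ^^ k) A) (Omega_pow k A A (\<lambda>x. g (f x))) (\<lambda>x. x)"
      by (rule stable_eq_trans[OF Omega_pow_stable_eq[OF that(3,4,4)] Omega_pow_id[OF that(4)] ObA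
          ObA])
    show ?thesis by (rule stable_eq_trans[OF 1 2 ObA ObA])
  qed
  show ?thesis
    by (rule stable_isoI[OF Omega_pow_hom[OF assms(2,3) g(1)] Omega_pow_hom[OF assms(3,2) g(2)]
        c[OF g(1-3) assms(2,3)] c[OF g(2,1,4) assms(3,2)]])
qed

lemma projective_iff_proj_factor_id: "A \<in> Ob \<Longrightarrow> projective R A \<longleftrightarrow> proj_factor A A (\<lambda>x. x)"
  using projective_iff_stable_eq stable_eq_zero_iff_proj_factor hom_id by blast

lemma stable_eq_proj_factor:
  assumes "stable_eq A B f g" "proj_factor A B f" "A \<in> Ob" "B \<in> Ob" shows "proj_factor A B g"
proof -
  have h: "f \<in> Hom A B" "g \<in> Hom A B" using assms(1) unfolding stable_eq_def by blast+
  have "stable_eq A B f (\<lambda>_. \<zero>\<^bsub>B\<^esub>)" using stable_eq_zero_iff_proj_factor[OF assms(3,4) h(1)]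
      assms(2) by blast
  then have "stable_eq A B g (\<lambda>_. \<zero>\<^bsub>B\<^esub>)" using stable_eq_trans[OF stable_eq_sym[OF assms(1,3,4)] _
      assms(3,4)] by blast
  then show ?thesis using stable_eq_zero_iff_proj_factor[OF assms(3,4) h(2)] by blast
qed

text \<open>The Igusa--Todorov argument: if \<open>A\<close> and \<open>B\<close> are stably isomorphic then \<open>f\<close> is stably an
  endomorphism \<open>a\<close> of \<open>A\<close>. As \<open>\<Omega>\<^sup>m a\<close> is a stable isomorphism for \<open>m \<ge> pd Y\<close>, the summand on which
  \<open>a\<close> is nilpotent has finite projective dimension, hence at most \<open>b\<close>; so \<open>\<Omega>\<^sup>b a\<close> is already a
  stable isomorphism.\<close>

lemma projective_Syz_of_stable_endo:
  assumes se: "short_exact R A B Y f g" and Ob: "A \<in> Ob" "B \<in> Ob" "Y \<in> Ob" and \<gamma>: "stable_iso B A \<gamma>"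
    and Y: "projective R ((Syz R ^^ m) Y)"
    and b: "\<And>Z k. \<lbrakk>Z \<in> Ob; summand Z A; projective R ((Syz R ^^ k) Z)\<rbrakk> \<Longrightarrow> projective R ((Syz R ^^
        b) Z)"
  shows "projective R ((Syz R ^^ Suc b) Y)"
proof -
  have f: "f \<in> Hom A B" using short_exactD(1)[OF se] Ob by simp
  have gh: "\<gamma> \<in> Hom B A" using \<gamma> unfolding stable_iso_def by blast
  define a where "a x = \<gamma> (f x)" for x
  have a: "a \<in> Hom A A" unfolding a_def by (rule hom_comp[OF f gh])
  note Obk = Syz_funpow_Ob[OF Ob(1)] Syz_funpow_Ob[OF Ob(2)] Syz_funpow_Ob[OF Ob(3)]
  have comp_a: "stable_eq ((Syz R ^^ k) A) ((Syz R ^^ k) A) (Omega_pow k A A a) (\<lambda>x. Omega_pow k B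
      A \<gamma> (Omega_pow k A B f x))" for k
    unfolding a_def by (rule Omega_pow_comp[OF f gh Ob(1,2,1)])
  obtain Bm fm gm \<beta> where m: "Bm \<in> Ob" "short_exact R ((Syz R ^^ m) A) Bm ((Syz R ^^ m) Y) fm gm"
     "stable_iso Bm ((Syz R ^^ m) B) \<beta>" "stable_eq ((Syz R ^^ m) A) ((Syz R ^^ m) B) (\<lambda>x. \<beta> (fm
         x)) (Omega_pow m A B f)"
    using short_exact_Syz_funpow[OF se Ob, of m] by blast
  \<comment> \<open>\<Omega>^m Y is projective, so the m-th syzygy of \<open>f\<close>, and with it
    that of \<open>a\<close>, is a stable isomorphism.\<close>
  have "stable_iso ((Syz R ^^ m) A) Bm fm" by (rule stable_iso_if_projective_coker[OF m(2) Obk(1)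
      m(1) Obk(3) Y])
  from stable_iso_comp[OF this m(3) Obk(1) m(1) Obk(2)] have "stable_iso ((Syz R ^^ m) A) ((Syz R
      ^^ m) B) (Omega_pow m A B f)"
    by (rule stable_iso_stable_eq[OF _ m(4) Obk(1,2)])
  from stable_iso_comp[OF this Omega_pow_stable_iso[OF \<gamma> Ob(2,1)] Obk(1,2,1)] have am: "stable_iso
      ((Syz R ^^ m) A) ((Syz R ^^ m) A) (Omega_pow m A A a)"
    by (rule stable_iso_stable_eq[OF _ stable_eq_sym[OF comp_a Obk(1,1)] Obk(1,1)])
  obtain e h n where eh: "e \<in> Hom A A" "h \<in> Hom A A" "\<forall>x \<in> carrier A.
    e (e x) = e x \<and> h (a x) \<oplus>\<^bsub>A\<^esub> e x = x \<and> a (h x) \<oplus>\<^bsub>A\<^esub> e x = x \<and> (a ^^ n) (e x) = \<zero>\<^bsub>A\<^esub>"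
    using fitting[OF Ob(1) a] by blast
  obtain Z i p where Z: "Z \<in> Ob" "i \<in> Hom Z A" "p \<in> Hom A Z" "\<forall>z \<in> carrier Z. p (i z) = z" "\<forall>x \<in>
      carrier A. i (p x) = e x"
    using idempotent_split[OF Ob(1) eh(1)] eh(3) by blast
  have sZ: "summand Z A" using retract_summand[OF Ob(1) Z(1-3)] Z(4) by blast
  have Obm: "(Syz R ^^ m) A \<in> Ob" "(Syz R ^^ m) Z \<in> Ob" using Ob Z by simp_all
  have aje: "(\<lambda>x. (a ^^ j) (e x)) \<in> Hom A A" for j by (rule hom_comp[OF eh(1) hom_funpow[OF a]])
  have "proj_factor A A (\<lambda>x. (a ^^ n) (e x))"
    by (rule proj_factor_cong[OF proj_factor_zero[OF Ob(1,1)] _ aje]) (use eh(3) in simp)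
  then have base0: "proj_factor ((Syz R ^^ m) A) ((Syz R ^^ m) A) (Omega_pow m A A (\<lambda>x. (a ^^ n)
      (e x)))"
    by (rule Omega_pow_proj_factor[OF _ Ob(1,1)])
  obtain l where l: "l \<in> Hom ((Syz R ^^ m) A) ((Syz R ^^ m) A)"
    "stable_eq ((Syz R ^^ m) A) ((Syz R ^^ m) A) (\<lambda>x. l (Omega_pow m A A a x)) (\<lambda>x. x)" using
        stable_isoE[OF am] by metis
  \<comment> \<open>Downward induction from \<open>(a ^^ n) (e x)\<close>, which vanishes: each
    factor \<Omega>^m a is cancelled by its stable left inverse \<open>l\<close>, until \<Omega>^m e
    itself is stably zero.\<close>
  have "proj_factor ((Syz R ^^ m) A) ((Syz R ^^ m) A) (Omega_pow m A A (\<lambda>x. (a ^^ j) (e x)))" if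
      "j \<le> n" for j
    using that
  proof (induction j rule: inc_induct)
    case base show ?case by (rule base0)
  next
    case (step j)
    note hj = Omega_pow_hom[OF Ob(1,1) aje, of m j]
    have "stable_eq ((Syz R ^^ m) A) ((Syz R ^^ m) A) (Omega_pow m A A (\<lambda>x. (a ^^ Suc j) (e x)))
        (\<lambda>x. Omega_pow m A A a (Omega_pow m A A (\<lambda>x. (a ^^ j) (e x)) x))"
      using Omega_pow_comp[OF aje a Ob(1,1,1), of m j] by simp
    from stable_eq_proj_factor[OF this step.IH Obm(1,1)] have 1: "proj_factor ((Syz R ^^ m) A)
        ((Syz R ^^ m) A) (\<lambda>x. l (Omega_pow m A A a (Omega_pow m A A (\<lambda>x. (a ^^ j) (e x)) x)))"
      by (rule proj_factor_comp_left[OF _ l(1)])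
    have "stable_eq ((Syz R ^^ m) A) ((Syz R ^^ m) A) (\<lambda>x. l (Omega_pow m A A a (Omega_pow m A A
        (\<lambda>x. (a ^^ j) (e x)) x))) (Omega_pow m A A (\<lambda>x. (a ^^ j) (e x)))"
      by (rule stable_eq_comp[OF stable_eq_refl[OF Obm(1,1) hj] l(2) Obm(1,1,1)])
    from stable_eq_proj_factor[OF this 1 Obm(1,1)] show ?case .
  qed
  from this[of 0] have em: "proj_factor ((Syz R ^^ m) A) ((Syz R ^^ m) A) (Omega_pow m A A e)" by
      simp
  have ei: "(\<lambda>z. e (i z)) \<in> Hom Z A" and pe: "(\<lambda>x. p (e x)) \<in> Hom A Z"
    by (rule hom_comp[OF Z(2) eh(1)], rule hom_comp[OF eh(1) Z(3)])
  \<comment> \<open>The identity of \<open>Z\<close> is the composite of \<open>i\<close>,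
    \<open>e\<close> and \<open>p\<close>, so it too becomes stably zero under \<Omega>^m.\<close>
  have "proj_factor ((Syz R ^^ m) Z) ((Syz R ^^ m) Z) (\<lambda>x. x)"
  proof -
    have 1: "proj_factor ((Syz R ^^ m) Z) ((Syz R ^^ m) A) (\<lambda>z. Omega_pow m A A e (Omega_pow m Z A
        i z))"
      by (rule proj_factor_comp_right[OF em Omega_pow_hom[OF Z(1) Ob(1) Z(2)]])
    have "proj_factor ((Syz R ^^ m) Z) ((Syz R ^^ m) A) (Omega_pow m Z A (\<lambda>z. e (i z)))"
      by (rule stable_eq_proj_factor[OF stable_eq_sym[OF Omega_pow_comp[OF Z(2) eh(1) Z(1)
          Ob(1,1)] Obm(2,1)] 1 Obm(2,1)])
    then have 2: "proj_factor ((Syz R ^^ m) Z) ((Syz R ^^ m) Z) (\<lambda>z. Omega_pow m A Z p (Omega_pow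
        m Z A (\<lambda>z. e (i z)) z))"
      by (rule proj_factor_comp_left[OF _ Omega_pow_hom[OF Ob(1) Z(1) Z(3)]])
    have 3: "proj_factor ((Syz R ^^ m) Z) ((Syz R ^^ m) Z) (Omega_pow m Z Z (\<lambda>z. p (e (i z))))"
      by (rule stable_eq_proj_factor[OF stable_eq_sym[OF Omega_pow_comp[OF ei Z(3) Z(1) Ob(1)
          Z(1)] Obm(2,2)] 2 Obm(2,2)])
    have "p (e (i z)) = z" if "z \<in> carrier Z" for z
      using Z(4,5) hom_simps(1)[OF Z(2) that] that by metis
    then have "stable_eq Z Z (\<lambda>z. p (e (i z))) (\<lambda>z. z)"
      by (intro stable_eqI[OF Z(1,1) hom_comp[OF ei Z(3)] hom_id])
    then have "stable_eq ((Syz R ^^ m) Z) ((Syz R ^^ m) Z) (Omega_pow m Z Z (\<lambda>z. p (e (i z))))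
        (\<lambda>x. x)"
      using stable_eq_trans[OF Omega_pow_stable_eq[OF _ Z(1,1)] Omega_pow_id[OF Z(1)] Obm(2,2)] by
          blast
    from stable_eq_proj_factor[OF this 3 Obm(2,2)] show ?thesis .
  qed
  then have "projective R ((Syz R ^^ m) Z)" using projective_iff_proj_factor_id[OF Obm(2)] by blast
  \<comment> \<open>Here the exponent \<open>m\<close>, which depends on \<open>Y\<close>, gives way
    to the uniform \<open>b\<close>.\<close>
  then have Zb: "projective R ((Syz R ^^ b) Z)" by (rule b[OF Z(1) sZ])
  have Obb: "(Syz R ^^ b) A \<in> Ob" "(Syz R ^^ b) Z \<in> Ob" using Ob Z by simp_all
  have "proj_factor ((Syz R ^^ b) A) ((Syz R ^^ b) Z) (Omega_pow b A Z p)"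
    using proj_factor_projective[OF Omega_pow_hom[OF Ob(1) Z(1) Z(3)] _ Obb] Zb by blast
  then have "proj_factor ((Syz R ^^ b) A) ((Syz R ^^ b) A) (\<lambda>x. Omega_pow b Z A i (Omega_pow b A Z
      p x))"
    by (rule proj_factor_comp_left[OF _ Omega_pow_hom[OF Z(1) Ob(1) Z(2)]])
  from stable_eq_proj_factor[OF stable_eq_sym[OF Omega_pow_comp[OF Z(3,2) Ob(1) Z(1) Ob(1)]
      Obb(1,1)] this Obb(1,1)]
  have 1: "proj_factor ((Syz R ^^ b) A) ((Syz R ^^ b) A) (Omega_pow b A A (\<lambda>x. i (p x)))" .
  have "stable_eq A A (\<lambda>x. i (p x)) e" by (rule stable_eqI[OF Ob(1,1) hom_comp[OF Z(3,2)]
      eh(1)]) (use Z(5) in simp)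
  from stable_eq_proj_factor[OF Omega_pow_stable_eq[OF this Ob(1,1)] 1 Obb(1,1)] have eb:
      "proj_factor ((Syz R ^^ b) A) ((Syz R ^^ b) A) (Omega_pow b A A e)" .
  have e0: "stable_eq ((Syz R ^^ b) A) ((Syz R ^^ b) A) (Omega_pow b A A e) (\<lambda>_. \<zero>\<^bsub>(Syz R ^^ b) A\<^esub>)"
    using stable_eq_zero_iff_proj_factor[OF Obb(1,1) Omega_pow_hom[OF Ob(1,1) eh(1)]] eb by blast
  \<comment> \<open>\<Omega>^b e vanishes stably, so \<open>v u + e = 1\<close> becomes a one-sided
    inverse relation; used for \<open>a\<close> and \<open>h\<close> in both orders it inverts
    \<Omega>^b a.\<close>
  have inv: "stable_eq ((Syz R ^^ b) A) ((Syz R ^^ b) A) (\<lambda>x. Omega_pow b A A v (Omega_pow b A A u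
      x)) (\<lambda>x. x)"
    if u: "u \<in> Hom A A" and v: "v \<in> Hom A A" and uv: "\<And>x. x \<in> carrier A \<Longrightarrow> v (u x) \<oplus>\<^bsub>A\<^esub> e x = x"
        for u v
  proof -
    let ?A = "(Syz R ^^ b) A"
    note c = hom_comp[OF u v]
    note C = hom_comp[OF Omega_pow_hom[OF Ob(1,1) u, of b] Omega_pow_hom[OF Ob(1,1) v, of b]]
    have s: "stable_eq A A (\<lambda>x. v (u x) \<oplus>\<^bsub>A\<^esub> e x) (\<lambda>x. x)"
      by (rule stable_eqI[OF Ob(1,1) hom_add[OF Ob_Mod[OF Ob(1)] c eh(1)] hom_id uv])
    have 1: "stable_eq ?A ?A (Omega_pow b A A (\<lambda>x. v (u x) \<oplus>\<^bsub>A\<^esub> e x)) (\<lambda>x. x)"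
      by (rule stable_eq_trans[OF Omega_pow_stable_eq[OF s Ob(1,1)] Omega_pow_id[OF Ob(1)]
          Obb(1,1)])
    have 2: "stable_eq ?A ?A (\<lambda>x. Omega_pow b A A (\<lambda>x. v (u x)) x \<oplus>\<^bsub>?A\<^esub> Omega_pow b A A e x) (\<lambda>x.
        x)"
      by (rule stable_eq_trans[OF stable_eq_sym[OF Omega_pow_add[OF c eh(1) Ob(1,1)] Obb(1,1)] 1
          Obb(1,1)])
    have 3: "stable_eq ?A ?A (\<lambda>x. Omega_pow b A A v (Omega_pow b A A u x) \<oplus>\<^bsub>?A\<^esub> \<zero>\<^bsub>?A\<^esub>) (\<lambda>x.
        Omega_pow b A A (\<lambda>x. v (u x)) x \<oplus>\<^bsub>?A\<^esub> Omega_pow b A A e x)"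
      by (rule stable_eq_add[OF stable_eq_sym[OF Omega_pow_comp[OF u v Ob(1,1,1)] Obb(1,1)]
          stable_eq_sym[OF e0 Obb(1,1)] Obb(1,1)])
    have 4: "stable_eq ?A ?A (\<lambda>x. Omega_pow b A A v (Omega_pow b A A u x)) (\<lambda>x. Omega_pow b A A v
        (Omega_pow b A A u x) \<oplus>\<^bsub>?A\<^esub> \<zero>\<^bsub>?A\<^esub>)"
    proof (rule stable_eqI[OF Obb(1,1) C hom_add[OF Ob_Mod[OF Obb(1)] C hom_zero[OF Ob_Mod[OF
        Obb(1)]]]])
      fix x assume "x \<in> carrier ?A"
      then show "Omega_pow b A A v (Omega_pow b A A u x) = Omega_pow b A A v (Omega_pow b A A u x)
          \<oplus>\<^bsub>?A\<^esub> \<zero>\<^bsub>?A\<^esub>"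
        using hom_simps(1)[OF C] Obb(1) by simp
    qed
    show ?thesis by (rule stable_eq_trans[OF 4 stable_eq_trans[OF 3 2 Obb(1,1)] Obb(1,1)])
  qed
  have ab: "stable_iso ((Syz R ^^ b) A) ((Syz R ^^ b) A) (Omega_pow b A A a)"
    by (rule stable_isoI[OF Omega_pow_hom[OF Ob(1,1) a] Omega_pow_hom[OF Ob(1,1) eh(2)] inv[OF a
        eh(2)] inv[OF eh(2) a]])
      (use eh(3) in simp_all)
  from stable_iso_stable_eq[OF ab comp_a Obb(1,1)] have fb: "stable_iso ((Syz R ^^ b) A) ((Syz R
      ^^ b) B) (Omega_pow b A B f)"
    by (rule stable_iso_cancel[OF _ Omega_pow_stable_iso[OF \<gamma> Ob(2,1)] Omega_pow_hom[OF Ob(1,2) f]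
        Obk(1,2,1)])
  obtain Bb fb' gb \<beta>b where bb: "Bb \<in> Ob" "short_exact R ((Syz R ^^ b) A) Bb ((Syz R ^^ b) Y) fb'
      gb"
     "stable_iso Bb ((Syz R ^^ b) B) \<beta>b" "stable_eq ((Syz R ^^ b) A) ((Syz R ^^ b) B) (\<lambda>x. \<beta>b (fb'
         x)) (Omega_pow b A B f)"
    using short_exact_Syz_funpow[OF se Ob, of b] by blast
  have "fb' \<in> Hom ((Syz R ^^ b) A) Bb" using short_exactD(1)[OF bb(2)] Obk bb(1) by simp
  then have "stable_iso ((Syz R ^^ b) A) Bb fb'"
    using stable_iso_cancel[OF stable_iso_stable_eq[OF fb stable_eq_sym[OF bb(4) Obk(1,2)]
        Obk(1,2)] bb(3) _ Obk(1) bb(1) Obk(2)] by blast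
  \<comment> \<open>The cokernel of a stable isomorphism costs the additional syzygy in
    \<open>Suc b\<close>.\<close>
  then show ?thesis using projective_Syz_coker[OF bb(2) Obk(1) bb(1) Obk(3)] by simp
qed

section \<open>Finiteness of the finitistic dimension\<close>

lemma short_exact_iso:
  assumes se: "short_exact R A B Y f g" and i: "iso_pair A A' \<phi> \<phi>'" "iso_pair B B' \<psi> \<psi>'"
    and M: "LMod A" "LMod B" "LMod A'" "LMod B'" "LMod Y"
  shows "short_exact R A' B' Y (\<lambda>x. \<psi> (f (\<phi>' x))) (\<lambda>x. g (\<psi>' x))"
proof -
  note d = short_exactD[OF se M(1,2,5)]
  note h = iso_pairD[OF i(1)] iso_pairD[OF i(2)]
  note [simp] = hom_simps[OF h(1)] hom_simps[OF h(2)] hom_simps[OF h(5)] hom_simps[OF h(6)]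
      h(3,4,7,8) M d(3)
    hom_simps[OF d(1)] hom_simps[OF d(2)]
  show ?thesis
  proof (rule short_exactI)
    show "(\<lambda>x. \<psi> (f (\<phi>' x))) \<in> Hom A' B'" by (rule hom_comp[OF hom_comp[OF h(2) d(1)] h(5)])
    show "(\<lambda>x. g (\<psi>' x)) \<in> Hom B' Y" by (rule hom_comp[OF h(6) d(2)])
  next
    fix y assume y: "y \<in> carrier B'" "g (\<psi>' y) = \<zero>\<^bsub>Y\<^esub>"
    then obtain a where "a \<in> carrier A" "f a = \<psi>' y" using d(4)[of "\<psi>' y"] by auto
    then show "\<exists>a\<in>carrier A'. \<psi> (f (\<phi>' a)) = y" using y by (intro bexI[of _ "\<phi> a"]) simp_all
  next
    fix c assume "c \<in> carrier Y"
    then obtain z where "z \<in> carrier B" "g z = c" using d(5) by blast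
    then show "\<exists>b\<in>carrier B'. g (\<psi>' b) = c" by (intro bexI[of _ "\<psi> z"]) simp_all
  next
    fix a assume a: "a \<in> carrier A'" "\<psi> (f (\<phi>' a)) = \<zero>\<^bsub>B'\<^esub>"
    have "f (\<phi>' a) = \<psi>' (\<psi> (f (\<phi>' a)))" using a(1) by simp
    also have "\<dots> = \<zero>\<^bsub>B\<^esub>" unfolding a(2) by simp
    finally have "\<phi>' a = \<zero>\<^bsub>A\<^esub>" using d(6)[of "\<phi>' a"] a by simp
    then have "\<phi> (\<phi>' a) = \<phi> \<zero>\<^bsub>A\<^esub>" by simp
    then show "a = \<zero>\<^bsub>A'\<^esub>" using a by simp
  qed simp_all
qed

text \<open>The sequence in the definition of a GLIT class lives on pairs, while syzygies are formed
  in \<open>fmod R\<close>.\<close>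

lemma dsum_short_exact:
  assumes se: "short_exact R (A1 \<boxplus> A2) (B1 \<boxplus> B2) Y f g"
    and Ob: "A1 \<in> Ob" "A2 \<in> Ob" "B1 \<in> Ob" "B2 \<in> Ob" "Y \<in> Ob"
  shows "\<exists>A \<in> Ob. \<exists>B \<in> Ob. (\<exists>i j p q. biproduct A1 A2 A i j p q) \<and> (\<exists>i j p q. biproduct B1 B2 B i
      j p q) \<and>
    (\<exists>f g. short_exact R A B Y f g)"
proof -
  obtain A i j p q where A: "A \<in> Ob" "biproduct A1 A2 A i j p q" using biproduct_ex[OF Ob(1,2)] by
      blast
  obtain B i' j' p' q' where B: "B \<in> Ob" "biproduct B1 B2 B i' j' p' q'" using biproduct_ex[OF
      Ob(3,4)] by blast
  note dA = dsum_biproduct[OF Ob(1,2)[THEN Ob_Mod]] and dB = dsum_biproduct[OF Ob(3,4)[THEN Ob_Mod]]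
  note iA = biproduct_unique[OF dA(2) A(2) Ob(1,2)[THEN Ob_Mod] dA(1) Ob_Mod[OF A(1)]]
  note iB = biproduct_unique[OF dB(2) B(2) Ob(3,4)[THEN Ob_Mod] dB(1) Ob_Mod[OF B(1)]]
  note short_exact_iso[OF se iA iB dA(1) dB(1) Ob_Mod[OF A(1)] Ob_Mod[OF B(1)] Ob_Mod[OF Ob(5)]]
  then show ?thesis using A B by blast
qed

lemma projective_Syz_mono:
  assumes "projective R ((Syz R ^^ m) X)" "X \<in> Ob" "m \<le> n"
  shows "projective R ((Syz R ^^ n) X)"
  using assms(3) by (induction n rule: dec_induct) (simp_all add: Syz_projective assms(1,2))

theorem fin_dim_GLIT_class:
  assumes "GLIT_class R n t V D C" shows "fin_dim R C < \<infinity>"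
proof (cases "C = {}")
  case True
  \<comment> \<open>The empty supremum is zero. For nonempty \<open>C\<close> the exact sequences
    supply a member of \<open>D\<close>, and hence zero belongs to \<open>K\<close> below.\<close>
  then show ?thesis by (simp add: fin_dim_def bot_enat_def)
next
  case False
  let ?L = "IT_L R" and ?c = "IT_class R"
  have C: "C \<subseteq> Ob" and t: "1 \<le> t" and V: "V \<in> Ob" and D: "D \<subseteq> Ob" "add_class R D = D"
    and tD: "(Syz R ^^ t) ` D \<subseteq> D" and Phi: "Phi_dim R D < \<infinity>"
    and seq: "\<And>X. X \<in> C \<Longrightarrow> \<exists>V0 \<in> add_class R {V}. \<exists>V1 \<in> add_class R {V}. \<exists>D0 \<in> D. \<exists>D1 \<in> D. \<exists>f g.
        short_exact R (V1 \<boxplus> D1) (V0 \<boxplus> D0) ((Syz R ^^ n) X) f g"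
    using assms unfolding GLIT_class_def by simp_all
  obtain d where "Phi_dim R D = enat d" using Phi by auto
  then have d: "IT_Phi R X \<le> d" if "X \<in> D" for X
  proof -
    have "enat (IT_Phi R X) \<le> Phi_dim R D" unfolding Phi_dim_def by (rule Sup_upper) (use that in
        blast)
    then show ?thesis using \<open>Phi_dim R D = enat d\<close> by simp
  qed
  have D_ne: "D \<noteq> {}" using False seq by blast
  have D_kernel: "(?L ^^ d) x = 0" if "X \<in> D" "Poly_Mapping.keys x \<subseteq> Poly_Mapping.keys (?c X)"
      "(?L ^^ m) x = 0" for X x m
    using IT_span_kernel[OF _ _ that(3) d[OF that(1)]] IT_span_eq that D by blast
  \<comment> \<open>Elements supported on the class of a single module of \<open>D\<close>. Closure
    of \<open>D\<close> under finite direct sums makes this a subgroup, and \<open>d\<close> is a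
    common exponent for the elements that some power of \<open>L\<close> kills.\<close>
  define K :: "(('a, 'a list) module set \<Rightarrow>\<^sub>0 int) set" where "K = {x. \<exists>X \<in> D. Poly_Mapping.keys x
      \<subseteq> Poly_Mapping.keys (?c X)}"
  have D_sum: "\<exists>X \<in> D. Poly_Mapping.keys (?c X) = Poly_Mapping.keys (?c X1) \<union> Poly_Mapping.keys
      (?c X2)"
    if "X1 \<in> D" "X2 \<in> D" for X1 X2
  proof -
    have Ob: "X1 \<in> Ob" "X2 \<in> Ob" using that D by blast+
    obtain X i j p q where X: "X \<in> Ob" "biproduct X1 X2 X i j p q" using biproduct_ex[OF Ob] by
        blast
    have "decomp X [X1, X2]" by (rule decomp_ConsI[OF Ob(2) X(2) decomp_self[OF Ob(2)]])
    moreover have "summand X X" by (rule retract_summand[OF X(1,1) hom_id hom_id]) simp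
    ultimately have "X \<in> add_class R D"
      unfolding add_class_iff[OF D(1)] using X(1) that
      by (intro conjI exI[of _ X] exI[of _ "[X1, X2]"]) simp_all
    then have "X \<in> D" using D(2) by simp
    then show ?thesis using keys_IT_class_biproduct[OF X(2) Ob X(1)] by blast
  qed
  have "frag_subgroup K" unfolding frag_subgroup_def
  proof (intro conjI ballI)
    show "0 \<in> K" using D_ne by (auto simp: K_def)
    fix x y assume "x \<in> K" "y \<in> K"
    then obtain X1 X2 where X: "X1 \<in> D" "Poly_Mapping.keys x \<subseteq> Poly_Mapping.keys (?c X1)"
      "X2 \<in> D" "Poly_Mapping.keys y \<subseteq> Poly_Mapping.keys (?c X2)" unfolding K_def by blast
    then obtain X where "X \<in> D" "Poly_Mapping.keys (?c X) = Poly_Mapping.keys (?c X1) \<union>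
        Poly_Mapping.keys (?c X2)"
      using D_sum by blast
    then have "Poly_Mapping.keys (x - y) \<subseteq> Poly_Mapping.keys (?c X)" using keys_diff[of x y] X by
        blast
    then show "x - y \<in> K" unfolding K_def using \<open>X \<in> D\<close> by blast
  qed
  moreover have "IT.bounded_kernel K"
    unfolding IT.bounded_kernel_def K_def using D_kernel by blast
  \<comment> \<open>After adjoining the non-projective indecomposable summands of \<open>V\<close>,
    the classes of both terms \<open>A\<close> and \<open>B\<close> of every sequence lie in one
    subgroup.\<close>
  ultimately obtain K' where K': "frag_subgroup K'" "IT.bounded_kernel K'" "K \<subseteq> K'" "frag_of `
      Poly_Mapping.keys (?c V) \<subseteq> K'"
    using IT.bounded_kernel_adjoin_finite[of "frag_of ` Poly_Mapping.keys (?c V)" K] by auto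
  then obtain N0 where N0: "\<And>x m. x \<in> K' \<Longrightarrow> (?L ^^ m) x = 0 \<Longrightarrow> (?L ^^ N0) x = 0"
    unfolding IT.bounded_kernel_def by blast
  \<comment> \<open>A multiple of \<open>t\<close>, so that \<Omega>^N sends modules of
    \<open>D\<close> into \<open>D\<close>; at least \<open>N0\<close>, because \<open>t\<close> is
    positive.\<close>
  define N where "N = t * N0"
  have "N0 \<le> N" using t by (simp add: N_def)
  then have N: "(?L ^^ N) x = 0" if "x \<in> K'" "(?L ^^ m) x = 0" for x m
    using IT.funpow_zero_mono[OF N0[OF that]] by blast
  have ND: "(Syz R ^^ N) X \<in> D" if "X \<in> D" for X
  proof -
    have "((Syz R ^^ t) ^^ k) X \<in> D" for k by (induction k) (use that tD in auto)
    then show ?thesis unfolding N_def by (simp add: funpow_mult mult.commute)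
  qed
  \<comment> \<open>A finite set containing every class that can occur in \<Omega>^N of a module
    from \<open>add V\<close>.\<close>
  define G where "G = (\<Union>v \<in> Poly_Mapping.keys (?c V). Poly_Mapping.keys ((?L ^^ N) (frag_of v)))"
  have "finite G" unfolding G_def by simp
  \<comment> \<open>For a class that no power kills the \<open>LEAST\<close> is unspecified, which
    can only enlarge the maximum in \<open>b\<close>. The \<open>0\<close> inserted there covers an
    empty \<open>G\<close>.\<close>
  define \<kappa> where "\<kappa> c = (LEAST k. (?L ^^ k) (frag_of c) = 0)" for c
  define b where "b = max d (Max (insert 0 (\<kappa> ` G)))"
  have bG: "(?L ^^ b) (frag_of c) = 0" if "c \<in> G" "(?L ^^ k) (frag_of c) = 0" for c k
  proof -
    have "(?L ^^ \<kappa> c) (frag_of c) = 0" unfolding \<kappa>_def using that(2) by (rule LeastI)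
    moreover have "\<kappa> c \<le> Max (insert 0 (\<kappa> ` G))" using \<open>finite G\<close> that(1) by (intro Max_ge) auto
    then have "\<kappa> c \<le> b" unfolding b_def by simp
    ultimately show ?thesis by (rule IT.funpow_zero_mono)
  qed
  have addV: "V' \<in> Ob" "Poly_Mapping.keys (?c V') \<subseteq> Poly_Mapping.keys (?c V)" "?c V' \<in> K'"
    if "V' \<in> add_class R {V}" for V'
  proof -
    have "{V} \<subseteq> Ob" using V by simp
    from add_class_iff[OF this, of V'] that obtain W Ms where
      W: "W \<in> Ob" "set Ms \<subseteq> {V}" "decomp W Ms" "summand V' W" and V': "V' \<in> Ob" by blast
    show "V' \<in> Ob" by (rule V')
    have "set Ms \<subseteq> Ob" using W(2) V by blast
    then have "Poly_Mapping.keys (?c W) \<subseteq> Poly_Mapping.keys (?c V)"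
      using keys_IT_class_decomp[OF W(3,1)] W(2) by auto
    then show k: "Poly_Mapping.keys (?c V') \<subseteq> Poly_Mapping.keys (?c V)"
      using keys_IT_class_summand[OF W(4) V' W(1)] by blast
    show "?c V' \<in> K'" by (rule frag_subgroup_keys[OF K'(1)]) (use k K'(4) in blast)
  qed
  have addD: "X \<in> Ob" "?c X \<in> K'" if "X \<in> D" for X using that D K'(3) unfolding K_def by blast+
  have bound: "pd R X \<le> enat (Suc b + (N + n))" if X: "X \<in> C" and fin: "pd R X < \<infinity>" for X
  proof -
    have XOb: "X \<in> Ob" using X C by blast
    define Y where "Y = (Syz R ^^ n) X"
    have Y: "Y \<in> Ob" using XOb by (simp add: Y_def)
    obtain V0 V1 D0 D1 f g where s: "V0 \<in> add_class R {V}" "V1 \<in> add_class R {V}" "D0 \<in> D" "D1 \<in> D"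
      "short_exact R (V1 \<boxplus> D1) (V0 \<boxplus> D0) Y f g" using seq[OF X] unfolding Y_def by blast
    note Ob = addV(1)[OF s(2)] addD(1)[OF s(4)] addV(1)[OF s(1)] addD(1)[OF s(3)]
    obtain A B i j p q i' j' p' q' f g where AB: "A \<in> Ob" "B \<in> Ob" "biproduct V1 D1 A i j p q"
        "biproduct V0 D0 B i' j' p' q'"
      "short_exact R A B Y f g" using dsum_short_exact[OF s(5) Ob Y] by blast
    have cA: "?c A = ?c V1 + ?c D1" by (rule IT_class_biproduct[OF AB(3) Ob(1,2) AB(1)])
    have cB: "?c B = ?c V0 + ?c D0" by (rule IT_class_biproduct[OF AB(4) Ob(3,4) AB(2)])
    have "?c A \<in> K'" unfolding cA
      by (rule frag_subgroup_closed(2)[OF K'(1) addV(3)[OF s(2)] addD(2)[OF s(4)]])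
    moreover have "?c B \<in> K'" unfolding cB
      by (rule frag_subgroup_closed(2)[OF K'(1) addV(3)[OF s(1)] addD(2)[OF s(3)]])
    ultimately have AB_K: "?c A - ?c B \<in> K'" by (rule frag_subgroup_closed(3)[OF K'(1)])
    obtain m0 where "pd R X \<le> enat m0" using fin by (metis enat_ord_simps(6) less_infinityE
        order_refl)
    then obtain m where m: "projective R ((Syz R ^^ m) X)" using pd_le_iff[OF XOb] by blast
    have proj: "projective R ((Syz R ^^ m) ((Syz R ^^ k) X))" for k
      using projective_Syz_mono[OF m XOb, of "m + k"] by (simp add: funpow_add)
    have pY: "projective R ((Syz R ^^ m) Y)" unfolding Y_def by (rule proj)
    obtain Bm fm gm \<beta> where h: "Bm \<in> Ob" "short_exact R ((Syz R ^^ m) A) Bm ((Syz R ^^ m) Y) fm gm"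
      "stable_iso Bm ((Syz R ^^ m) B) \<beta>" using short_exact_Syz_funpow[OF AB(5,1,2) Y, of m] by blast
    note Obm = Syz_funpow_Ob[OF AB(1), of m] Syz_funpow_Ob[OF AB(2), of m] Syz_funpow_Ob[OF Y, of m]
    \<comment> \<open>With a projective end term the other two terms are stably isomorphic, so
      \<open>L ^^ m\<close> kills \<open>[A] - [B]\<close>. The exponent \<open>m\<close> depends on
      \<open>X\<close>; membership in \<open>K'\<close> replaces it by \<open>N\<close>.\<close>
    have "stable_iso ((Syz R ^^ m) A) Bm fm" by (rule stable_iso_if_projective_coker[OF h(2)
        Obm(1) h(1) Obm(3) pY])
    then have "?c ((Syz R ^^ m) A) = ?c ((Syz R ^^ m) B)"
      using IT_class_stable_iso[OF _ Obm(1) h(1)] IT_class_stable_iso[OF h(3,1) Obm(2)] by simp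
    then have "(?L ^^ m) (?c A - ?c B) = 0"
      using IT_L_funpow_IT_class[OF AB(1), of m] IT_L_funpow_IT_class[OF AB(2), of m]
      by (simp add: frag_endo.L_diff[OF IT.frag_endo_funpow])
    then have "(?L ^^ N) (?c A - ?c B) = 0" by (rule N[OF AB_K])
    then have cN: "?c ((Syz R ^^ N) A) = ?c ((Syz R ^^ N) B)"
      using IT_L_funpow_IT_class[OF AB(1), of N] IT_L_funpow_IT_class[OF AB(2), of N]
      by (simp add: frag_endo.L_diff[OF IT.frag_endo_funpow])
    note ObN = Syz_funpow_Ob[OF AB(1), of N] Syz_funpow_Ob[OF AB(2), of N] Syz_funpow_Ob[OF Y, of N]
    obtain BN fN gN \<beta>N where hN: "BN \<in> Ob" "short_exact R ((Syz R ^^ N) A) BN ((Syz R ^^ N) Y) fN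
        gN"
      "stable_iso BN ((Syz R ^^ N) B) \<beta>N" using short_exact_Syz_funpow[OF AB(5,1,2) Y, of N] by
          blast
    have "?c BN = ?c ((Syz R ^^ N) A)" using IT_class_stable_iso[OF hN(3,1) ObN(2)] cN by simp
    \<comment> \<open>Composing \<open>fN\<close> with \<open>\<gamma>\<close> gives the
      endomorphism of \<Omega>^N A to which Fitting's lemma is applied.\<close>
    then obtain \<gamma> where \<gamma>: "stable_iso BN ((Syz R ^^ N) A) \<gamma>" using stable_iso_iff_IT_class[OF
        hN(1) ObN(1)] by blast
    have "projective R ((Syz R ^^ Suc b) ((Syz R ^^ N) Y))"
    proof (rule projective_Syz_of_stable_endo[OF hN(2) ObN(1) hN(1) ObN(3) \<gamma>])
      show "projective R ((Syz R ^^ m) ((Syz R ^^ N) Y))"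
        using proj[of "N + n"] by (simp add: Y_def funpow_add)
    next
      fix Z k assume Z: "Z \<in> Ob" "summand Z ((Syz R ^^ N) A)" "projective R ((Syz R ^^ k) Z)"
      \<comment> \<open>By additivity it suffices to bound the exponent on each non-projective
        indecomposable summand of \<open>Z\<close>.\<close>
      have "(?L ^^ b) (frag_of c) = 0" if c: "c \<in> Poly_Mapping.keys (?c Z)" for c
      proof -
        obtain M where M: "M \<in> indecs" "\<not> projective R M" "summand M Z" "c = iso_class R M"
          using c unfolding keys_IT_class[OF Z(1)] by (auto simp: ind_nonproj_def indecs_def)
        have MOb: "M \<in> Ob" using indecsD(1)[OF M(1)] .
        obtain W i j p q where W: "W \<in> Ob" "biproduct M W Z i j p q" using M(3) unfolding
            summand_def by blast
        have "(?L ^^ k) (?c Z) = 0"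
          using IT_L_funpow_IT_class[OF Z(1)] IT_class_projective[OF Z(3)] Z(1) by simp
        then have "?c ((Syz R ^^ k) M) + ?c ((Syz R ^^ k) W) = 0"
          using IT_class_biproduct[OF W(2) MOb W(1) Z(1)] IT_L_funpow_IT_class[OF MOb]
              IT_L_funpow_IT_class[OF W(1)]
          by (simp add: frag_endo.L_add[OF IT.frag_endo_funpow])
        then have sum0: "Poly_Mapping.lookup (?c ((Syz R ^^ k) M)) x + Poly_Mapping.lookup (?c
            ((Syz R ^^ k) W)) x = 0" for x
          by (metis lookup_add lookup_zero)
        \<comment> \<open>Nonnegative coefficients with sum zero vanish, so finite projective
          dimension passes from \<open>Z\<close> to its summand \<open>M\<close>.\<close>
        have "Poly_Mapping.lookup (?c ((Syz R ^^ k) M)) x = 0" for x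
          using sum0[of x] IT_class_nonneg[OF Syz_funpow_Ob[OF MOb, of k], of x]
            IT_class_nonneg[OF Syz_funpow_Ob[OF W(1), of k], of x] by linarith
        then have "?c ((Syz R ^^ k) M) = 0" by (intro poly_mapping_eqI) simp
        then have Lk: "(?L ^^ k) (frag_of c) = 0"
          using IT_L_funpow_IT_class[OF MOb, of k] IT_class_indecs[OF M(1)] M(2,4) by simp
        have "c \<in> Poly_Mapping.keys (?c ((Syz R ^^ N) A))"
          using keys_IT_class_summand[OF Z(2,1) ObN(1)] c by blast
        also have "?c ((Syz R ^^ N) A) = (?L ^^ N) (?c V1) + ?c ((Syz R ^^ N) D1)"
          using IT_L_funpow_IT_class[OF AB(1), of N] IT_L_funpow_IT_class[OF Ob(2), of N] cA
          by (simp add: frag_endo.L_add[OF IT.frag_endo_funpow])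
        \<comment> \<open>Either case gives a bound independent of \<open>X\<close>:
          \<open>G\<close> is finite, and \<Omega>^N D1 lies in \<open>D\<close>.\<close>
        finally consider "c \<in> Poly_Mapping.keys ((?L ^^ N) (?c V1))" | "c \<in> Poly_Mapping.keys (?c
            ((Syz R ^^ N) D1))"
          using keys_add[of "(?L ^^ N) (?c V1)" "?c ((Syz R ^^ N) D1)"] by blast
        then show ?thesis
        proof cases
          case 1
          then have "c \<in> G"
            using frag_endo.keys_L_subset[OF IT.frag_endo_funpow addV(2)[OF s(2)], of N] unfolding
                G_def by blast
          then show ?thesis using bG Lk by blast
        next
          case 2
          then have "(?L ^^ d) (frag_of c) = 0" by (intro D_kernel[OF ND[OF s(4)] _ Lk]) simp
          then show ?thesis by (rule IT.funpow_zero_mono) (simp add: b_def)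
        qed
      qed
      then have "(?L ^^ b) (?c Z) = 0" by (rule frag_endo.L_eq_0[OF IT.frag_endo_funpow])
      then show "projective R ((Syz R ^^ b) Z)"
        using IT_L_funpow_IT_class[OF Z(1)] IT_class_eq_0_iff Z(1) by simp
    qed
    \<comment> \<open>\<open>n\<close> syzygies lead to \<open>Y\<close>, \<open>N\<close> more make
      the first two terms stably isomorphic, \<open>b\<close> dispose of the nilpotent part, and the
      last one accounts for the cokernel.\<close>
    then have "projective R ((Syz R ^^ (Suc b + (N + n))) X)" by (simp add: Y_def funpow_add)
    then show ?thesis using pd_le_iff[OF XOb] by blast
  qed
  have "fin_dim R C \<le> enat (Suc b + (N + n))"
    unfolding fin_dim_def by (rule Sup_least) (use bound in blast)
  then show ?thesis using enat_ord_code(4) order_le_less_trans by blast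
qed

end

theorem theorem3p13:
  fixes K :: "('k, 'r) ring_scheme" and \<Lambda> :: "('k, 'a) module"
  assumes "artin_algebra K \<Lambda>"
  shows "(\<forall>n t V D C. GLIT_class \<Lambda> n t V D C \<longrightarrow> fin_dim \<Lambda> C < \<infinity>) \<and>
    (GLIT_algebra \<Lambda> \<longrightarrow> fin_dim \<Lambda> (fmod \<Lambda>) < \<infinity>)"
proof -
  interpret artin_algebra K \<Lambda> by fact
  interpret finite_length_ring \<Lambda>
    by unfold_locales (rule chain_cond_left_ideals)
  show ?thesis using fin_dim_GLIT_class unfolding GLIT_algebra_def by blast
qed

end
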